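(* Let $S$ be a scheme and let $a,b,c,d\in\mathbb{P}^1(S)$ be pairwise strongly distinct. The cross-ratio enjoys the following symmetries: (1) $(c,d;a,b)=(a,b;c,d)$; (2) $(b,a;c,d)=(a,b;c,d)^{-1}$; (3) $(a,c;b,d)=1-(a,b;c,d)$.
   Context: $\mathbb{P}^1=\mathbb{P}^1_{\mathbb{Z}}$ with standard homogeneous coordinates $x_0,x_1\in\Gamma(\mathbb{P}^1,\mathcal{O}(1))$, and $\mathbb{P}^1(S)=\mathrm{Hom}(S,\mathbb{P}^1)$. A point $a\in\mathbb{P}^1(S)$ is the same as an equivalence class of data $(A;a_0,a_1)$, where $A$ is a line bundle on $S$ (isomorphic to $a^*\mathcal{O}(1)$) and $a_0,a_1$ are global sections of $A$ (corresponding to $a^*(x_0),a^*(x_1)$) that generate $A$; $(A;a_0,a_1)$ and $(A';a_0',a_1')$ are equivalent iff there is an isomorphism $A\to A'$ taking $a_i$ to $a_i'$ for $i=0,1$. Two morphisms of schemes $f,g\colon X\to Y$ are strongly distinct if their equalizer in the category of schemes is the empty scheme $\varnothing\to X$. Cross-ratio: if $a,b,c,d\in\mathbb{P}^1(S)$ are pairwise strongly distinct, they can be represented by data $(L;a_0,a_1)$, $(L;b_0,b_1)$, $(L;c_0,c_1)$, $(L;d_0,d_1)$ with a common line bundle $L$ satisfying $L^{\otimes 2}\cong\mathcal{O}_S$. Put $\Delta(a,b)=a_0\otimes b_1-a_1\otimes b_0\in\Gamma(S,L^{\otimes 2})$ (similarly for other pairs); it is nowhere vanishing for strongly distinct points.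 Choose an isomorphism $\varphi\colon L^{\otimes 2}\to\mathcal{O}_S$. Then $$(a,b;c,d)=\frac{\varphi(\Delta(a,c))\,\varphi(\Delta(b,d))}{\varphi(\Delta(a,d))\,\varphi(\Delta(b,c))}\in\Gamma(S,\mathcal{O}_S),$$ which does not depend on the choices and is a unit of $\Gamma(S,\mathcal{O}_S)$. *)

theory Defs
  imports
    "HOL-Analysis.Abstract_Topology"
    "HOL-Algebra.Ideal"
    "HOL-Algebra.Module"
    "HOL-Computational_Algebra.Polynomial"
begin

section \<open>Sheaves, germs and stalks\<close>

text \<open>
  Presheaves are given by a family of sections indexed by subsets of the space together with
  restriction maps; only the values on open sets matter. The cover in the gluing axiom may be
  empty, which forces a single section over the empty set.
\<close>

definition is_sheaf ::
  "'a topology \<Rightarrow> ('a set \<Rightarrow> 'c set) \<Rightarrow> ('a set \<Rightarrow> 'a set \<Rightarrow> 'c \<Rightarrow> 'c) \<Rightarrow> bool" where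
  "is_sheaf X F r \<longleftrightarrow>
     (\<forall>U V. openin X U \<and> openin X V \<and> V \<subseteq> U \<longrightarrow> (\<forall>s\<in>F U. r U V s \<in> F V)) \<and>
     (\<forall>U. openin X U \<longrightarrow> (\<forall>s\<in>F U. r U U s = s)) \<and>
     (\<forall>U V W. openin X U \<and> openin X V \<and> openin X W \<and> W \<subseteq> V \<and> V \<subseteq> U \<longrightarrow>
        (\<forall>s\<in>F U. r V W (r U V s) = r U W s)) \<and>
     (\<forall>\<U> s. (\<forall>V\<in>\<U>. openin X V \<and> s V \<in> F V) \<and>
        (\<forall>V\<in>\<U>. \<forall>W\<in>\<U>. r V (V \<inter> W) (s V) = r W (V \<inter> W) (s W)) \<longrightarrow>
        (\<exists>!t. t \<in> F (\<Union>\<U>) \<and> (\<forall>V\<in>\<U>. r (\<Union>\<U>) V t = s V)))"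

text \<open>A germ is the class of all local sections agreeing with a given one near the point.\<close>

definition germ ::
  "'a topology \<Rightarrow> ('a set \<Rightarrow> ('c, 'm) ring_scheme) \<Rightarrow> ('a set \<Rightarrow> 'a set \<Rightarrow> 'c \<Rightarrow> 'c) \<Rightarrow>
   'a \<Rightarrow> 'a set \<Rightarrow> 'c \<Rightarrow> ('a set \<times> 'c) set" where
  "germ X F r x U s =
     {(V, t). openin X V \<and> x \<in> V \<and> t \<in> carrier (F V) \<and>
        (\<exists>W. openin X W \<and> x \<in> W \<and> W \<subseteq> U \<inter> V \<and> r U W s = r V W t)}"

text \<open>
  Operations on equivalence classes are written as the union of the classes obtained from all
  representatives; wherever this is used, all these classes coincide. Modules are records extending
  rings, so the definition serves for them as well (with meaningless \<open>mult\<close> and \<open>one\<close>).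
\<close>

definition stalk ::
  "'a topology \<Rightarrow> ('a set \<Rightarrow> ('c, 'm) ring_scheme) \<Rightarrow> ('a set \<Rightarrow> 'a set \<Rightarrow> 'c \<Rightarrow> 'c) \<Rightarrow>
   'a \<Rightarrow> ('a set \<times> 'c) set ring" where
  "stalk X F r x =
     \<lparr>carrier = {germ X F r x U s | U s. openin X U \<and> x \<in> U \<and> s \<in> carrier (F U)},
      monoid.mult = (\<lambda>A B. \<Union>{germ X F r x (U \<inter> V)
                (r U (U \<inter> V) s \<otimes>\<^bsub>F (U \<inter> V)\<^esub> r V (U \<inter> V) t) | U s V t. (U, s) \<in> A \<and> (V, t) \<in> B}),
      one = germ X F r x (topspace X) \<one>\<^bsub>F (topspace X)\<^esub>,
      zero = germ X F r x (topspace X) \<zero>\<^bsub>F (topspace X)\<^esub>,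
      add = (\<lambda>A B. \<Union>{germ X F r x (U \<inter> V)
                (r U (U \<inter> V) s \<oplus>\<^bsub>F (U \<inter> V)\<^esub> r V (U \<inter> V) t) | U s V t. (U, s) \<in> A \<and> (V, t) \<in> B})\<rparr>"


section \<open>Locally ringed spaces\<close>

record ('a, 'b) ringed_space =
  rs_top :: "'a topology"
  rs_ring :: "'a set \<Rightarrow> 'b ring"
  rs_res :: "'a set \<Rightarrow> 'a set \<Rightarrow> 'b \<Rightarrow> 'b"

abbreviation rs_pts :: "('a, 'b) ringed_space \<Rightarrow> 'a set" where
  "rs_pts S \<equiv> topspace (rs_top S)"

abbreviation rs_global :: "('a, 'b) ringed_space \<Rightarrow> 'b ring" where
  "rs_global S \<equiv> rs_ring S (rs_pts S)"

abbreviation rs_germ :: "('a, 'b) ringed_space \<Rightarrow> 'a \<Rightarrow> 'a set \<Rightarrow> 'b \<Rightarrow> ('a set \<times> 'b) set" where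
  "rs_germ S \<equiv> germ (rs_top S) (rs_ring S) (rs_res S)"

abbreviation rs_stalk :: "('a, 'b) ringed_space \<Rightarrow> 'a \<Rightarrow> ('a set \<times> 'b) set ring" where
  "rs_stalk S \<equiv> stalk (rs_top S) (rs_ring S) (rs_res S)"

definition ringed_space :: "('a, 'b) ringed_space \<Rightarrow> bool" where
  "ringed_space S \<longleftrightarrow>
     is_sheaf (rs_top S) (\<lambda>U. carrier (rs_ring S U)) (rs_res S) \<and>
     (\<forall>U. openin (rs_top S) U \<longrightarrow> cring (rs_ring S U)) \<and>
     (\<forall>U V. openin (rs_top S) U \<and> openin (rs_top S) V \<and> V \<subseteq> U \<longrightarrow>
        rs_res S U V \<in> ring_hom (rs_ring S U) (rs_ring S V))"

definition local_ring :: "('r, 'm) ring_scheme \<Rightarrow> bool" where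
  "local_ring R \<longleftrightarrow> cring R \<and> (\<exists>!\<mm>. maximalideal \<mm> R)"

definition locally_ringed_space :: "('a, 'b) ringed_space \<Rightarrow> bool" where
  "locally_ringed_space S \<longleftrightarrow> ringed_space S \<and> (\<forall>x\<in>rs_pts S. local_ring (rs_stalk S x))"

text \<open>
  A morphism consists of a map of points and, for every open set of the target, a map from
  sections over it to sections over the preimage. The fields are total functions, so morphisms
  are compared by \<open>mor_eq\<close>, not by equality of records.
\<close>

record ('a, 'b, 'c, 'd) lrs_mor =
  mor_pt :: "'a \<Rightarrow> 'c"
  mor_sec :: "'c set \<Rightarrow> 'd \<Rightarrow> 'b"

definition mor_preim :: "('a, 'b) ringed_space \<Rightarrow> ('a, 'b, 'c, 'd) lrs_mor \<Rightarrow> 'c set \<Rightarrow> 'a set" where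
  "mor_preim X f V = {x \<in> rs_pts X. mor_pt f x \<in> V}"

definition stalk_map ::
  "('a, 'b) ringed_space \<Rightarrow> ('a, 'b, 'c, 'd) lrs_mor \<Rightarrow> 'a \<Rightarrow>
   ('c set \<times> 'd) set \<Rightarrow> ('a set \<times> 'b) set" where
  "stalk_map X f x A = \<Union>{rs_germ X x (mor_preim X f V) (mor_sec f V s) | V s. (V, s) \<in> A}"

text \<open>In a local ring the non-units form the maximal ideal.\<close>

definition lrs_hom ::
  "('a, 'b) ringed_space \<Rightarrow> ('c, 'd) ringed_space \<Rightarrow> ('a, 'b, 'c, 'd) lrs_mor set" where
  "lrs_hom X Y =
     {f. continuous_map (rs_top X) (rs_top Y) (mor_pt f) \<and>
         (\<forall>V. openin (rs_top Y) V \<longrightarrow>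
            mor_sec f V \<in> ring_hom (rs_ring Y V) (rs_ring X (mor_preim X f V))) \<and>
         (\<forall>V W. openin (rs_top Y) V \<and> openin (rs_top Y) W \<and> W \<subseteq> V \<longrightarrow>
            (\<forall>s\<in>carrier (rs_ring Y V).
               rs_res X (mor_preim X f V) (mor_preim X f W) (mor_sec f V s)
                 = mor_sec f W (rs_res Y V W s))) \<and>
         (\<forall>x\<in>rs_pts X. \<forall>A\<in>carrier (rs_stalk Y (mor_pt f x)) - Units (rs_stalk Y (mor_pt f x)).
            stalk_map X f x A \<notin> Units (rs_stalk X x))}"

definition mor_eq ::
  "('a, 'b) ringed_space \<Rightarrow> ('c, 'd) ringed_space \<Rightarrow>
   ('a, 'b, 'c, 'd) lrs_mor \<Rightarrow> ('a, 'b, 'c, 'd) lrs_mor \<Rightarrow> bool" where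
  "mor_eq X Y f g \<longleftrightarrow>
     (\<forall>x\<in>rs_pts X. mor_pt f x = mor_pt g x) \<and>
     (\<forall>V. openin (rs_top Y) V \<longrightarrow> (\<forall>s\<in>carrier (rs_ring Y V). mor_sec f V s = mor_sec g V s))"

definition mor_id :: "('a, 'b, 'a, 'b) lrs_mor" where
  "mor_id = \<lparr>mor_pt = id, mor_sec = (\<lambda>_. id)\<rparr>"

text \<open>\<open>mor_comp Y g f\<close> is the composite of \<open>f\<close> followed by \<open>g\<close>, where \<open>Y\<close> is the source of \<open>g\<close>.\<close>

definition mor_comp ::
  "('c, 'd) ringed_space \<Rightarrow> ('c, 'd, 'e, 'f) lrs_mor \<Rightarrow> ('a, 'b, 'c, 'd) lrs_mor \<Rightarrow>
   ('a, 'b, 'e, 'f) lrs_mor" where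
  "mor_comp Y g f =
     \<lparr>mor_pt = mor_pt g \<circ> mor_pt f,
      mor_sec = (\<lambda>W. mor_sec f (mor_preim Y g W) \<circ> mor_sec g W)\<rparr>"

definition lrs_isomorphic :: "('a, 'b) ringed_space \<Rightarrow> ('c, 'd) ringed_space \<Rightarrow> bool" where
  "lrs_isomorphic X Y \<longleftrightarrow>
     (\<exists>f\<in>lrs_hom X Y. \<exists>g\<in>lrs_hom Y X.
        mor_eq X X (mor_comp Y g f) mor_id \<and> mor_eq Y Y (mor_comp X f g) mor_id)"

definition open_sub :: "('a, 'b) ringed_space \<Rightarrow> 'a set \<Rightarrow> ('a, 'b) ringed_space" where
  "open_sub S U = S\<lparr>rs_top := subtopology (rs_top S) U\<rparr>"


section \<open>Localization; sheaves of fractions\<close>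

text \<open>\<open>loc_frac R T r s\<close> is the fraction \<open>r/s\<close> in the localization of \<open>R\<close> at \<open>T\<close>.\<close>

definition loc_frac :: "('r, 'm) ring_scheme \<Rightarrow> 'r set \<Rightarrow> 'r \<Rightarrow> 'r \<Rightarrow> ('r \<times> 'r) set" where
  "loc_frac R T r s =
     {(r', s'). r' \<in> carrier R \<and> s' \<in> T \<and>
        (\<exists>u\<in>T. u \<otimes>\<^bsub>R\<^esub> (r \<otimes>\<^bsub>R\<^esub> s' \<ominus>\<^bsub>R\<^esub> r' \<otimes>\<^bsub>R\<^esub> s) = \<zero>\<^bsub>R\<^esub>)}"

definition localization :: "('r, 'm) ring_scheme \<Rightarrow> 'r set \<Rightarrow> ('r \<times> 'r) set ring" where
  "localization R T =
     \<lparr>carrier = {loc_frac R T r s | r s. r \<in> carrier R \<and> s \<in> T},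
      monoid.mult = (\<lambda>A B. \<Union>{loc_frac R T (r \<otimes>\<^bsub>R\<^esub> r') (s \<otimes>\<^bsub>R\<^esub> s') | r s r' s'. (r, s) \<in> A \<and> (r', s') \<in> B}),
      one = loc_frac R T \<one>\<^bsub>R\<^esub> \<one>\<^bsub>R\<^esub>,
      zero = loc_frac R T \<zero>\<^bsub>R\<^esub> \<one>\<^bsub>R\<^esub>,
      add = (\<lambda>A B. \<Union>{loc_frac R T (r \<otimes>\<^bsub>R\<^esub> s' \<oplus>\<^bsub>R\<^esub> r' \<otimes>\<^bsub>R\<^esub> s) (s \<otimes>\<^bsub>R\<^esub> s')
                 | r s r' s'. (r, s) \<in> A \<and> (r', s') \<in> B})\<rparr>"

definition pointwise_ring ::
  "('p \<Rightarrow> ('s, 'm) ring_scheme) \<Rightarrow> 'p set \<Rightarrow> ('p \<Rightarrow> 's) set \<Rightarrow> ('p \<Rightarrow> 's) ring" where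
  "pointwise_ring A U C =
     \<lparr>carrier = C,
      monoid.mult = (\<lambda>s t. \<lambda>p\<in>U. s p \<otimes>\<^bsub>A p\<^esub> t p),
      one = (\<lambda>p\<in>U. \<one>\<^bsub>A p\<^esub>),
      zero = (\<lambda>p\<in>U. \<zero>\<^bsub>A p\<^esub>),
      add = (\<lambda>s t. \<lambda>p\<in>U. s p \<oplus>\<^bsub>A p\<^esub> t p)\<rparr>"

text \<open>
  Functions on \<open>U\<close> with value at \<open>p\<close> in the localization of \<open>R\<close> at \<open>T p\<close> that are locally of the
  form \<open>r/f\<close> with \<open>(r, f)\<close> in the set \<open>N\<close> of admissible fractions. For \<open>Spec\<close> all fractions are
  admissible; for the sheaves \<open>\<O>(n)\<close> on \<open>Proj\<close> those which are homogeneous of degree \<open>n\<close>.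
\<close>

definition fraction_sections ::
  "('r, 'm) ring_scheme \<Rightarrow> 'p topology \<Rightarrow> ('p \<Rightarrow> 'r set) \<Rightarrow> ('r \<times> 'r) set \<Rightarrow> 'p set \<Rightarrow>
   ('p \<Rightarrow> ('r \<times> 'r) set) set" where
  "fraction_sections R X T N U =
     {s \<in> extensional U. \<forall>p\<in>U. \<exists>V r f. openin X V \<and> p \<in> V \<and> V \<subseteq> U \<and> (r, f) \<in> N \<and>
        (\<forall>q\<in>V. f \<in> T q \<and> s q = loc_frac R (T q) r f)}"


section \<open>Schemes\<close>

definition Spec_top :: "('r, 'm) ring_scheme \<Rightarrow> 'r set topology" where
  "Spec_top R = topology_generated_by {{\<pp>. primeideal \<pp> R \<and> f \<notin> \<pp>} | f. f \<in> carrier R}"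

definition Spec ::
  "('r, 'm) ring_scheme \<Rightarrow> ('r set, 'r set \<Rightarrow> ('r \<times> 'r) set) ringed_space" where
  "Spec R =
     \<lparr>rs_top = Spec_top R,
      rs_ring = (\<lambda>U. pointwise_ring (\<lambda>\<pp>. localization R (carrier R - \<pp>)) U
         (fraction_sections R (Spec_top R) (\<lambda>\<pp>. carrier R - \<pp>) (carrier R \<times> carrier R) U)),
      rs_res = (\<lambda>U V s. restrict s V)\<rparr>"

text \<open>
  An affine scheme is isomorphic to the spectrum of its own ring of global sections, so it is no
  loss to let \<open>R\<close> range over rings with elements in the type of sections.
\<close>

definition affine_scheme :: "('a, 'b) ringed_space \<Rightarrow> bool" where
  "affine_scheme S \<longleftrightarrow>
     locally_ringed_space S \<and> (\<exists>R :: 'b ring. cring R \<and> lrs_isomorphic S (Spec R))"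

definition is_scheme :: "('a, 'b) ringed_space \<Rightarrow> bool" where
  "is_scheme S \<longleftrightarrow>
     locally_ringed_space S \<and>
     (\<forall>x\<in>rs_pts S. \<exists>U. openin (rs_top S) U \<and> x \<in> U \<and> affine_scheme (open_sub S U))"

definition is_equalizer ::
  "('a, 'b) ringed_space \<Rightarrow> ('c, 'd) ringed_space \<Rightarrow>
   ('a, 'b, 'c, 'd) lrs_mor \<Rightarrow> ('a, 'b, 'c, 'd) lrs_mor \<Rightarrow>
   ('e, 'f) ringed_space \<Rightarrow> ('e, 'f, 'a, 'b) lrs_mor \<Rightarrow> bool" where
  "is_equalizer X Y f g E e \<longleftrightarrow>
     is_scheme E \<and> e \<in> lrs_hom E X \<and> mor_eq E Y (mor_comp X f e) (mor_comp X g e) \<and>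
     (\<forall>(T :: ('e, 'f) ringed_space) t.
        is_scheme T \<and> t \<in> lrs_hom T X \<and> mor_eq T Y (mor_comp X f t) (mor_comp X g t) \<longrightarrow>
        (\<exists>u\<in>lrs_hom T E. mor_eq T X (mor_comp E e u) t \<and>
           (\<forall>v\<in>lrs_hom T E. mor_eq T X (mor_comp E e v) t \<longrightarrow> mor_eq T E u v)))"

text \<open>
  HOL cannot quantify over test schemes \<open>T\<close> of all types, so their types are fixed here. The choice
  is large enough: the true equalizer is an immersion into \<open>X\<close>, so if it has a point over
  \<open>x \<in> X\<close>, then the spectrum of the residue field of \<open>X\<close> at \<open>x\<close> equalizes \<open>f\<close> and \<open>g\<close>. That
  scheme is realized on the point set \<open>{x}\<close>, with sections cosets of the maximal ideal in the
  stalk at \<open>x\<close>. Hence the equalizer is empty for these types iff it is empty for all types.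
\<close>

definition strongly_distinct ::
  "('a, 'b) ringed_space \<Rightarrow> ('c, 'd) ringed_space \<Rightarrow>
   ('a, 'b, 'c, 'd) lrs_mor \<Rightarrow> ('a, 'b, 'c, 'd) lrs_mor \<Rightarrow> bool" where
  "strongly_distinct X Y f g \<longleftrightarrow>
     (\<exists>(E :: ('a, ('a set \<times> 'b) set set) ringed_space) e.
        is_equalizer X Y f g E e \<and> rs_pts E = {})"


section \<open>Sheaves of modules\<close>

record ('a, 'b, 'c) mod_sheaf =
  ms_mod :: "'a set \<Rightarrow> ('b, 'c) module"
  ms_res :: "'a set \<Rightarrow> 'a set \<Rightarrow> 'c \<Rightarrow> 'c"

definition with_smult :: "('c, 'm) ring_scheme \<Rightarrow> ('r \<Rightarrow> 'c \<Rightarrow> 'c) \<Rightarrow> ('r, 'c) module" where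
  "with_smult A f =
     \<lparr>carrier = carrier A, monoid.mult = monoid.mult A, one = one A, zero = zero A, add = add A,
      module.smult = f\<rparr>"

definition is_mod_sheaf :: "('a, 'b) ringed_space \<Rightarrow> ('a, 'b, 'c) mod_sheaf \<Rightarrow> bool" where
  "is_mod_sheaf S M \<longleftrightarrow>
     is_sheaf (rs_top S) (\<lambda>U. carrier (ms_mod M U)) (ms_res M) \<and>
     (\<forall>U. openin (rs_top S) U \<longrightarrow> Module.module (rs_ring S U) (ms_mod M U)) \<and>
     (\<forall>U V. openin (rs_top S) U \<and> openin (rs_top S) V \<and> V \<subseteq> U \<longrightarrow>
        (\<forall>m\<in>carrier (ms_mod M U). \<forall>n\<in>carrier (ms_mod M U).
           ms_res M U V (m \<oplus>\<^bsub>ms_mod M U\<^esub> n) = ms_res M U V m \<oplus>\<^bsub>ms_mod M V\<^esub> ms_res M U V n) \<and>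
        (\<forall>c\<in>carrier (rs_ring S U). \<forall>m\<in>carrier (ms_mod M U).
           ms_res M U V (c \<odot>\<^bsub>ms_mod M U\<^esub> m) = rs_res S U V c \<odot>\<^bsub>ms_mod M V\<^esub> ms_res M U V m))"

definition mod_sheaf_iso ::
  "('a, 'b) ringed_space \<Rightarrow> ('a, 'b, 'c) mod_sheaf \<Rightarrow> ('a, 'b, 'd) mod_sheaf \<Rightarrow>
   ('a set \<Rightarrow> 'c \<Rightarrow> 'd) \<Rightarrow> bool" where
  "mod_sheaf_iso S M N \<phi> \<longleftrightarrow>
     (\<forall>U. openin (rs_top S) U \<longrightarrow>
        bij_betw (\<phi> U) (carrier (ms_mod M U)) (carrier (ms_mod N U)) \<and>
        (\<forall>m\<in>carrier (ms_mod M U). \<forall>n\<in>carrier (ms_mod M U).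
           \<phi> U (m \<oplus>\<^bsub>ms_mod M U\<^esub> n) = \<phi> U m \<oplus>\<^bsub>ms_mod N U\<^esub> \<phi> U n) \<and>
        (\<forall>c\<in>carrier (rs_ring S U). \<forall>m\<in>carrier (ms_mod M U).
           \<phi> U (c \<odot>\<^bsub>ms_mod M U\<^esub> m) = c \<odot>\<^bsub>ms_mod N U\<^esub> \<phi> U m)) \<and>
     (\<forall>U V. openin (rs_top S) U \<and> openin (rs_top S) V \<and> V \<subseteq> U \<longrightarrow>
        (\<forall>m\<in>carrier (ms_mod M U). \<phi> V (ms_res M U V m) = ms_res N U V (\<phi> U m)))"

definition struct_sheaf :: "('a, 'b) ringed_space \<Rightarrow> ('a, 'b, 'b) mod_sheaf" where
  "struct_sheaf S =
     \<lparr>ms_mod = (\<lambda>U. with_smult (rs_ring S U) (monoid.mult (rs_ring S U))), ms_res = rs_res S\<rparr>"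

definition line_bundle :: "('a, 'b) ringed_space \<Rightarrow> ('a, 'b, 'c) mod_sheaf \<Rightarrow> bool" where
  "line_bundle S L \<longleftrightarrow>
     is_mod_sheaf S L \<and>
     (\<forall>x\<in>rs_pts S. \<exists>U. openin (rs_top S) U \<and> x \<in> U \<and>
        (\<exists>\<phi>. mod_sheaf_iso (open_sub S U) (struct_sheaf S) L \<phi>))"

abbreviation ms_global :: "('a, 'b) ringed_space \<Rightarrow> ('a, 'b, 'c) mod_sheaf \<Rightarrow> ('b, 'c) module" where
  "ms_global S M \<equiv> ms_mod M (rs_pts S)"

abbreviation ms_germ ::
  "('a, 'b) ringed_space \<Rightarrow> ('a, 'b, 'c) mod_sheaf \<Rightarrow> 'a \<Rightarrow> 'a set \<Rightarrow> 'c \<Rightarrow> ('a set \<times> 'c) set" where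
  "ms_germ S M \<equiv> germ (rs_top S) (ms_mod M) (ms_res M)"

definition ms_stalk ::
  "('a, 'b) ringed_space \<Rightarrow> ('a, 'b, 'c) mod_sheaf \<Rightarrow> 'a \<Rightarrow>
   (('a set \<times> 'b) set, ('a set \<times> 'c) set) module" where
  "ms_stalk S M x = with_smult (stalk (rs_top S) (ms_mod M) (ms_res M) x)
     (\<lambda>A B. \<Union>{ms_germ S M x (U \<inter> V)
        (rs_res S U (U \<inter> V) c \<odot>\<^bsub>ms_mod M (U \<inter> V)\<^esub> ms_res M V (U \<inter> V) m)
        | U c V m. (U, c) \<in> A \<and> (V, m) \<in> B})"

definition generate_sheaf ::
  "('a, 'b) ringed_space \<Rightarrow> ('a, 'b, 'c) mod_sheaf \<Rightarrow> 'c \<Rightarrow> 'c \<Rightarrow> bool" where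
  "generate_sheaf S M m0 m1 \<longleftrightarrow>
     (\<forall>x\<in>rs_pts S. \<forall>A\<in>carrier (ms_stalk S M x).
        \<exists>c0\<in>carrier (rs_stalk S x). \<exists>c1\<in>carrier (rs_stalk S x).
          A = c0 \<odot>\<^bsub>ms_stalk S M x\<^esub> ms_germ S M x (rs_pts S) m0
              \<oplus>\<^bsub>ms_stalk S M x\<^esub> c1 \<odot>\<^bsub>ms_stalk S M x\<^esub> ms_germ S M x (rs_pts S) m1)"


section \<open>Tensor products\<close>

text \<open>
  The list \<open>[(m\<^sub>1, n\<^sub>1), \<dots>, (m\<^sub>k, n\<^sub>k)]\<close> stands for the sum of the \<open>m\<^sub>i \<otimes> n\<^sub>i\<close>. Formal negatives are
  unnecessary: \<open>(-m) \<otimes> n\<close> is an additive inverse of \<open>m \<otimes> n\<close> by \<open>add_left\<close> and \<open>zero\<close>.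
\<close>

inductive tensor_eq ::
  "('r, 'x) ring_scheme \<Rightarrow> ('r, 'm) module \<Rightarrow> ('r, 'n) module \<Rightarrow>
   ('m \<times> 'n) list \<Rightarrow> ('m \<times> 'n) list \<Rightarrow> bool"
  for R M N where
  refl: "set xs \<subseteq> carrier M \<times> carrier N \<Longrightarrow> tensor_eq R M N xs xs"
| sym: "tensor_eq R M N xs ys \<Longrightarrow> tensor_eq R M N ys xs"
| trans: "tensor_eq R M N xs ys \<Longrightarrow> tensor_eq R M N ys zs \<Longrightarrow> tensor_eq R M N xs zs"
| cong: "tensor_eq R M N xs xs' \<Longrightarrow> tensor_eq R M N ys ys' \<Longrightarrow>
         tensor_eq R M N (xs @ ys) (xs' @ ys')"
| comm: "set xs \<subseteq> carrier M \<times> carrier N \<Longrightarrow> set ys \<subseteq> carrier M \<times> carrier N \<Longrightarrow>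
         tensor_eq R M N (xs @ ys) (ys @ xs)"
| add_left: "m \<in> carrier M \<Longrightarrow> m' \<in> carrier M \<Longrightarrow> n \<in> carrier N \<Longrightarrow>
         tensor_eq R M N [(m \<oplus>\<^bsub>M\<^esub> m', n)] [(m, n), (m', n)]"
| add_right: "m \<in> carrier M \<Longrightarrow> n \<in> carrier N \<Longrightarrow> n' \<in> carrier N \<Longrightarrow>
         tensor_eq R M N [(m, n \<oplus>\<^bsub>N\<^esub> n')] [(m, n), (m, n')]"
| smult: "r \<in> carrier R \<Longrightarrow> m \<in> carrier M \<Longrightarrow> n \<in> carrier N \<Longrightarrow>
         tensor_eq R M N [(r \<odot>\<^bsub>M\<^esub> m, n)] [(m, r \<odot>\<^bsub>N\<^esub> n)]"
| zero: "n \<in> carrier N \<Longrightarrow> tensor_eq R M N [(\<zero>\<^bsub>M\<^esub>, n)] []"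

definition tensor_class ::
  "('r, 'x) ring_scheme \<Rightarrow> ('r, 'm) module \<Rightarrow> ('r, 'n) module \<Rightarrow>
   ('m \<times> 'n) list \<Rightarrow> ('m \<times> 'n) list set" where
  "tensor_class R M N xs = {ys. tensor_eq R M N xs ys}"

text \<open>
  The tensor product of \<open>M\<close> and \<open>N\<close> over \<open>R\<close>, on which a scalar \<open>c\<close> acts through \<open>act c\<close> on
  pairs: via either factor for the \<open>R\<close>-module structure, via the right factor for extension of
  scalars. There is no multiplication, so \<open>mult\<close> and \<open>one\<close> are irrelevant.
\<close>

definition tensor_module ::
  "('r, 'x) ring_scheme \<Rightarrow> ('r, 'm) module \<Rightarrow> ('r, 'n) module \<Rightarrow>
   ('c \<Rightarrow> 'm \<times> 'n \<Rightarrow> 'm \<times> 'n) \<Rightarrow> ('c, ('m \<times> 'n) list set) module" where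
  "tensor_module R M N act =
     \<lparr>carrier = {tensor_class R M N xs | xs. set xs \<subseteq> carrier M \<times> carrier N},
      monoid.mult = undefined,
      one = undefined,
      zero = tensor_class R M N [],
      add = (\<lambda>A B. \<Union>{tensor_class R M N (xs @ ys) | xs ys. xs \<in> A \<and> ys \<in> B}),
      module.smult = (\<lambda>c A. \<Union>{tensor_class R M N (map (act c) xs) | xs. xs \<in> A})\<rparr>"

text \<open>
  Tensor products and pullbacks of sheaves of modules are sheafifications. Their sections over
  \<open>U\<close> are the functions assigning to \<open>x \<in> U\<close> an element of the stalk, which locally come from a
  finite sum of tensors of sections.
\<close>

definition ms_pointwise ::
  "('a, 'b) ringed_space \<Rightarrow> ('a \<Rightarrow> (('a set \<times> 'b) set, 's) module) \<Rightarrow> 'a set \<Rightarrow> ('a \<Rightarrow> 's) set \<Rightarrow>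
   ('b, 'a \<Rightarrow> 's) module" where
  "ms_pointwise S A U C =
     with_smult (pointwise_ring A U C) (\<lambda>c s. \<lambda>x\<in>U. rs_germ S x U c \<odot>\<^bsub>A x\<^esub> s x)"

definition tensor_stalk_class ::
  "('a, 'b) ringed_space \<Rightarrow> ('a, 'b, 'c) mod_sheaf \<Rightarrow> ('a, 'b, 'd) mod_sheaf \<Rightarrow> 'a \<Rightarrow> 'a set \<Rightarrow>
   ('c \<times> 'd) list \<Rightarrow> (('a set \<times> 'c) set \<times> ('a set \<times> 'd) set) list set" where
  "tensor_stalk_class S M N x U xs =
     tensor_class (rs_stalk S x) (ms_stalk S M x) (ms_stalk S N x)
       (map (map_prod (ms_germ S M x U) (ms_germ S N x U)) xs)"

definition tensor_sheaf ::
  "('a, 'b) ringed_space \<Rightarrow> ('a, 'b, 'c) mod_sheaf \<Rightarrow> ('a, 'b, 'd) mod_sheaf \<Rightarrow>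
   ('a, 'b, 'a \<Rightarrow> (('a set \<times> 'c) set \<times> ('a set \<times> 'd) set) list set) mod_sheaf" where
  "tensor_sheaf S M N =
     \<lparr>ms_mod = (\<lambda>U. ms_pointwise S
        (\<lambda>x. tensor_module (rs_stalk S x) (ms_stalk S M x) (ms_stalk S N x)
               (\<lambda>c (m, n). (c \<odot>\<^bsub>ms_stalk S M x\<^esub> m, n)))
        U
        {s \<in> extensional U. \<forall>x\<in>U. \<exists>V xs. openin (rs_top S) V \<and> x \<in> V \<and> V \<subseteq> U \<and>
           set xs \<subseteq> carrier (ms_mod M V) \<times> carrier (ms_mod N V) \<and>
           (\<forall>y\<in>V. s y = tensor_stalk_class S M N y V xs)}),
      ms_res = (\<lambda>U V s. restrict s V)\<rparr>"

definition global_tensor ::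
  "('a, 'b) ringed_space \<Rightarrow> ('a, 'b, 'c) mod_sheaf \<Rightarrow> ('a, 'b, 'd) mod_sheaf \<Rightarrow> 'c \<Rightarrow> 'd \<Rightarrow>
   'a \<Rightarrow> (('a set \<times> 'c) set \<times> ('a set \<times> 'd) set) list set" where
  "global_tensor S M N m n = (\<lambda>x\<in>rs_pts S. tensor_stalk_class S M N x (rs_pts S) [(m, n)])"

text \<open>The stalk of the structure sheaf of \<open>X\<close> at \<open>x\<close> as a module over the stalk of \<open>Y\<close> at \<open>f x\<close>.\<close>

definition stalk_via ::
  "('a, 'b) ringed_space \<Rightarrow> ('a, 'b, 'c, 'd) lrs_mor \<Rightarrow> 'a \<Rightarrow>
   (('c set \<times> 'd) set, ('a set \<times> 'b) set) module" where
  "stalk_via X f x = with_smult (rs_stalk X x) (\<lambda>r g. stalk_map X f x r \<otimes>\<^bsub>rs_stalk X x\<^esub> g)"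

definition pullback_stalk_class ::
  "('a, 'b) ringed_space \<Rightarrow> ('c, 'd) ringed_space \<Rightarrow> ('a, 'b, 'c, 'd) lrs_mor \<Rightarrow>
   ('c, 'd, 'e) mod_sheaf \<Rightarrow> 'a \<Rightarrow> 'a set \<Rightarrow> 'c set \<Rightarrow> ('e \<times> 'b) list \<Rightarrow>
   (('c set \<times> 'e) set \<times> ('a set \<times> 'b) set) list set" where
  "pullback_stalk_class X Y f F x V W xs =
     tensor_class (rs_stalk Y (mor_pt f x)) (ms_stalk Y F (mor_pt f x)) (stalk_via X f x)
       (map (map_prod (ms_germ Y F (mor_pt f x) W) (rs_germ X x V)) xs)"

definition pullback_sheaf ::
  "('a, 'b) ringed_space \<Rightarrow> ('c, 'd) ringed_space \<Rightarrow> ('a, 'b, 'c, 'd) lrs_mor \<Rightarrow>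
   ('c, 'd, 'e) mod_sheaf \<Rightarrow>
   ('a, 'b, 'a \<Rightarrow> (('c set \<times> 'e) set \<times> ('a set \<times> 'b) set) list set) mod_sheaf" where
  "pullback_sheaf X Y f F =
     \<lparr>ms_mod = (\<lambda>U. ms_pointwise X
        (\<lambda>x. tensor_module (rs_stalk Y (mor_pt f x)) (ms_stalk Y F (mor_pt f x)) (stalk_via X f x)
               (\<lambda>c (m, g). (m, c \<otimes>\<^bsub>rs_stalk X x\<^esub> g)))
        U
        {s \<in> extensional U. \<forall>x\<in>U. \<exists>V W xs. openin (rs_top X) V \<and> x \<in> V \<and> V \<subseteq> U \<and>
           openin (rs_top Y) W \<and> mor_pt f ` V \<subseteq> W \<and>
           set xs \<subseteq> carrier (ms_mod F W) \<times> carrier (rs_ring X V) \<and>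
           (\<forall>y\<in>V. s y = pullback_stalk_class X Y f F y V W xs)}),
      ms_res = (\<lambda>U V s. restrict s V)\<rparr>"

definition pullback_section ::
  "('a, 'b) ringed_space \<Rightarrow> ('c, 'd) ringed_space \<Rightarrow> ('a, 'b, 'c, 'd) lrs_mor \<Rightarrow>
   ('c, 'd, 'e) mod_sheaf \<Rightarrow> 'e \<Rightarrow>
   'a \<Rightarrow> (('c set \<times> 'e) set \<times> ('a set \<times> 'b) set) list set" where
  "pullback_section X Y f F m =
     (\<lambda>x\<in>rs_pts X. pullback_stalk_class X Y f F x (rs_pts X) (rs_pts Y) [(m, \<one>\<^bsub>rs_global X\<^esub>)])"


section \<open>\<open>Proj\<close> of a graded ring\<close>

text \<open>\<open>G d\<close> is the homogeneous part of degree \<open>d\<close> of the graded ring \<open>R\<close>.\<close>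

definition Proj_pts :: "('r, 'm) ring_scheme \<Rightarrow> (nat \<Rightarrow> 'r set) \<Rightarrow> 'r set set" where
  "Proj_pts R G =
     {\<pp>. primeideal \<pp> R \<and> \<pp> = genideal R (\<pp> \<inter> (\<Union>d. G d)) \<and> \<not> (\<Union>d\<in>{1..}. G d) \<subseteq> \<pp>}"

definition Proj_top :: "('r, 'm) ring_scheme \<Rightarrow> (nat \<Rightarrow> 'r set) \<Rightarrow> 'r set topology" where
  "Proj_top R G = topology_generated_by {{\<pp> \<in> Proj_pts R G. f \<notin> \<pp>} | f. f \<in> (\<Union>d\<in>{1..}. G d)}"

definition Proj_denoms :: "(nat \<Rightarrow> 'r set) \<Rightarrow> 'r set \<Rightarrow> 'r set" where
  "Proj_denoms G \<pp> = (\<Union>d. G d) - \<pp>"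

text \<open>Sections of \<open>\<O>(n)\<close>; multiplication is meaningful only for \<open>n = 0\<close>.\<close>

definition Proj_twist ::
  "('r, 'm) ring_scheme \<Rightarrow> (nat \<Rightarrow> 'r set) \<Rightarrow> nat \<Rightarrow> 'r set set \<Rightarrow>
   ('r set \<Rightarrow> ('r \<times> 'r) set) ring" where
  "Proj_twist R G n U =
     pointwise_ring (\<lambda>\<pp>. localization R (Proj_denoms G \<pp>)) U
       (fraction_sections R (Proj_top R G) (Proj_denoms G) (\<Union>d. G (d + n) \<times> G d) U)"

definition Proj ::
  "('r, 'm) ring_scheme \<Rightarrow> (nat \<Rightarrow> 'r set) \<Rightarrow>
   ('r set, 'r set \<Rightarrow> ('r \<times> 'r) set) ringed_space" where
  "Proj R G =
     \<lparr>rs_top = Proj_top R G, rs_ring = Proj_twist R G 0, rs_res = (\<lambda>U V s. restrict s V)\<rparr>"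

definition Proj_sheaf ::
  "('r, 'm) ring_scheme \<Rightarrow> (nat \<Rightarrow> 'r set) \<Rightarrow> nat \<Rightarrow>
   ('r set, 'r set \<Rightarrow> ('r \<times> 'r) set, 'r set \<Rightarrow> ('r \<times> 'r) set) mod_sheaf" where
  "Proj_sheaf R G n =
     \<lparr>ms_mod = (\<lambda>U. with_smult (Proj_twist R G n U)
        (\<lambda>c s. \<lambda>\<pp>\<in>U. c \<pp> \<otimes>\<^bsub>localization R (Proj_denoms G \<pp>)\<^esub> s \<pp>)),
      ms_res = (\<lambda>U V s. restrict s V)\<rparr>"

text \<open>The global section of \<open>\<O>(n)\<close> given by a homogeneous element of degree \<open>n\<close>.\<close>

definition Proj_section ::
  "('r, 'm) ring_scheme \<Rightarrow> (nat \<Rightarrow> 'r set) \<Rightarrow> 'r \<Rightarrow> 'r set \<Rightarrow> ('r \<times> 'r) set" where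
  "Proj_section R G r = (\<lambda>\<pp>\<in>Proj_pts R G. loc_frac R (Proj_denoms G \<pp>) r \<one>\<^bsub>R\<^esub>)"


section \<open>The projective line over the integers\<close>

text \<open>
  Polynomials in two variables over the integers are represented as \<^typ>\<open>int poly poly\<close>,
  \<open>x\<^sub>0\<close> being the inner and \<open>x\<^sub>1\<close> the outer variable.
\<close>

definition Z_x0_x1 :: "int poly poly ring" where
  "Z_x0_x1 = \<lparr>carrier = UNIV, monoid.mult = (*), one = 1, zero = 0, add = (+)\<rparr>"

definition bihom :: "nat \<Rightarrow> int poly poly set" where
  "bihom d = {p. \<forall>i j. poly.coeff (poly.coeff p i) j \<noteq> 0 \<longrightarrow> i + j = d}"

type_synonym P1_pt = "int poly poly set"
type_synonym P1_sec = "P1_pt \<Rightarrow> (int poly poly \<times> int poly poly) set"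

definition P1 :: "(P1_pt, P1_sec) ringed_space" where
  "P1 = Proj Z_x0_x1 bihom"

definition P1_O1 :: "(P1_pt, P1_sec, P1_sec) mod_sheaf" where
  "P1_O1 = Proj_sheaf Z_x0_x1 bihom 1"

definition P1_x0 :: P1_sec where
  "P1_x0 = Proj_section Z_x0_x1 bihom [:[:0, 1:]:]"

definition P1_x1 :: P1_sec where
  "P1_x1 = Proj_section Z_x0_x1 bihom [:0, 1:]"

type_synonym ('a, 'b) P1_point = "('a, 'b, P1_pt, P1_sec) lrs_mor"

text \<open>\<open>(L; l0, l1)\<close> is in the equivalence class of data corresponding to the point \<open>a\<close>.\<close>

definition represents ::
  "('a, 'b) ringed_space \<Rightarrow> ('a, 'b) P1_point \<Rightarrow> ('a, 'b, 'c) mod_sheaf \<Rightarrow> 'c \<times> 'c \<Rightarrow> bool" where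
  "represents S a L = (\<lambda>(l0, l1).
     line_bundle S L \<and> l0 \<in> carrier (ms_global S L) \<and> l1 \<in> carrier (ms_global S L) \<and>
     generate_sheaf S L l0 l1 \<and>
     (\<exists>\<theta>. mod_sheaf_iso S (pullback_sheaf S P1 a P1_O1) L \<theta> \<and>
        \<theta> (rs_pts S) (pullback_section S P1 a P1_O1 P1_x0) = l0 \<and>
        \<theta> (rs_pts S) (pullback_section S P1 a P1_O1 P1_x1) = l1))"


section \<open>The cross-ratio\<close>

definition cr_Delta ::
  "('a, 'b) ringed_space \<Rightarrow> ('a, 'b, 'c) mod_sheaf \<Rightarrow> 'c \<times> 'c \<Rightarrow> 'c \<times> 'c \<Rightarrow>
   'a \<Rightarrow> (('a set \<times> 'c) set \<times> ('a set \<times> 'c) set) list set" where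
  "cr_Delta S L = (\<lambda>(a0, a1) (b0, b1).
     global_tensor S L L a0 b1 \<ominus>\<^bsub>ms_global S (tensor_sheaf S L L)\<^esub> global_tensor S L L a1 b0)"

definition cr_formula ::
  "('a, 'b) ringed_space \<Rightarrow> ('a, 'b, 'c) mod_sheaf \<Rightarrow>
   ('a set \<Rightarrow> ('a \<Rightarrow> (('a set \<times> 'c) set \<times> ('a set \<times> 'c) set) list set) \<Rightarrow> 'b) \<Rightarrow>
   'c \<times> 'c \<Rightarrow> 'c \<times> 'c \<Rightarrow> 'c \<times> 'c \<Rightarrow> 'c \<times> 'c \<Rightarrow> 'b" where
  "cr_formula S L \<phi> a b c d =
     (let D = (\<lambda>p q. \<phi> (rs_pts S) (cr_Delta S L p q))
      in (D a c \<otimes>\<^bsub>rs_global S\<^esub> D b d)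
           \<otimes>\<^bsub>rs_global S\<^esub> inv\<^bsub>rs_global S\<^esub> (D a d \<otimes>\<^bsub>rs_global S\<^esub> D b c))"

text \<open>
  The type of the sections of the common line bundle \<open>L\<close> has to be fixed; the one chosen is that
  of pullbacks of \<open>\<O>(1)\<close>. As any \<open>L\<close> that can occur is isomorphic to such a pullback, this does
  not restrict the choice of \<open>L\<close>.
\<close>

type_synonym ('a, 'b) P1_pullback_sec =
  "'a \<Rightarrow> ((P1_pt set \<times> P1_sec) set \<times> ('a set \<times> 'b) set) list set"

definition cross_ratio ::
  "('a, 'b) ringed_space \<Rightarrow> ('a, 'b) P1_point \<Rightarrow> ('a, 'b) P1_point \<Rightarrow>
   ('a, 'b) P1_point \<Rightarrow> ('a, 'b) P1_point \<Rightarrow> 'b" where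
  "cross_ratio S a b c d =
     (THE r. \<exists>(L :: ('a, 'b, ('a, 'b) P1_pullback_sec) mod_sheaf) \<alpha> \<beta> \<gamma> \<delta> \<phi>.
        represents S a L \<alpha> \<and> represents S b L \<beta> \<and> represents S c L \<gamma> \<and> represents S d L \<delta> \<and>
        mod_sheaf_iso S (tensor_sheaf S L L) (struct_sheaf S) \<phi> \<and>
        r = cr_formula S L \<phi> \<alpha> \<beta> \<gamma> \<delta>)"

end

theory Submission
  imports Defs "HOL-Algebra.QuotRing"
begin

text \<open>
  A basis \<open>e\<close> of \<open>a\<^sup>*\<O>(1)\<close> over an open set \<open>U\<close> gives homogeneous coordinates \<open>p\<close> of \<open>a\<close> over \<open>U\<close>,
  unique up to a unit; similarly \<open>q\<close>, \<open>r\<close>, \<open>s\<close> for \<open>b\<close>, \<open>c\<close>, \<open>d\<close>. If \<open>a\<close> and \<open>b\<close> are strongly distinct,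
  then \<open>[p q] = p\<^sub>0 q\<^sub>1 - p\<^sub>1 q\<^sub>0\<close> is a unit: otherwise it vanishes in the residue field \<open>K\<close> of some point,
  and the scheme \<open>Spec K\<close> equalizes \<open>a\<close> and \<open>b\<close>.

  For any representation by a common line bundle, the cross-ratio \<open>\<rho>\<close> satisfies
  \<open>\<rho> [p s][q r] = [p r][q s]\<close> in local coordinates, because the trivialization of the square of the bundle
  multiplies every bracket by the same local unit. This relation determines \<open>\<rho>\<close>. A common bundle
  exists: \<open>e\<^sub>b \<mapsto> [p r]/[q r] e\<^sub>a\<close> glues to an isomorphism \<open>b\<^sup>*\<O>(1) \<rightarrow> a\<^sup>*\<O>(1)\<close>, and
  \<open>e\<^sub>a \<otimes> e\<^sub>a \<mapsto> [q r]/([p q][p r])\<close> to a trivialization of the square. The symmetries follow from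
  \<open>[q p] = -[p q]\<close> and the Pluecker relation \<open>[p r][q s] - [p s][q r] = [p q][r s]\<close>.
\<close>


section \<open>Sheaves and germs\<close>

text \<open>The definitions are stalkwise: operations on stalks are unions over all representatives,
  tensor products are classes of lists under a generated relation, and tensor and pullback sheaves
  consist of functions into such stalks. They become computable through rank one: tensoring with a
  free module on one generator gives the other factor back. So line bundles are handled through
  bases, local sections \<open>e\<close> for which \<open>c \<mapsto> c e\<close> is bijective over
  every smaller open set, and isomorphisms are built by matching bases with equal transition
  coefficients.

  A second obstacle lies between strong distinctness and units. A vanishing bracket only says that
  coordinate ratios of \<open>a\<close> and \<open>b\<close> have equal values in a residue field,
  whereas equality of morphisms concerns every section over every open set of the projective line.
  The agreement therefore has to be propagated: from the ratios \<open>x_j / x_k\<close> to all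
  forms, from these to the image points, because a homogeneous prime is determined by its forms, and
  finally to fractions.\<close>

locale presheaf =
  fixes X :: "'a topology" and C :: "'a set \<Rightarrow> 'c set" and r :: "'a set \<Rightarrow> 'a set \<Rightarrow> 'c \<Rightarrow> 'c"
  assumes res_in: "openin X U \<Longrightarrow> openin X V \<Longrightarrow> V \<subseteq> U \<Longrightarrow> s \<in> C U \<Longrightarrow> r U V s \<in> C V"
    and res_id: "openin X U \<Longrightarrow> s \<in> C U \<Longrightarrow> r U U s = s"
    and res_res: "openin X U \<Longrightarrow> openin X V \<Longrightarrow> openin X W \<Longrightarrow> W \<subseteq> V \<Longrightarrow> V \<subseteq> U \<Longrightarrow> s \<in> C U
      \<Longrightarrow> r V W (r U V s) = r U W s"

locale sheaf = presheaf +
  assumes glue: "(\<forall>V\<in>\<U>. openin X V \<and> s V \<in> C V) \<Longrightarrow>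
      (\<forall>V\<in>\<U>. \<forall>W\<in>\<U>. r V (V \<inter> W) (s V) = r W (V \<inter> W) (s W)) \<Longrightarrow>
      \<exists>!t. t \<in> C (\<Union>\<U>) \<and> (\<forall>V\<in>\<U>. r (\<Union>\<U>) V t = s V)"

lemma is_sheaf_iff: "is_sheaf X C r \<longleftrightarrow> sheaf X C r"
proof
  assume *: "is_sheaf X C r"
  show "sheaf X C r"
  proof
    fix \<U> and s :: "'a set \<Rightarrow> 'b"
    assume "\<forall>V\<in>\<U>. openin X V \<and> s V \<in> C V"
      "\<forall>V\<in>\<U>. \<forall>W\<in>\<U>. r V (V \<inter> W) (s V) = r W (V \<inter> W) (s W)"
    then show "\<exists>!t. t \<in> C (\<Union>\<U>) \<and> (\<forall>V\<in>\<U>. r (\<Union>\<U>) V t = s V)"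
      using * unfolding is_sheaf_def by (elim conjE) metis
  qed (use * in \<open>simp_all add: is_sheaf_def\<close>)
next
  assume "sheaf X C r"
  then interpret sheaf X C r .
  show "is_sheaf X C r"
    unfolding is_sheaf_def
  proof (intro conjI allI impI ballI; (elim conjE)?)
    fix \<U> and s :: "'a set \<Rightarrow> 'b"
    assume "\<forall>V\<in>\<U>. openin X V \<and> s V \<in> C V"
      "\<forall>V\<in>\<U>. \<forall>W\<in>\<U>. r V (V \<inter> W) (s V) = r W (V \<inter> W) (s W)"
    then show "\<exists>!t. t \<in> C (\<Union>\<U>) \<and> (\<forall>V\<in>\<U>. r (\<Union>\<U>) V t = s V)"
      by (rule glue)
  qed (use res_in res_id res_res in simp_all)
qed

context sheaf
begin

text \<open>Both sections glue the same family, namely their common restrictions to the open sets on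
  which they agree, and gluing is unique.\<close>

lemma eqI:
  assumes U: "openin X U" and s: "s \<in> C U" and t: "t \<in> C U"
    and loc: "\<And>x. x \<in> U \<Longrightarrow> \<exists>V. openin X V \<and> x \<in> V \<and> V \<subseteq> U \<and> r U V s = r U V t"
  shows "s = t"
proof -
  define \<U> where "\<U> = {V. openin X V \<and> V \<subseteq> U \<and> r U V s = r U V t}"
  have un: "\<Union>\<U> = U" using loc unfolding \<U>_def by blast
  have "\<exists>!t'. t' \<in> C (\<Union>\<U>) \<and> (\<forall>V\<in>\<U>. r (\<Union>\<U>) V t' = r U V s)"
    by (rule glue) (use U s t in \<open>auto simp: \<U>_def res_in res_res openin_Int\<close>)
  then show ?thesis using s t unfolding un by (auto simp: \<U>_def)
qed

text \<open>The property \<open>P\<close> singles out at most one section over each open set and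
  survives restriction, so local solutions agree on overlaps automatically. This spares later gluing
  arguments the choice of a cover; the glued section restricts to every solution, not only to the
  chosen ones.\<close>

lemma glue_property:
  assumes U: "openin X U"
    and ex: "\<And>x. x \<in> U \<Longrightarrow> \<exists>V s. openin X V \<and> x \<in> V \<and> V \<subseteq> U \<and> s \<in> C V \<and> P V s"
    and restr: "\<And>V V' s. openin X V \<Longrightarrow> openin X V' \<Longrightarrow> V' \<subseteq> V \<Longrightarrow> V \<subseteq> U \<Longrightarrow> s \<in> C V \<Longrightarrow> P V s
      \<Longrightarrow> P V' (r V V' s)"
    and uniq: "\<And>V s s'. openin X V \<Longrightarrow> V \<subseteq> U \<Longrightarrow> s \<in> C V \<Longrightarrow> s' \<in> C V \<Longrightarrow> P V s \<Longrightarrow> P V s' \<Longrightarrow> s = s'"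
  obtains t where "t \<in> C U"
    "\<And>V s. openin X V \<Longrightarrow> V \<subseteq> U \<Longrightarrow> s \<in> C V \<Longrightarrow> P V s \<Longrightarrow> r U V t = s"
proof -
  define \<U> where "\<U> = {V. openin X V \<and> V \<subseteq> U \<and> (\<exists>s\<in>C V. P V s)}"
  define \<sigma> where "\<sigma> V = (SOME s. s \<in> C V \<and> P V s)" for V
  have \<sigma>: "\<sigma> V \<in> C V \<and> P V (\<sigma> V)" if "V \<in> \<U>" for V
    using that unfolding \<U>_def \<sigma>_def by (auto intro: someI2_ex)
  have un: "\<Union>\<U> = U"
  proof
    show "U \<subseteq> \<Union>\<U>"
    proof
      fix x assume "x \<in> U"
      from ex[OF this] obtain V s where "openin X V" "x \<in> V" "V \<subseteq> U" "s \<in> C V" "P V s" by blast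
      then show "x \<in> \<Union>\<U>" unfolding \<U>_def by blast
    qed
  qed (auto simp: \<U>_def)
  have "\<exists>!t. t \<in> C (\<Union>\<U>) \<and> (\<forall>V\<in>\<U>. r (\<Union>\<U>) V t = \<sigma> V)"
  proof (rule glue; intro ballI)
    fix V W assume VW: "V \<in> \<U>" "W \<in> \<U>"
    then have o: "openin X V" "openin X W" "openin X (V \<inter> W)" "V \<subseteq> U" "W \<subseteq> U"
      unfolding \<U>_def by auto
    show "r V (V \<inter> W) (\<sigma> V) = r W (V \<inter> W) (\<sigma> W)"
    proof (rule uniq[of "V \<inter> W"])
      show "P (V \<inter> W) (r V (V \<inter> W) (\<sigma> V))" using VW o \<sigma> by (intro restr) auto
      show "P (V \<inter> W) (r W (V \<inter> W) (\<sigma> W))" using VW o \<sigma> by (intro restr) auto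
    qed (use VW o \<sigma> in \<open>auto intro!: res_in\<close>)
  qed (use \<sigma> in \<open>auto simp: \<U>_def\<close>)
  then obtain t where t: "t \<in> C U" "\<And>V. V \<in> \<U> \<Longrightarrow> r U V t = \<sigma> V" unfolding un by blast
  show thesis
  proof (rule that[OF t(1)])
    fix V s assume V: "openin X V" "V \<subseteq> U" "s \<in> C V" "P V s"
    then have "V \<in> \<U>" unfolding \<U>_def by blast
    with t \<sigma> V uniq show "r U V t = s" by metis
  qed
qed

end

text \<open>The condition \<open>Q\<close>, required only near each point, may be any that passes to
  smaller open sets and ignores values outside the set. Sheaves of fractions, tensor products and
  pullbacks all have this form.\<close>

lemma local_functions_sheaf:
  assumes restr: "\<And>V V' s. openin X V \<Longrightarrow> openin X V' \<Longrightarrow> V' \<subseteq> V \<Longrightarrow> Q V s \<Longrightarrow> Q V' s"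
    and local: "\<And>V s t. Q V s \<Longrightarrow> (\<And>x. x \<in> V \<Longrightarrow> s x = t x) \<Longrightarrow> Q V t"
  shows "sheaf X (\<lambda>U. {s \<in> extensional U. \<forall>x\<in>U. \<exists>V. openin X V \<and> x \<in> V \<and> V \<subseteq> U \<and> Q V s})
     (\<lambda>U V s. restrict s V)" (is "sheaf X ?C ?r")
proof
  have resin: "restrict s V \<in> ?C V" if UV: "openin X V" "V \<subseteq> U" "s \<in> ?C U" for U V s
  proof -
    have UV3: "\<forall>x\<in>U. \<exists>V. openin X V \<and> x \<in> V \<and> V \<subseteq> U \<and> Q V s"
      using UV(3) by simp
    have "\<exists>W. openin X W \<and> x \<in> W \<and> W \<subseteq> V \<and> Q W (restrict s V)" if x: "x \<in> V" for x
    proof -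
      obtain W where W: "openin X W" "x \<in> W" "W \<subseteq> U" "Q W s"
        using bspec[OF UV3 subsetD[OF UV(2) x]] by blast
      have "Q (W \<inter> V) s" using W UV(1) by - (rule restr[of W "W \<inter> V" s], auto)
      then have "Q (W \<inter> V) (restrict s V)" by (rule local) auto
      then show ?thesis using W UV(1) x by (intro exI[of _ "W \<inter> V"]) auto
    qed
    then show ?thesis by (simp del: restrict_apply)
  qed
  show "?r U V s \<in> ?C V" if "openin X U" "openin X V" "V \<subseteq> U" "s \<in> ?C U" for U V s
    using resin[OF that(2-4)] .
  show "restrict s U = s" if "s \<in> ?C U" for U s
    using that by (auto simp: extensional_restrict)
  show "restrict (restrict s V) W = restrict s W" if "W \<subseteq> V" for V W and s :: "'a \<Rightarrow> 'b"
    using that by (auto simp: restrict_def fun_eq_iff)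
  fix \<U> and s :: "'a set \<Rightarrow> 'a \<Rightarrow> 'b"
  assume s: "\<forall>V\<in>\<U>. openin X V \<and> s V \<in> ?C V"
    and compat: "\<forall>V\<in>\<U>. \<forall>W\<in>\<U>. restrict (s V) (V \<inter> W) = restrict (s W) (V \<inter> W)"
  \<comment> \<open>The value at a point is taken from an arbitrary member of the cover that
    contains it; compatibility makes the choice irrelevant.\<close>
  define t where "t = (\<lambda>x\<in>\<Union>\<U>. s (SOME V. V \<in> \<U> \<and> x \<in> V) x)"
  have t: "t x = s V x" if "V \<in> \<U>" "x \<in> V" for V x
  proof -
    define W where "W = (SOME V. V \<in> \<U> \<and> x \<in> V)"
    have W: "W \<in> \<U> \<and> x \<in> W" unfolding W_def using that by (intro someI) auto
    then have "restrict (s V) (V \<inter> W) x = restrict (s W) (V \<inter> W) x" using compat that by metis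
    moreover have "t x = s W x" using that unfolding t_def W_def by auto
    ultimately show ?thesis using W that by simp
  qed
  have tC: "t \<in> ?C (\<Union>\<U>)"
  proof -
    have "\<exists>W. openin X W \<and> x \<in> W \<and> W \<subseteq> \<Union>\<U> \<and> Q W t" if x: "x \<in> \<Union>\<U>" for x
    proof -
      obtain V where V: "V \<in> \<U>" "x \<in> V" using x by blast
      then obtain W where W: "openin X W" "x \<in> W" "W \<subseteq> V" "Q W (s V)"
        using bspec[OF s V(1)] by auto
      have "Q W t" using W(4) by (rule local) (use t V W in auto)
      then show ?thesis using W V by blast
    qed
    then show ?thesis by (auto simp: t_def)
  qed
  have tres: "restrict t V = s V" if "V \<in> \<U>" for V
    using that t s by (auto simp: fun_eq_iff restrict_def extensional_def)
  show "\<exists>!t. t \<in> ?C (\<Union>\<U>) \<and> (\<forall>V\<in>\<U>. restrict t V = s V)"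
  proof (rule ex1I[of _ t])
    fix t' assume t': "t' \<in> ?C (\<Union>\<U>) \<and> (\<forall>V\<in>\<U>. restrict t' V = s V)"
    have "t' x = t x" for x
    proof (cases "x \<in> \<Union>\<U>")
      case True
      then obtain V where "V \<in> \<U>" "x \<in> V" by blast
      then show ?thesis using t t' by (metis restrict_apply')
    next
      case False
      then show ?thesis using t' tC by (auto simp: extensional_def)
    qed
    then show "t' = t" by blast
  qed (use tC tres in auto)
qed

text \<open>Only the carriers enter, and module records extend ring records, so germs of functions
  and germs of sections of module sheaves are treated together.\<close>

locale ring_presheaf =
  fixes X :: "'a topology" and F :: "'a set \<Rightarrow> ('c, 'm) ring_scheme"
    and r :: "'a set \<Rightarrow> 'a set \<Rightarrow> 'c \<Rightarrow> 'c"
  assumes presheaf: "presheaf X (\<lambda>U. carrier (F U)) r"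
begin

sublocale presheaf X "\<lambda>U. carrier (F U)" r by (rule presheaf)

lemma germ_self: "openin X U \<Longrightarrow> x \<in> U \<Longrightarrow> s \<in> carrier (F U) \<Longrightarrow> (U, s) \<in> germ X F r x U s"
  unfolding germ_def by blast

lemma germ_eqI:
  assumes "openin X U" "openin X V" "openin X W" "x \<in> W" "W \<subseteq> U" "W \<subseteq> V"
    "s \<in> carrier (F U)" "t \<in> carrier (F V)" "r U W s = r V W t"
  shows "germ X F r x U s = germ X F r x V t"
proof -
  have "germ X F r x U s \<subseteq> germ X F r x V t"
    if a: "openin X U" "openin X V" "W \<subseteq> U" "W \<subseteq> V" "s \<in> carrier (F U)" "t \<in> carrier (F V)"
      "r U W s = r V W t" for U V s t
  proof clarify
    fix V' t' assume "(V', t') \<in> germ X F r x U s"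
    then obtain W' where W': "openin X V'" "x \<in> V'" "t' \<in> carrier (F V')"
      "openin X W'" "x \<in> W'" "W' \<subseteq> U \<inter> V'" "r U W' s = r V' W' t'"
      unfolding germ_def by blast
    have o: "openin X (W \<inter> W')" using assms W' by auto
    have "r V (W \<inter> W') t = r W (W \<inter> W') (r V W t)" using a assms(3) W' o by (intro res_res[symmetric]) auto
    also have "\<dots> = r U (W \<inter> W') s"
      unfolding a(7)[symmetric] using a assms(3) W' o by (intro res_res) auto
    also have "\<dots> = r W' (W \<inter> W') (r U W' s)" using a W' o by (intro res_res[symmetric]) auto
    also have "\<dots> = r V' (W \<inter> W') t'" unfolding W'(7) using a W' o by (intro res_res) auto
    finally show "(V', t') \<in> germ X F r x V t"
      unfolding germ_def using W' a(3,4) o assms(4)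
      by (intro CollectI case_prodI conjI exI[of _ "W \<inter> W'"]) auto
  qed
  from this[of U V s t] this[of V U t s] show ?thesis using assms by simp
qed

lemma germ_eqD:
  assumes "germ X F r x U s = germ X F r x V t" "openin X V" "x \<in> V" "t \<in> carrier (F V)"
  obtains W where "openin X W" "x \<in> W" "W \<subseteq> U" "W \<subseteq> V" "r U W s = r V W t"
proof -
  have "(V, t) \<in> germ X F r x U s" using germ_self[of V x t] assms by simp
  then show thesis using that unfolding germ_def by blast
qed

lemma germ_memD:
  assumes "(V, t) \<in> germ X F r x U s" "openin X U" "s \<in> carrier (F U)"
  shows "openin X V" "x \<in> V" "t \<in> carrier (F V)" "germ X F r x V t = germ X F r x U s"
proof -
  from assms show 1: "openin X V" "x \<in> V" "t \<in> carrier (F V)" unfolding germ_def by auto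
  from assms(1) obtain W where "openin X W" "x \<in> W" "W \<subseteq> U \<inter> V" "r U W s = r V W t"
    unfolding germ_def by auto
  then show "germ X F r x V t = germ X F r x U s"
    using 1 assms by (intro germ_eqI[of _ _ W]) auto
qed

lemma germ_res:
  assumes "openin X U" "openin X V" "x \<in> V" "V \<subseteq> U" "s \<in> carrier (F U)"
  shows "germ X F r x V (r U V s) = germ X F r x U s"
  using assms by (intro germ_eqI[of _ _ V]) (auto simp: res_res res_in)

end

text \<open>An operation that commutes with restriction descends to germs: any representatives agree
  with the given ones on a common neighbourhood. Hence the unions over all representatives in
  \<open>stalk\<close> and \<open>ms_stalk\<close> are unions of one-element sets. Three sheaves are
  allowed so that scalar multiplication is covered too.\<close>

lemma germ_operation:
  assumes F: "ring_presheaf X F rF" and G: "ring_presheaf X G rG" and H: "ring_presheaf X H rH"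
    and cl: "\<And>U s t. openin X U \<Longrightarrow> s \<in> carrier (F U) \<Longrightarrow> t \<in> carrier (G U) \<Longrightarrow> f U s t \<in> carrier (H U)"
    and nat: "\<And>U V s t. openin X U \<Longrightarrow> openin X V \<Longrightarrow> V \<subseteq> U \<Longrightarrow> s \<in> carrier (F U) \<Longrightarrow>
      t \<in> carrier (G U) \<Longrightarrow> rH U V (f U s t) = f V (rF U V s) (rG U V t)"
    and U: "openin X U" "x \<in> U" "s \<in> carrier (F U)" and t: "t \<in> carrier (G U)"
  shows "\<Union>{germ X H rH x (U' \<inter> V') (f (U' \<inter> V') (rF U' (U' \<inter> V') s') (rG V' (U' \<inter> V') t'))
      | U' s' V' t'. (U', s') \<in> germ X F rF x U s \<and> (V', t') \<in> germ X G rG x U t}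
    = germ X H rH x U (f U s t)" (is "\<Union>?S = ?g")
proof -
  interpret F: ring_presheaf X F rF by fact
  interpret G: ring_presheaf X G rG by fact
  interpret H: ring_presheaf X H rH by fact
  have "germ X H rH x (U' \<inter> V') (f (U' \<inter> V') (rF U' (U' \<inter> V') s') (rG V' (U' \<inter> V') t')) = ?g"
    if st: "(U', s') \<in> germ X F rF x U s" "(V', t') \<in> germ X G rG x U t" for U' s' V' t'
  proof -
    note 1 = F.germ_memD[OF st(1) U(1) U(3)] and 2 = G.germ_memD[OF st(2) U(1) t]
    obtain A where A: "openin X A" "x \<in> A" "A \<subseteq> U'" "A \<subseteq> U" "rF U' A s' = rF U A s"
      using F.germ_eqD[OF 1(4) U] by metis
    obtain B where B: "openin X B" "x \<in> B" "B \<subseteq> V'" "B \<subseteq> U" "rG V' B t' = rG U B t"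
      using G.germ_eqD[OF 2(4) U(1,2) t] by metis
    have o: "openin X (A \<inter> B)" "openin X (U' \<inter> V')" using A B 1 2 by auto
    have s: "rF U' (A \<inter> B) s' = rF U (A \<inter> B) s"
      using F.res_res[of U' A "A \<inter> B" s'] F.res_res[of U A "A \<inter> B" s] A 1 o U by simp
    have t: "rG V' (A \<inter> B) t' = rG U (A \<inter> B) t"
      using G.res_res[of V' B "A \<inter> B" t'] G.res_res[of U B "A \<inter> B" t] B 2 o U t by simp
    show ?thesis
    proof (rule H.germ_eqI[of _ _ "A \<inter> B"])
      show "rH (U' \<inter> V') (A \<inter> B) (f (U' \<inter> V') (rF U' (U' \<inter> V') s') (rG V' (U' \<inter> V') t'))
          = rH U (A \<inter> B) (f U s t)"
      proof -
        have "rH (U' \<inter> V') (A \<inter> B) (f (U' \<inter> V') (rF U' (U' \<inter> V') s') (rG V' (U' \<inter> V') t'))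
          = f (A \<inter> B) (rF (U' \<inter> V') (A \<inter> B) (rF U' (U' \<inter> V') s'))
              (rG (U' \<inter> V') (A \<inter> B) (rG V' (U' \<inter> V') t'))"
          using A B 1 2 o by (intro nat F.res_in G.res_in) auto
        also have "rF (U' \<inter> V') (A \<inter> B) (rF U' (U' \<inter> V') s') = rF U (A \<inter> B) s"
          unfolding s[symmetric] using A B 1 o by (intro F.res_res) auto
        also have "rG (U' \<inter> V') (A \<inter> B) (rG V' (U' \<inter> V') t') = rG U (A \<inter> B) t"
          unfolding t[symmetric] using A B 2 o by (intro G.res_res) auto
        also have "f (A \<inter> B) (rF U (A \<inter> B) s) (rG U (A \<inter> B) t) = rH U (A \<inter> B) (f U s t)"
          using A o U \<open>t \<in> carrier (G U)\<close> by (intro nat[symmetric]) auto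
        finally show ?thesis .
      qed
    qed (use A B 1 2 o U \<open>t \<in> carrier (G U)\<close> in \<open>auto intro!: cl F.res_in G.res_in\<close>)
  qed
  moreover have "?S \<noteq> {}" using F.germ_self[OF U] G.germ_self[OF U(1,2) t] by blast
  ultimately have "?S = {?g}" by blast
  then show ?thesis by simp
qed


section \<open>Stalks of ringed spaces\<close>

context ring_presheaf
begin

lemma stalk_in: "openin X U \<Longrightarrow> x \<in> U \<Longrightarrow> s \<in> carrier (F U) \<Longrightarrow> germ X F r x U s \<in> carrier (stalk X F r x)"
  unfolding stalk_def by auto

lemma stalk_repE:
  assumes "A \<in> carrier (stalk X F r x)"
  obtains U s where "openin X U" "x \<in> U" "s \<in> carrier (F U)" "A = germ X F r x U s"
  using assms unfolding stalk_def by auto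

lemma stalk_rep_within:
  assumes "A \<in> carrier (stalk X F r x)" "openin X W" "x \<in> W"
  obtains U s where "openin X U" "x \<in> U" "U \<subseteq> W" "s \<in> carrier (F U)" "A = germ X F r x U s"
proof -
  obtain U s where U: "openin X U" "x \<in> U" "s \<in> carrier (F U)" "A = germ X F r x U s"
    using assms stalk_repE by metis
  show thesis
    using U assms(2,3) that[of "U \<inter> W" "r U (U \<inter> W) s"] germ_res[of U "U \<inter> W" x s] res_in[of U "U \<inter> W" s]
    by auto
qed

lemma stalk_rep2E:
  assumes "A \<in> carrier (stalk X F r x)" "B \<in> carrier (stalk X F r x)"
  obtains U s t where "openin X U" "x \<in> U" "s \<in> carrier (F U)" "t \<in> carrier (F U)"
    "A = germ X F r x U s" "B = germ X F r x U t"
proof -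
  obtain U s where U: "openin X U" "x \<in> U" "s \<in> carrier (F U)" "A = germ X F r x U s"
    using assms stalk_repE by metis
  obtain V t where V: "openin X V" "x \<in> V" "V \<subseteq> U" "t \<in> carrier (F V)" "B = germ X F r x V t"
    using stalk_rep_within[OF assms(2) U(1,2)] by metis
  show thesis using U V that[of V "r U V s" t] germ_res[of U V x s] res_in[of U V s] by auto
qed

lemma stalk_rep3E:
  assumes "A \<in> carrier (stalk X F r x)" "B \<in> carrier (stalk X F r x)" "C \<in> carrier (stalk X F r x)"
  obtains U s t u where "openin X U" "x \<in> U" "s \<in> carrier (F U)" "t \<in> carrier (F U)" "u \<in> carrier (F U)"
    "A = germ X F r x U s" "B = germ X F r x U t" "C = germ X F r x U u"
proof -
  obtain U s t where U: "openin X U" "x \<in> U" "s \<in> carrier (F U)" "t \<in> carrier (F U)"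
    "A = germ X F r x U s" "B = germ X F r x U t"
    using stalk_rep2E[OF assms(1,2)] by metis
  obtain V u where V: "openin X V" "x \<in> V" "V \<subseteq> U" "u \<in> carrier (F V)" "C = germ X F r x V u"
    using stalk_rep_within[OF assms(3) U(1,2)] by metis
  show thesis
    using U V that[of V "r U V s" "r U V t" u] germ_res[of U V x] res_in[of U V] by auto
qed

end

locale additive_presheaf = ring_presheaf +
  assumes add_in: "openin X U \<Longrightarrow> s \<in> carrier (F U) \<Longrightarrow> t \<in> carrier (F U) \<Longrightarrow> s \<oplus>\<^bsub>F U\<^esub> t \<in> carrier (F U)"
    and res_add: "openin X U \<Longrightarrow> openin X V \<Longrightarrow> V \<subseteq> U \<Longrightarrow> s \<in> carrier (F U) \<Longrightarrow> t \<in> carrier (F U)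
      \<Longrightarrow> r U V (s \<oplus>\<^bsub>F U\<^esub> t) = r U V s \<oplus>\<^bsub>F V\<^esub> r U V t"
begin

lemma stalk_add:
  assumes "openin X U" "x \<in> U" "s \<in> carrier (F U)" "t \<in> carrier (F U)"
  shows "germ X F r x U s \<oplus>\<^bsub>stalk X F r x\<^esub> germ X F r x U t = germ X F r x U (s \<oplus>\<^bsub>F U\<^esub> t)"
proof -
  have "ring_presheaf X F r" by unfold_locales
  from germ_operation[OF this this this, of "\<lambda>U. (\<oplus>\<^bsub>F U\<^esub>)"] add_in res_add assms
  show ?thesis by (simp add: stalk_def)
qed

end

locale ringed =
  fixes S :: "('a, 'b) ringed_space"
  assumes ringed: "ringed_space S"
begin

abbreviation opn :: "'a set \<Rightarrow> bool" where "opn \<equiv> openin (rs_top S)"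
abbreviation \<O> where "\<O> \<equiv> rs_ring S"
abbreviation res where "res \<equiv> rs_res S"
abbreviation \<O>\<^sub>x where "\<O>\<^sub>x \<equiv> rs_stalk S"

sublocale \<O>: sheaf "rs_top S" "\<lambda>U. carrier (\<O> U)" res
  using ringed unfolding ringed_space_def is_sheaf_iff by blast

lemma cring_\<O>: "opn U \<Longrightarrow> cring (\<O> U)"
  using ringed unfolding ringed_space_def by blast

lemma res_hom: "opn U \<Longrightarrow> opn V \<Longrightarrow> V \<subseteq> U \<Longrightarrow> res U V \<in> ring_hom (\<O> U) (\<O> V)"
  using ringed unfolding ringed_space_def by blast

lemma res_simps:
  assumes "opn U" "opn V" "V \<subseteq> U"
  shows "s \<in> carrier (\<O> U) \<Longrightarrow> res U V s \<in> carrier (\<O> V)"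
    and "s \<in> carrier (\<O> U) \<Longrightarrow> t \<in> carrier (\<O> U) \<Longrightarrow> res U V (s \<oplus>\<^bsub>\<O> U\<^esub> t) = res U V s \<oplus>\<^bsub>\<O> V\<^esub> res U V t"
    and "s \<in> carrier (\<O> U) \<Longrightarrow> t \<in> carrier (\<O> U) \<Longrightarrow> res U V (s \<otimes>\<^bsub>\<O> U\<^esub> t) = res U V s \<otimes>\<^bsub>\<O> V\<^esub> res U V t"
    and "res U V \<one>\<^bsub>\<O> U\<^esub> = \<one>\<^bsub>\<O> V\<^esub>"
    and "res U V \<zero>\<^bsub>\<O> U\<^esub> = \<zero>\<^bsub>\<O> V\<^esub>"
    and "s \<in> carrier (\<O> U) \<Longrightarrow> res U V (\<ominus>\<^bsub>\<O> U\<^esub> s) = \<ominus>\<^bsub>\<O> V\<^esub> res U V s"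
    and "s \<in> carrier (\<O> U) \<Longrightarrow> t \<in> carrier (\<O> U) \<Longrightarrow> res U V (s \<ominus>\<^bsub>\<O> U\<^esub> t) = res U V s \<ominus>\<^bsub>\<O> V\<^esub> res U V t"
proof -
  interpret U: cring "\<O> U" using assms cring_\<O> by blast
  interpret V: cring "\<O> V" using assms cring_\<O> by blast
  interpret h: ring_hom_cring "\<O> U" "\<O> V" "res U V"
    by unfold_locales (rule res_hom[OF assms])
  show "s \<in> carrier (\<O> U) \<Longrightarrow> res U V s \<in> carrier (\<O> V)" by simp
  show "s \<in> carrier (\<O> U) \<Longrightarrow> t \<in> carrier (\<O> U) \<Longrightarrow> res U V (s \<oplus>\<^bsub>\<O> U\<^esub> t) = res U V s \<oplus>\<^bsub>\<O> V\<^esub> res U V t" by simp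
  show "s \<in> carrier (\<O> U) \<Longrightarrow> t \<in> carrier (\<O> U) \<Longrightarrow> res U V (s \<otimes>\<^bsub>\<O> U\<^esub> t) = res U V s \<otimes>\<^bsub>\<O> V\<^esub> res U V t" by simp
  show "res U V \<one>\<^bsub>\<O> U\<^esub> = \<one>\<^bsub>\<O> V\<^esub>" "res U V \<zero>\<^bsub>\<O> U\<^esub> = \<zero>\<^bsub>\<O> V\<^esub>" by simp_all
  show "s \<in> carrier (\<O> U) \<Longrightarrow> res U V (\<ominus>\<^bsub>\<O> U\<^esub> s) = \<ominus>\<^bsub>\<O> V\<^esub> res U V s" by simp
  show "s \<in> carrier (\<O> U) \<Longrightarrow> t \<in> carrier (\<O> U) \<Longrightarrow> res U V (s \<ominus>\<^bsub>\<O> U\<^esub> t) = res U V s \<ominus>\<^bsub>\<O> V\<^esub> res U V t"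
    by (simp add: a_minus_def)
qed

sublocale \<O>: additive_presheaf "rs_top S" \<O> res
  by unfold_locales (auto simp: res_simps \<O>.res_id \<O>.res_res intro: ring.ring_simprules cring.axioms(1)[OF cring_\<O>])

lemma stalk_mult:
  assumes "opn U" "x \<in> U" "s \<in> carrier (\<O> U)" "t \<in> carrier (\<O> U)"
  shows "rs_germ S x U s \<otimes>\<^bsub>\<O>\<^sub>x x\<^esub> rs_germ S x U t = rs_germ S x U (s \<otimes>\<^bsub>\<O> U\<^esub> t)"
proof -
  have "ring_presheaf (rs_top S) \<O> res" by unfold_locales
  from germ_operation[OF this this this, of "\<lambda>U. (\<otimes>\<^bsub>\<O> U\<^esub>)"] assms
  show ?thesis by (simp add: stalk_def res_simps cring.cring_simprules(5)[OF cring_\<O>])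
qed

lemma germ_one: "opn U \<Longrightarrow> x \<in> U \<Longrightarrow> rs_germ S x U \<one>\<^bsub>\<O> U\<^esub> = \<one>\<^bsub>\<O>\<^sub>x x\<^esub>"
  using \<O>.germ_res[of "rs_pts S" U x "\<one>\<^bsub>rs_global S\<^esub>"] cring.cring_simprules(6)[OF cring_\<O>]
  by (simp add: stalk_def res_simps openin_subset)

lemma germ_zero: "opn U \<Longrightarrow> x \<in> U \<Longrightarrow> rs_germ S x U \<zero>\<^bsub>\<O> U\<^esub> = \<zero>\<^bsub>\<O>\<^sub>x x\<^esub>"
  using \<O>.germ_res[of "rs_pts S" U x "\<zero>\<^bsub>rs_global S\<^esub>"] cring.cring_simprules(2)[OF cring_\<O>]
  by (simp add: stalk_def res_simps openin_subset)

text \<open>Each axiom involves at most three germs, which have representatives over one open set;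
  there it is an axiom of the ring of sections.\<close>

lemma cring_stalk:
  assumes x: "x \<in> rs_pts S"
  shows "cring (\<O>\<^sub>x x)"
proof -
  let ?g = "rs_germ S x"
  have top: "opn (rs_pts S)" by simp
  interpret top: cring "rs_global S" using cring_\<O>[OF top] .
  have add: "A \<oplus>\<^bsub>\<O>\<^sub>x x\<^esub> B \<in> carrier (\<O>\<^sub>x x)" if "A \<in> carrier (\<O>\<^sub>x x)" "B \<in> carrier (\<O>\<^sub>x x)" for A B
    using \<O>.stalk_rep2E[OF that] by (metis \<O>.stalk_add \<O>.stalk_in \<O>.add_in)
  have mult: "A \<otimes>\<^bsub>\<O>\<^sub>x x\<^esub> B \<in> carrier (\<O>\<^sub>x x)" if "A \<in> carrier (\<O>\<^sub>x x)" "B \<in> carrier (\<O>\<^sub>x x)" for A B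
    using \<O>.stalk_rep2E[OF that] by (metis stalk_mult \<O>.stalk_in cring.cring_simprules(5) cring_\<O>)
  have one: "\<one>\<^bsub>\<O>\<^sub>x x\<^esub> \<in> carrier (\<O>\<^sub>x x)" and zero: "\<zero>\<^bsub>\<O>\<^sub>x x\<^esub> \<in> carrier (\<O>\<^sub>x x)"
    using germ_one[OF top x] germ_zero[OF top x] \<O>.stalk_in[OF top x] by (metis top.one_closed, metis top.zero_closed)
  show ?thesis
  proof (rule cringI)
    show "abelian_group (\<O>\<^sub>x x)"
    proof (rule abelian_groupI)
      fix A B C assume ABC: "A \<in> carrier (\<O>\<^sub>x x)" "B \<in> carrier (\<O>\<^sub>x x)" "C \<in> carrier (\<O>\<^sub>x x)"
      obtain U s t u where U: "opn U" "x \<in> U" "s \<in> carrier (\<O> U)" "t \<in> carrier (\<O> U)" "u \<in> carrier (\<O> U)"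
        "A = ?g U s" "B = ?g U t" "C = ?g U u" using \<O>.stalk_rep3E[OF ABC] by metis
      interpret U: cring "\<O> U" using cring_\<O>[OF U(1)] .
      show "(A \<oplus>\<^bsub>\<O>\<^sub>x x\<^esub> B) \<oplus>\<^bsub>\<O>\<^sub>x x\<^esub> C = A \<oplus>\<^bsub>\<O>\<^sub>x x\<^esub> (B \<oplus>\<^bsub>\<O>\<^sub>x x\<^esub> C)"
        using U by (simp add: \<O>.stalk_add U.add.m_assoc)
    next
      fix A B assume AB: "A \<in> carrier (\<O>\<^sub>x x)" "B \<in> carrier (\<O>\<^sub>x x)"
      obtain U s t where U: "opn U" "x \<in> U" "s \<in> carrier (\<O> U)" "t \<in> carrier (\<O> U)"
        "A = ?g U s" "B = ?g U t" using \<O>.stalk_rep2E[OF AB] by metis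
      interpret U: cring "\<O> U" using cring_\<O>[OF U(1)] .
      show "A \<oplus>\<^bsub>\<O>\<^sub>x x\<^esub> B = B \<oplus>\<^bsub>\<O>\<^sub>x x\<^esub> A" using U by (simp add: \<O>.stalk_add U.add.m_comm)
      show "\<zero>\<^bsub>\<O>\<^sub>x x\<^esub> \<oplus>\<^bsub>\<O>\<^sub>x x\<^esub> A = A" using U by (simp add: \<O>.stalk_add flip: germ_zero[OF U(1,2)])
      show "\<exists>B\<in>carrier (\<O>\<^sub>x x). B \<oplus>\<^bsub>\<O>\<^sub>x x\<^esub> A = \<zero>\<^bsub>\<O>\<^sub>x x\<^esub>"
        using U by (intro bexI[of _ "?g U (\<ominus>\<^bsub>\<O> U\<^esub> s)"])
          (auto simp: \<O>.stalk_add U.l_neg \<O>.stalk_in simp flip: germ_zero[OF U(1,2)])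
    qed (use add zero in auto)
    show "comm_monoid (\<O>\<^sub>x x)"
    proof (rule comm_monoidI)
      fix A B C assume ABC: "A \<in> carrier (\<O>\<^sub>x x)" "B \<in> carrier (\<O>\<^sub>x x)" "C \<in> carrier (\<O>\<^sub>x x)"
      obtain U s t u where U: "opn U" "x \<in> U" "s \<in> carrier (\<O> U)" "t \<in> carrier (\<O> U)" "u \<in> carrier (\<O> U)"
        "A = ?g U s" "B = ?g U t" "C = ?g U u" using \<O>.stalk_rep3E[OF ABC] by metis
      interpret U: cring "\<O> U" using cring_\<O>[OF U(1)] .
      show "(A \<otimes>\<^bsub>\<O>\<^sub>x x\<^esub> B) \<otimes>\<^bsub>\<O>\<^sub>x x\<^esub> C = A \<otimes>\<^bsub>\<O>\<^sub>x x\<^esub> (B \<otimes>\<^bsub>\<O>\<^sub>x x\<^esub> C)"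
        using U by (simp add: stalk_mult U.m_assoc)
    next
      fix A B assume AB: "A \<in> carrier (\<O>\<^sub>x x)" "B \<in> carrier (\<O>\<^sub>x x)"
      obtain U s t where U: "opn U" "x \<in> U" "s \<in> carrier (\<O> U)" "t \<in> carrier (\<O> U)"
        "A = ?g U s" "B = ?g U t" using \<O>.stalk_rep2E[OF AB] by metis
      interpret U: cring "\<O> U" using cring_\<O>[OF U(1)] .
      show "A \<otimes>\<^bsub>\<O>\<^sub>x x\<^esub> B = B \<otimes>\<^bsub>\<O>\<^sub>x x\<^esub> A" using U by (simp add: stalk_mult U.m_comm)
      show "\<one>\<^bsub>\<O>\<^sub>x x\<^esub> \<otimes>\<^bsub>\<O>\<^sub>x x\<^esub> A = A" using U by (simp add: stalk_mult flip: germ_one[OF U(1,2)])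
    qed (use mult one in auto)
    fix A B C assume ABC: "A \<in> carrier (\<O>\<^sub>x x)" "B \<in> carrier (\<O>\<^sub>x x)" "C \<in> carrier (\<O>\<^sub>x x)"
    obtain U s t u where U: "opn U" "x \<in> U" "s \<in> carrier (\<O> U)" "t \<in> carrier (\<O> U)" "u \<in> carrier (\<O> U)"
      "A = ?g U s" "B = ?g U t" "C = ?g U u" using \<O>.stalk_rep3E[OF ABC] by metis
    interpret U: cring "\<O> U" using cring_\<O>[OF U(1)] .
    show "(A \<oplus>\<^bsub>\<O>\<^sub>x x\<^esub> B) \<otimes>\<^bsub>\<O>\<^sub>x x\<^esub> C = A \<otimes>\<^bsub>\<O>\<^sub>x x\<^esub> C \<oplus>\<^bsub>\<O>\<^sub>x x\<^esub> B \<otimes>\<^bsub>\<O>\<^sub>x x\<^esub> C"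
      using U by (simp add: stalk_mult \<O>.stalk_add U.l_distr)
  qed
qed

lemma germ_hom:
  assumes "opn U" "x \<in> U"
  shows "rs_germ S x U \<in> ring_hom (\<O> U) (\<O>\<^sub>x x)"
  using assms by (intro ring_hom_memI) (auto simp: \<O>.stalk_in stalk_mult \<O>.stalk_add germ_one)

lemma opn_pts: "opn U \<Longrightarrow> x \<in> U \<Longrightarrow> x \<in> rs_pts S"
  using openin_subset by blast

lemma germ_ring_hom_cring:
  assumes "opn U" "x \<in> U"
  shows "ring_hom_cring (\<O> U) (\<O>\<^sub>x x) (rs_germ S x U)"
  using germ_hom[OF assms] cring_\<O>[OF assms(1)] cring_stalk[OF opn_pts[OF assms]]
  by (simp add: ring_hom_cring_def ring_hom_cring_axioms_def)

lemma germ_inj: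
  assumes "opn U" "s \<in> carrier (\<O> U)" "t \<in> carrier (\<O> U)" "\<And>x. x \<in> U \<Longrightarrow> rs_germ S x U s = rs_germ S x U t"
  shows "s = t"
  using assms(1-3)
proof (rule \<O>.eqI)
  fix x assume "x \<in> U"
  from \<O>.germ_eqD[OF assms(4)[OF this] assms(1) this assms(3)]
  show "\<exists>V. opn V \<and> x \<in> V \<and> V \<subseteq> U \<and> res U V s = res U V t" by metis
qed

text \<open>Inverses are unique and restrict to inverses, so local inverses satisfy the hypotheses
  of \<open>\<O>.glue_property\<close>.\<close>

lemma Units_local:
  assumes U: "opn U" and s: "s \<in> carrier (\<O> U)"
    and loc: "\<And>x. x \<in> U \<Longrightarrow> \<exists>V. opn V \<and> x \<in> V \<and> V \<subseteq> U \<and> res U V s \<in> Units (\<O> V)"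
  shows "s \<in> Units (\<O> U)"
proof -
  interpret U: cring "\<O> U" using cring_\<O>[OF U] .
  obtain t where t: "t \<in> carrier (\<O> U)" "\<And>V c. opn V \<Longrightarrow> V \<subseteq> U \<Longrightarrow> c \<in> carrier (\<O> V) \<Longrightarrow>
      c \<otimes>\<^bsub>\<O> V\<^esub> res U V s = \<one>\<^bsub>\<O> V\<^esub> \<Longrightarrow> res U V t = c"
  proof (rule \<O>.glue_property[OF U, of "\<lambda>V c. c \<otimes>\<^bsub>\<O> V\<^esub> res U V s = \<one>\<^bsub>\<O> V\<^esub>"])
    show "\<exists>V c. opn V \<and> x \<in> V \<and> V \<subseteq> U \<and> c \<in> carrier (\<O> V) \<and> c \<otimes>\<^bsub>\<O> V\<^esub> res U V s = \<one>\<^bsub>\<O> V\<^esub>"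
      if "x \<in> U" for x using loc[OF that] unfolding Units_def by blast
    show "res V V' c \<otimes>\<^bsub>\<O> V'\<^esub> res U V' s = \<one>\<^bsub>\<O> V'\<^esub>"
      if "opn V" "opn V'" "V' \<subseteq> V" "V \<subseteq> U" "c \<in> carrier (\<O> V)" "c \<otimes>\<^bsub>\<O> V\<^esub> res U V s = \<one>\<^bsub>\<O> V\<^esub>" for V V' c
      using that res_simps(3)[of V V' c "res U V s"] res_simps(4)[of V V'] \<O>.res_res[of U V V' s]
        U s by (simp add: \<O>.res_in)
    show "c = c'" if a: "opn V" "V \<subseteq> U" "c \<in> carrier (\<O> V)" "c' \<in> carrier (\<O> V)"
       "c \<otimes>\<^bsub>\<O> V\<^esub> res U V s = \<one>\<^bsub>\<O> V\<^esub>" "c' \<otimes>\<^bsub>\<O> V\<^esub> res U V s = \<one>\<^bsub>\<O> V\<^esub>" for V c c'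
    proof -
      interpret V: cring "\<O> V" using cring_\<O>[OF a(1)] .
      show ?thesis using V.inv_unique[of c "res U V s" c'] a U s \<O>.res_in[of U V s]
        by (simp add: V.m_comm)
    qed
  qed (assumption | blast)+
  have "t \<otimes>\<^bsub>\<O> U\<^esub> s = \<one>\<^bsub>\<O> U\<^esub>"
  proof (rule \<O>.eqI[OF U])
    fix x assume "x \<in> U"
    then obtain V where V: "opn V" "x \<in> V" "V \<subseteq> U" "res U V s \<in> Units (\<O> V)" using loc by blast
    then obtain c where c: "c \<in> carrier (\<O> V)" "c \<otimes>\<^bsub>\<O> V\<^esub> res U V s = \<one>\<^bsub>\<O> V\<^esub>" unfolding Units_def by blast
    have "res U V (t \<otimes>\<^bsub>\<O> U\<^esub> s) = res U V \<one>\<^bsub>\<O> U\<^esub>"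
      using t(2)[OF V(1,3) c] c(2) V U s t(1) by (simp add: res_simps)
    then show "\<exists>V. opn V \<and> x \<in> V \<and> V \<subseteq> U \<and> res U V (t \<otimes>\<^bsub>\<O> U\<^esub> s) = res U V \<one>\<^bsub>\<O> U\<^esub>" using V by blast
  qed (use t s in auto)
  then show ?thesis using t(1) s U.m_comm unfolding Units_def by force
qed

lemma res_Units:
  assumes "opn U" "opn V" "V \<subseteq> U" "s \<in> Units (\<O> U)"
  shows "res U V s \<in> Units (\<O> V)"
proof -
  obtain t where "t \<in> carrier (\<O> U)" "t \<otimes>\<^bsub>\<O> U\<^esub> s = \<one>\<^bsub>\<O> U\<^esub>" "s \<otimes>\<^bsub>\<O> U\<^esub> t = \<one>\<^bsub>\<O> U\<^esub>" "s \<in> carrier (\<O> U)"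
    using assms(4) unfolding Units_def by blast
  then show ?thesis unfolding Units_def using assms(1-3)
    by (auto intro!: bexI[of _ "res U V t"] simp: res_simps simp flip: res_simps(3))
qed

text \<open>An inverse germ is represented on some neighbourhood; the product equals one only as a
  germ there, hence as a section after shrinking.\<close>

lemma germ_Units_iff:
  assumes "opn U" "x \<in> U" "s \<in> carrier (\<O> U)"
  shows "rs_germ S x U s \<in> Units (\<O>\<^sub>x x) \<longleftrightarrow> (\<exists>V. opn V \<and> x \<in> V \<and> V \<subseteq> U \<and> res U V s \<in> Units (\<O> V))"
proof
  assume "\<exists>V. opn V \<and> x \<in> V \<and> V \<subseteq> U \<and> res U V s \<in> Units (\<O> V)"
  then obtain V where V: "opn V" "x \<in> V" "V \<subseteq> U" "res U V s \<in> Units (\<O> V)" by blast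
  then obtain c where "c \<in> carrier (\<O> V)" "c \<otimes>\<^bsub>\<O> V\<^esub> res U V s = \<one>\<^bsub>\<O> V\<^esub>" "res U V s \<otimes>\<^bsub>\<O> V\<^esub> c = \<one>\<^bsub>\<O> V\<^esub>"
    unfolding Units_def by blast
  then have "rs_germ S x V (res U V s) \<in> Units (\<O>\<^sub>x x)"
    unfolding Units_def using V assms
    by (auto intro!: bexI[of _ "rs_germ S x V c"] simp: \<O>.stalk_in stalk_mult germ_one res_simps)
  then show "rs_germ S x U s \<in> Units (\<O>\<^sub>x x)" using \<O>.germ_res assms V by simp
next
  assume "rs_germ S x U s \<in> Units (\<O>\<^sub>x x)"
  then obtain A where A: "A \<in> carrier (\<O>\<^sub>x x)" "A \<otimes>\<^bsub>\<O>\<^sub>x x\<^esub> rs_germ S x U s = \<one>\<^bsub>\<O>\<^sub>x x\<^esub>" unfolding Units_def by blast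
  obtain V t where V: "opn V" "x \<in> V" "V \<subseteq> U" "t \<in> carrier (\<O> V)" "A = rs_germ S x V t"
    using \<O>.stalk_rep_within[OF A(1) assms(1,2)] by metis
  interpret V: cring "\<O> V" using cring_\<O>[OF V(1)] .
  have "rs_germ S x V (t \<otimes>\<^bsub>\<O> V\<^esub> res U V s) = rs_germ S x V \<one>\<^bsub>\<O> V\<^esub>"
    using A(2) V assms by (simp add: germ_one res_simps \<O>.germ_res flip: stalk_mult)
  from \<O>.germ_eqD[OF this V(1,2)] obtain W where W: "opn W" "x \<in> W" "W \<subseteq> V"
    "res V W (t \<otimes>\<^bsub>\<O> V\<^esub> res U V s) = res V W \<one>\<^bsub>\<O> V\<^esub>" by auto
  interpret W: cring "\<O> W" using cring_\<O>[OF W(1)] .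
  have "res V W t \<otimes>\<^bsub>\<O> W\<^esub> res U W s = \<one>\<^bsub>\<O> W\<^esub>"
    using W V assms by (simp add: res_simps \<O>.res_res)
  moreover have "res U W s \<in> carrier (\<O> W)" "res V W t \<in> carrier (\<O> W)" using W V assms by (auto simp: res_simps)
  ultimately have "res U W s \<in> Units (\<O> W)" unfolding Units_def using W.m_comm by force
  then show "\<exists>V. opn V \<and> x \<in> V \<and> V \<subseteq> U \<and> res U V s \<in> Units (\<O> V)" using W V by blast
qed

end


section \<open>Sheaves of modules and local bases\<close>

locale mod_sheaf = ringed S for S :: "('a, 'b) ringed_space" +
  fixes M :: "('a, 'b, 'c) mod_sheaf"
  assumes mod_sheaf: "is_mod_sheaf S M"
begin

abbreviation \<M> where "\<M> \<equiv> ms_mod M"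
abbreviation mres where "mres \<equiv> ms_res M"

sublocale \<M>: sheaf "rs_top S" "\<lambda>U. carrier (\<M> U)" mres
  using mod_sheaf unfolding is_mod_sheaf_def is_sheaf_iff by blast

lemma module: "opn U \<Longrightarrow> Module.module (\<O> U) (\<M> U)"
  using mod_sheaf unfolding is_mod_sheaf_def by blast

lemma abelian_group_\<M>: "opn U \<Longrightarrow> abelian_group (\<M> U)"
  using module by (simp add: module_def)

lemma mres_add:
  "opn U \<Longrightarrow> opn V \<Longrightarrow> V \<subseteq> U \<Longrightarrow> m \<in> carrier (\<M> U) \<Longrightarrow> n \<in> carrier (\<M> U)
    \<Longrightarrow> mres U V (m \<oplus>\<^bsub>\<M> U\<^esub> n) = mres U V m \<oplus>\<^bsub>\<M> V\<^esub> mres U V n"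
  using mod_sheaf by (simp add: is_mod_sheaf_def)

lemma mres_smult:
  "opn U \<Longrightarrow> opn V \<Longrightarrow> V \<subseteq> U \<Longrightarrow> c \<in> carrier (\<O> U) \<Longrightarrow> m \<in> carrier (\<M> U)
    \<Longrightarrow> mres U V (c \<odot>\<^bsub>\<M> U\<^esub> m) = res U V c \<odot>\<^bsub>\<M> V\<^esub> mres U V m"
  using mod_sheaf by (simp add: is_mod_sheaf_def)

sublocale \<M>: additive_presheaf "rs_top S" \<M> mres
proof unfold_locales
  fix U s t assume "opn U" "s \<in> carrier (\<M> U)" "t \<in> carrier (\<M> U)"
  then show "s \<oplus>\<^bsub>\<M> U\<^esub> t \<in> carrier (\<M> U)"
    using abelian_group_\<M> by (simp add: abelian_group.axioms(1) abelian_monoid.a_closed)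
qed (rule mres_add)

lemma smult_closed: "opn U \<Longrightarrow> c \<in> carrier (\<O> U) \<Longrightarrow> m \<in> carrier (\<M> U) \<Longrightarrow> c \<odot>\<^bsub>\<M> U\<^esub> m \<in> carrier (\<M> U)"
  using module by (rule module.smult_closed)

text \<open>Preservation of zero is not part of \<open>is_mod_sheaf\<close>; it follows from
  additivity, because zero is the only element equal to its own double.\<close>

lemma mres_zero: "opn U \<Longrightarrow> opn V \<Longrightarrow> V \<subseteq> U \<Longrightarrow> mres U V \<zero>\<^bsub>\<M> U\<^esub> = \<zero>\<^bsub>\<M> V\<^esub>"
proof -
  assume o: "opn U" "opn V" "V \<subseteq> U"
  interpret U: abelian_group "\<M> U" using abelian_group_\<M> o by blast
  interpret V: abelian_group "\<M> V" using abelian_group_\<M> o by blast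
  have "mres U V \<zero>\<^bsub>\<M> U\<^esub> \<oplus>\<^bsub>\<M> V\<^esub> mres U V \<zero>\<^bsub>\<M> U\<^esub> = mres U V \<zero>\<^bsub>\<M> U\<^esub>"
    using mres_add[OF o U.zero_closed U.zero_closed] by simp
  then show ?thesis using V.add.l_cancel_one \<M>.res_in[OF o U.zero_closed] by blast
qed

abbreviation mgerm where "mgerm \<equiv> ms_germ S M"
abbreviation \<M>\<^sub>x where "\<M>\<^sub>x \<equiv> ms_stalk S M"

lemma mstalk_carrier: "carrier (\<M>\<^sub>x x) = carrier (stalk (rs_top S) \<M> mres x)"
  by (simp add: ms_stalk_def with_smult_def)

lemma mgerm_in: "opn U \<Longrightarrow> x \<in> U \<Longrightarrow> m \<in> carrier (\<M> U) \<Longrightarrow> mgerm x U m \<in> carrier (\<M>\<^sub>x x)"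
  unfolding mstalk_carrier by (rule \<M>.stalk_in)

lemma mstalk_add:
  assumes "opn U" "x \<in> U" "m \<in> carrier (\<M> U)" "n \<in> carrier (\<M> U)"
  shows "mgerm x U m \<oplus>\<^bsub>\<M>\<^sub>x x\<^esub> mgerm x U n = mgerm x U (m \<oplus>\<^bsub>\<M> U\<^esub> n)"
  using \<M>.stalk_add[OF assms] by (simp add: ms_stalk_def with_smult_def)

lemma mstalk_smult:
  assumes "opn U" "x \<in> U" "c \<in> carrier (\<O> U)" "m \<in> carrier (\<M> U)"
  shows "rs_germ S x U c \<odot>\<^bsub>\<M>\<^sub>x x\<^esub> mgerm x U m = mgerm x U (c \<odot>\<^bsub>\<M> U\<^esub> m)"
proof -
  have 1: "ring_presheaf (rs_top S) \<O> res" "ring_presheaf (rs_top S) \<M> mres" by unfold_locales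
  from germ_operation[OF 1(1,2,2), of "\<lambda>U. (\<odot>\<^bsub>\<M> U\<^esub>)"] assms
  show ?thesis by (simp add: ms_stalk_def with_smult_def smult_closed mres_smult)
qed

lemma mgerm_zero: "opn U \<Longrightarrow> x \<in> U \<Longrightarrow> mgerm x U \<zero>\<^bsub>\<M> U\<^esub> = \<zero>\<^bsub>\<M>\<^sub>x x\<^esub>"
  using \<M>.germ_res[of "rs_pts S" U x "\<zero>\<^bsub>\<M> (rs_pts S)\<^esub>"] abelian_group_\<M>[of "rs_pts S"]
  by (simp add: ms_stalk_def with_smult_def stalk_def mres_zero openin_subset abelian_group_def abelian_monoid.zero_closed)

lemma mstalk_repE:
  assumes "A \<in> carrier (\<M>\<^sub>x x)" "opn W" "x \<in> W"
  obtains U m where "opn U" "x \<in> U" "U \<subseteq> W" "m \<in> carrier (\<M> U)" "A = mgerm x U m"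
  using \<M>.stalk_rep_within[OF assms[unfolded mstalk_carrier]] by metis

lemma mstalk_rep3E:
  assumes "A \<in> carrier (\<M>\<^sub>x x)" "B \<in> carrier (\<M>\<^sub>x x)" "C \<in> carrier (\<M>\<^sub>x x)" "a \<in> carrier (\<O>\<^sub>x x)" "b \<in> carrier (\<O>\<^sub>x x)"
  obtains U l m n c d where "opn U" "x \<in> U" "l \<in> carrier (\<M> U)" "m \<in> carrier (\<M> U)" "n \<in> carrier (\<M> U)"
    "c \<in> carrier (\<O> U)" "d \<in> carrier (\<O> U)"
    "A = mgerm x U l" "B = mgerm x U m" "C = mgerm x U n" "a = rs_germ S x U c" "b = rs_germ S x U d"
proof -
  obtain U l m n where U: "opn U" "x \<in> U" "l \<in> carrier (\<M> U)" "m \<in> carrier (\<M> U)" "n \<in> carrier (\<M> U)"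
    "A = mgerm x U l" "B = mgerm x U m" "C = mgerm x U n"
    using \<M>.stalk_rep3E[OF assms(1-3)[unfolded mstalk_carrier]] by metis
  obtain V c d where V: "opn V" "x \<in> V" "c \<in> carrier (\<O> V)" "d \<in> carrier (\<O> V)"
    "a = rs_germ S x V c" "b = rs_germ S x V d"
    using \<O>.stalk_rep2E[OF assms(4,5)] by metis
  let ?W = "U \<inter> V"
  show thesis
    using that[of ?W "mres U ?W l" "mres U ?W m" "mres U ?W n" "res V ?W c" "res V ?W d"] U V
      \<M>.germ_res[of U ?W x] \<O>.germ_res[of V ?W x] \<M>.res_in[of U ?W] \<O>.res_in[of V ?W]
    by (simp add: openin_Int)
qed

lemma mstalk_module:
  assumes x: "x \<in> rs_pts S"
  shows "Module.module (\<O>\<^sub>x x) (\<M>\<^sub>x x)"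
proof -
  interpret R: cring "\<O>\<^sub>x x" using cring_stalk[OF x] .
  have zero: "\<zero>\<^bsub>\<M>\<^sub>x x\<^esub> \<in> carrier (\<M>\<^sub>x x)"
    using mgerm_zero[of "rs_pts S" x] mgerm_in[of "rs_pts S" x] x abelian_group_\<M>[of "rs_pts S"]
    by (metis abelian_group_def abelian_monoid.zero_closed openin_topspace)
  \<comment> \<open>All module axioms go into one statement, so that representatives over a common
    open set are chosen only once.\<close>
  have main: "A \<oplus>\<^bsub>\<M>\<^sub>x x\<^esub> B \<in> carrier (\<M>\<^sub>x x) \<and> a \<odot>\<^bsub>\<M>\<^sub>x x\<^esub> A \<in> carrier (\<M>\<^sub>x x)
     \<and> (A \<oplus>\<^bsub>\<M>\<^sub>x x\<^esub> B) \<oplus>\<^bsub>\<M>\<^sub>x x\<^esub> C = A \<oplus>\<^bsub>\<M>\<^sub>x x\<^esub> (B \<oplus>\<^bsub>\<M>\<^sub>x x\<^esub> C) \<and> A \<oplus>\<^bsub>\<M>\<^sub>x x\<^esub> B = B \<oplus>\<^bsub>\<M>\<^sub>x x\<^esub> A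
     \<and> \<zero>\<^bsub>\<M>\<^sub>x x\<^esub> \<oplus>\<^bsub>\<M>\<^sub>x x\<^esub> A = A \<and> (\<exists>D\<in>carrier (\<M>\<^sub>x x). D \<oplus>\<^bsub>\<M>\<^sub>x x\<^esub> A = \<zero>\<^bsub>\<M>\<^sub>x x\<^esub>)
     \<and> (a \<oplus>\<^bsub>\<O>\<^sub>x x\<^esub> b) \<odot>\<^bsub>\<M>\<^sub>x x\<^esub> A = a \<odot>\<^bsub>\<M>\<^sub>x x\<^esub> A \<oplus>\<^bsub>\<M>\<^sub>x x\<^esub> b \<odot>\<^bsub>\<M>\<^sub>x x\<^esub> A
     \<and> a \<odot>\<^bsub>\<M>\<^sub>x x\<^esub> (A \<oplus>\<^bsub>\<M>\<^sub>x x\<^esub> B) = a \<odot>\<^bsub>\<M>\<^sub>x x\<^esub> A \<oplus>\<^bsub>\<M>\<^sub>x x\<^esub> a \<odot>\<^bsub>\<M>\<^sub>x x\<^esub> B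
     \<and> (a \<otimes>\<^bsub>\<O>\<^sub>x x\<^esub> b) \<odot>\<^bsub>\<M>\<^sub>x x\<^esub> A = a \<odot>\<^bsub>\<M>\<^sub>x x\<^esub> (b \<odot>\<^bsub>\<M>\<^sub>x x\<^esub> A) \<and> \<one>\<^bsub>\<O>\<^sub>x x\<^esub> \<odot>\<^bsub>\<M>\<^sub>x x\<^esub> A = A"
    if ABC: "A \<in> carrier (\<M>\<^sub>x x)" "B \<in> carrier (\<M>\<^sub>x x)" "C \<in> carrier (\<M>\<^sub>x x)"
      and ab: "a \<in> carrier (\<O>\<^sub>x x)" "b \<in> carrier (\<O>\<^sub>x x)" for A B C a b
  proof -
    obtain U l m n c d where U: "opn U" "x \<in> U" "l \<in> carrier (\<M> U)" "m \<in> carrier (\<M> U)" "n \<in> carrier (\<M> U)"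
      "c \<in> carrier (\<O> U)" "d \<in> carrier (\<O> U)"
      and eq: "A = mgerm x U l" "B = mgerm x U m" "C = mgerm x U n" "a = rs_germ S x U c" "b = rs_germ S x U d"
      using mstalk_rep3E[OF ABC ab] by metis
    interpret U: module "\<O> U" "\<M> U" using module[OF U(1)] .
    note simps = mstalk_add mstalk_smult mgerm_in \<O>.stalk_add stalk_mult
    have 1: "\<exists>D\<in>carrier (\<M>\<^sub>x x). D \<oplus>\<^bsub>\<M>\<^sub>x x\<^esub> A = \<zero>\<^bsub>\<M>\<^sub>x x\<^esub>"
      using U unfolding eq by (intro bexI[of _ "mgerm x U (\<ominus>\<^bsub>\<M> U\<^esub> l)"])
        (simp_all add: simps U.M.l_neg flip: mgerm_zero[OF U(1,2)])
    show ?thesis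
      by (intro conjI 1)
       (use U in \<open>simp_all add: eq simps U.M.a_ac U.smult_l_distr U.smult_r_distr
         U.smult_assoc1 flip: germ_one[OF U(1,2)] mgerm_zero[OF U(1,2)]\<close>)
  qed
  note M = main[THEN conjunct1]
    main[THEN conjunct2, THEN conjunct1]
    main[THEN conjunct2, THEN conjunct2, THEN conjunct1]
    main[THEN conjunct2, THEN conjunct2, THEN conjunct2, THEN conjunct1]
    main[THEN conjunct2, THEN conjunct2, THEN conjunct2, THEN conjunct2, THEN conjunct1]
    main[THEN conjunct2, THEN conjunct2, THEN conjunct2, THEN conjunct2, THEN conjunct2, THEN conjunct1]
    main[THEN conjunct2, THEN conjunct2, THEN conjunct2, THEN conjunct2, THEN conjunct2, THEN conjunct2, THEN conjunct1]
    main[THEN conjunct2, THEN conjunct2, THEN conjunct2, THEN conjunct2, THEN conjunct2, THEN conjunct2, THEN conjunct2, THEN conjunct1]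
    main[THEN conjunct2, THEN conjunct2, THEN conjunct2, THEN conjunct2, THEN conjunct2, THEN conjunct2, THEN conjunct2, THEN conjunct2, THEN conjunct1]
    main[THEN conjunct2, THEN conjunct2, THEN conjunct2, THEN conjunct2, THEN conjunct2, THEN conjunct2, THEN conjunct2, THEN conjunct2, THEN conjunct2]
  show ?thesis
    by (intro moduleI abelian_groupI R.is_cring zero)
      (rule M; (assumption | rule zero R.zero_closed))+
qed

end

text \<open>Such an \<open>e\<close> trivializes \<open>M\<close> over \<open>U\<close>. Bijectivity
  is demanded over every open \<open>V\<close> inside \<open>U\<close>, since bijectivity over
  \<open>U\<close> alone does not pass to smaller sets.\<close>

definition basis :: "('a, 'b) ringed_space \<Rightarrow> ('a, 'b, 'c) mod_sheaf \<Rightarrow> 'a set \<Rightarrow> 'c \<Rightarrow> bool" where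
  "basis S M U e \<longleftrightarrow> openin (rs_top S) U \<and> e \<in> carrier (ms_mod M U) \<and>
     (\<forall>V. openin (rs_top S) V \<and> V \<subseteq> U \<longrightarrow>
        bij_betw (\<lambda>c. c \<odot>\<^bsub>ms_mod M V\<^esub> ms_res M U V e) (carrier (rs_ring S V)) (carrier (ms_mod M V)))"

lemma basisD:
  assumes "basis S M U e"
  shows "openin (rs_top S) U" "e \<in> carrier (ms_mod M U)"
    "openin (rs_top S) V \<Longrightarrow> V \<subseteq> U \<Longrightarrow>
      bij_betw (\<lambda>c. c \<odot>\<^bsub>ms_mod M V\<^esub> ms_res M U V e) (carrier (rs_ring S V)) (carrier (ms_mod M V))"
  using assms unfolding basis_def by auto

lemma mod_sheaf_isoD:
  assumes "mod_sheaf_iso S M N \<phi>" and "openin (rs_top S) U"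
  shows "bij_betw (\<phi> U) (carrier (ms_mod M U)) (carrier (ms_mod N U))"
    "m \<in> carrier (ms_mod M U) \<Longrightarrow> \<phi> U m \<in> carrier (ms_mod N U)"
    "m \<in> carrier (ms_mod M U) \<Longrightarrow> n \<in> carrier (ms_mod M U) \<Longrightarrow>
      \<phi> U (m \<oplus>\<^bsub>ms_mod M U\<^esub> n) = \<phi> U m \<oplus>\<^bsub>ms_mod N U\<^esub> \<phi> U n"
    "c \<in> carrier (rs_ring S U) \<Longrightarrow> m \<in> carrier (ms_mod M U) \<Longrightarrow>
      \<phi> U (c \<odot>\<^bsub>ms_mod M U\<^esub> m) = c \<odot>\<^bsub>ms_mod N U\<^esub> \<phi> U m"
    "openin (rs_top S) V \<Longrightarrow> V \<subseteq> U \<Longrightarrow> m \<in> carrier (ms_mod M U) \<Longrightarrow>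
      ms_res N U V (\<phi> U m) = \<phi> V (ms_res M U V m)"
proof -
  show b: "bij_betw (\<phi> U) (carrier (ms_mod M U)) (carrier (ms_mod N U))"
    using assms by (simp add: mod_sheaf_iso_def)
  show "m \<in> carrier (ms_mod M U) \<Longrightarrow> \<phi> U m \<in> carrier (ms_mod N U)" by (rule bij_betw_apply[OF b])
qed (use assms in \<open>simp_all add: mod_sheaf_iso_def\<close>)

context mod_sheaf
begin

lemma basis_coefE:
  assumes "basis S M U e" "opn V" "V \<subseteq> U" "m \<in> carrier (\<M> V)"
  obtains c where "c \<in> carrier (\<O> V)" "m = c \<odot>\<^bsub>\<M> V\<^esub> mres U V e"
  using basisD(3)[OF assms(1-3)] assms(4) unfolding bij_betw_def by blast

lemma basis_cancel:
  assumes "basis S M U e" "opn V" "V \<subseteq> U" "c \<in> carrier (\<O> V)" "d \<in> carrier (\<O> V)"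
    "c \<odot>\<^bsub>\<M> V\<^esub> mres U V e = d \<odot>\<^bsub>\<M> V\<^esub> mres U V e"
  shows "c = d"
  using basisD(3)[OF assms(1-3)] assms(4-6) unfolding bij_betw_def inj_on_def by blast

lemma basis_res:
  assumes "basis S M U e" "opn V" "V \<subseteq> U"
  shows "basis S M V (mres U V e)"
  using assms basisD(1,2)[OF assms(1)] basisD(3)[OF assms(1)]
  unfolding basis_def by (auto simp: \<M>.res_in \<M>.res_res)

text \<open>Each basis is a multiple of the other, and the product of the two coefficients fixes
  \<open>e\<close>; by uniqueness of coefficients it is one.\<close>

lemma basis_coef_Units:
  assumes e: "basis S M U e" "basis S M U e'" and c: "c \<in> carrier (\<O> U)" "e' = c \<odot>\<^bsub>\<M> U\<^esub> e"
  shows "c \<in> Units (\<O> U)"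
proof -
  note U = basisD(1,2)[OF e(1)]
  interpret module "\<O> U" "\<M> U" using module U by blast
  have id: "mres U U e = e" "mres U U e' = e'" using U basisD[OF e(2)] \<M>.res_id by auto
  obtain d where d: "d \<in> carrier (\<O> U)" "e = d \<odot>\<^bsub>\<M> U\<^esub> e'"
    using basis_coefE[OF e(2) U(1) _ U(2)] id by auto
  have "(d \<otimes>\<^bsub>\<O> U\<^esub> c) \<odot>\<^bsub>\<M> U\<^esub> mres U U e = \<one>\<^bsub>\<O> U\<^esub> \<odot>\<^bsub>\<M> U\<^esub> mres U U e"
    using c(1) d(1) U c(2)[symmetric] d(2)[symmetric] by (simp add: id(1) smult_assoc1)
  then have "d \<otimes>\<^bsub>\<O> U\<^esub> c = \<one>\<^bsub>\<O> U\<^esub>"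
    using basis_cancel[OF e(1) U(1)] c(1) d(1) by simp
  then show ?thesis using c(1) d(1) R.m_comm[of c d] unfolding Units_def by auto
qed

lemma basis_smult:
  assumes e: "basis S M U e" and u: "u \<in> Units (\<O> U)"
  shows "basis S M U (u \<odot>\<^bsub>\<M> U\<^esub> e)"
  unfolding basis_def
proof (intro conjI allI impI; (elim conjE)?)
  note U = basisD(1,2)[OF e]
  interpret U: module "\<O> U" "\<M> U" using module U by blast
  have uc: "u \<in> carrier (\<O> U)" using u U.R.Units_closed by blast
  show "opn U" "u \<odot>\<^bsub>\<M> U\<^esub> e \<in> carrier (\<M> U)" using U uc by simp_all
  fix V assume V: "opn V" "V \<subseteq> U"
  interpret V: module "\<O> V" "\<M> V" using module V by blast
  let ?u = "res U V u"
  have u': "?u \<in> Units (\<O> V)" using res_Units U V u by blast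
  have eV: "mres U V e \<in> carrier (\<M> V)" using U V \<M>.res_in by blast
  have "bij_betw (\<lambda>c. c \<otimes>\<^bsub>\<O> V\<^esub> ?u) (carrier (\<O> V)) (carrier (\<O> V))"
    by (rule bij_betw_byWitness[where f'="\<lambda>c. c \<otimes>\<^bsub>\<O> V\<^esub> inv\<^bsub>\<O> V\<^esub> ?u"])
      (use u' V.R.Units_closed[OF u'] in \<open>auto simp: V.R.m_assoc\<close>)
  from bij_betw_trans[OF this basisD(3)[OF e V]]
  have b: "bij_betw ((\<lambda>c. c \<odot>\<^bsub>\<M> V\<^esub> mres U V e) \<circ> (\<lambda>c. c \<otimes>\<^bsub>\<O> V\<^esub> ?u)) (carrier (\<O> V)) (carrier (\<M> V))" .
  have eq: "c \<odot>\<^bsub>\<M> V\<^esub> mres U V (u \<odot>\<^bsub>\<M> U\<^esub> e)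
      = ((\<lambda>c. c \<odot>\<^bsub>\<M> V\<^esub> mres U V e) \<circ> (\<lambda>c. c \<otimes>\<^bsub>\<O> V\<^esub> ?u)) c" if "c \<in> carrier (\<O> V)" for c
    using U V uc V.R.Units_closed[OF u'] eV that by (simp add: mres_smult V.smult_assoc1)
  show "bij_betw (\<lambda>c. c \<odot>\<^bsub>\<M> V\<^esub> mres U V (u \<odot>\<^bsub>\<M> U\<^esub> e)) (carrier (\<O> V)) (carrier (\<M> V))"
    by (rule iffD2[OF bij_betw_cong[OF eq] b])
qed

text \<open>Surjectivity comes from coefficients over small neighbourhoods. For injectivity, an
  equality of germs is an equality of sections nearby, where coefficients are unique.\<close>

lemma basis_stalk:
  assumes e: "basis S M U e" and x: "x \<in> U"
  shows "bij_betw (\<lambda>c. c \<odot>\<^bsub>\<M>\<^sub>x x\<^esub> mgerm x U e) (carrier (\<O>\<^sub>x x)) (carrier (\<M>\<^sub>x x))"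
  unfolding bij_betw_def
proof
  note U = basisD(1,2)[OF e]
  interpret X: module "\<O>\<^sub>x x" "\<M>\<^sub>x x" using mstalk_module opn_pts U x by blast
  have ge: "mgerm x U e \<in> carrier (\<M>\<^sub>x x)" using U x mgerm_in by blast
  show "inj_on (\<lambda>c. c \<odot>\<^bsub>\<M>\<^sub>x x\<^esub> mgerm x U e) (carrier (\<O>\<^sub>x x))"
  proof (rule inj_onI)
    fix a b assume ab: "a \<in> carrier (\<O>\<^sub>x x)" "b \<in> carrier (\<O>\<^sub>x x)"
      and eq: "a \<odot>\<^bsub>\<M>\<^sub>x x\<^esub> mgerm x U e = b \<odot>\<^bsub>\<M>\<^sub>x x\<^esub> mgerm x U e"
    obtain V0 c0 d0 where V0: "opn V0" "x \<in> V0" "c0 \<in> carrier (\<O> V0)" "d0 \<in> carrier (\<O> V0)"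
      "a = rs_germ S x V0 c0" "b = rs_germ S x V0 d0" using \<O>.stalk_rep2E[OF ab] by metis
    define V where "V = V0 \<inter> U"
    define c d where "c = res V0 V c0" and "d = res V0 V d0"
    have V: "opn V" "x \<in> V" "V \<subseteq> U" "c \<in> carrier (\<O> V)" "d \<in> carrier (\<O> V)"
      "a = rs_germ S x V c" "b = rs_germ S x V d"
      using V0 U x \<O>.res_in[of V0 V] \<O>.germ_res[of V0 V x] by (auto simp: V_def c_def d_def)
    have eV: "mres U V e \<in> carrier (\<M> V)" using V U \<M>.res_in by blast
    have "mgerm x V (c \<odot>\<^bsub>\<M> V\<^esub> mres U V e) = mgerm x V (d \<odot>\<^bsub>\<M> V\<^esub> mres U V e)"
      using eq V U eV by (simp add: mstalk_smult[symmetric] \<M>.germ_res)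
    from \<M>.germ_eqD[OF this V(1,2)] obtain W where W: "opn W" "x \<in> W" "W \<subseteq> V"
      "mres V W (c \<odot>\<^bsub>\<M> V\<^esub> mres U V e) = mres V W (d \<odot>\<^bsub>\<M> V\<^esub> mres U V e)"
      using smult_closed V eV by metis
    have "res V W c \<odot>\<^bsub>\<M> W\<^esub> mres U W e = res V W d \<odot>\<^bsub>\<M> W\<^esub> mres U W e"
      using W V U eV by (simp add: mres_smult \<M>.res_res)
    then have "res V W c = res V W d"
      using basis_cancel[OF e W(1)] W V by (auto simp: res_simps)
    then show "a = b" unfolding V(6,7) using V W by (intro \<O>.germ_eqI[of _ _ W]) auto
  qed
  have "A \<in> (\<lambda>c. c \<odot>\<^bsub>\<M>\<^sub>x x\<^esub> mgerm x U e) ` carrier (\<O>\<^sub>x x)" if A: "A \<in> carrier (\<M>\<^sub>x x)" for A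
  proof -
    obtain V m where V: "opn V" "x \<in> V" "V \<subseteq> U" "m \<in> carrier (\<M> V)" "A = mgerm x V m"
      using mstalk_repE[OF A U(1) x] by metis
    obtain c where c: "c \<in> carrier (\<O> V)" "m = c \<odot>\<^bsub>\<M> V\<^esub> mres U V e"
      using basis_coefE[OF e V(1,3,4)] .
    have "A = rs_germ S x V c \<odot>\<^bsub>\<M>\<^sub>x x\<^esub> mgerm x U e"
      using c V U mstalk_smult[OF V(1,2) c(1), of "mres U V e"] \<M>.res_in[of U V e] \<M>.germ_res[of U V x e] by simp
    then show ?thesis using \<O>.stalk_in[OF V(1,2) c(1)] by blast
  qed
  then show "(\<lambda>c. c \<odot>\<^bsub>\<M>\<^sub>x x\<^esub> mgerm x U e) ` carrier (\<O>\<^sub>x x) = carrier (\<M>\<^sub>x x)" using ge by auto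
qed

lemma iso_basis:
  assumes iso: "mod_sheaf_iso S M N \<phi>" and e: "basis S M U e"
  shows "basis S N U (\<phi> U e)"
  unfolding basis_def
proof (intro conjI allI impI; (elim conjE)?)
  note U = basisD(1,2)[OF e]
  show "opn U" by (rule U)
  show "\<phi> U e \<in> carrier (ms_mod N U)" by (rule mod_sheaf_isoD(2)[OF iso U])
  fix V assume V: "opn V" "V \<subseteq> U"
  note b = bij_betw_trans[OF basisD(3)[OF e V] mod_sheaf_isoD(1)[OF iso V(1)]]
  have eq: "c \<odot>\<^bsub>ms_mod N V\<^esub> ms_res N U V (\<phi> U e) = (\<phi> V \<circ> (\<lambda>c. c \<odot>\<^bsub>\<M> V\<^esub> mres U V e)) c"
    if "c \<in> carrier (\<O> V)" for c
    using U V that by (simp add: mod_sheaf_isoD[OF iso] \<M>.res_in)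
  show "bij_betw (\<lambda>c. c \<odot>\<^bsub>ms_mod N V\<^esub> ms_res N U V (\<phi> U e)) (carrier (\<O> V)) (carrier (ms_mod N V))"
    by (rule iffD2[OF bij_betw_cong[OF eq] b])
qed

end

context ringed
begin

lemma struct_sheaf_simps:
  "carrier (ms_mod (struct_sheaf S) U) = carrier (\<O> U)"
  "add (ms_mod (struct_sheaf S) U) = add (\<O> U)"
  "zero (ms_mod (struct_sheaf S) U) = zero (\<O> U)"
  "module.smult (ms_mod (struct_sheaf S) U) = monoid.mult (\<O> U)"
  "ms_res (struct_sheaf S) = res"
  by (simp_all add: struct_sheaf_def with_smult_def)

lemma struct_mod_sheaf: "mod_sheaf S (struct_sheaf S)"
proof unfold_locales
  have "is_sheaf (rs_top S) (\<lambda>U. carrier (\<O> U)) res"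
    unfolding is_sheaf_iff by unfold_locales
  moreover have "Module.module (\<O> U) (ms_mod (struct_sheaf S) U)" if "opn U" for U
  proof -
    interpret cring "\<O> U" using cring_\<O> that .
    show ?thesis
      by (intro moduleI abelian_groupI is_cring)
        (auto simp: struct_sheaf_simps a_ac l_distr r_distr m_assoc intro: l_neg)
  qed
  ultimately show "is_mod_sheaf S (struct_sheaf S)"
    unfolding is_mod_sheaf_def by (simp add: struct_sheaf_simps res_simps)
qed

lemma struct_basis_one: "opn U \<Longrightarrow> basis S (struct_sheaf S) U \<one>\<^bsub>\<O> U\<^esub>"
proof -
  assume U: "opn U"
  interpret cring "\<O> U" using cring_\<O> U .
  have "bij_betw (\<lambda>c. c \<otimes>\<^bsub>\<O> V\<^esub> \<one>\<^bsub>\<O> V\<^esub>) (carrier (\<O> V)) (carrier (\<O> V))" if "opn V" for V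
  proof -
    interpret V: cring "\<O> V" using cring_\<O> that .
    show ?thesis by (rule bij_betw_byWitness[where f'="\<lambda>c. c"]) auto
  qed
  then show ?thesis using U by (auto simp: basis_def struct_sheaf_simps res_simps)
qed

text \<open>A trivialization is determined by the image of one, which is a basis; conversely a basis
  \<open>e\<close> gives the trivialization \<open>c \<mapsto> c e\<close>. From here on local
  triviality is used in the form of bases.\<close>

lemma line_bundle_iff:
  "line_bundle S L \<longleftrightarrow> is_mod_sheaf S L \<and> (\<forall>x\<in>rs_pts S. \<exists>U e. x \<in> U \<and> basis S L U e)"
proof -
  have "(\<exists>\<phi>. mod_sheaf_iso (open_sub S U) (struct_sheaf S) L \<phi>) \<longleftrightarrow> (\<exists>e. basis S L U e)"
    if L: "is_mod_sheaf S L" and U: "opn U" for U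
  proof -
    interpret L: mod_sheaf S L by unfold_locales fact
    have op: "openin (rs_top (open_sub S U)) V \<longleftrightarrow> opn V \<and> V \<subseteq> U" for V
      using U by (auto simp: open_sub_def openin_subtopology)
    have rng: "rs_ring (open_sub S U) = \<O>" by (simp add: open_sub_def)
    show ?thesis
    proof
      assume "\<exists>\<phi>. mod_sheaf_iso (open_sub S U) (struct_sheaf S) L \<phi>"
      then obtain \<phi> where \<phi>: "mod_sheaf_iso (open_sub S U) (struct_sheaf S) L \<phi>" ..
      note \<phi> = mod_sheaf_isoD[OF \<phi>, unfolded op rng struct_sheaf_simps]
      have one: "\<one>\<^bsub>\<O> U\<^esub> \<in> carrier (\<O> U)" using cring.cring_simprules(6)[OF cring_\<O>] U .
      have "basis S L U (\<phi> U \<one>\<^bsub>\<O> U\<^esub>)"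
        unfolding basis_def
      proof (intro conjI allI impI; (elim conjE)?)
        show "opn U" by fact
        show "\<phi> U \<one>\<^bsub>\<O> U\<^esub> \<in> carrier (ms_mod L U)" using \<phi>(2) U one by blast
        fix V assume V: "opn V" "V \<subseteq> U"
        interpret V: cring "\<O> V" using cring_\<O> V(1) .
        have eq: "c \<odot>\<^bsub>ms_mod L V\<^esub> ms_res L U V (\<phi> U \<one>\<^bsub>\<O> U\<^esub>) = \<phi> V c" if c: "c \<in> carrier (\<O> V)" for c
          using V U one c \<phi>(4)[of V c "\<one>\<^bsub>\<O> V\<^esub>"] by (simp add: \<phi>(5) res_simps)
        show "bij_betw (\<lambda>c. c \<odot>\<^bsub>ms_mod L V\<^esub> ms_res L U V (\<phi> U \<one>\<^bsub>\<O> U\<^esub>)) (carrier (\<O> V)) (carrier (ms_mod L V))"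
          by (rule iffD2[OF bij_betw_cong[OF eq] \<phi>(1)[OF conjI[OF V]]])
      qed
      then show "\<exists>e. basis S L U e" ..
    next
      assume "\<exists>e. basis S L U e"
      then obtain e where e: "basis S L U e" ..
      have "mod_sheaf_iso (open_sub S U) (struct_sheaf S) L (\<lambda>V c. c \<odot>\<^bsub>ms_mod L V\<^esub> ms_res L U V e)"
        unfolding mod_sheaf_iso_def op rng struct_sheaf_simps
      proof (intro conjI allI impI ballI; (elim conjE)?)
        fix V assume V: "opn V" "V \<subseteq> U"
        interpret V: module "\<O> V" "ms_mod L V" using L.module V(1) .
        note b = basisD[OF e]
        show "bij_betw (\<lambda>c. c \<odot>\<^bsub>ms_mod L V\<^esub> ms_res L U V e) (carrier (\<O> V)) (carrier (ms_mod L V))"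
          using b(3) V .
        have eV: "ms_res L U V e \<in> carrier (ms_mod L V)" using L.\<M>.res_in b V by blast
        fix c d assume cd: "c \<in> carrier (\<O> V)" "d \<in> carrier (\<O> V)"
        show "(c \<oplus>\<^bsub>\<O> V\<^esub> d) \<odot>\<^bsub>ms_mod L V\<^esub> ms_res L U V e
            = c \<odot>\<^bsub>ms_mod L V\<^esub> ms_res L U V e \<oplus>\<^bsub>ms_mod L V\<^esub> d \<odot>\<^bsub>ms_mod L V\<^esub> ms_res L U V e"
          using V.smult_l_distr cd eV by blast
        show "(c \<otimes>\<^bsub>\<O> V\<^esub> d) \<odot>\<^bsub>ms_mod L V\<^esub> ms_res L U V e
            = c \<odot>\<^bsub>ms_mod L V\<^esub> (d \<odot>\<^bsub>ms_mod L V\<^esub> ms_res L U V e)"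
          using V.smult_assoc1 cd eV by blast
      next
        fix V W c assume VW: "opn V" "V \<subseteq> U" "opn W" "W \<subseteq> U" "W \<subseteq> V" and c: "c \<in> carrier (\<O> V)"
        note b = basisD[OF e]
        show "res V W c \<odot>\<^bsub>ms_mod L W\<^esub> ms_res L U W e = ms_res L V W (c \<odot>\<^bsub>ms_mod L V\<^esub> ms_res L U V e)"
          using VW c b L.\<M>.res_in by (simp add: L.mres_smult L.\<M>.res_res)
      qed
      then show "\<exists>\<phi>. mod_sheaf_iso (open_sub S U) (struct_sheaf S) L \<phi>" by blast
    qed
  qed
  then show ?thesis unfolding line_bundle_def by (meson basisD(1))
qed

end


section \<open>Sheaves of local sections of families of modules\<close>

text \<open>\<open>Q V s\<close> expresses that \<open>s\<close> has over \<open>V\<close> the form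
  of an admissible local section, such as a finite sum of tensors. A section need have this form
  only near each point, which is what sheafification asks.\<close>

definition fibre_sections :: "('a, 'b) ringed_space \<Rightarrow> ('a set \<Rightarrow> ('a \<Rightarrow> 's) \<Rightarrow> bool) \<Rightarrow> 'a set \<Rightarrow> ('a \<Rightarrow> 's) set" where
  "fibre_sections S Q U =
     {s \<in> extensional U. \<forall>x\<in>U. \<exists>V. openin (rs_top S) V \<and> x \<in> V \<and> V \<subseteq> U \<and> Q V s}"

definition fibre_sheaf_of ::
  "('a, 'b) ringed_space \<Rightarrow> ('a \<Rightarrow> (('a set \<times> 'b) set, 's) module) \<Rightarrow> ('a set \<Rightarrow> ('a \<Rightarrow> 's) \<Rightarrow> bool)
    \<Rightarrow> ('a, 'b, 'a \<Rightarrow> 's) mod_sheaf" where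
  "fibre_sheaf_of S F Q =
     \<lparr>ms_mod = (\<lambda>U. ms_pointwise S F U (fibre_sections S Q U)), ms_res = (\<lambda>U V s. restrict s V)\<rparr>"

lemma fibre_sheaf_simps:
  "carrier (ms_mod (fibre_sheaf_of S F Q) U) = fibre_sections S Q U"
  "add (ms_mod (fibre_sheaf_of S F Q) U) = (\<lambda>s t. \<lambda>p\<in>U. s p \<oplus>\<^bsub>F p\<^esub> t p)"
  "zero (ms_mod (fibre_sheaf_of S F Q) U) = (\<lambda>p\<in>U. \<zero>\<^bsub>F p\<^esub>)"
  "module.smult (ms_mod (fibre_sheaf_of S F Q) U) = (\<lambda>c s. \<lambda>x\<in>U. rs_germ S x U c \<odot>\<^bsub>F x\<^esub> s x)"
  "ms_res (fibre_sheaf_of S F Q) = (\<lambda>U V s. restrict s V)"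
  by (simp_all add: fibre_sheaf_of_def ms_pointwise_def with_smult_def pointwise_ring_def)

text \<open>The admissible forms are closed under restriction and the module operations.
  \<open>Q_local\<close> makes \<open>Q\<close> blind to values outside \<open>V\<close>, so that
  restricting a function to a larger set \<open>U\<close> does not affect it.\<close>

locale fibre_sheaf = ringed S for S :: "('a, 'b) ringed_space" +
  fixes F :: "'a \<Rightarrow> (('a set \<times> 'b) set, 's) module" and Q :: "'a set \<Rightarrow> ('a \<Rightarrow> 's) \<Rightarrow> bool"
  assumes fibre_module: "x \<in> rs_pts S \<Longrightarrow> Module.module (\<O>\<^sub>x x) (F x)"
    and Q_in: "opn V \<Longrightarrow> Q V s \<Longrightarrow> x \<in> V \<Longrightarrow> s x \<in> carrier (F x)"
    and Q_restr: "opn V \<Longrightarrow> opn V' \<Longrightarrow> V' \<subseteq> V \<Longrightarrow> Q V s \<Longrightarrow> Q V' s"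
    and Q_local: "Q V s \<Longrightarrow> (\<And>x. x \<in> V \<Longrightarrow> s x = t x) \<Longrightarrow> Q V t"
    and Q_add: "opn V \<Longrightarrow> Q V s \<Longrightarrow> Q V t \<Longrightarrow> Q V (\<lambda>x. s x \<oplus>\<^bsub>F x\<^esub> t x)"
    and Q_smult: "opn V \<Longrightarrow> c \<in> carrier (\<O> V) \<Longrightarrow> Q V s \<Longrightarrow> Q V (\<lambda>x. rs_germ S x V c \<odot>\<^bsub>F x\<^esub> s x)"
    and Q_zero: "opn V \<Longrightarrow> Q V (\<lambda>x. \<zero>\<^bsub>F x\<^esub>)"
begin

abbreviation sec where "sec \<equiv> fibre_sections S Q"

lemma secE:
  assumes "s \<in> sec U" "x \<in> U"
  obtains V where "opn V" "x \<in> V" "V \<subseteq> U" "Q V s"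
  using assms unfolding fibre_sections_def by blast

lemma sec_in:
  assumes "s \<in> sec U" "x \<in> U" shows "s x \<in> carrier (F x)"
  using secE[OF assms] Q_in by metis

lemma sec_outside: "s \<in> sec U \<Longrightarrow> x \<notin> U \<Longrightarrow> s x = undefined"
  unfolding fibre_sections_def extensional_def by blast

lemma secI:
  assumes "\<And>x. x \<in> U \<Longrightarrow> \<exists>V. opn V \<and> x \<in> V \<and> V \<subseteq> U \<and> Q V s"
  shows "restrict s U \<in> sec U"
proof -
  have "\<exists>V. opn V \<and> x \<in> V \<and> V \<subseteq> U \<and> Q V (restrict s U)" if x: "x \<in> U" for x
  proof -
    obtain V where V: "opn V" "x \<in> V" "V \<subseteq> U" "Q V s" using assms[OF x] by blast
    have "Q V (restrict s U)" by (rule Q_local[OF V(4)]) (use V in auto)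
    then show ?thesis using V by blast
  qed
  then show ?thesis unfolding fibre_sections_def by simp
qed

lemma sec_add:
  assumes "opn U" "s \<in> sec U" "t \<in> sec U"
  shows "(\<lambda>p\<in>U. s p \<oplus>\<^bsub>F p\<^esub> t p) \<in> sec U"
proof (rule secI)
  fix x assume x: "x \<in> U"
  obtain V where V: "opn V" "x \<in> V" "V \<subseteq> U" "Q V s" using secE[OF assms(2) x] .
  obtain W where W: "opn W" "x \<in> W" "W \<subseteq> U" "Q W t" using secE[OF assms(3) x] .
  have o: "opn (V \<inter> W)" using V W by blast
  have "Q (V \<inter> W) s" "Q (V \<inter> W) t"
    by (rule Q_restr[OF V(1) o _ V(4)], simp) (rule Q_restr[OF W(1) o _ W(4)], simp)
  then have "Q (V \<inter> W) (\<lambda>p. s p \<oplus>\<^bsub>F p\<^esub> t p)" by (rule Q_add[OF o])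
  then show "\<exists>V. opn V \<and> x \<in> V \<and> V \<subseteq> U \<and> Q V (\<lambda>p. s p \<oplus>\<^bsub>F p\<^esub> t p)" using V W o by blast
qed

lemma sec_smult:
  assumes "opn U" "c \<in> carrier (\<O> U)" "s \<in> sec U"
  shows "(\<lambda>x\<in>U. rs_germ S x U c \<odot>\<^bsub>F x\<^esub> s x) \<in> sec U"
proof (rule secI)
  fix x assume x: "x \<in> U"
  obtain V where V: "opn V" "x \<in> V" "V \<subseteq> U" "Q V s" using secE[OF assms(3) x] .
  have "Q V (\<lambda>y. rs_germ S y V (res U V c) \<odot>\<^bsub>F y\<^esub> s y)"
    using V assms by (intro Q_smult) (auto simp: res_simps)
  then have "Q V (\<lambda>y. rs_germ S y U c \<odot>\<^bsub>F y\<^esub> s y)"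
    by (rule Q_local) (use \<O>.germ_res[OF assms(1) V(1) _ V(3) assms(2)] in auto)
  then show "\<exists>V. opn V \<and> x \<in> V \<and> V \<subseteq> U \<and> Q V (\<lambda>x. rs_germ S x U c \<odot>\<^bsub>F x\<^esub> s x)" using V by blast
qed

lemma sec_zero: "opn U \<Longrightarrow> (\<lambda>p\<in>U. \<zero>\<^bsub>F p\<^esub>) \<in> sec U"
  using Q_zero by (intro secI) auto

abbreviation "\<F> \<equiv> fibre_sheaf_of S F Q"

lemma fibre_sheaf_module:
  assumes U: "opn U"
  shows "Module.module (\<O> U) (ms_mod \<F> U)"
proof -
  interpret U: cring "\<O> U" using cring_\<O>[OF U] .
  have fm: "Module.module (\<O>\<^sub>x x) (F x)" if "x \<in> U" for x using fibre_module opn_pts[OF U that] .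
  have fa: "abelian_group (F x)" if "x \<in> U" for x using fm[OF that] by (simp add: module_def)
  note g = \<O>.stalk_in[OF U]
  show ?thesis
  proof (intro moduleI abelian_groupI U.is_cring, unfold fibre_sheaf_simps)
    fix s t u assume s: "s \<in> sec U" "t \<in> sec U" "u \<in> sec U"
    show "(\<lambda>p\<in>U. (\<lambda>p\<in>U. s p \<oplus>\<^bsub>F p\<^esub> t p) p \<oplus>\<^bsub>F p\<^esub> u p) = (\<lambda>p\<in>U. s p \<oplus>\<^bsub>F p\<^esub> (\<lambda>p\<in>U. t p \<oplus>\<^bsub>F p\<^esub> u p) p)"
      using abelian_monoid.a_assoc[OF abelian_group.axioms(1)[OF fa]] sec_in s
      by (intro restrict_ext) auto
  next
    fix s t assume s: "s \<in> sec U" "t \<in> sec U"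
    show "(\<lambda>p\<in>U. s p \<oplus>\<^bsub>F p\<^esub> t p) \<in> sec U" using sec_add[OF U s] .
    show "(\<lambda>p\<in>U. s p \<oplus>\<^bsub>F p\<^esub> t p) = (\<lambda>p\<in>U. t p \<oplus>\<^bsub>F p\<^esub> s p)"
      using abelian_monoid.a_comm[OF abelian_group.axioms(1)[OF fa]] sec_in s
      by (intro restrict_ext) auto
    fix c assume c: "c \<in> carrier (\<O> U)"
    show "(\<lambda>p\<in>U. rs_germ S p U c \<odot>\<^bsub>F p\<^esub> (\<lambda>p\<in>U. s p \<oplus>\<^bsub>F p\<^esub> t p) p) =
       (\<lambda>p\<in>U. (\<lambda>x\<in>U. rs_germ S x U c \<odot>\<^bsub>F x\<^esub> s x) p \<oplus>\<^bsub>F p\<^esub> (\<lambda>x\<in>U. rs_germ S x U c \<odot>\<^bsub>F x\<^esub> t x) p)"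
      using module.smult_r_distr[OF fm] sec_in s g c by (intro restrict_ext) auto
  next
    show "(\<lambda>p\<in>U. \<zero>\<^bsub>F p\<^esub>) \<in> sec U" using sec_zero[OF U] .
    fix s assume s: "s \<in> sec U"
    show "(\<lambda>p\<in>U. (\<lambda>p\<in>U. \<zero>\<^bsub>F p\<^esub>) p \<oplus>\<^bsub>F p\<^esub> s p) = s"
      using abelian_monoid.l_zero[OF abelian_group.axioms(1)[OF fa]] sec_in[OF s] sec_outside[OF s]
      by (auto simp: fun_eq_iff restrict_def)
    \<comment> \<open>The closure assumptions contain no negation; the additive inverse of
      \<open>s\<close> is obtained as \<open>(-1) s\<close>.\<close>
    have m1: "\<ominus>\<^bsub>\<O> U\<^esub> \<one>\<^bsub>\<O> U\<^esub> \<in> carrier (\<O> U)" by simp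
    have "rs_germ S x U (\<ominus>\<^bsub>\<O> U\<^esub> \<one>\<^bsub>\<O> U\<^esub>) \<odot>\<^bsub>F x\<^esub> s x \<oplus>\<^bsub>F x\<^esub> s x = \<zero>\<^bsub>F x\<^esub>" if x: "x \<in> U" for x
    proof -
      interpret x: module "\<O>\<^sub>x x" "F x" using fm[OF x] .
      interpret h: ring_hom_cring "\<O> U" "\<O>\<^sub>x x" "rs_germ S x U" using germ_ring_hom_cring[OF U x] .
      show ?thesis using sec_in[OF s x] by (simp add: x.smult_l_minus x.M.l_neg)
    qed
    then show "\<exists>t\<in>sec U. (\<lambda>p\<in>U. t p \<oplus>\<^bsub>F p\<^esub> s p) = (\<lambda>p\<in>U. \<zero>\<^bsub>F p\<^esub>)"
      by (intro bexI[OF _ sec_smult[OF U m1 s]] restrict_ext) auto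
    show "(\<lambda>x\<in>U. rs_germ S x U \<one>\<^bsub>\<O> U\<^esub> \<odot>\<^bsub>F x\<^esub> s x) = s"
      using module.smult_one[OF fm] sec_in[OF s] sec_outside[OF s] germ_one[OF U]
      by (auto simp: fun_eq_iff restrict_def)
    fix a b assume ab: "a \<in> carrier (\<O> U)" "b \<in> carrier (\<O> U)"
    show "(\<lambda>x\<in>U. rs_germ S x U a \<odot>\<^bsub>F x\<^esub> s x) \<in> sec U" using sec_smult[OF U ab(1) s] .
    show "(\<lambda>x\<in>U. rs_germ S x U (a \<oplus>\<^bsub>\<O> U\<^esub> b) \<odot>\<^bsub>F x\<^esub> s x) =
       (\<lambda>p\<in>U. (\<lambda>x\<in>U. rs_germ S x U a \<odot>\<^bsub>F x\<^esub> s x) p \<oplus>\<^bsub>F p\<^esub> (\<lambda>x\<in>U. rs_germ S x U b \<odot>\<^bsub>F x\<^esub> s x) p)"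
      using module.smult_l_distr[OF fm] sec_in[OF s] g ab
      by (intro restrict_ext) (auto simp: \<O>.stalk_add[OF U, symmetric])
    show "(\<lambda>x\<in>U. rs_germ S x U (a \<otimes>\<^bsub>\<O> U\<^esub> b) \<odot>\<^bsub>F x\<^esub> s x) =
       (\<lambda>x\<in>U. rs_germ S x U a \<odot>\<^bsub>F x\<^esub> (\<lambda>x\<in>U. rs_germ S x U b \<odot>\<^bsub>F x\<^esub> s x) x)"
      using module.smult_assoc1[OF fm] sec_in[OF s] g ab
      by (intro restrict_ext) (auto simp: stalk_mult[OF U, symmetric])
  qed
qed

lemma fibre_mod_sheaf: "mod_sheaf S \<F>"
proof unfold_locales
  have "is_sheaf (rs_top S) (\<lambda>U. carrier (ms_mod \<F> U)) (ms_res \<F>)"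
    unfolding is_sheaf_iff fibre_sheaf_simps fibre_sections_def
    by (rule local_functions_sheaf) (use Q_restr Q_local in metis)+
  then show "is_mod_sheaf S \<F>"
    unfolding is_mod_sheaf_def
  proof (intro conjI allI impI ballI; (elim conjE)?)
    fix U V s t assume UV: "opn U" "opn V" "V \<subseteq> U"
    show "ms_res \<F> U V (s \<oplus>\<^bsub>ms_mod \<F> U\<^esub> t) = ms_res \<F> U V s \<oplus>\<^bsub>ms_mod \<F> V\<^esub> ms_res \<F> U V t"
      using UV by (auto simp: fibre_sheaf_simps fun_eq_iff restrict_def)
    fix c assume c: "c \<in> carrier (\<O> U)"
    show "ms_res \<F> U V (c \<odot>\<^bsub>ms_mod \<F> U\<^esub> s) = res U V c \<odot>\<^bsub>ms_mod \<F> V\<^esub> ms_res \<F> U V s"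
      using UV c \<O>.germ_res[OF UV(1,2) _ UV(3) c] by (auto simp: fibre_sheaf_simps fun_eq_iff restrict_def)
  qed (use fibre_sheaf_module in auto)
qed

text \<open>Freeness is tested in the stalks, where it gives uniqueness of coefficients. Existence
  over a whole open set is asked only for functions of the special form \<open>Q\<close>; for a
  general section such coefficients exist locally and glue because they are unique.\<close>

lemma fibre_basis:
  assumes U: "opn U" and s0: "s0 \<in> sec U"
    and bij: "\<And>x. x \<in> U \<Longrightarrow> bij_betw (\<lambda>g. g \<odot>\<^bsub>F x\<^esub> s0 x) (carrier (\<O>\<^sub>x x)) (carrier (F x))"
    and coef: "\<And>V s. opn V \<Longrightarrow> V \<subseteq> U \<Longrightarrow> Q V s \<Longrightarrow>
      \<exists>c\<in>carrier (\<O> V). \<forall>x\<in>V. s x = rs_germ S x V c \<odot>\<^bsub>F x\<^esub> s0 x"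
  shows "basis S \<F> U s0"
  unfolding basis_def fibre_sheaf_simps
proof (intro conjI allI impI; (elim conjE)?)
  fix V assume V: "opn V" "V \<subseteq> U"
  have inj: "rs_germ S x W c = rs_germ S x W d"
    if "opn W" "x \<in> W" "W \<subseteq> U" "c \<in> carrier (\<O> W)" "d \<in> carrier (\<O> W)"
      "rs_germ S x W c \<odot>\<^bsub>F x\<^esub> s0 x = rs_germ S x W d \<odot>\<^bsub>F x\<^esub> s0 x" for x W c d
    using bij[of x] that \<O>.stalk_in[OF that(1,2)] unfolding bij_betw_def inj_on_def by blast
  show "bij_betw (\<lambda>c. \<lambda>x\<in>V. rs_germ S x V c \<odot>\<^bsub>F x\<^esub> restrict s0 V x) (carrier (\<O> V)) (sec V)"
    unfolding bij_betw_def
  proof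
    show "inj_on (\<lambda>c. \<lambda>x\<in>V. rs_germ S x V c \<odot>\<^bsub>F x\<^esub> restrict s0 V x) (carrier (\<O> V))"
    proof (rule inj_onI)
      fix c d assume cd: "c \<in> carrier (\<O> V)" "d \<in> carrier (\<O> V)"
        and eq: "(\<lambda>x\<in>V. rs_germ S x V c \<odot>\<^bsub>F x\<^esub> restrict s0 V x) = (\<lambda>x\<in>V. rs_germ S x V d \<odot>\<^bsub>F x\<^esub> restrict s0 V x)"
      show "c = d"
      proof (rule germ_inj[OF V(1) cd])
        fix x assume x: "x \<in> V"
        have "rs_germ S x V c \<odot>\<^bsub>F x\<^esub> s0 x = rs_germ S x V d \<odot>\<^bsub>F x\<^esub> s0 x"
          using fun_cong[OF eq, of x] x by simp
        then show "rs_germ S x V c = rs_germ S x V d" by (rule inj[OF V(1) x V(2) cd])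
      qed
    qed
    have "s \<in> (\<lambda>c. \<lambda>x\<in>V. rs_germ S x V c \<odot>\<^bsub>F x\<^esub> restrict s0 V x) ` carrier (\<O> V)" if s: "s \<in> sec V" for s
    proof -
      let ?P = "\<lambda>W c. \<forall>x\<in>W. s x = rs_germ S x W c \<odot>\<^bsub>F x\<^esub> s0 x"
      obtain c where c: "c \<in> carrier (\<O> V)"
        "\<And>W d. opn W \<Longrightarrow> W \<subseteq> V \<Longrightarrow> d \<in> carrier (\<O> W) \<Longrightarrow> ?P W d \<Longrightarrow> res V W c = d"
      proof (rule \<O>.glue_property[OF V(1), of ?P])
        fix x assume "x \<in> V"
        obtain W where W: "opn W" "x \<in> W" "W \<subseteq> V" "Q W s" using secE[OF s \<open>x \<in> V\<close>] .
        from coef[OF W(1) _ W(4)] W V show "\<exists>W d. opn W \<and> x \<in> W \<and> W \<subseteq> V \<and> d \<in> carrier (\<O> W) \<and> ?P W d"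
          by blast
      next
        fix W W' d assume "opn W" "opn W'" "W' \<subseteq> W" "d \<in> carrier (\<O> W)" "?P W d"
        then show "?P W' (res W W' d)" using \<O>.germ_res by (auto simp: subset_iff)
      next
        fix W d d' assume W: "opn W" "W \<subseteq> V" and d: "d \<in> carrier (\<O> W)" "d' \<in> carrier (\<O> W)"
          and P: "?P W d" "?P W d'"
        show "d = d'"
        proof (rule germ_inj[OF W(1) d])
          fix x assume x: "x \<in> W"
          show "rs_germ S x W d = rs_germ S x W d'"
            using P x W V by (intro inj[OF W(1) x _ d]) auto
        qed
      qed (assumption | blast)+
      have "s x = (\<lambda>x\<in>V. rs_germ S x V c \<odot>\<^bsub>F x\<^esub> restrict s0 V x) x" for x
      proof (cases "x \<in> V")
        case True
        obtain W where W: "opn W" "x \<in> W" "W \<subseteq> V" "Q W s" using secE[OF s True] .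
        obtain d where d: "d \<in> carrier (\<O> W)" "?P W d" using coef[OF W(1) _ W(4)] W V by blast
        have "res V W c = d" using c(2)[OF W(1,3) d] .
        then show ?thesis using True d W \<O>.germ_res[OF V(1) W(1,2,3) c(1)] by simp
      next
        case False
        then show ?thesis using sec_outside[OF s] by simp
      qed
      then show ?thesis using c(1) by blast
    qed
    moreover have "(\<lambda>x\<in>V. rs_germ S x V c \<odot>\<^bsub>F x\<^esub> restrict s0 V x) \<in> sec V" if "c \<in> carrier (\<O> V)" for c
    proof -
      interpret \<F>: mod_sheaf S \<F> by (rule fibre_mod_sheaf)
      have "restrict s0 V \<in> sec V"
        using \<F>.\<M>.res_in[OF U V] s0 by (simp add: fibre_sheaf_simps)
      from sec_smult[OF V(1) that this] show ?thesis .
    qed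
    ultimately show "(\<lambda>c. \<lambda>x\<in>V. rs_germ S x V c \<odot>\<^bsub>F x\<^esub> restrict s0 V x) ` carrier (\<O> V) = sec V" by blast
  qed
qed (use U s0 in auto)

end

section \<open>Tensoring with a free module of rank one\<close>

text \<open>\<open>T\<close> is not assumed to be even a group; each of its axioms is pulled back
  along the bijection.\<close>

lemma module_transport:
  assumes N: "Module.module R N" and bij: "bij_betw \<phi> (carrier N) (carrier T)"
    and add: "\<And>a b. a \<in> carrier N \<Longrightarrow> b \<in> carrier N \<Longrightarrow> \<phi> a \<oplus>\<^bsub>T\<^esub> \<phi> b = \<phi> (a \<oplus>\<^bsub>N\<^esub> b)"
    and zero: "\<zero>\<^bsub>T\<^esub> = \<phi> \<zero>\<^bsub>N\<^esub>"
    and smult: "\<And>c a. c \<in> carrier R \<Longrightarrow> a \<in> carrier N \<Longrightarrow> c \<odot>\<^bsub>T\<^esub> \<phi> a = \<phi> (c \<odot>\<^bsub>N\<^esub> a)"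
  shows "Module.module R T"
proof -
  interpret N: module R N by fact
  have im: "carrier T = \<phi> ` carrier N" using bij by (simp add: bij_betw_def)
  show ?thesis
    by (intro moduleI abelian_groupI N.is_cring)
      (auto simp: im add zero smult N.M.a_ac N.smult_l_distr N.smult_r_distr N.smult_assoc1
        intro!: imageI bexI[where x="\<ominus>\<^bsub>N\<^esub> _"] simp: N.M.r_neg)
qed

text \<open>The rules of \<open>tensor_eq\<close> can prove lists equivalent, but inequivalence
  needs an invariant. For \<open>M\<close> free on \<open>e\<close> this invariant is
  \<open>ev\<close>, the additive map sending \<open>c e \<otimes> n\<close> to \<open>c n\<close>.
  It is complete, because every list is equivalent to \<open>[(e, ev xs)]\<close>. So the tensor
  product is identified with \<open>N\<close>.\<close>

locale free_tensor = M: module R M + N: module R N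
  for R :: "('r, 'x) ring_scheme" and M :: "('r, 'm) module" and N :: "('r, 'n) module" +
  fixes e :: 'm
  assumes e_in: "e \<in> carrier M"
    and e_bij: "bij_betw (\<lambda>c. c \<odot>\<^bsub>M\<^esub> e) (carrier R) (carrier M)"
begin

definition coef :: "'m \<Rightarrow> 'r" where "coef = the_inv_into (carrier R) (\<lambda>c. c \<odot>\<^bsub>M\<^esub> e)"

lemma coef_in: "m \<in> carrier M \<Longrightarrow> coef m \<in> carrier R"
  unfolding coef_def using e_bij by (metis bij_betw_def bij_betw_the_inv_into bij_betw_apply)

lemma coef_smult: "m \<in> carrier M \<Longrightarrow> coef m \<odot>\<^bsub>M\<^esub> e = m"
  unfolding coef_def using e_bij by (metis (no_types, lifting) bij_betw_def f_the_inv_into_f)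

lemma coef_eqI: "c \<in> carrier R \<Longrightarrow> c \<odot>\<^bsub>M\<^esub> e = m \<Longrightarrow> coef m = c"
  unfolding coef_def using e_bij by (metis (no_types, lifting) bij_betw_def the_inv_into_f_f)

lemma coef_add: "m \<in> carrier M \<Longrightarrow> m' \<in> carrier M \<Longrightarrow> coef (m \<oplus>\<^bsub>M\<^esub> m') = coef m \<oplus>\<^bsub>R\<^esub> coef m'"
  by (rule coef_eqI) (simp_all add: coef_in coef_smult M.smult_l_distr e_in)

lemma coef_scale: "m \<in> carrier M \<Longrightarrow> c \<in> carrier R \<Longrightarrow> coef (c \<odot>\<^bsub>M\<^esub> m) = c \<otimes>\<^bsub>R\<^esub> coef m"
  by (rule coef_eqI) (simp_all add: coef_in coef_smult M.smult_assoc1 e_in)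

lemma coef_zero: "coef \<zero>\<^bsub>M\<^esub> = \<zero>\<^bsub>R\<^esub>"
  by (rule coef_eqI) (simp_all add: e_in)

definition val :: "'m \<times> 'n \<Rightarrow> 'n" where "val p = coef (fst p) \<odot>\<^bsub>N\<^esub> snd p"

definition ev :: "('m \<times> 'n) list \<Rightarrow> 'n" where "ev xs = foldr (\<lambda>p s. val p \<oplus>\<^bsub>N\<^esub> s) xs \<zero>\<^bsub>N\<^esub>"

lemma val_in: "p \<in> carrier M \<times> carrier N \<Longrightarrow> val p \<in> carrier N"
  by (auto simp: val_def coef_in)

lemma ev_simps: "ev [] = \<zero>\<^bsub>N\<^esub>" "ev (p # xs) = val p \<oplus>\<^bsub>N\<^esub> ev xs"
  by (simp_all add: ev_def)

lemma ev_in: "set xs \<subseteq> carrier M \<times> carrier N \<Longrightarrow> ev xs \<in> carrier N"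
  by (induction xs) (auto simp: ev_simps intro!: N.M.a_closed val_in)

lemma ev_append: "set xs \<subseteq> carrier M \<times> carrier N \<Longrightarrow> set ys \<subseteq> carrier M \<times> carrier N \<Longrightarrow>
    ev (xs @ ys) = ev xs \<oplus>\<^bsub>N\<^esub> ev ys"
  by (induction xs) (auto simp: ev_simps ev_in val_in N.M.a_assoc)

lemma ev_single: "p \<in> carrier M \<times> carrier N \<Longrightarrow> ev [p] = val p"
  by (simp add: ev_simps val_in)

lemma tensor_eq_ev:
  "tensor_eq R M N xs ys \<Longrightarrow>
    set xs \<subseteq> carrier M \<times> carrier N \<and> set ys \<subseteq> carrier M \<times> carrier N \<and> ev xs = ev ys"
proof (induction rule: tensor_eq.induct)
  case (comm xs ys)
  then show ?case by (auto simp: ev_append ev_in N.M.a_comm)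
next
  case (smult r m n)
  then show ?case
    by (auto simp: ev_simps val_def coef_in coef_scale N.smult_assoc1[symmetric] M.R.m_comm)
qed (auto simp: ev_append ev_simps val_def coef_in coef_add coef_zero N.smult_l_distr N.smult_r_distr)

lemma tensor_eq_normal:
  "set xs \<subseteq> carrier M \<times> carrier N \<Longrightarrow> tensor_eq R M N xs [(e, ev xs)]"
proof (induction xs)
  case Nil
  \<comment> \<open>The empty list is linked to \<open>[(e, 0)]\<close> through
    \<open>[(0, 0)]\<close>: one rule moves the scalar zero across the pair, the other deletes a
    pair with left entry zero.\<close>
  have "tensor_eq R M N [(\<zero>\<^bsub>R\<^esub> \<odot>\<^bsub>M\<^esub> e, \<zero>\<^bsub>N\<^esub>)] [(e, \<zero>\<^bsub>R\<^esub> \<odot>\<^bsub>N\<^esub> \<zero>\<^bsub>N\<^esub>)]"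
    by (rule tensor_eq.smult) (auto simp: e_in)
  moreover have "tensor_eq R M N [(\<zero>\<^bsub>M\<^esub>, \<zero>\<^bsub>N\<^esub>)] []" by (rule tensor_eq.zero) simp
  ultimately show ?case by (simp add: ev_simps e_in) (meson tensor_eq.sym tensor_eq.trans)
next
  case (Cons p xs)
  obtain m n where p: "p = (m, n)" "m \<in> carrier M" "n \<in> carrier N" using Cons.prems by (cases p) auto
  have "tensor_eq R M N [(coef m \<odot>\<^bsub>M\<^esub> e, n)] [(e, coef m \<odot>\<^bsub>N\<^esub> n)]"
    using p by (intro tensor_eq.smult) (auto simp: e_in coef_in)
  then have 1: "tensor_eq R M N [p] [(e, val p)]" using p by (simp add: coef_smult val_def)
  have "tensor_eq R M N ([p] @ xs) ([(e, val p)] @ [(e, ev xs)])"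
    using Cons by (intro tensor_eq.cong 1) auto
  moreover have "tensor_eq R M N [(e, val p \<oplus>\<^bsub>N\<^esub> ev xs)] [(e, val p), (e, ev xs)]"
    using Cons.prems by (intro tensor_eq.add_right) (auto simp: e_in val_in ev_in)
  ultimately show ?case by (simp add: ev_simps) (meson tensor_eq.sym tensor_eq.trans)
qed

lemma tensor_eq_iff:
  "tensor_eq R M N xs ys \<longleftrightarrow>
    set xs \<subseteq> carrier M \<times> carrier N \<and> set ys \<subseteq> carrier M \<times> carrier N \<and> ev xs = ev ys"
  using tensor_eq_ev tensor_eq_normal by (metis tensor_eq.sym tensor_eq.trans)

definition cls :: "'n \<Rightarrow> ('m \<times> 'n) list set" where "cls n = tensor_class R M N [(e, n)]"

lemma mem_tensor_class:
  "set xs \<subseteq> carrier M \<times> carrier N \<Longrightarrow>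
    tensor_class R M N xs = {ys. set ys \<subseteq> carrier M \<times> carrier N \<and> ev ys = ev xs}"
  unfolding tensor_class_def tensor_eq_iff by auto

lemma ev_gen: "n \<in> carrier N \<Longrightarrow> ev [(e, n)] = n"
  using coef_eqI[of "\<one>\<^bsub>R\<^esub>" e] by (simp add: ev_simps val_def e_in)

lemma cls_eq: "n \<in> carrier N \<Longrightarrow> cls n = {ys. set ys \<subseteq> carrier M \<times> carrier N \<and> ev ys = n}"
  unfolding cls_def by (simp add: mem_tensor_class e_in ev_gen)

lemma tensor_class_eq_cls: "set xs \<subseteq> carrier M \<times> carrier N \<Longrightarrow> tensor_class R M N xs = cls (ev xs)"
  by (simp add: cls_eq ev_in mem_tensor_class)

lemma gen_mem_cls: "n \<in> carrier N \<Longrightarrow> [(e, n)] \<in> cls n"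
  by (simp add: cls_eq e_in ev_gen)

lemma cls_inj: "inj_on cls (carrier N)"
  by (rule inj_onI) (metis (mono_tags, lifting) cls_eq gen_mem_cls mem_Collect_eq)

text \<open>The scalars of the result need not be those over which the tensor product is formed: for
  extension of scalars they act on the right factor. \<open>N'\<close> is the same group as
  \<open>N\<close>, viewed over the new ring \<open>R'\<close>.\<close>

context
  fixes R' :: "('s, 'y) ring_scheme" and N' :: "('s, 'n) module"
    and act :: "'s \<Rightarrow> 'm \<times> 'n \<Rightarrow> 'm \<times> 'n"
  assumes N': "Module.module R' N'"
    and N'_eq: "carrier N' = carrier N" "add N' = add N" "zero N' = zero N"
    and act_in: "\<And>c p. c \<in> carrier R' \<Longrightarrow> p \<in> carrier M \<times> carrier N \<Longrightarrow> act c p \<in> carrier M \<times> carrier N"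
    and act_val: "\<And>c p. c \<in> carrier R' \<Longrightarrow> p \<in> carrier M \<times> carrier N \<Longrightarrow> val (act c p) = c \<odot>\<^bsub>N'\<^esub> val p"
begin

abbreviation "T \<equiv> tensor_module R M N act"

lemma tensor_carrier: "carrier T = cls ` carrier N"
proof -
  have "carrier T = {cls (ev xs) |xs. set xs \<subseteq> carrier M \<times> carrier N}"
    unfolding tensor_module_def using tensor_class_eq_cls by auto
  also have "\<dots> = cls ` carrier N"
  proof
    show "cls ` carrier N \<subseteq> {cls (ev xs) |xs. set xs \<subseteq> carrier M \<times> carrier N}"
    proof
      fix A assume "A \<in> cls ` carrier N"
      then obtain n where "n \<in> carrier N" "A = cls n" by blast
      then show "A \<in> {cls (ev xs) |xs. set xs \<subseteq> carrier M \<times> carrier N}"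
        using e_in ev_gen by (intro CollectI exI[of _ "[(e, n)]"]) simp
    qed
  qed (use ev_in in blast)
  finally show ?thesis .
qed

lemma tensor_add:
  assumes "a \<in> carrier N" "b \<in> carrier N"
  shows "cls a \<oplus>\<^bsub>T\<^esub> cls b = cls (a \<oplus>\<^bsub>N\<^esub> b)"
proof -
  have "{tensor_class R M N (xs @ ys) |xs ys. xs \<in> cls a \<and> ys \<in> cls b} = {cls (a \<oplus>\<^bsub>N\<^esub> b)}" (is "?S = _")
  proof
    show "?S \<subseteq> {cls (a \<oplus>\<^bsub>N\<^esub> b)}"
      using assms by (auto simp: cls_eq tensor_class_eq_cls ev_append)
    then show "{cls (a \<oplus>\<^bsub>N\<^esub> b)} \<subseteq> ?S" using gen_mem_cls assms by blast
  qed
  then show ?thesis by (simp add: tensor_module_def)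
qed

lemma tensor_zero: "\<zero>\<^bsub>T\<^esub> = cls \<zero>\<^bsub>N\<^esub>"
  using tensor_class_eq_cls[of "[]"] by (simp add: tensor_module_def ev_simps)

lemma ev_act:
  assumes c: "c \<in> carrier R'"
  shows "set xs \<subseteq> carrier M \<times> carrier N \<Longrightarrow>
    set (map (act c) xs) \<subseteq> carrier M \<times> carrier N \<and> ev (map (act c) xs) = c \<odot>\<^bsub>N'\<^esub> ev xs"
proof (induction xs)
  case Nil
  interpret N': module R' N' by (rule N')
  show ?case using N'.smult_r_null[OF c] by (simp add: ev_simps N'_eq)
next
  case (Cons p xs)
  interpret N': module R' N' by (rule N')
  show ?case using Cons act_in[OF c] act_val[OF c] N'.smult_r_distr[OF c, of "val p" "ev xs"]
    by (simp add: ev_simps N'_eq val_in ev_in)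
qed

lemma tensor_smult:
  assumes "c \<in> carrier R'" "a \<in> carrier N"
  shows "c \<odot>\<^bsub>T\<^esub> cls a = cls (c \<odot>\<^bsub>N'\<^esub> a)"
proof -
  have "{tensor_class R M N (map (act c) xs) |xs. xs \<in> cls a} = {cls (c \<odot>\<^bsub>N'\<^esub> a)}" (is "?S = _")
  proof
    show "?S \<subseteq> {cls (c \<odot>\<^bsub>N'\<^esub> a)}"
      using assms ev_act[OF assms(1)] by (auto simp: cls_eq[OF assms(2)] tensor_class_eq_cls)
    then show "{cls (c \<odot>\<^bsub>N'\<^esub> a)} \<subseteq> ?S" using gen_mem_cls[OF assms(2)] by blast
  qed
  then show ?thesis by (simp add: tensor_module_def)
qed

lemma tensor_class_append:
  assumes "set xs \<subseteq> carrier M \<times> carrier N" "set ys \<subseteq> carrier M \<times> carrier N"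
  shows "tensor_class R M N xs \<oplus>\<^bsub>T\<^esub> tensor_class R M N ys = tensor_class R M N (xs @ ys)"
  using assms by (simp add: tensor_class_eq_cls tensor_add ev_in ev_append)

lemma tensor_class_act:
  assumes "c \<in> carrier R'" "set xs \<subseteq> carrier M \<times> carrier N"
  shows "c \<odot>\<^bsub>T\<^esub> tensor_class R M N xs = tensor_class R M N (map (act c) xs)"
  using assms ev_act[OF assms] by (simp add: tensor_class_eq_cls tensor_smult ev_in del: set_map)

lemma tensor_module_module: "Module.module R' T"
  by (rule module_transport[OF N', of cls])
    (simp_all add: N'_eq bij_betw_def cls_inj tensor_carrier tensor_add tensor_zero tensor_smult)

end

end


section \<open>Tensor products of line bundles\<close>

text \<open>The stalk and the local condition of \<open>tensor_sheaf\<close> are separated here, so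
  that the sheaf becomes an instance of \<open>fibre_sheaf\<close>.\<close>

definition tensor_fibre where
  "tensor_fibre S M N x = tensor_module (rs_stalk S x) (ms_stalk S M x) (ms_stalk S N x)
      (\<lambda>c (m, n). (c \<odot>\<^bsub>ms_stalk S M x\<^esub> m, n))"

definition tensor_shape where
  "tensor_shape S M N V s \<longleftrightarrow> (\<exists>xs. set xs \<subseteq> carrier (ms_mod M V) \<times> carrier (ms_mod N V) \<and>
     (\<forall>y\<in>V. s y = tensor_stalk_class S M N y V xs))"

lemma tensor_sheaf_eq: "tensor_sheaf S M N = fibre_sheaf_of S (tensor_fibre S M N) (tensor_shape S M N)"
  unfolding tensor_sheaf_def fibre_sheaf_of_def fibre_sections_def tensor_shape_def
  by (simp add: tensor_fibre_def[abs_def])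

definition local_tensor where
  "local_tensor S M N U m n = (\<lambda>y\<in>U. tensor_stalk_class S M N y U [(m, n)])"

locale tensor_bundle = L: mod_sheaf S L + N: mod_sheaf S N
  for S :: "('a, 'b) ringed_space" and L :: "('a, 'b, 'c) mod_sheaf" and N :: "('a, 'b, 'd) mod_sheaf" +
  assumes local_basis: "x \<in> rs_pts S \<Longrightarrow> \<exists>U e. x \<in> U \<and> basis S L U e"
begin

lemma free_tensor_at:
  assumes "basis S L U e" "x \<in> U"
  shows "free_tensor (L.\<O>\<^sub>x x) (ms_stalk S L x) (ms_stalk S N x) (ms_germ S L x U e)"
proof -
  have x: "x \<in> rs_pts S" using L.opn_pts basisD(1)[OF assms(1)] assms(2) .
  show ?thesis
    using L.mstalk_module[OF x] N.mstalk_module[OF x] L.basis_stalk[OF assms]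
      L.mgerm_in[OF basisD(1)[OF assms(1)] assms(2) basisD(2)[OF assms(1)]]
    by (simp add: free_tensor_def free_tensor_axioms_def)
qed

text \<open>The results on \<open>free_tensor\<close> at a single stalk, with scalars acting on the
  left factor. A basis of \<open>L\<close> near \<open>x\<close> identifies the fibre with the stalk
  of \<open>N\<close>. The conclusions of the first, fourth and fifth claim do not mention the
  basis, so for them any basis around \<open>x\<close> will do.\<close>

lemma fibre_facts:
  fixes x defines "T \<equiv> tensor_fibre S L N x"
  assumes e: "basis S L U e" and x: "x \<in> U"
  shows "Module.module (L.\<O>\<^sub>x x) T"
    "bij_betw (free_tensor.cls (L.\<O>\<^sub>x x) (ms_stalk S L x) (ms_stalk S N x) (ms_germ S L x U e))
       (carrier (ms_stalk S N x)) (carrier T)"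
    "c \<in> carrier (L.\<O>\<^sub>x x) \<Longrightarrow> n \<in> carrier (ms_stalk S N x) \<Longrightarrow>
      c \<odot>\<^bsub>T\<^esub> free_tensor.cls (L.\<O>\<^sub>x x) (ms_stalk S L x) (ms_stalk S N x) (ms_germ S L x U e) n
       = free_tensor.cls (L.\<O>\<^sub>x x) (ms_stalk S L x) (ms_stalk S N x) (ms_germ S L x U e) (c \<odot>\<^bsub>ms_stalk S N x\<^esub> n)"
    "set xs \<subseteq> carrier (ms_stalk S L x) \<times> carrier (ms_stalk S N x) \<Longrightarrow>
     set ys \<subseteq> carrier (ms_stalk S L x) \<times> carrier (ms_stalk S N x) \<Longrightarrow>
      tensor_class (L.\<O>\<^sub>x x) (ms_stalk S L x) (ms_stalk S N x) xs \<oplus>\<^bsub>T\<^esub>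
      tensor_class (L.\<O>\<^sub>x x) (ms_stalk S L x) (ms_stalk S N x) ys =
      tensor_class (L.\<O>\<^sub>x x) (ms_stalk S L x) (ms_stalk S N x) (xs @ ys)"
    "c \<in> carrier (L.\<O>\<^sub>x x) \<Longrightarrow> set xs \<subseteq> carrier (ms_stalk S L x) \<times> carrier (ms_stalk S N x) \<Longrightarrow>
      c \<odot>\<^bsub>T\<^esub> tensor_class (L.\<O>\<^sub>x x) (ms_stalk S L x) (ms_stalk S N x) xs =
      tensor_class (L.\<O>\<^sub>x x) (ms_stalk S L x) (ms_stalk S N x) (map (\<lambda>(m, n). (c \<odot>\<^bsub>ms_stalk S L x\<^esub> m, n)) xs)"
proof -
  interpret f: free_tensor "L.\<O>\<^sub>x x" "ms_stalk S L x" "ms_stalk S N x" "ms_germ S L x U e"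
    by (rule free_tensor_at[OF e x])
  let ?act = "\<lambda>c (m, n). (c \<odot>\<^bsub>ms_stalk S L x\<^esub> m, n)"
  have 1: "?act c p \<in> carrier (ms_stalk S L x) \<times> carrier (ms_stalk S N x)"
    "f.val (?act c p) = c \<odot>\<^bsub>ms_stalk S N x\<^esub> f.val p"
    if "c \<in> carrier (L.\<O>\<^sub>x x)" "p \<in> carrier (ms_stalk S L x) \<times> carrier (ms_stalk S N x)" for c p
    using that by (auto simp: f.val_def f.coef_scale f.coef_in f.N.smult_assoc1)
  note f = f.N.module_axioms HOL.refl HOL.refl HOL.refl 1
  show "Module.module (L.\<O>\<^sub>x x) T" unfolding T_def tensor_fibre_def by (rule f.tensor_module_module[OF f])
  show "bij_betw f.cls (carrier (ms_stalk S N x)) (carrier T)"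
    unfolding T_def tensor_fibre_def bij_betw_def using f.cls_inj f.tensor_carrier[OF f] by simp
  show "c \<in> carrier (L.\<O>\<^sub>x x) \<Longrightarrow> n \<in> carrier (ms_stalk S N x) \<Longrightarrow>
      c \<odot>\<^bsub>T\<^esub> f.cls n = f.cls (c \<odot>\<^bsub>ms_stalk S N x\<^esub> n)"
    unfolding T_def tensor_fibre_def by (rule f.tensor_smult[OF f])
  show "set xs \<subseteq> carrier (ms_stalk S L x) \<times> carrier (ms_stalk S N x) \<Longrightarrow>
     set ys \<subseteq> carrier (ms_stalk S L x) \<times> carrier (ms_stalk S N x) \<Longrightarrow>
      tensor_class (L.\<O>\<^sub>x x) (ms_stalk S L x) (ms_stalk S N x) xs \<oplus>\<^bsub>T\<^esub>
      tensor_class (L.\<O>\<^sub>x x) (ms_stalk S L x) (ms_stalk S N x) ys =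
      tensor_class (L.\<O>\<^sub>x x) (ms_stalk S L x) (ms_stalk S N x) (xs @ ys)"
    unfolding T_def tensor_fibre_def by (rule f.tensor_class_append[OF f])
  show "c \<in> carrier (L.\<O>\<^sub>x x) \<Longrightarrow> set xs \<subseteq> carrier (ms_stalk S L x) \<times> carrier (ms_stalk S N x) \<Longrightarrow>
      c \<odot>\<^bsub>T\<^esub> tensor_class (L.\<O>\<^sub>x x) (ms_stalk S L x) (ms_stalk S N x) xs =
      tensor_class (L.\<O>\<^sub>x x) (ms_stalk S L x) (ms_stalk S N x) (map (?act c) xs)"
    unfolding T_def tensor_fibre_def by (rule f.tensor_class_act[OF f])
qed

lemma germ_list_in:
  assumes "L.opn V" "x \<in> V" "set xs \<subseteq> carrier (ms_mod L V) \<times> carrier (ms_mod N V)"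
  shows "set (map (map_prod (ms_germ S L x V) (ms_germ S N x V)) xs)
    \<subseteq> carrier (ms_stalk S L x) \<times> carrier (ms_stalk S N x)"
  using assms L.mgerm_in[OF assms(1,2)] N.mgerm_in[OF assms(1,2)] by (auto simp: subset_iff)

lemma stalk_class_in:
  assumes "L.opn V" "x \<in> V" "set xs \<subseteq> carrier (ms_mod L V) \<times> carrier (ms_mod N V)"
  shows "tensor_stalk_class S L N x V xs \<in> carrier (tensor_fibre S L N x)"
  unfolding tensor_stalk_class_def tensor_fibre_def tensor_module_def
  using germ_list_in[OF assms] by (simp del: set_map) blast

lemma stalk_class_append:
  assumes V: "L.opn V" "x \<in> V" and xs: "set xs \<subseteq> carrier (ms_mod L V) \<times> carrier (ms_mod N V)"
    and ys: "set ys \<subseteq> carrier (ms_mod L V) \<times> carrier (ms_mod N V)"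
  shows "tensor_stalk_class S L N x V xs \<oplus>\<^bsub>tensor_fibre S L N x\<^esub> tensor_stalk_class S L N x V ys
    = tensor_stalk_class S L N x V (xs @ ys)"
proof -
  obtain U e where e: "x \<in> U" "basis S L U e" using local_basis L.opn_pts[OF V] by blast
  show ?thesis unfolding tensor_stalk_class_def map_append
    by (rule fibre_facts(4)[OF e(2,1) germ_list_in[OF V xs] germ_list_in[OF V ys]])
qed

lemma stalk_class_smult:
  assumes V: "L.opn V" "x \<in> V" and xs: "set xs \<subseteq> carrier (ms_mod L V) \<times> carrier (ms_mod N V)"
    and c: "c \<in> carrier (L.\<O> V)"
  shows "rs_germ S x V c \<odot>\<^bsub>tensor_fibre S L N x\<^esub> tensor_stalk_class S L N x V xs
    = tensor_stalk_class S L N x V (map (\<lambda>(m, n). (c \<odot>\<^bsub>ms_mod L V\<^esub> m, n)) xs)"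
proof -
  obtain U e where e: "x \<in> U" "basis S L U e" using local_basis L.opn_pts[OF V] by blast
  have eq: "map (\<lambda>(m, n). (rs_germ S x V c \<odot>\<^bsub>ms_stalk S L x\<^esub> m, n)) (map (map_prod (ms_germ S L x V) (ms_germ S N x V)) xs)
    = map (map_prod (ms_germ S L x V) (ms_germ S N x V)) (map (\<lambda>(m, n). (c \<odot>\<^bsub>ms_mod L V\<^esub> m, n)) xs)"
    using xs L.mstalk_smult[OF V c] by auto
  show ?thesis
    using fibre_facts(5)[OF e(2,1) L.\<O>.stalk_in[OF V c] germ_list_in[OF V xs]]
    by (simp only: tensor_stalk_class_def eq)
qed

lemma stalk_class_res:
  assumes V: "L.opn V" and V': "L.opn V'" "x \<in> V'" "V' \<subseteq> V"
    and xs: "set xs \<subseteq> carrier (ms_mod L V) \<times> carrier (ms_mod N V)"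
  shows "tensor_stalk_class S L N x V' (map (map_prod (ms_res L V V') (ms_res N V V')) xs)
    = tensor_stalk_class S L N x V xs"
proof -
  have eq: "map (map_prod (ms_germ S L x V') (ms_germ S N x V')) (map (map_prod (ms_res L V V') (ms_res N V V')) xs)
    = map (map_prod (ms_germ S L x V) (ms_germ S N x V)) xs"
    using xs L.\<M>.germ_res[OF V V'] N.\<M>.germ_res[OF V V'] by (auto simp: map_prod_def split: prod.splits)
  show ?thesis by (simp only: tensor_stalk_class_def eq)
qed

sublocale T: fibre_sheaf S "tensor_fibre S L N" "tensor_shape S L N"
proof (rule fibre_sheaf.intro[OF L.ringed_axioms fibre_sheaf_axioms.intro])
  show "Module.module (L.\<O>\<^sub>x x) (tensor_fibre S L N x)" if "x \<in> rs_pts S" for x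
    using local_basis[OF that] fibre_facts(1) by blast
  show "s x \<in> carrier (tensor_fibre S L N x)"
    if "L.opn V" "tensor_shape S L N V s" "x \<in> V" for V s x
    using that stalk_class_in unfolding tensor_shape_def by metis
  show "tensor_shape S L N V' s" if V: "L.opn V" "L.opn V'" "V' \<subseteq> V" and s: "tensor_shape S L N V s" for V V' s
  proof -
    obtain xs where xs: "set xs \<subseteq> carrier (ms_mod L V) \<times> carrier (ms_mod N V)"
      "\<forall>y\<in>V. s y = tensor_stalk_class S L N y V xs" using s unfolding tensor_shape_def by blast
    have "set (map (map_prod (ms_res L V V') (ms_res N V V')) xs) \<subseteq> carrier (ms_mod L V') \<times> carrier (ms_mod N V')"
      using xs(1) L.\<M>.res_in[OF V] N.\<M>.res_in[OF V] by (auto simp: subset_iff)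
    moreover have "s y = tensor_stalk_class S L N y V' (map (map_prod (ms_res L V V') (ms_res N V V')) xs)"
      if "y \<in> V'" for y
      unfolding stalk_class_res[OF V(1,2) that V(3) xs(1)] using xs(2) V(3) that by blast
    ultimately show ?thesis unfolding tensor_shape_def by blast
  qed
  show "tensor_shape S L N V t" if "tensor_shape S L N V s" "\<And>x. x \<in> V \<Longrightarrow> s x = t x" for V s t
    using that unfolding tensor_shape_def by simp
  show "tensor_shape S L N V (\<lambda>x. s x \<oplus>\<^bsub>tensor_fibre S L N x\<^esub> t x)"
    if V: "L.opn V" and s: "tensor_shape S L N V s" and t: "tensor_shape S L N V t" for V s t
  proof -
    obtain xs where xs: "set xs \<subseteq> carrier (ms_mod L V) \<times> carrier (ms_mod N V)"
      "\<forall>y\<in>V. s y = tensor_stalk_class S L N y V xs" using s unfolding tensor_shape_def by blast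
    obtain ys where ys: "set ys \<subseteq> carrier (ms_mod L V) \<times> carrier (ms_mod N V)"
      "\<forall>y\<in>V. t y = tensor_stalk_class S L N y V ys" using t unfolding tensor_shape_def by blast
    show ?thesis unfolding tensor_shape_def
      by (rule exI[of _ "xs @ ys"]) (use xs ys stalk_class_append[OF V _ xs(1) ys(1)] in auto)
  qed
  show "tensor_shape S L N V (\<lambda>x. rs_germ S x V c \<odot>\<^bsub>tensor_fibre S L N x\<^esub> s x)"
    if V: "L.opn V" and c: "c \<in> carrier (L.\<O> V)" and s: "tensor_shape S L N V s" for V c s
  proof -
    obtain xs where xs: "set xs \<subseteq> carrier (ms_mod L V) \<times> carrier (ms_mod N V)"
      "\<forall>y\<in>V. s y = tensor_stalk_class S L N y V xs" using s unfolding tensor_shape_def by blast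
    show ?thesis unfolding tensor_shape_def
      by (rule exI[of _ "map (\<lambda>(m, n). (c \<odot>\<^bsub>ms_mod L V\<^esub> m, n)) xs"])
        (use xs stalk_class_smult[OF V _ xs(1) c] L.smult_closed[OF V c] in \<open>auto simp: subset_iff\<close>)
  qed
  show "tensor_shape S L N V (\<lambda>x. \<zero>\<^bsub>tensor_fibre S L N x\<^esub>)" for V
    unfolding tensor_shape_def
    by (rule exI[of _ "[]"]) (simp add: tensor_stalk_class_def tensor_fibre_def tensor_module_def)
qed

abbreviation \<T> where "\<T> \<equiv> tensor_sheaf S L N"

lemma tensor_mod_sheaf: "mod_sheaf S \<T>"
  unfolding tensor_sheaf_eq by (rule T.fibre_mod_sheaf)

lemma local_tensor_in:
  assumes U: "L.opn U" and mn: "m \<in> carrier (ms_mod L U)" "n \<in> carrier (ms_mod N U)"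
  shows "local_tensor S L N U m n \<in> carrier (ms_mod \<T> U)"
proof -
  have "tensor_shape S L N U (\<lambda>y. tensor_stalk_class S L N y U [(m, n)])"
    unfolding tensor_shape_def using mn by (intro exI[of _ "[(m, n)]"]) auto
  then show ?thesis
    unfolding tensor_sheaf_eq fibre_sheaf_simps local_tensor_def using U by (intro T.secI) blast
qed

lemma local_tensor_res:
  assumes "L.opn U" "L.opn V" "V \<subseteq> U" "m \<in> carrier (ms_mod L U)" "n \<in> carrier (ms_mod N U)"
  shows "ms_res \<T> U V (local_tensor S L N U m n) = local_tensor S L N V (ms_res L U V m) (ms_res N U V n)"
  using assms stalk_class_res[OF assms(1,2) _ assms(3), of _ "[(m, n)]"]
  by (auto simp: tensor_sheaf_eq fibre_sheaf_simps local_tensor_def fun_eq_iff restrict_def)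

lemma stalk_class_scale:
  assumes e: "basis S L U e" and f: "f \<in> carrier (ms_mod N U)" and V: "L.opn V" "V \<subseteq> U" "x \<in> V"
    and cd: "c \<in> carrier (L.\<O> V)" "d \<in> carrier (L.\<O> V)"
  shows "tensor_stalk_class S L N x V [(c \<odot>\<^bsub>ms_mod L V\<^esub> ms_res L U V e, d \<odot>\<^bsub>ms_mod N V\<^esub> ms_res N U V f)]
    = rs_germ S x V (c \<otimes>\<^bsub>L.\<O> V\<^esub> d) \<odot>\<^bsub>tensor_fibre S L N x\<^esub> tensor_stalk_class S L N x U [(e, f)]"
proof -
  note U = basisD(1,2)[OF e]
  have xU: "x \<in> U" using V by blast
  interpret f: free_tensor "L.\<O>\<^sub>x x" "ms_stalk S L x" "ms_stalk S N x" "ms_germ S L x U e"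
    by (rule free_tensor_at[OF e xU])
  have eV: "ms_res L U V e \<in> carrier (ms_mod L V)" "ms_res N U V f \<in> carrier (ms_mod N V)"
    using L.\<M>.res_in N.\<M>.res_in U V f by blast+
  have g: "ms_germ S L x V (c \<odot>\<^bsub>ms_mod L V\<^esub> ms_res L U V e) = rs_germ S x V c \<odot>\<^bsub>ms_stalk S L x\<^esub> ms_germ S L x U e"
    "ms_germ S N x V (d \<odot>\<^bsub>ms_mod N V\<^esub> ms_res N U V f) = rs_germ S x V d \<odot>\<^bsub>ms_stalk S N x\<^esub> ms_germ S N x U f"
    using L.mstalk_smult[OF V(1,3) cd(1) eV(1)] N.mstalk_smult[OF V(1,3) cd(2) eV(2)]
      L.\<M>.germ_res[OF U(1) V(1,3,2) U(2)] N.\<M>.germ_res[OF U(1) V(1,3,2) f] by simp_all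
  have cdx: "rs_germ S x V c \<in> carrier (L.\<O>\<^sub>x x)" "rs_germ S x V d \<in> carrier (L.\<O>\<^sub>x x)"
    using L.\<O>.stalk_in V cd by blast+
  have fx: "ms_germ S N x U f \<in> carrier (ms_stalk S N x)" using N.mgerm_in U(1) xU f by blast
  have "tensor_stalk_class S L N x V [(c \<odot>\<^bsub>ms_mod L V\<^esub> ms_res L U V e, d \<odot>\<^bsub>ms_mod N V\<^esub> ms_res N U V f)]
    = f.cls (f.val (rs_germ S x V c \<odot>\<^bsub>ms_stalk S L x\<^esub> ms_germ S L x U e, rs_germ S x V d \<odot>\<^bsub>ms_stalk S N x\<^esub> ms_germ S N x U f))"
    unfolding tensor_stalk_class_def using cdx fx f.e_in
    by (simp add: g f.tensor_class_eq_cls f.ev_single del: map_map)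
  also have "f.val (rs_germ S x V c \<odot>\<^bsub>ms_stalk S L x\<^esub> ms_germ S L x U e, rs_germ S x V d \<odot>\<^bsub>ms_stalk S N x\<^esub> ms_germ S N x U f)
    = rs_germ S x V (c \<otimes>\<^bsub>L.\<O> V\<^esub> d) \<odot>\<^bsub>ms_stalk S N x\<^esub> ms_germ S N x U f"
    using cdx fx f.coef_eqI[OF cdx(1) HOL.refl] L.stalk_mult[OF V(1,3) cd, symmetric]
    by (simp add: f.val_def f.N.smult_assoc1)
  also have "f.cls \<dots> = rs_germ S x V (c \<otimes>\<^bsub>L.\<O> V\<^esub> d) \<odot>\<^bsub>tensor_fibre S L N x\<^esub> f.cls (ms_germ S N x U f)"
    using L.stalk_mult[OF V(1,3) cd, symmetric] cdx fx by (simp add: fibre_facts(3)[OF e xU])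
  also have "f.cls (ms_germ S N x U f) = tensor_stalk_class S L N x U [(e, f)]"
    by (simp add: tensor_stalk_class_def f.cls_def)
  finally show ?thesis .
qed

text \<open>In a stalk, scaling \<open>e \<otimes> f\<close> is scaling \<open>f\<close> followed by
  the identification of the fibre with the stalk of \<open>N\<close>, and both maps are bijective.
  Over open sets the coefficient of a list is computed by \<open>stalk_class_scale\<close>.\<close>

lemma local_tensor_basis:
  assumes e: "basis S L U e" and f: "basis S N U f"
  shows "basis S \<T> U (local_tensor S L N U e f)"
  unfolding tensor_sheaf_eq
proof (rule T.fibre_basis)
  note U = basisD(1,2)[OF e] and fU = basisD(2)[OF f]
  show "L.opn U" by (rule U)
  show "local_tensor S L N U e f \<in> T.sec U"
    using local_tensor_in[OF U fU] by (simp add: tensor_sheaf_eq fibre_sheaf_simps)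
  show "bij_betw (\<lambda>g. g \<odot>\<^bsub>tensor_fibre S L N x\<^esub> local_tensor S L N U e f x)
      (carrier (L.\<O>\<^sub>x x)) (carrier (tensor_fibre S L N x))" if x: "x \<in> U" for x
  proof -
    interpret f: free_tensor "L.\<O>\<^sub>x x" "ms_stalk S L x" "ms_stalk S N x" "ms_germ S L x U e"
      by (rule free_tensor_at[OF e x])
    note b = bij_betw_trans[OF N.basis_stalk[OF f x] fibre_facts(2)[OF e x]]
    have fx: "ms_germ S N x U f \<in> carrier (ms_stalk S N x)" using N.mgerm_in U(1) x fU by blast
    have eq: "g \<odot>\<^bsub>tensor_fibre S L N x\<^esub> local_tensor S L N U e f x
       = (f.cls \<circ> (\<lambda>g. g \<odot>\<^bsub>ms_stalk S N x\<^esub> ms_germ S N x U f)) g" if "g \<in> carrier (L.\<O>\<^sub>x x)" for g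
      using fibre_facts(3)[OF e x that fx] x
      by (simp add: local_tensor_def tensor_stalk_class_def f.cls_def)
    show ?thesis by (rule iffD2[OF bij_betw_cong[OF eq] b])
  qed
  fix V s assume V: "L.opn V" "V \<subseteq> U" and s: "tensor_shape S L N V s"
  obtain xs where xs: "set xs \<subseteq> carrier (ms_mod L V) \<times> carrier (ms_mod N V)"
    "\<forall>y\<in>V. s y = tensor_stalk_class S L N y V xs" using s unfolding tensor_shape_def by blast
  let ?P = "\<lambda>xs c. \<forall>x\<in>V. tensor_stalk_class S L N x V xs
    = rs_germ S x V c \<odot>\<^bsub>tensor_fibre S L N x\<^esub> tensor_stalk_class S L N x U [(e, f)]"
  interpret V: cring "L.\<O> V" by (rule L.cring_\<O>[OF V(1)])
  \<comment> \<open>A sum of tensors \<open>a e \<otimes> b f\<close> has as coefficient the sum of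
    the products \<open>a b\<close>, which the induction builds up pair by pair.\<close>
  have "\<exists>c\<in>carrier (L.\<O> V). ?P xs c"
    using xs(1)
  proof (induction xs)
    case Nil
    have "tensor_stalk_class S L N x V [] = \<zero>\<^bsub>L.\<O>\<^sub>x x\<^esub> \<odot>\<^bsub>tensor_fibre S L N x\<^esub> tensor_stalk_class S L N x U [(e, f)]"
      if x: "x \<in> V" for x
    proof -
      interpret t: module "L.\<O>\<^sub>x x" "tensor_fibre S L N x" using fibre_facts(1)[OF e] x V by blast
      have "tensor_stalk_class S L N x U [(e, f)] \<in> carrier (tensor_fibre S L N x)"
        using stalk_class_in[OF U(1), of x "[(e, f)]"] x V U fU by auto
      then show ?thesis by (simp add: tensor_stalk_class_def) (simp add: tensor_fibre_def tensor_module_def)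
    qed
    then show ?case by (intro bexI[of _ "\<zero>\<^bsub>L.\<O> V\<^esub>"]) (auto simp: L.germ_zero[OF V(1)])
  next
    case (Cons p xs)
    then obtain c where c: "c \<in> carrier (L.\<O> V)" "?P xs c" by auto
    obtain m n where p: "p = (m, n)" "m \<in> carrier (ms_mod L V)" "n \<in> carrier (ms_mod N V)"
      using Cons.prems by (cases p) auto
    obtain a where a: "a \<in> carrier (L.\<O> V)" "m = a \<odot>\<^bsub>ms_mod L V\<^esub> ms_res L U V e"
      using L.basis_coefE[OF e V p(2)] .
    obtain b where b: "b \<in> carrier (L.\<O> V)" "n = b \<odot>\<^bsub>ms_mod N V\<^esub> ms_res N U V f"
      using N.basis_coefE[OF f V p(3)] .
    have "?P (p # xs) ((a \<otimes>\<^bsub>L.\<O> V\<^esub> b) \<oplus>\<^bsub>L.\<O> V\<^esub> c)"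
    proof
      fix x assume x: "x \<in> V"
      interpret t: module "L.\<O>\<^sub>x x" "tensor_fibre S L N x" using fibre_facts(1)[OF e] x V by blast
      have t: "tensor_stalk_class S L N x U [(e, f)] \<in> carrier (tensor_fibre S L N x)"
        using stalk_class_in[OF U(1), of x "[(e, f)]"] x V U fU by auto
      have "tensor_stalk_class S L N x V (p # xs)
        = tensor_stalk_class S L N x V [p] \<oplus>\<^bsub>tensor_fibre S L N x\<^esub> tensor_stalk_class S L N x V xs"
        using stalk_class_append[OF V(1) x, of "[p]" xs] Cons.prems by simp
      also have "tensor_stalk_class S L N x V [p] = rs_germ S x V (a \<otimes>\<^bsub>L.\<O> V\<^esub> b) \<odot>\<^bsub>tensor_fibre S L N x\<^esub> tensor_stalk_class S L N x U [(e, f)]"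
        unfolding p a(2) b(2) by (rule stalk_class_scale[OF e fU V x a(1) b(1)])
      also have "tensor_stalk_class S L N x V xs = rs_germ S x V c \<odot>\<^bsub>tensor_fibre S L N x\<^esub> tensor_stalk_class S L N x U [(e, f)]"
        using c(2) x by blast
      finally show "tensor_stalk_class S L N x V (p # xs)
        = rs_germ S x V ((a \<otimes>\<^bsub>L.\<O> V\<^esub> b) \<oplus>\<^bsub>L.\<O> V\<^esub> c) \<odot>\<^bsub>tensor_fibre S L N x\<^esub> tensor_stalk_class S L N x U [(e, f)]"
        using t.smult_l_distr[OF L.\<O>.stalk_in[OF V(1) x] L.\<O>.stalk_in[OF V(1) x] t] a(1) b(1) c(1)
          L.\<O>.stalk_add[OF V(1) x]
        by simp
    qed
    then show ?case using a(1) b(1) c(1) by blast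
  qed
  then obtain c where c: "c \<in> carrier (L.\<O> V)" "?P xs c" by blast
  have "s x = rs_germ S x V c \<odot>\<^bsub>tensor_fibre S L N x\<^esub> local_tensor S L N U e f x" if "x \<in> V" for x
    using c(2) xs(2) that subsetD[OF V(2) that] by (simp add: local_tensor_def)
  with c(1) show "\<exists>c\<in>carrier (L.\<O> V). \<forall>x\<in>V. s x = rs_germ S x V c \<odot>\<^bsub>tensor_fibre S L N x\<^esub> local_tensor S L N U e f x"
    by blast
qed

lemma local_tensor_scale:
  assumes e: "basis S L U e" and f: "f \<in> carrier (ms_mod N U)"
    and cd: "c \<in> carrier (L.\<O> U)" "d \<in> carrier (L.\<O> U)"
  shows "local_tensor S L N U (c \<odot>\<^bsub>ms_mod L U\<^esub> e) (d \<odot>\<^bsub>ms_mod N U\<^esub> f)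
    = (c \<otimes>\<^bsub>L.\<O> U\<^esub> d) \<odot>\<^bsub>ms_mod \<T> U\<^esub> local_tensor S L N U e f"
  using stalk_class_scale[OF e f basisD(1)[OF e] subset_refl _ cd]
    L.\<M>.res_id[OF basisD(1,2)[OF e]] N.\<M>.res_id[OF basisD(1)[OF e] f]
  by (auto simp: local_tensor_def tensor_sheaf_eq fibre_sheaf_simps fun_eq_iff restrict_def)

end


section \<open>Pullbacks of line bundles\<close>

text \<open>Morphisms of ringed spaces, before the condition on non-units of the stalks. Stalk maps
  can thus be computed for a candidate morphism, and \<open>lrs_homI\<close> adds that condition
  afterwards.\<close>

locale rs_morphism = X: ringed X + Y: ringed Y
  for X :: "('a, 'b) ringed_space" and Y :: "('c, 'd) ringed_space" +
  fixes f :: "('a, 'b, 'c, 'd) lrs_mor"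
  assumes cont: "continuous_map (rs_top X) (rs_top Y) (mor_pt f)"
    and sec_hom: "Y.opn V \<Longrightarrow> mor_sec f V \<in> ring_hom (Y.\<O> V) (X.\<O> (mor_preim X f V))"
    and sec_nat: "Y.opn V \<Longrightarrow> Y.opn W \<Longrightarrow> W \<subseteq> V \<Longrightarrow> s \<in> carrier (Y.\<O> V) \<Longrightarrow>
      X.res (mor_preim X f V) (mor_preim X f W) (mor_sec f V s) = mor_sec f W (Y.res V W s)"
begin

abbreviation pre where "pre \<equiv> mor_preim X f"
abbreviation pt where "pt \<equiv> mor_pt f"

lemma pre_open: "Y.opn V \<Longrightarrow> X.opn (pre V)"
  unfolding mor_preim_def by (rule openin_continuous_map_preimage[OF cont])

lemma mem_pre: "x \<in> pre V \<longleftrightarrow> x \<in> rs_pts X \<and> pt x \<in> V"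
  unfolding mor_preim_def by simp

lemma pre_mono: "W \<subseteq> V \<Longrightarrow> pre W \<subseteq> pre V"
  unfolding mor_preim_def by auto

lemma pt_in: "x \<in> rs_pts X \<Longrightarrow> pt x \<in> rs_pts Y"
  using cont by (auto simp: continuous_map_def)

lemma sec_in: "Y.opn V \<Longrightarrow> s \<in> carrier (Y.\<O> V) \<Longrightarrow> mor_sec f V s \<in> carrier (X.\<O> (pre V))"
  using sec_hom ring_hom_closed by metis

text \<open>Two representatives of a germ agree near \<open>pt x\<close>, and naturality carries
  this to a neighbourhood of \<open>x\<close>. So the union in \<open>stalk_map\<close> runs over a
  single class.\<close>

lemma stalk_map_germ:
  assumes V: "Y.opn V" "x \<in> pre V" and s: "s \<in> carrier (Y.\<O> V)"
  shows "stalk_map X f x (rs_germ Y (pt x) V s) = rs_germ X x (pre V) (mor_sec f V s)"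
proof -
  have x: "x \<in> rs_pts X" "pt x \<in> V" using V mem_pre by auto
  have "rs_germ X x (pre V') (mor_sec f V' s') = rs_germ X x (pre V) (mor_sec f V s)"
    if "(V', s') \<in> rs_germ Y (pt x) V s" for V' s'
  proof -
    note 1 = Y.\<O>.germ_memD[OF that V(1) s]
    obtain W where W: "Y.opn W" "pt x \<in> W" "W \<subseteq> V'" "W \<subseteq> V" "Y.res V' W s' = Y.res V W s"
      using Y.\<O>.germ_eqD[OF 1(4) V(1) x(2) s] .
    show ?thesis
    proof (rule X.\<O>.germ_eqI[of _ _ "pre W"])
      show "X.res (pre V') (pre W) (mor_sec f V' s') = X.res (pre V) (pre W) (mor_sec f V s)"
        using sec_nat[OF 1(1) W(1,3) 1(3)] sec_nat[OF V(1) W(1,4) s] W(5) by simp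
    qed (use 1 W V x s in \<open>auto intro: pre_open sec_in simp: mem_pre\<close>)
  qed
  then have "{rs_germ X x (pre V') (mor_sec f V' s') |V' s'. (V', s') \<in> rs_germ Y (pt x) V s}
      = {rs_germ X x (pre V) (mor_sec f V s)}"
    using Y.\<O>.germ_self[OF V(1) x(2) s] by blast
  then show ?thesis unfolding stalk_map_def by simp
qed

lemma stalk_map_hom:
  assumes x: "x \<in> rs_pts X"
  shows "stalk_map X f x \<in> ring_hom (Y.\<O>\<^sub>x (pt x)) (X.\<O>\<^sub>x x)"
proof (rule ring_hom_memI)
  have mem: "x \<in> pre V" if "pt x \<in> V" for V using x that mem_pre by blast
  fix A B assume AB: "A \<in> carrier (Y.\<O>\<^sub>x (pt x))" "B \<in> carrier (Y.\<O>\<^sub>x (pt x))"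
  obtain V s t where V: "Y.opn V" "pt x \<in> V" and st: "s \<in> carrier (Y.\<O> V)" "t \<in> carrier (Y.\<O> V)"
    and eq: "A = rs_germ Y (pt x) V s" "B = rs_germ Y (pt x) V t" using Y.\<O>.stalk_rep2E[OF AB] .
  interpret V: cring "Y.\<O> V" by (rule Y.cring_\<O>[OF V(1)])
  note xV = mem[OF V(2)]
  note h = sec_hom[OF V(1)]
  show "stalk_map X f x A \<in> carrier (X.\<O>\<^sub>x x)"
    using V st eq xV by (simp add: stalk_map_germ X.\<O>.stalk_in pre_open sec_in)
  show "stalk_map X f x (A \<otimes>\<^bsub>Y.\<O>\<^sub>x (pt x)\<^esub> B) = stalk_map X f x A \<otimes>\<^bsub>X.\<O>\<^sub>x x\<^esub> stalk_map X f x B"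
    using V st xV pre_open[OF V(1)] sec_in[OF V(1)] ring_hom_mult[OF h st] unfolding eq
    by (simp add: stalk_map_germ Y.stalk_mult X.stalk_mult)
  show "stalk_map X f x (A \<oplus>\<^bsub>Y.\<O>\<^sub>x (pt x)\<^esub> B) = stalk_map X f x A \<oplus>\<^bsub>X.\<O>\<^sub>x x\<^esub> stalk_map X f x B"
    using V st xV pre_open[OF V(1)] sec_in[OF V(1)] ring_hom_add[OF h st] unfolding eq
    by (simp add: stalk_map_germ Y.\<O>.stalk_add X.\<O>.stalk_add)
next
  let ?V = "rs_pts Y"
  have V: "Y.opn ?V" "pt x \<in> ?V" "x \<in> pre ?V" using x pt_in mem_pre by auto
  show "stalk_map X f x \<one>\<^bsub>Y.\<O>\<^sub>x (pt x)\<^esub> = \<one>\<^bsub>X.\<O>\<^sub>x x\<^esub>"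
    using stalk_map_germ[OF V(1,3), of "\<one>\<^bsub>Y.\<O> ?V\<^esub>"] cring.cring_simprules(6)[OF Y.cring_\<O>[OF V(1)]]
      ring_hom_one[OF sec_hom[OF V(1)]]
    by (simp add: Y.germ_one[OF V(1,2)] X.germ_one[OF pre_open[OF V(1)] V(3)])
qed

end

lemma lrs_hom_morphism:
  assumes "ringed_space X" "ringed_space Y" "f \<in> lrs_hom X Y"
  shows "rs_morphism X Y f"
  using assms unfolding lrs_hom_def rs_morphism_def ringed_def rs_morphism_axioms_def by blast

lemma with_smult_simps [simp]:
  "carrier (with_smult A \<sigma>) = carrier A" "add (with_smult A \<sigma>) = add A" "zero (with_smult A \<sigma>) = zero A"
  "module.smult (with_smult A \<sigma>) = \<sigma>"
  by (simp_all add: with_smult_def)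

lemma module_via_hom:
  assumes R: "cring R" and A: "cring A" and h: "h \<in> ring_hom R A"
  shows "Module.module R (with_smult A (\<lambda>r g. h r \<otimes>\<^bsub>A\<^esub> g))"
proof -
  interpret R: cring R by fact
  interpret A: cring A by fact
  interpret h: ring_hom_cring R A h by unfold_locales (rule h)
  show ?thesis
    by (intro moduleI abelian_groupI R)
      (auto simp: A.a_ac A.l_distr A.r_distr A.m_assoc intro!: bexI[where x="\<ominus>\<^bsub>A\<^esub> _"] simp: A.r_neg)
qed

lemma regular_module: "cring R \<Longrightarrow> Module.module R (with_smult R (monoid.mult R))"
  using module_via_hom[of R R "\<lambda>r. r"] by (simp add: ring_hom_def)

definition pullback_fibre where
  "pullback_fibre X Y f F x =
     tensor_module (rs_stalk Y (mor_pt f x)) (ms_stalk Y F (mor_pt f x)) (stalk_via X f x)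
       (\<lambda>c (m, g). (m, c \<otimes>\<^bsub>rs_stalk X x\<^esub> g))"

definition pullback_shape where
  "pullback_shape X Y f F V s \<longleftrightarrow> (\<exists>W xs. openin (rs_top Y) W \<and> mor_pt f ` V \<subseteq> W \<and>
     set xs \<subseteq> carrier (ms_mod F W) \<times> carrier (rs_ring X V) \<and>
     (\<forall>y\<in>V. s y = pullback_stalk_class X Y f F y V W xs))"

lemma pullback_sheaf_eq:
  "pullback_sheaf X Y f F = fibre_sheaf_of X (pullback_fibre X Y f F) (pullback_shape X Y f F)"
  unfolding pullback_sheaf_def fibre_sheaf_of_def fibre_sections_def pullback_shape_def
  by (simp add: pullback_fibre_def[abs_def])

definition local_pullback where
  "local_pullback X Y f F W m =
    (\<lambda>y\<in>mor_preim X f W. pullback_stalk_class X Y f F y (mor_preim X f W) W [(m, \<one>\<^bsub>rs_ring X (mor_preim X f W)\<^esub>)])"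

locale pullback_bundle = rs_morphism X Y f + F: mod_sheaf Y F
  for X :: "('a, 'b) ringed_space" and Y :: "('c, 'd) ringed_space"
    and f :: "('a, 'b, 'c, 'd) lrs_mor" and F :: "('c, 'd, 'e) mod_sheaf" +
  assumes local_basis: "y \<in> rs_pts Y \<Longrightarrow> \<exists>W e. y \<in> W \<and> basis Y F W e"
begin

abbreviation (input) FM where "FM x \<equiv> ms_stalk Y F (pt x)"
abbreviation (input) tclass where "tclass x \<equiv> tensor_class (Y.\<O>\<^sub>x (pt x)) (FM x) (stalk_via X f x)"
abbreviation (input) pcls where "pcls x W e \<equiv>
  free_tensor.cls (Y.\<O>\<^sub>x (pt x)) (FM x) (stalk_via X f x) (ms_germ Y F (pt x) W e)"

lemma stalk_via_simps [simp]:
  "carrier (stalk_via X f x) = carrier (X.\<O>\<^sub>x x)" "add (stalk_via X f x) = add (X.\<O>\<^sub>x x)"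
  "zero (stalk_via X f x) = zero (X.\<O>\<^sub>x x)"
  "r \<odot>\<^bsub>stalk_via X f x\<^esub> g = stalk_map X f x r \<otimes>\<^bsub>X.\<O>\<^sub>x x\<^esub> g"
  by (simp_all add: stalk_via_def)

lemma free_tensor_at:
  assumes e: "basis Y F W e" and x: "x \<in> pre W"
  shows "free_tensor (Y.\<O>\<^sub>x (pt x)) (FM x) (stalk_via X f x) (ms_germ Y F (pt x) W e)"
proof -
  have xx: "x \<in> rs_pts X" "pt x \<in> W" using x mem_pre by auto
  show ?thesis
    using F.mstalk_module[OF pt_in[OF xx(1)]] F.basis_stalk[OF e xx(2)]
      F.mgerm_in[OF basisD(1)[OF e] xx(2) basisD(2)[OF e]]
      module_via_hom[OF Y.cring_stalk[OF pt_in[OF xx(1)]] X.cring_stalk[OF xx(1)] stalk_map_hom[OF xx(1)]]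
    by (simp add: free_tensor_def free_tensor_axioms_def stalk_via_def)
qed

text \<open>The tensor product is formed over the stalk of \<open>Y\<close>, while the scalars come
  from the stalk of \<open>X\<close> and act on the right factor. Since \<open>F\<close> is free on
  \<open>e\<close> at \<open>pt x\<close>, the fibre is a copy of the stalk of \<open>X\<close>,
  free on \<open>e \<otimes> 1\<close>.\<close>

lemma fibre_facts:
  fixes x defines "T \<equiv> pullback_fibre X Y f F x"
  assumes e: "basis Y F W e" and x: "x \<in> pre W"
  shows "Module.module (X.\<O>\<^sub>x x) T"
    "bij_betw (pcls x W e) (carrier (X.\<O>\<^sub>x x)) (carrier T)"
    "c \<in> carrier (X.\<O>\<^sub>x x) \<Longrightarrow> g \<in> carrier (X.\<O>\<^sub>x x) \<Longrightarrow>
      c \<odot>\<^bsub>T\<^esub> pcls x W e g = pcls x W e (c \<otimes>\<^bsub>X.\<O>\<^sub>x x\<^esub> g)"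
    "set xs \<subseteq> carrier (FM x) \<times> carrier (X.\<O>\<^sub>x x) \<Longrightarrow> set ys \<subseteq> carrier (FM x) \<times> carrier (X.\<O>\<^sub>x x) \<Longrightarrow>
      tclass x xs \<oplus>\<^bsub>T\<^esub> tclass x ys = tclass x (xs @ ys)"
    "c \<in> carrier (X.\<O>\<^sub>x x) \<Longrightarrow> set xs \<subseteq> carrier (FM x) \<times> carrier (X.\<O>\<^sub>x x) \<Longrightarrow>
      c \<odot>\<^bsub>T\<^esub> tclass x xs = tclass x (map (\<lambda>(m, g). (m, c \<otimes>\<^bsub>X.\<O>\<^sub>x x\<^esub> g)) xs)"
proof -
  interpret f: free_tensor "Y.\<O>\<^sub>x (pt x)" "FM x" "stalk_via X f x" "ms_germ Y F (pt x) W e"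
    by (rule free_tensor_at[OF e x])
  have xx: "x \<in> rs_pts X" "pt x \<in> rs_pts Y" using x mem_pre pt_in by auto
  interpret x: cring "X.\<O>\<^sub>x x" by (rule X.cring_stalk[OF xx(1)])
  let ?act = "\<lambda>c (m, g). (m, c \<otimes>\<^bsub>X.\<O>\<^sub>x x\<^esub> g)"
  have sm: "stalk_map X f x r \<in> carrier (X.\<O>\<^sub>x x)" if "r \<in> carrier (Y.\<O>\<^sub>x (pt x))" for r
    using ring_hom_closed[OF stalk_map_hom[OF xx(1)] that] .
  have 1: "?act c p \<in> carrier (FM x) \<times> carrier (stalk_via X f x)"
    "f.val (?act c p) = c \<odot>\<^bsub>with_smult (X.\<O>\<^sub>x x) (\<otimes>\<^bsub>X.\<O>\<^sub>x x\<^esub>)\<^esub> f.val p"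
    if "c \<in> carrier (X.\<O>\<^sub>x x)" "p \<in> carrier (FM x) \<times> carrier (stalk_via X f x)" for c p
    using that by (auto simp: f.val_def f.coef_in sm x.m_lcomm)
  have N': "Module.module (X.\<O>\<^sub>x x) (with_smult (X.\<O>\<^sub>x x) (\<otimes>\<^bsub>X.\<O>\<^sub>x x\<^esub>))"
    by (rule regular_module) (rule x.is_cring)
  have 2: "carrier (with_smult (X.\<O>\<^sub>x x) (\<otimes>\<^bsub>X.\<O>\<^sub>x x\<^esub>)) = carrier (stalk_via X f x)"
    "add (with_smult (X.\<O>\<^sub>x x) (\<otimes>\<^bsub>X.\<O>\<^sub>x x\<^esub>)) = add (stalk_via X f x)"
    "zero (with_smult (X.\<O>\<^sub>x x) (\<otimes>\<^bsub>X.\<O>\<^sub>x x\<^esub>)) = zero (stalk_via X f x)" by simp_all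
  note f = N' 2 1
  show "Module.module (X.\<O>\<^sub>x x) T" unfolding T_def pullback_fibre_def by (rule f.tensor_module_module[OF f])
  show "bij_betw f.cls (carrier (X.\<O>\<^sub>x x)) (carrier T)"
    unfolding T_def pullback_fibre_def bij_betw_def using f.cls_inj f.tensor_carrier[OF f] by simp
  show "c \<odot>\<^bsub>T\<^esub> f.cls g = f.cls (c \<otimes>\<^bsub>X.\<O>\<^sub>x x\<^esub> g)"
    if "c \<in> carrier (X.\<O>\<^sub>x x)" "g \<in> carrier (X.\<O>\<^sub>x x)" for c g
    unfolding T_def pullback_fibre_def using f.tensor_smult[OF f, of c g] that by simp
  show "tclass x xs \<oplus>\<^bsub>T\<^esub> tclass x ys = tclass x (xs @ ys)"
    if "set xs \<subseteq> carrier (FM x) \<times> carrier (X.\<O>\<^sub>x x)" "set ys \<subseteq> carrier (FM x) \<times> carrier (X.\<O>\<^sub>x x)" for xs ys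
    unfolding T_def pullback_fibre_def by (rule f.tensor_class_append[OF f]) (use that in simp_all)
  show "c \<odot>\<^bsub>T\<^esub> tclass x xs = tclass x (map (?act c) xs)"
    if "c \<in> carrier (X.\<O>\<^sub>x x)" "set xs \<subseteq> carrier (FM x) \<times> carrier (X.\<O>\<^sub>x x)" for c xs
    unfolding T_def pullback_fibre_def by (rule f.tensor_class_act[OF f]) (use that in simp_all)
qed

lemma basis_at:
  assumes "x \<in> rs_pts X" obtains W e where "x \<in> pre W" "basis Y F W e"
  using local_basis[OF pt_in[OF assms]] assms mem_pre by metis

abbreviation (input) pclass where "pclass x V W xs \<equiv> pullback_stalk_class X Y f F x V W xs"
abbreviation (input) fits where "fits V W xs \<equiv> X.opn V \<and> Y.opn W \<and> pt ` V \<subseteq> W \<and>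
  set xs \<subseteq> carrier (ms_mod F W) \<times> carrier (X.\<O> V)"

lemma germ_list_in:
  assumes "fits V W xs" "x \<in> V"
  shows "set (map (map_prod (ms_germ Y F (pt x) W) (rs_germ X x V)) xs) \<subseteq> carrier (FM x) \<times> carrier (X.\<O>\<^sub>x x)"
  using assms F.mgerm_in[of W "pt x"] X.\<O>.stalk_in[of V x] by (auto simp: subset_iff)

lemma stalk_class_in:
  assumes "fits V W xs" "x \<in> V"
  shows "pclass x V W xs \<in> carrier (pullback_fibre X Y f F x)"
  unfolding pullback_stalk_class_def pullback_fibre_def tensor_module_def
  using germ_list_in[OF assms] by (simp del: set_map) blast

lemma stalk_class_append:
  assumes xs: "fits V W xs" and ys: "fits V W ys" and x: "x \<in> V"
  shows "pclass x V W xs \<oplus>\<^bsub>pullback_fibre X Y f F x\<^esub> pclass x V W ys = pclass x V W (xs @ ys)"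
proof -
  have "x \<in> rs_pts X" using X.opn_pts xs x by blast
  then obtain U e where e: "x \<in> pre U" "basis Y F U e" by (rule basis_at)
  show ?thesis unfolding pullback_stalk_class_def map_append
    by (rule fibre_facts(4)[OF e(2,1) germ_list_in[OF xs x] germ_list_in[OF ys x]])
qed

lemma stalk_class_smult:
  assumes xs: "fits V W xs" and x: "x \<in> V" and c: "c \<in> carrier (X.\<O> V)"
  shows "rs_germ X x V c \<odot>\<^bsub>pullback_fibre X Y f F x\<^esub> pclass x V W xs
    = pclass x V W (map (\<lambda>(m, g). (m, c \<otimes>\<^bsub>X.\<O> V\<^esub> g)) xs)"
proof -
  have V: "X.opn V" using xs by blast
  obtain U e where e: "x \<in> pre U" "basis Y F U e" using basis_at[OF X.opn_pts[OF V x]] .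
  have eq: "map (\<lambda>(m, g). (m, rs_germ X x V c \<otimes>\<^bsub>X.\<O>\<^sub>x x\<^esub> g)) (map (map_prod (ms_germ Y F (pt x) W) (rs_germ X x V)) xs)
    = map (map_prod (ms_germ Y F (pt x) W) (rs_germ X x V)) (map (\<lambda>(m, g). (m, c \<otimes>\<^bsub>X.\<O> V\<^esub> g)) xs)"
    using xs X.stalk_mult[OF V x c] by auto
  show ?thesis
    using fibre_facts(5)[OF e(2,1) X.\<O>.stalk_in[OF V x c] germ_list_in[OF xs x]]
    by (simp only: pullback_stalk_class_def eq)
qed

lemma fits_res:
  assumes "fits V W xs" "X.opn V'" "V' \<subseteq> V" "Y.opn W'" "W' \<subseteq> W" "pt ` V' \<subseteq> W'"
  shows "fits V' W' (map (map_prod (ms_res F W W') (X.res V V')) xs)"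
  using assms F.\<M>.res_in[of W W'] X.\<O>.res_in[of V V'] by (auto simp: subset_iff)

lemma stalk_class_res:
  assumes xs: "fits V W xs" and V': "X.opn V'" "V' \<subseteq> V" and W': "Y.opn W'" "W' \<subseteq> W" "pt ` V' \<subseteq> W'"
    and x: "x \<in> V'"
  shows "pclass x V' W' (map (map_prod (ms_res F W W') (X.res V V')) xs) = pclass x V W xs"
proof -
  have o: "X.opn V" "Y.opn W" and px: "pt x \<in> W'" using xs W' x by auto
  have eq: "map (map_prod (ms_germ Y F (pt x) W') (rs_germ X x V')) (map (map_prod (ms_res F W W') (X.res V V')) xs)
    = map (map_prod (ms_germ Y F (pt x) W) (rs_germ X x V)) xs"
    using xs F.\<M>.germ_res[OF o(2) W'(1) px W'(2)] X.\<O>.germ_res[OF o(1) V'(1) x V'(2)]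
    by (auto simp: map_prod_def split: prod.splits)
  show ?thesis by (simp only: pullback_stalk_class_def eq)
qed

lemma shapeE:
  assumes "X.opn V" "pullback_shape X Y f F V s"
  obtains W xs where "fits V W xs" "\<forall>x\<in>V. s x = pclass x V W xs"
  using assms unfolding pullback_shape_def by blast

lemma shapeI:
  "fits V W xs \<Longrightarrow> (\<And>x. x \<in> V \<Longrightarrow> s x = pclass x V W xs) \<Longrightarrow> pullback_shape X Y f F V s"
  unfolding pullback_shape_def by blast

sublocale P: fibre_sheaf X "pullback_fibre X Y f F" "pullback_shape X Y f F"
proof (rule fibre_sheaf.intro[OF X.ringed_axioms fibre_sheaf_axioms.intro])
  show "Module.module (X.\<O>\<^sub>x x) (pullback_fibre X Y f F x)" if "x \<in> rs_pts X" for x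
    using basis_at[OF that] fibre_facts(1) by metis
  show "s x \<in> carrier (pullback_fibre X Y f F x)"
    if "X.opn V" "pullback_shape X Y f F V s" "x \<in> V" for V s x
    using shapeE[OF that(1,2)] stalk_class_in that(3) by metis
  show "pullback_shape X Y f F V' s"
    if V: "X.opn V" "X.opn V'" "V' \<subseteq> V" and s: "pullback_shape X Y f F V s" for V V' s
  proof -
    obtain W xs where xs: "fits V W xs" "\<forall>x\<in>V. s x = pclass x V W xs" using shapeE[OF V(1) s] .
    have W: "Y.opn W" "W \<subseteq> W" "pt ` V' \<subseteq> W" using xs(1) V(3) by (auto simp: image_subset_iff subset_iff)
    show ?thesis
      by (rule shapeI[OF fits_res[OF xs(1) V(2,3) W]])
        (use stalk_class_res[OF xs(1) V(2,3) W] xs(2) V(3) in auto)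
  qed
  show "pullback_shape X Y f F V t" if "pullback_shape X Y f F V s" "\<And>x. x \<in> V \<Longrightarrow> s x = t x" for V s t
    using that unfolding pullback_shape_def by simp
  show "pullback_shape X Y f F V (\<lambda>x. s x \<oplus>\<^bsub>pullback_fibre X Y f F x\<^esub> t x)"
    if V: "X.opn V" and s: "pullback_shape X Y f F V s" and t: "pullback_shape X Y f F V t" for V s t
  proof -
    obtain W xs where xs: "fits V W xs" "\<forall>x\<in>V. s x = pclass x V W xs" using shapeE[OF V(1) s] .
    obtain W' ys where ys: "fits V W' ys" "\<forall>x\<in>V. t x = pclass x V W' ys" using shapeE[OF V(1) t] .
    \<comment> \<open>The two lists may use sections over different open sets of \<open>Y\<close>;
      both are restricted to the intersection before they are appended.\<close>
    let ?W = "W \<inter> W'"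
    have W: "Y.opn ?W" "?W \<subseteq> W" "?W \<subseteq> W'" "pt ` V \<subseteq> ?W" using xs ys by auto
    note f1 = fits_res[OF xs(1) V subset_refl W(1,2,4)] and f2 = fits_res[OF ys(1) V subset_refl W(1,3,4)]
    show ?thesis
    proof (rule shapeI)
      fix x assume x: "x \<in> V"
      show "s x \<oplus>\<^bsub>pullback_fibre X Y f F x\<^esub> t x = pclass x V ?W
         (map (map_prod (ms_res F W ?W) (X.res V V)) xs @ map (map_prod (ms_res F W' ?W) (X.res V V)) ys)"
        unfolding stalk_class_append[OF f1 f2 x, symmetric] bspec[OF xs(2) x] bspec[OF ys(2) x]
          stalk_class_res[OF xs(1) V subset_refl W(1,2,4) x] stalk_class_res[OF ys(1) V subset_refl W(1,3,4) x] ..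
    qed (use f1 f2 in auto)
  qed
  show "pullback_shape X Y f F V (\<lambda>x. rs_germ X x V c \<odot>\<^bsub>pullback_fibre X Y f F x\<^esub> s x)"
    if V: "X.opn V" and c: "c \<in> carrier (X.\<O> V)" and s: "pullback_shape X Y f F V s" for V c s
  proof -
    obtain W xs where xs: "fits V W xs" "\<forall>x\<in>V. s x = pclass x V W xs" using shapeE[OF V(1) s] .
    interpret V: cring "X.\<O> V" by (rule X.cring_\<O>[OF V])
    show ?thesis
      by (rule shapeI[of _ W "map (\<lambda>(m, g). (m, c \<otimes>\<^bsub>X.\<O> V\<^esub> g)) xs"])
        (use xs c stalk_class_smult[OF xs(1) _ c] in auto)
  qed
  show "pullback_shape X Y f F V (\<lambda>x. \<zero>\<^bsub>pullback_fibre X Y f F x\<^esub>)" if V: "X.opn V" for V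
    using openin_subset[OF V] pt_in V
    by (intro shapeI[of _ "rs_pts Y" "[]"])
      (auto simp: pullback_stalk_class_def pullback_fibre_def tensor_module_def)
qed

abbreviation \<P> where "\<P> \<equiv> pullback_sheaf X Y f F"

lemma pullback_mod_sheaf: "mod_sheaf X \<P>"
  unfolding pullback_sheaf_eq by (rule P.fibre_mod_sheaf)

lemma pre_fits: "Y.opn W \<Longrightarrow> m \<in> carrier (ms_mod F W) \<Longrightarrow> fits (pre W) W [(m, \<one>\<^bsub>X.\<O> (pre W)\<^esub>)]"
  using cring.cring_simprules(6)[OF X.cring_\<O>[OF pre_open]] pre_open by (auto simp: mem_pre)

lemma local_pullback_in:
  assumes W: "Y.opn W" and m: "m \<in> carrier (ms_mod F W)"
  shows "local_pullback X Y f F W m \<in> carrier (ms_mod \<P> (pre W))"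
proof -
  have "pullback_shape X Y f F (pre W) (\<lambda>y. pclass y (pre W) W [(m, \<one>\<^bsub>X.\<O> (pre W)\<^esub>)])"
    by (rule shapeI[OF pre_fits[OF W m] HOL.refl])
  then show ?thesis
    unfolding pullback_sheaf_eq fibre_sheaf_simps local_pullback_def using pre_open[OF W] by (intro P.secI) blast
qed

lemma local_pullback_res:
  assumes W: "Y.opn W" "Y.opn W'" "W' \<subseteq> W" and m: "m \<in> carrier (ms_mod F W)"
  shows "ms_res \<P> (pre W) (pre W') (local_pullback X Y f F W m) = local_pullback X Y f F W' (ms_res F W W' m)"
proof -
  have "pt ` pre W' \<subseteq> W'" by (auto simp: mem_pre)
  note 1 = stalk_class_res[OF pre_fits[OF W(1) m] pre_open[OF W(2)] pre_mono[OF W(3)] W(2,3) this]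
  show ?thesis
    using 1 pre_mono[OF W(3)] X.res_simps(4)[OF pre_open[OF W(1)] pre_open[OF W(2)] pre_mono[OF W(3)]]
    by (auto simp: pullback_sheaf_eq fibre_sheaf_simps local_pullback_def fun_eq_iff restrict_def)
qed

text \<open>The scalar \<open>c\<close> crosses the tensor sign and becomes its image under the
  stalk map, which is the germ of the pulled back function.\<close>

lemma stalk_class_scale:
  assumes e: "basis Y F W e" and V: "X.opn V" "x \<in> V" and W': "Y.opn W'" "W' \<subseteq> W" "pt ` V \<subseteq> W'"
    and c: "c \<in> carrier (Y.\<O> W')" and g: "g \<in> carrier (X.\<O> V)"
  shows "pclass x V W' [(c \<odot>\<^bsub>ms_mod F W'\<^esub> ms_res F W W' e, g)]
    = rs_germ X x V (X.res (pre W') V (mor_sec f W' c) \<otimes>\<^bsub>X.\<O> V\<^esub> g) \<odot>\<^bsub>pullback_fibre X Y f F x\<^esub>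
        pclass x (pre W) W [(e, \<one>\<^bsub>X.\<O> (pre W)\<^esub>)]"
proof -
  note W = basisD(1,2)[OF e]
  have xx: "x \<in> rs_pts X" "pt x \<in> W'" "pt x \<in> W" using X.opn_pts[OF V] V W' by auto
  have xW: "x \<in> pre W" "x \<in> pre W'" using xx mem_pre by auto
  have VW: "V \<subseteq> pre W'" using W'(3) X.opn_pts[OF V(1)] by (auto simp: mem_pre)
  interpret x: cring "X.\<O>\<^sub>x x" by (rule X.cring_stalk[OF xx(1)])
  interpret V: cring "X.\<O> V" by (rule X.cring_\<O>[OF V(1)])
  interpret f: free_tensor "Y.\<O>\<^sub>x (pt x)" "FM x" "stalk_via X f x" "ms_germ Y F (pt x) W e"
    by (rule free_tensor_at[OF e xW(1)])
  have eW: "ms_res F W W' e \<in> carrier (ms_mod F W')" using F.\<M>.res_in W W' by blast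
  have ge: "ms_germ Y F (pt x) W' (c \<odot>\<^bsub>ms_mod F W'\<^esub> ms_res F W W' e) = rs_germ Y (pt x) W' c \<odot>\<^bsub>FM x\<^esub> ms_germ Y F (pt x) W e"
    using F.mstalk_smult[OF W'(1) xx(2) c eW] F.\<M>.germ_res[OF W(1) W'(1) xx(2) W'(2) W(2)] by simp
  have cx: "rs_germ Y (pt x) W' c \<in> carrier (Y.\<O>\<^sub>x (pt x))" and gx: "rs_germ X x V g \<in> carrier (X.\<O>\<^sub>x x)"
    by (rule Y.\<O>.stalk_in[OF W'(1) xx(2) c], rule X.\<O>.stalk_in[OF V g])
  have fc: "mor_sec f W' c \<in> carrier (X.\<O> (pre W'))" by (rule sec_in[OF W'(1) c])
  have sm: "stalk_map X f x (rs_germ Y (pt x) W' c) = rs_germ X x V (X.res (pre W') V (mor_sec f W' c))"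
    using stalk_map_germ[OF W'(1) xW(2) c] X.\<O>.germ_res[OF pre_open[OF W'(1)] V VW fc] by simp
  have rc: "X.res (pre W') V (mor_sec f W' c) \<in> carrier (X.\<O> V)"
    using X.\<O>.res_in[OF pre_open[OF W'(1)] V(1) VW fc] .
  have "pclass x V W' [(c \<odot>\<^bsub>ms_mod F W'\<^esub> ms_res F W W' e, g)]
     = f.cls (f.val (rs_germ Y (pt x) W' c \<odot>\<^bsub>FM x\<^esub> ms_germ Y F (pt x) W e, rs_germ X x V g))"
    unfolding pullback_stalk_class_def using cx gx f.e_in
    by (simp add: ge f.tensor_class_eq_cls f.ev_single)
  also have "f.val (rs_germ Y (pt x) W' c \<odot>\<^bsub>FM x\<^esub> ms_germ Y F (pt x) W e, rs_germ X x V g)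
     = rs_germ X x V (X.res (pre W') V (mor_sec f W' c) \<otimes>\<^bsub>X.\<O> V\<^esub> g)"
    using f.coef_eqI[OF cx HOL.refl] rc g by (simp add: f.val_def sm X.stalk_mult[OF V])
  also have "f.cls \<dots> = rs_germ X x V (X.res (pre W') V (mor_sec f W' c) \<otimes>\<^bsub>X.\<O> V\<^esub> g)
      \<odot>\<^bsub>pullback_fibre X Y f F x\<^esub> f.cls \<one>\<^bsub>X.\<O>\<^sub>x x\<^esub>"
    using rc g X.\<O>.stalk_in[OF V] by (simp add: fibre_facts(3)[OF e xW(1)])
  also have "f.cls \<one>\<^bsub>X.\<O>\<^sub>x x\<^esub> = pclass x (pre W) W [(e, \<one>\<^bsub>X.\<O> (pre W)\<^esub>)]"
    by (simp add: pullback_stalk_class_def f.cls_def X.germ_one[OF pre_open[OF W(1)] xW(1)])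
  finally show ?thesis .
qed

lemma local_pullback_basis:
  assumes e: "basis Y F W e"
  shows "basis X \<P> (pre W) (local_pullback X Y f F W e)"
  unfolding pullback_sheaf_eq
proof (rule P.fibre_basis)
  note W = basisD(1,2)[OF e]
  let ?s = "\<lambda>x. pclass x (pre W) W [(e, \<one>\<^bsub>X.\<O> (pre W)\<^esub>)]"
  show U: "X.opn (pre W)" by (rule pre_open[OF W(1)])
  show "local_pullback X Y f F W e \<in> P.sec (pre W)"
    using local_pullback_in[OF W] by (simp add: pullback_sheaf_eq fibre_sheaf_simps)
  show "bij_betw (\<lambda>g. g \<odot>\<^bsub>pullback_fibre X Y f F x\<^esub> local_pullback X Y f F W e x)
      (carrier (X.\<O>\<^sub>x x)) (carrier (pullback_fibre X Y f F x))" if x: "x \<in> pre W" for x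
  proof -
    interpret x: cring "X.\<O>\<^sub>x x" by (rule X.cring_stalk[OF X.opn_pts[OF U x]])
    interpret f: free_tensor "Y.\<O>\<^sub>x (pt x)" "FM x" "stalk_via X f x" "ms_germ Y F (pt x) W e"
      by (rule free_tensor_at[OF e x])
    have eq: "g \<odot>\<^bsub>pullback_fibre X Y f F x\<^esub> local_pullback X Y f F W e x = f.cls g"
      if "g \<in> carrier (X.\<O>\<^sub>x x)" for g
      using fibre_facts(3)[OF e x that x.one_closed] x that
      by (simp add: local_pullback_def pullback_stalk_class_def f.cls_def X.germ_one[OF U x])
    show ?thesis by (rule iffD2[OF bij_betw_cong[OF eq] fibre_facts(2)[OF e x]])
  qed
  fix V s assume V: "X.opn V" "V \<subseteq> pre W" and s: "pullback_shape X Y f F V s"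
  obtain W0 xs0 where xs0: "fits V W0 xs0" "\<forall>x\<in>V. s x = pclass x V W0 xs0" using shapeE[OF V(1) s] .
  \<comment> \<open>The given list lives over an open set \<open>W0\<close> of \<open>Y\<close>
    unrelated to \<open>W\<close>; over the intersection its entries become multiples of
    \<open>e\<close>.\<close>
  define W' where "W' = W \<inter> W0"
  define xs where "xs = map (map_prod (ms_res F W0 W') (X.res V V)) xs0"
  have W': "Y.opn W'" "W' \<subseteq> W" "W' \<subseteq> W0" "pt ` V \<subseteq> W'"
    using W xs0 V by (auto simp: W'_def mem_pre)
  have xs: "fits V W' xs" "\<And>x. x \<in> V \<Longrightarrow> s x = pclass x V W' xs"
    using fits_res[OF xs0(1) V(1) subset_refl W'(1,3,4)] xs0(2)
      stalk_class_res[OF xs0(1) V(1) subset_refl W'(1,3,4)] by (auto simp: xs_def)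
  let ?P = "\<lambda>xs c. \<forall>x\<in>V. pclass x V W' xs = rs_germ X x V c \<odot>\<^bsub>pullback_fibre X Y f F x\<^esub> ?s x"
  interpret V: cring "X.\<O> V" by (rule X.cring_\<O>[OF V(1)])
  have mod: "Module.module (X.\<O>\<^sub>x x) (pullback_fibre X Y f F x)" "?s x \<in> carrier (pullback_fibre X Y f F x)"
    if "x \<in> V" for x
    using fibre_facts(1)[OF e] stalk_class_in[OF pre_fits[OF W]] that V by auto
  have "\<exists>c\<in>carrier (X.\<O> V). ?P xs c"
    using xs(1)
  proof (induction xs)
    case Nil
    have "pclass x V W' [] = \<zero>\<^bsub>X.\<O>\<^sub>x x\<^esub> \<odot>\<^bsub>pullback_fibre X Y f F x\<^esub> ?s x" if x: "x \<in> V" for x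
      using module.smult_l_null[OF mod[OF x]]
      by simp (simp add: pullback_stalk_class_def pullback_fibre_def tensor_module_def)
    then show ?case by (intro bexI[of _ "\<zero>\<^bsub>X.\<O> V\<^esub>"]) (auto simp: X.germ_zero[OF V(1)])
  next
    case (Cons p xs)
    then obtain c where c: "c \<in> carrier (X.\<O> V)" "?P xs c" by auto
    obtain m g where p: "p = (m, g)" "m \<in> carrier (ms_mod F W')" "g \<in> carrier (X.\<O> V)"
      using Cons.prems by (cases p) auto
    obtain a where a: "a \<in> carrier (Y.\<O> W')" "m = a \<odot>\<^bsub>ms_mod F W'\<^esub> ms_res F W W' e"
      using F.basis_coefE[OF e W'(1,2) p(2)] .
    let ?a = "X.res (pre W') V (mor_sec f W' a) \<otimes>\<^bsub>X.\<O> V\<^esub> g"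
    have VW: "V \<subseteq> pre W'" using W'(4) X.opn_pts[OF V(1)] by (auto simp: mem_pre)
    have a': "?a \<in> carrier (X.\<O> V)"
      using X.\<O>.res_in[OF pre_open[OF W'(1)] V(1) VW sec_in[OF W'(1) a(1)]] p(3) by simp
    have "?P (p # xs) (?a \<oplus>\<^bsub>X.\<O> V\<^esub> c)"
    proof
      fix x assume x: "x \<in> V"
      have "pclass x V W' (p # xs)
        = pclass x V W' [p] \<oplus>\<^bsub>pullback_fibre X Y f F x\<^esub> pclass x V W' xs"
        using stalk_class_append[of V W' "[p]" xs x] x Cons.prems by simp
      also have "pclass x V W' [p] = rs_germ X x V ?a \<odot>\<^bsub>pullback_fibre X Y f F x\<^esub> ?s x"
        unfolding p a(2) by (rule stalk_class_scale[OF e V(1) x W'(1,2,4) a(1) p(3)])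
      also have "pclass x V W' xs = rs_germ X x V c \<odot>\<^bsub>pullback_fibre X Y f F x\<^esub> ?s x"
        using c(2) x by blast
      finally show "pclass x V W' (p # xs) = rs_germ X x V (?a \<oplus>\<^bsub>X.\<O> V\<^esub> c) \<odot>\<^bsub>pullback_fibre X Y f F x\<^esub> ?s x"
        using module.smult_l_distr[OF mod(1)[OF x] X.\<O>.stalk_in[OF V(1) x a'] X.\<O>.stalk_in[OF V(1) x c(1)] mod(2)[OF x]]
          X.\<O>.stalk_add[OF V(1) x a' c(1)]
        by simp
    qed
    then show ?case using a' c(1) by blast
  qed
  then obtain c where c: "c \<in> carrier (X.\<O> V)" "?P xs c" by blast
  have "s x = rs_germ X x V c \<odot>\<^bsub>pullback_fibre X Y f F x\<^esub> local_pullback X Y f F W e x" if "x \<in> V" for x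
    using c(2) xs(2) that subsetD[OF V(2) that] by (simp add: local_pullback_def)
  with c(1) show "\<exists>c\<in>carrier (X.\<O> V). \<forall>x\<in>V. s x = rs_germ X x V c \<odot>\<^bsub>pullback_fibre X Y f F x\<^esub> local_pullback X Y f F W e x"
    by blast
qed

lemma local_pullback_scale:
  assumes e: "basis Y F W e" and c: "c \<in> carrier (Y.\<O> W)"
  shows "local_pullback X Y f F W (c \<odot>\<^bsub>ms_mod F W\<^esub> e)
    = mor_sec f W c \<odot>\<^bsub>ms_mod \<P> (pre W)\<^esub> local_pullback X Y f F W e"
proof -
  note W = basisD(1,2)[OF e]
  note U = pre_open[OF W(1)]
  interpret U: cring "X.\<O> (pre W)" by (rule X.cring_\<O>[OF U])
  have "pt ` pre W \<subseteq> W" by (auto simp: mem_pre)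
  from stalk_class_scale[OF e U _ W(1) subset_refl this c U.one_closed]
  show ?thesis
    using F.\<M>.res_id[OF W] X.\<O>.res_id[OF U sec_in[OF W(1) c]] sec_in[OF W(1) c]
    by (auto simp: local_pullback_def pullback_sheaf_eq fibre_sheaf_simps fun_eq_iff restrict_def)
qed

lemma pullback_section_eq: "pullback_section X Y f F m = local_pullback X Y f F (rs_pts Y) m"
proof -
  have "pre (rs_pts Y) = rs_pts X" using pt_in by (auto simp: mem_pre)
  then show ?thesis unfolding pullback_section_def local_pullback_def by simp
qed

lemma pullback_line_bundle: "line_bundle X \<P>"
  unfolding X.line_bundle_iff
proof (intro conjI ballI)
  show "is_mod_sheaf X \<P>" using pullback_mod_sheaf by (simp add: mod_sheaf_def mod_sheaf_axioms_def)
  fix x assume "x \<in> rs_pts X"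
  then obtain W e where "x \<in> pre W" "basis Y F W e" by (rule basis_at)
  then show "\<exists>U e. x \<in> U \<and> basis X \<P> U e" using local_pullback_basis by blast
qed

end


section \<open>Isomorphisms from compatible local bases\<close>

text \<open>Each triple prescribes the isomorphism \<open>c m \<mapsto> c n\<close> over
  \<open>U\<close>, and \<open>compat\<close> says that transition coefficients on the side of
  \<open>M\<close> are also valid on the side of \<open>N\<close>. The family may contain all
  admissible triples at once, so no cover has to be selected.\<close>

locale matching_bases = M: mod_sheaf S M + N: mod_sheaf S N
  for S :: "('a, 'b) ringed_space" and M :: "('a, 'b, 'c) mod_sheaf" and N :: "('a, 'b, 'd) mod_sheaf" +
  fixes \<B> :: "('a set \<times> 'c \<times> 'd) set"
  assumes bases: "(U, m, n) \<in> \<B> \<Longrightarrow> basis S M U m \<and> basis S N U n"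
    and cover: "x \<in> rs_pts S \<Longrightarrow> \<exists>U m n. (U, m, n) \<in> \<B> \<and> x \<in> U"
    and compat: "(U, m, n) \<in> \<B> \<Longrightarrow> (U', m', n') \<in> \<B> \<Longrightarrow> M.opn V \<Longrightarrow> V \<subseteq> U \<Longrightarrow> V \<subseteq> U' \<Longrightarrow>
      c \<in> carrier (M.\<O> V) \<Longrightarrow> ms_res M U V m = c \<odot>\<^bsub>ms_mod M V\<^esub> ms_res M U' V m' \<Longrightarrow>
      ms_res N U V n = c \<odot>\<^bsub>ms_mod N V\<^esub> ms_res N U' V n'"
begin

text \<open>The graph of the isomorphism to be constructed. A relation can be read in both
  directions, so existence and uniqueness of images give those of preimages as well.\<close>

definition matched :: "'a set \<Rightarrow> 'c \<Rightarrow> 'd \<Rightarrow> bool" where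
  "matched U m n \<longleftrightarrow> m \<in> carrier (ms_mod M U) \<and> n \<in> carrier (ms_mod N U) \<and>
     (\<forall>W m0 n0 V c. (W, m0, n0) \<in> \<B> \<longrightarrow> M.opn V \<longrightarrow> V \<subseteq> U \<longrightarrow> V \<subseteq> W \<longrightarrow> c \<in> carrier (M.\<O> V) \<longrightarrow>
        ms_res M U V m = c \<odot>\<^bsub>ms_mod M V\<^esub> ms_res M W V m0 \<longrightarrow>
        ms_res N U V n = c \<odot>\<^bsub>ms_mod N V\<^esub> ms_res N W V n0)"

lemma matchedD:
  assumes "matched U m n"
  shows "m \<in> carrier (ms_mod M U)" "n \<in> carrier (ms_mod N U)"
    "(W, m0, n0) \<in> \<B> \<Longrightarrow> M.opn V \<Longrightarrow> V \<subseteq> U \<Longrightarrow> V \<subseteq> W \<Longrightarrow> c \<in> carrier (M.\<O> V) \<Longrightarrow>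
        ms_res M U V m = c \<odot>\<^bsub>ms_mod M V\<^esub> ms_res M W V m0 \<Longrightarrow>
        ms_res N U V n = c \<odot>\<^bsub>ms_mod N V\<^esub> ms_res N W V n0"
  using assms unfolding matched_def by simp_all

lemma coefE:
  assumes "M.opn U" "m \<in> carrier (ms_mod M U)" "(W, m0, n0) \<in> \<B>" "M.opn V" "V \<subseteq> U" "V \<subseteq> W"
  obtains c where "c \<in> carrier (M.\<O> V)" "ms_res M U V m = c \<odot>\<^bsub>ms_mod M V\<^esub> ms_res M W V m0"
  using M.basis_coefE[OF conjunct1[OF bases[OF assms(3)]] assms(4,6) M.\<M>.res_in[OF assms(1,4,5,2)]] by metis

lemma matched_ex:
  assumes U: "M.opn U" and m: "m \<in> carrier (ms_mod M U)"
  obtains n where "matched U m n"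
proof -
  \<comment> \<open>\<open>P V n\<close> says that \<open>n\<close> has the same coefficient as
    \<open>m\<close> with respect to some triple over a set containing \<open>V\<close>. Uniqueness,
    which the gluing requires, is the independence of the triple and comes from
    \<open>compat\<close>.\<close>
  define P where "P V n \<longleftrightarrow> (\<exists>W m0 n0 c. (W, m0, n0) \<in> \<B> \<and> V \<subseteq> W \<and> c \<in> carrier (M.\<O> V) \<and>
    ms_res M U V m = c \<odot>\<^bsub>ms_mod M V\<^esub> ms_res M W V m0 \<and> n = c \<odot>\<^bsub>ms_mod N V\<^esub> ms_res N W V n0)" for V n
  have in0: "ms_res M W V m0 \<in> carrier (ms_mod M V)" "ms_res N W V n0 \<in> carrier (ms_mod N V)" "M.opn W"
    if "(W, m0, n0) \<in> \<B>" "M.opn V" "V \<subseteq> W" for V W m0 n0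
    using basisD(1,2)[OF conjunct1[OF bases[OF that(1)]]] basisD(2)[OF conjunct2[OF bases[OF that(1)]]]
      M.\<M>.res_in N.\<M>.res_in that by auto
  obtain n where n: "n \<in> carrier (ms_mod N U)"
    "\<And>V n'. M.opn V \<Longrightarrow> V \<subseteq> U \<Longrightarrow> n' \<in> carrier (ms_mod N V) \<Longrightarrow> P V n' \<Longrightarrow> ms_res N U V n = n'"
  proof (rule N.\<M>.glue_property[OF U, of P])
    fix x assume x: "x \<in> U"
    obtain W m0 n0 where W: "(W, m0, n0) \<in> \<B>" "x \<in> W" using cover[OF M.opn_pts[OF U x]] by blast
    let ?V = "U \<inter> W"
    have V: "M.opn ?V" "?V \<subseteq> U" "?V \<subseteq> W" using U basisD(1)[OF conjunct1[OF bases[OF W(1)]]] by auto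
    obtain c where c: "c \<in> carrier (M.\<O> ?V)" "ms_res M U ?V m = c \<odot>\<^bsub>ms_mod M ?V\<^esub> ms_res M W ?V m0"
      using coefE[OF U m W(1) V] .
    have "P ?V (c \<odot>\<^bsub>ms_mod N ?V\<^esub> ms_res N W ?V n0)" unfolding P_def using W(1) V(3) c by blast
    moreover have "c \<odot>\<^bsub>ms_mod N ?V\<^esub> ms_res N W ?V n0 \<in> carrier (ms_mod N ?V)"
      using N.smult_closed[OF V(1) c(1)] in0[OF W(1) V(1,3)] by blast
    ultimately show "\<exists>V n. M.opn V \<and> x \<in> V \<and> V \<subseteq> U \<and> n \<in> carrier (ms_mod N V) \<and> P V n"
      using V x W(2) by blast
  next
    fix V V' n assume V: "M.opn V" "M.opn V'" "V' \<subseteq> V" "V \<subseteq> U" and P: "P V n"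
    obtain W m0 n0 c where W: "(W, m0, n0) \<in> \<B>" "V \<subseteq> W" "c \<in> carrier (M.\<O> V)"
      "ms_res M U V m = c \<odot>\<^bsub>ms_mod M V\<^esub> ms_res M W V m0" "n = c \<odot>\<^bsub>ms_mod N V\<^esub> ms_res N W V n0"
      using P unfolding P_def by blast
    note i = in0[OF W(1) V(1) W(2)]
    have "ms_res M U V' m = ms_res M V V' (ms_res M U V m)" using M.\<M>.res_res U V m by simp
    also have "\<dots> = M.res V V' c \<odot>\<^bsub>ms_mod M V'\<^esub> ms_res M W V' m0"
      unfolding W(4) using M.mres_smult[OF V(1-3) W(3) i(1)]
        M.\<M>.res_res[OF i(3) V(1,2,3) W(2)] basisD(2)[OF conjunct1[OF bases[OF W(1)]]] by simp
    finally have 1: "ms_res M U V' m = M.res V V' c \<odot>\<^bsub>ms_mod M V'\<^esub> ms_res M W V' m0" .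
    have 2: "ms_res N V V' n = M.res V V' c \<odot>\<^bsub>ms_mod N V'\<^esub> ms_res N W V' n0"
      unfolding W(5) using N.mres_smult[OF V(1-3) W(3) i(2)]
        N.\<M>.res_res[OF i(3) V(1,2,3) W(2)] basisD(2)[OF conjunct2[OF bases[OF W(1)]]] by simp
    have "M.res V V' c \<in> carrier (M.\<O> V')" using M.\<O>.res_in[OF V(1-3) W(3)] .
    then show "P V' (ms_res N V V' n)" unfolding P_def using W(1,2) V(3) 1 2 by blast
  next
    fix V n n' assume V: "M.opn V" "V \<subseteq> U" and P: "P V n" "P V n'"
    obtain W m0 n0 c where W: "(W, m0, n0) \<in> \<B>" "V \<subseteq> W" "c \<in> carrier (M.\<O> V)"
      "ms_res M U V m = c \<odot>\<^bsub>ms_mod M V\<^esub> ms_res M W V m0" "n = c \<odot>\<^bsub>ms_mod N V\<^esub> ms_res N W V n0"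
      using P(1) unfolding P_def by blast
    obtain W' m0' n0' c' where W': "(W', m0', n0') \<in> \<B>" "V \<subseteq> W'" "c' \<in> carrier (M.\<O> V)"
      "ms_res M U V m = c' \<odot>\<^bsub>ms_mod M V\<^esub> ms_res M W' V m0'" "n' = c' \<odot>\<^bsub>ms_mod N V\<^esub> ms_res N W' V n0'"
      using P(2) unfolding P_def by blast
    interpret MV: module "M.\<O> V" "ms_mod M V" by (rule M.module[OF V(1)])
    interpret NV: module "M.\<O> V" "ms_mod N V" by (rule N.module[OF V(1)])
    note i = in0[OF W(1) V(1) W(2)] and i' = in0[OF W'(1) V(1) W'(2)]
    obtain d where d: "d \<in> carrier (M.\<O> V)" "ms_res M W V m0 = d \<odot>\<^bsub>ms_mod M V\<^esub> ms_res M W' V m0'"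
      using M.basis_coefE[OF conjunct1[OF bases[OF W'(1)]] V(1) W'(2) i(1)] .
    have "(c \<otimes>\<^bsub>M.\<O> V\<^esub> d) \<odot>\<^bsub>ms_mod M V\<^esub> ms_res M W' V m0' = c' \<odot>\<^bsub>ms_mod M V\<^esub> ms_res M W' V m0'"
      using W(3,4) W'(4) d i'(1) by (simp add: MV.smult_assoc1)
    then have "c \<otimes>\<^bsub>M.\<O> V\<^esub> d = c'"
      using M.basis_cancel[OF conjunct1[OF bases[OF W'(1)]] V(1) W'(2) _ W'(3)] W(3) d(1) by simp
    then show "n = n'"
      using compat[OF W(1) W'(1) V(1) W(2) W'(2) d] W(3,5) W'(5) d(1) i'(2) by (simp add: NV.smult_assoc1[symmetric])
  qed (assumption | blast)+
  have "matched U m n"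
    unfolding matched_def
  proof (intro conjI allI impI m n(1))
    fix W m0 n0 V c
    assume a: "(W, m0, n0) \<in> \<B>" "M.opn V" "V \<subseteq> U" "V \<subseteq> W" "c \<in> carrier (M.\<O> V)"
      "ms_res M U V m = c \<odot>\<^bsub>ms_mod M V\<^esub> ms_res M W V m0"
    have "P V (c \<odot>\<^bsub>ms_mod N V\<^esub> ms_res N W V n0)" unfolding P_def using a by blast
    then show "ms_res N U V n = c \<odot>\<^bsub>ms_mod N V\<^esub> ms_res N W V n0"
      using n(2)[OF a(2,3)] N.smult_closed[OF a(2,5)] in0[OF a(1,2,4)] by blast
  qed
  then show thesis by (rule that)
qed

lemma matched_unique:
  assumes U: "M.opn U" and mn: "matched U m n" "matched U m n'"
  shows "n = n'"
proof (rule N.\<M>.eqI[OF U matchedD(2)[OF mn(1)] matchedD(2)[OF mn(2)]])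
  fix x assume x: "x \<in> U"
  obtain W m0 n0 where W: "(W, m0, n0) \<in> \<B>" "x \<in> W" using cover[OF M.opn_pts[OF U x]] by blast
  let ?V = "U \<inter> W"
  have V: "M.opn ?V" "?V \<subseteq> U" "?V \<subseteq> W" using U basisD(1)[OF conjunct1[OF bases[OF W(1)]]] by auto
  obtain c where c: "c \<in> carrier (M.\<O> ?V)" "ms_res M U ?V m = c \<odot>\<^bsub>ms_mod M ?V\<^esub> ms_res M W ?V m0"
    using coefE[OF U matchedD(1)[OF mn(1)] W(1) V] .
  have "ms_res N U ?V n = ms_res N U ?V n'"
    using matchedD(3)[OF mn(1) W(1) V c] matchedD(3)[OF mn(2) W(1) V c] by simp
  then show "\<exists>V. M.opn V \<and> x \<in> V \<and> V \<subseteq> U \<and> ms_res N U V n = ms_res N U V n'" using V x W(2) by blast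
qed

lemma matched_swap:
  assumes U: "M.opn U" and mn: "matched U m n"
    and a: "(W, m0, n0) \<in> \<B>" "M.opn V" "V \<subseteq> U" "V \<subseteq> W" "c \<in> carrier (M.\<O> V)"
      "ms_res N U V n = c \<odot>\<^bsub>ms_mod N V\<^esub> ms_res N W V n0"
  shows "ms_res M U V m = c \<odot>\<^bsub>ms_mod M V\<^esub> ms_res M W V m0"
proof -
  obtain d where d: "d \<in> carrier (M.\<O> V)" "ms_res M U V m = d \<odot>\<^bsub>ms_mod M V\<^esub> ms_res M W V m0"
    using coefE[OF U matchedD(1)[OF mn] a(1-4)] .
  have "d = c" using N.basis_cancel[OF conjunct2[OF bases[OF a(1)]] a(2,4) d(1) a(5)]
      matchedD(3)[OF mn a(1-4) d] a(6) by simp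
  then show ?thesis using d by simp
qed

end

text \<open>Coefficients in a basis are unique, so a transition coefficient found on the side of
  \<open>N\<close> must be the one that \<open>compat\<close> transports from
  \<open>M\<close>.\<close>

lemma matching_bases_swap:
  assumes "matching_bases S M N \<B>"
  shows "matching_bases S N M ((\<lambda>(U, m, n). (U, n, m)) ` \<B>)" (is "matching_bases S N M ?B")
proof -
  interpret matching_bases S M N \<B> by fact
  have B: "(U, n, m) \<in> ?B \<longleftrightarrow> (U, m, n) \<in> \<B>" for U m n by force
  show ?thesis
  proof (intro matching_bases.intro matching_bases_axioms.intro N.mod_sheaf_axioms M.mod_sheaf_axioms; unfold B)
    show "basis S N U n \<and> basis S M U m" if "(U, m, n) \<in> \<B>" for U m n using bases[OF that] by blast
    show "\<exists>U n m. (U, m, n) \<in> \<B> \<and> x \<in> U" if "x \<in> rs_pts S" for x using cover[OF that] by blast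
    fix U m n U' m' n' V c
    assume a: "(U, m, n) \<in> \<B>" "(U', m', n') \<in> \<B>" "M.opn V" "V \<subseteq> U" "V \<subseteq> U'" "c \<in> carrier (M.\<O> V)"
      "ms_res N U V n = c \<odot>\<^bsub>ms_mod N V\<^esub> ms_res N U' V n'"
    note U = basisD(1,2)[OF conjunct1[OF bases[OF a(1)]]]
    obtain d where d: "d \<in> carrier (M.\<O> V)" "ms_res M U V m = d \<odot>\<^bsub>ms_mod M V\<^esub> ms_res M U' V m'"
      using coefE[OF U a(2,3,4,5)] .
    have "d = c" using N.basis_cancel[OF conjunct2[OF bases[OF a(2)]] a(3,5) d(1) a(6)]
      compat[OF a(1-5) d] a(7) by simp
    then show "ms_res M U V m = c \<odot>\<^bsub>ms_mod M V\<^esub> ms_res M U' V m'" using d by simp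
  qed
qed

context matching_bases
begin

text \<open>For the swapped family the relation is the converse of \<open>matched\<close>, so
  \<open>matched_ex\<close> and \<open>matched_unique\<close> apply to it.\<close>

lemma matched_sur:
  assumes U: "M.opn U" and n: "n \<in> carrier (ms_mod N U)"
  shows "\<exists>!m. matched U m n"
proof -
  let ?B = "(\<lambda>(U, m, n). (U, n, m)) ` \<B>"
  interpret sw: matching_bases S N M ?B by (rule matching_bases_swap) unfold_locales
  have B: "(U, n, m) \<in> ?B \<longleftrightarrow> (U, m, n) \<in> \<B>" for U m n by force
  have eq: "matched U m n \<longleftrightarrow> sw.matched U n m" for m
  proof
    assume mn: "matched U m n"
    show "sw.matched U n m" unfolding sw.matched_def B
      using matchedD(1,2)[OF mn] matched_swap[OF U mn] by blast
  next
    assume mn: "sw.matched U n m"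
    show "matched U m n" unfolding matched_def
      using sw.matchedD(1,2)[OF mn] sw.matched_swap[OF U mn, unfolded B] by blast
  qed
  show ?thesis unfolding eq using sw.matched_ex[OF U n] sw.matched_unique[OF U] by metis
qed

definition glued :: "'a set \<Rightarrow> 'c \<Rightarrow> 'd" where "glued U m = (THE n. matched U m n)"

lemma glued_eq: "M.opn U \<Longrightarrow> matched U m n \<Longrightarrow> glued U m = n"
  unfolding glued_def using matched_unique by blast

lemma glued_matched: "M.opn U \<Longrightarrow> m \<in> carrier (ms_mod M U) \<Longrightarrow> matched U m (glued U m)"
  using matched_ex glued_eq by metis

lemma glued_iso: "mod_sheaf_iso S M N glued"
  unfolding mod_sheaf_iso_def
proof (intro conjI allI impI ballI; (elim conjE)?)
  fix U assume U: "M.opn U"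
  interpret MU: module "M.\<O> U" "ms_mod M U" by (rule M.module[OF U])
  interpret NU: module "M.\<O> U" "ms_mod N U" by (rule N.module[OF U])
  note gm = glued_matched[OF U]
  show "bij_betw (glued U) (carrier (ms_mod M U)) (carrier (ms_mod N U))"
    unfolding bij_betw_def
  proof
    show "inj_on (glued U) (carrier (ms_mod M U))"
    proof (rule inj_onI)
      fix m m' assume m: "m \<in> carrier (ms_mod M U)" "m' \<in> carrier (ms_mod M U)" "glued U m = glued U m'"
      show "m = m'" using matched_sur[OF U matchedD(2)[OF gm[OF m(1)]]] gm[OF m(1)] gm[OF m(2)] m(3) by auto
    qed
    show "glued U ` carrier (ms_mod M U) = carrier (ms_mod N U)"
    proof
      show "glued U ` carrier (ms_mod M U) \<subseteq> carrier (ms_mod N U)" using gm matchedD(2) by blast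
      show "carrier (ms_mod N U) \<subseteq> glued U ` carrier (ms_mod M U)"
      proof
        fix n assume "n \<in> carrier (ms_mod N U)"
        then obtain m where "matched U m n" using matched_sur[OF U] by blast
        then show "n \<in> glued U ` carrier (ms_mod M U)" using glued_eq[OF U] matchedD(1) by blast
      qed
    qed
  qed
  show "glued U (m \<oplus>\<^bsub>ms_mod M U\<^esub> m') = glued U m \<oplus>\<^bsub>ms_mod N U\<^esub> glued U m'"
    if m: "m \<in> carrier (ms_mod M U)" "m' \<in> carrier (ms_mod M U)" for m m'
  proof (rule glued_eq[OF U], unfold matched_def, intro conjI allI impI)
    note g = gm[OF m(1)] gm[OF m(2)]
    note gc = matchedD(2)[OF g(1)] matchedD(2)[OF g(2)]
    show "m \<oplus>\<^bsub>ms_mod M U\<^esub> m' \<in> carrier (ms_mod M U)" "glued U m \<oplus>\<^bsub>ms_mod N U\<^esub> glued U m' \<in> carrier (ms_mod N U)"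
      using m gc by simp_all
    fix W m0 n0 V c
    assume a: "(W, m0, n0) \<in> \<B>" "M.opn V" "V \<subseteq> U" "V \<subseteq> W" "c \<in> carrier (M.\<O> V)"
      "ms_res M U V (m \<oplus>\<^bsub>ms_mod M U\<^esub> m') = c \<odot>\<^bsub>ms_mod M V\<^esub> ms_res M W V m0"
    interpret MV: module "M.\<O> V" "ms_mod M V" by (rule M.module[OF a(2)])
    interpret NV: module "M.\<O> V" "ms_mod N V" by (rule N.module[OF a(2)])
    note b = bases[OF a(1), THEN conjunct1] bases[OF a(1), THEN conjunct2]
    have in0: "ms_res M W V m0 \<in> carrier (ms_mod M V)" "ms_res N W V n0 \<in> carrier (ms_mod N V)"
      using M.\<M>.res_in[OF basisD(1)[OF b(1)] a(2,4) basisD(2)[OF b(1)]]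
        N.\<M>.res_in[OF basisD(1)[OF b(1)] a(2,4) basisD(2)[OF b(2)]] by auto
    obtain d where d: "d \<in> carrier (M.\<O> V)" "ms_res M U V m = d \<odot>\<^bsub>ms_mod M V\<^esub> ms_res M W V m0"
      using coefE[OF U m(1) a(1-4)] .
    obtain d' where d': "d' \<in> carrier (M.\<O> V)" "ms_res M U V m' = d' \<odot>\<^bsub>ms_mod M V\<^esub> ms_res M W V m0"
      using coefE[OF U m(2) a(1-4)] .
    have "(d \<oplus>\<^bsub>M.\<O> V\<^esub> d') \<odot>\<^bsub>ms_mod M V\<^esub> ms_res M W V m0 = c \<odot>\<^bsub>ms_mod M V\<^esub> ms_res M W V m0"
      using a(6) d d' in0(1) M.mres_add[OF U a(2,3) m] by (simp add: MV.smult_l_distr)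
    then have c: "d \<oplus>\<^bsub>M.\<O> V\<^esub> d' = c" using M.basis_cancel[OF b(1) a(2,4) _ a(5)] d(1) d'(1) by simp
    show "ms_res N U V (glued U m \<oplus>\<^bsub>ms_mod N U\<^esub> glued U m') = c \<odot>\<^bsub>ms_mod N V\<^esub> ms_res N W V n0"
      unfolding c[symmetric] N.mres_add[OF U a(2,3) gc] matchedD(3)[OF g(1) a(1-4) d] matchedD(3)[OF g(2) a(1-4) d']
      using NV.smult_l_distr[OF d(1) d'(1) in0(2)] by simp
  qed
  show "glued U (s \<odot>\<^bsub>ms_mod M U\<^esub> m) = s \<odot>\<^bsub>ms_mod N U\<^esub> glued U m"
    if s: "s \<in> carrier (M.\<O> U)" and m: "m \<in> carrier (ms_mod M U)" for s m
  proof (rule glued_eq[OF U], unfold matched_def, intro conjI allI impI)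
    note g = gm[OF m] note gc = matchedD(2)[OF g]
    show "s \<odot>\<^bsub>ms_mod M U\<^esub> m \<in> carrier (ms_mod M U)" "s \<odot>\<^bsub>ms_mod N U\<^esub> glued U m \<in> carrier (ms_mod N U)"
      using s m gc by simp_all
    fix W m0 n0 V c
    assume a: "(W, m0, n0) \<in> \<B>" "M.opn V" "V \<subseteq> U" "V \<subseteq> W" "c \<in> carrier (M.\<O> V)"
      "ms_res M U V (s \<odot>\<^bsub>ms_mod M U\<^esub> m) = c \<odot>\<^bsub>ms_mod M V\<^esub> ms_res M W V m0"
    interpret MV: module "M.\<O> V" "ms_mod M V" by (rule M.module[OF a(2)])
    interpret NV: module "M.\<O> V" "ms_mod N V" by (rule N.module[OF a(2)])
    note b = bases[OF a(1), THEN conjunct1] bases[OF a(1), THEN conjunct2]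
    have in0: "ms_res M W V m0 \<in> carrier (ms_mod M V)" "ms_res N W V n0 \<in> carrier (ms_mod N V)"
      using M.\<M>.res_in[OF basisD(1)[OF b(1)] a(2,4) basisD(2)[OF b(1)]]
        N.\<M>.res_in[OF basisD(1)[OF b(1)] a(2,4) basisD(2)[OF b(2)]] by auto
    obtain d where d: "d \<in> carrier (M.\<O> V)" "ms_res M U V m = d \<odot>\<^bsub>ms_mod M V\<^esub> ms_res M W V m0"
      using coefE[OF U m a(1-4)] .
    let ?s = "M.res U V s"
    have sV: "?s \<in> carrier (M.\<O> V)" using M.\<O>.res_in[OF U a(2,3) s] .
    have "(?s \<otimes>\<^bsub>M.\<O> V\<^esub> d) \<odot>\<^bsub>ms_mod M V\<^esub> ms_res M W V m0 = c \<odot>\<^bsub>ms_mod M V\<^esub> ms_res M W V m0"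
      using a(6) d sV in0(1) M.mres_smult[OF U a(2,3) s m] by (simp add: MV.smult_assoc1)
    then have c: "?s \<otimes>\<^bsub>M.\<O> V\<^esub> d = c" using M.basis_cancel[OF b(1) a(2,4) _ a(5)] d(1) sV by simp
    show "ms_res N U V (s \<odot>\<^bsub>ms_mod N U\<^esub> glued U m) = c \<odot>\<^bsub>ms_mod N V\<^esub> ms_res N W V n0"
      unfolding c[symmetric] N.mres_smult[OF U a(2,3) s gc] matchedD(3)[OF g a(1-4) d]
      using NV.smult_assoc1[OF sV d(1) in0(2)] by simp
  qed
next
  fix U V m assume U: "M.opn U" "M.opn V" "V \<subseteq> U" and m: "m \<in> carrier (ms_mod M U)"
  note g = glued_matched[OF U(1) m] note gc = matchedD(2)[OF g]
  show "glued V (ms_res M U V m) = ms_res N U V (glued U m)"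
  proof (rule glued_eq[OF U(2)], unfold matched_def, intro conjI allI impI)
    show "ms_res M U V m \<in> carrier (ms_mod M V)" "ms_res N U V (glued U m) \<in> carrier (ms_mod N V)"
      using M.\<M>.res_in[OF U m] N.\<M>.res_in[OF U gc] by auto
    fix W m0 n0 V' c
    assume a: "(W, m0, n0) \<in> \<B>" "M.opn V'" "V' \<subseteq> V" "V' \<subseteq> W" "c \<in> carrier (M.\<O> V')"
      "ms_res M V V' (ms_res M U V m) = c \<odot>\<^bsub>ms_mod M V'\<^esub> ms_res M W V' m0"
    have "V' \<subseteq> U" using a U by blast
    moreover have "ms_res M U V' m = c \<odot>\<^bsub>ms_mod M V'\<^esub> ms_res M W V' m0"
      using a(6) M.\<M>.res_res[OF U(1,2) a(2,3) U(3) m] by simp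
    ultimately show "ms_res N V V' (ms_res N U V (glued U m)) = c \<odot>\<^bsub>ms_mod N V'\<^esub> ms_res N W V' n0"
      using N.\<M>.res_res[OF U(1,2) a(2,3) U(3) gc] matchedD(3)[OF g a(1,2) _ a(4,5)] by simp
  qed
qed

end


section \<open>Localization and sheaves of fractions\<close>

locale denominators = domain R for R :: "('r, 'm) ring_scheme" (structure) +
  fixes T :: "'r set"
  assumes T_sub: "T \<subseteq> carrier R - {\<zero>}" and T_one: "\<one> \<in> T" and T_mult: "f \<in> T \<Longrightarrow> g \<in> T \<Longrightarrow> f \<otimes> g \<in> T"
begin

lemma T_in: "f \<in> T \<Longrightarrow> f \<in> carrier R" and T_nz: "f \<in> T \<Longrightarrow> f \<noteq> \<zero>" using T_sub by auto

abbreviation frac where "frac \<equiv> loc_frac R T"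
abbreviation Loc where "Loc \<equiv> localization R T"

text \<open>Over a domain, with zero excluded from the denominators, the auxiliary factor
  \<open>u\<close> of the definition cancels, and equality of fractions is plain cross
  multiplication.\<close>

lemma mem_frac:
  assumes "r \<in> carrier R" "f \<in> T"
  shows "(r', f') \<in> frac r f \<longleftrightarrow> r' \<in> carrier R \<and> f' \<in> T \<and> r \<otimes> f' = r' \<otimes> f"
proof -
  have "(\<exists>u\<in>T. u \<otimes> (r \<otimes> f' \<ominus> r' \<otimes> f) = \<zero>) \<longleftrightarrow> r \<otimes> f' = r' \<otimes> f"
    if "r' \<in> carrier R" "f' \<in> T"
  proof -
    have c: "r \<otimes> f' \<in> carrier R" "r' \<otimes> f \<in> carrier R" "r \<otimes> f' \<ominus> r' \<otimes> f \<in> carrier R"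
      using assms that T_in by auto
    have "r \<otimes> f' \<ominus> r' \<otimes> f = \<zero> \<longleftrightarrow> r \<otimes> f' = r' \<otimes> f"
      using c(1,2) by (metis a_minus_def add.inv_closed minus_equality r_neg)
    moreover have "(\<exists>u\<in>T. u \<otimes> (r \<otimes> f' \<ominus> r' \<otimes> f) = \<zero>) \<longleftrightarrow> r \<otimes> f' \<ominus> r' \<otimes> f = \<zero>"
    proof
      assume "\<exists>u\<in>T. u \<otimes> (r \<otimes> f' \<ominus> r' \<otimes> f) = \<zero>"
      then obtain u where u: "u \<in> T" "u \<otimes> (r \<otimes> f' \<ominus> r' \<otimes> f) = \<zero>" by blast
      then show "r \<otimes> f' \<ominus> r' \<otimes> f = \<zero>" using integral[OF u(2) T_in[OF u(1)] c(3)] T_nz[OF u(1)] by blast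
    next
      assume "r \<otimes> f' \<ominus> r' \<otimes> f = \<zero>"
      then show "\<exists>u\<in>T. u \<otimes> (r \<otimes> f' \<ominus> r' \<otimes> f) = \<zero>" using T_one by (intro bexI[of _ \<one>]) auto
    qed
    ultimately show ?thesis by simp
  qed
  then show ?thesis unfolding loc_frac_def by auto
qed

lemma frac_eq_iff:
  assumes "r \<in> carrier R" "f \<in> T" "r' \<in> carrier R" "f' \<in> T"
  shows "frac r f = frac r' f' \<longleftrightarrow> r \<otimes> f' = r' \<otimes> f"
proof
  assume "frac r f = frac r' f'"
  moreover have "(r', f') \<in> frac r' f'" using assms mem_frac by blast
  ultimately show "r \<otimes> f' = r' \<otimes> f" using assms mem_frac by blast
next
  assume eq: "r \<otimes> f' = r' \<otimes> f"
  have "r \<otimes> b = a \<otimes> f \<longleftrightarrow> r' \<otimes> b = a \<otimes> f'" if ab: "a \<in> carrier R" "b \<in> T" for a b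
  proof -
    note c = assms(1,3) ab(1) T_in[OF assms(2)] T_in[OF assms(4)] T_in[OF ab(2)]
    have "(r \<otimes> b) \<otimes> f' = (r \<otimes> f') \<otimes> b" using c by algebra
    also have "\<dots> = (r' \<otimes> b) \<otimes> f" unfolding eq using c by algebra
    finally have 1: "(r \<otimes> b) \<otimes> f' = (r' \<otimes> b) \<otimes> f" .
    have 2: "(a \<otimes> f) \<otimes> f' = (a \<otimes> f') \<otimes> f" using c by algebra
    have "r \<otimes> b = a \<otimes> f \<longleftrightarrow> (r \<otimes> b) \<otimes> f' = (a \<otimes> f) \<otimes> f'"
      using c T_nz[OF assms(4)] by (simp add: m_rcancel)
    also have "\<dots> \<longleftrightarrow> r' \<otimes> b = a \<otimes> f'"
      unfolding 1 2 using c T_nz[OF assms(2)] by (simp add: m_rcancel)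
    finally show ?thesis .
  qed
  then have "(a, b) \<in> frac r f \<longleftrightarrow> (a, b) \<in> frac r' f'" for a b
    using mem_frac assms by metis
  then show "frac r f = frac r' f'" by auto
qed

lemma frac_self: "r \<in> carrier R \<Longrightarrow> f \<in> T \<Longrightarrow> (r, f) \<in> frac r f"
  by (simp add: mem_frac)

lemma loc_carrier: "carrier Loc = {frac r f |r f. r \<in> carrier R \<and> f \<in> T}"
  by (simp add: localization_def)

lemma frac_in: "r \<in> carrier R \<Longrightarrow> f \<in> T \<Longrightarrow> frac r f \<in> carrier Loc"
  unfolding loc_carrier by blast

lemma locE:
  assumes "A \<in> carrier Loc" obtains r f where "r \<in> carrier R" "f \<in> T" "A = frac r f"
  using assms unfolding loc_carrier by blast

lemma frac_mult:
  assumes "r \<in> carrier R" "f \<in> T" "r' \<in> carrier R" "f' \<in> T"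
  shows "frac r f \<otimes>\<^bsub>Loc\<^esub> frac r' f' = frac (r \<otimes> r') (f \<otimes> f')"
proof -
  have "frac (a \<otimes> a') (b \<otimes> b') = frac (r \<otimes> r') (f \<otimes> f')"
    if "(a, b) \<in> frac r f" "(a', b') \<in> frac r' f'" for a b a' b'
  proof -
    have ab: "a \<in> carrier R" "b \<in> T" "r \<otimes> b = a \<otimes> f" "a' \<in> carrier R" "b' \<in> T" "r' \<otimes> b' = a' \<otimes> f'"
      using that assms mem_frac by auto
    note c = assms(1,3) ab(1,4) T_in[OF assms(2)] T_in[OF assms(4)] T_in[OF ab(2)] T_in[OF ab(5)]
    have "(a \<otimes> a') \<otimes> (f \<otimes> f') = (a \<otimes> f) \<otimes> (a' \<otimes> f')" using c by algebra
    also have "\<dots> = (r \<otimes> b) \<otimes> (r' \<otimes> b')" using ab by simp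
    also have "\<dots> = (r \<otimes> r') \<otimes> (b \<otimes> b')" using c by algebra
    finally show ?thesis using c assms(2,4) ab(2,5) by (subst frac_eq_iff) (auto intro: T_mult)
  qed
  then have "{frac (a \<otimes> a') (b \<otimes> b') |a b a' b'. (a, b) \<in> frac r f \<and> (a', b') \<in> frac r' f'}
      = {frac (r \<otimes> r') (f \<otimes> f')}"
    using frac_self assms by blast
  then show ?thesis by (simp add: localization_def)
qed

lemma frac_add:
  assumes "r \<in> carrier R" "f \<in> T" "r' \<in> carrier R" "f' \<in> T"
  shows "frac r f \<oplus>\<^bsub>Loc\<^esub> frac r' f' = frac (r \<otimes> f' \<oplus> r' \<otimes> f) (f \<otimes> f')"
proof -
  have "frac (a \<otimes> b' \<oplus> a' \<otimes> b) (b \<otimes> b') = frac (r \<otimes> f' \<oplus> r' \<otimes> f) (f \<otimes> f')"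
    if "(a, b) \<in> frac r f" "(a', b') \<in> frac r' f'" for a b a' b'
  proof -
    have ab: "a \<in> carrier R" "b \<in> T" "r \<otimes> b = a \<otimes> f" "a' \<in> carrier R" "b' \<in> T" "r' \<otimes> b' = a' \<otimes> f'"
      using that assms mem_frac by auto
    note c = assms(1,3) ab(1,4) T_in[OF assms(2)] T_in[OF assms(4)] T_in[OF ab(2)] T_in[OF ab(5)]
    have "(a \<otimes> b' \<oplus> a' \<otimes> b) \<otimes> (f \<otimes> f') = (a \<otimes> f) \<otimes> (b' \<otimes> f') \<oplus> (a' \<otimes> f') \<otimes> (b \<otimes> f)" using c by algebra
    also have "\<dots> = (r \<otimes> b) \<otimes> (b' \<otimes> f') \<oplus> (r' \<otimes> b') \<otimes> (b \<otimes> f)" using ab by simp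
    also have "\<dots> = (r \<otimes> f' \<oplus> r' \<otimes> f) \<otimes> (b \<otimes> b')" using c by algebra
    finally show ?thesis using c assms(2,4) ab(2,5) by (subst frac_eq_iff) (auto intro: T_mult)
  qed
  then have "{frac (a \<otimes> b' \<oplus> a' \<otimes> b) (b \<otimes> b') |a b a' b'. (a, b) \<in> frac r f \<and> (a', b') \<in> frac r' f'}
      = {frac (r \<otimes> f' \<oplus> r' \<otimes> f) (f \<otimes> f')}"
    using frac_self assms by blast
  then show ?thesis by (simp add: localization_def)
qed

lemma loc_one: "\<one>\<^bsub>Loc\<^esub> = frac \<one> \<one>" and loc_zero: "\<zero>\<^bsub>Loc\<^esub> = frac \<zero> \<one>"
  by (simp_all add: localization_def)

lemma cring_loc: "cring Loc"
proof -
  note simps = frac_mult frac_add loc_one loc_zero T_in T_mult T_one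
  show ?thesis
  proof (rule cringI)
    show "abelian_group Loc"
    proof (rule abelian_groupI)
      fix A B C assume "A \<in> carrier Loc" "B \<in> carrier Loc" "C \<in> carrier Loc"
      then obtain a f b g c h where *: "a \<in> carrier R" "f \<in> T" "b \<in> carrier R" "g \<in> T" "c \<in> carrier R" "h \<in> T"
        "A = frac a f" "B = frac b g" "C = frac c h" using locE by metis
      then have c: "f \<in> carrier R" "g \<in> carrier R" "h \<in> carrier R" using T_in by auto
      have "((a \<otimes> g \<oplus> b \<otimes> f) \<otimes> h \<oplus> c \<otimes> (f \<otimes> g)) = a \<otimes> (g \<otimes> h) \<oplus> (b \<otimes> h \<oplus> c \<otimes> g) \<otimes> f"
        using * c by algebra
      then show "(A \<oplus>\<^bsub>Loc\<^esub> B) \<oplus>\<^bsub>Loc\<^esub> C = A \<oplus>\<^bsub>Loc\<^esub> (B \<oplus>\<^bsub>Loc\<^esub> C)" using * by (simp add: simps m_assoc)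
    next
      fix A B assume "A \<in> carrier Loc" "B \<in> carrier Loc"
      then obtain a f b g where *: "a \<in> carrier R" "f \<in> T" "b \<in> carrier R" "g \<in> T" "A = frac a f" "B = frac b g"
        using locE by metis
      show "A \<oplus>\<^bsub>Loc\<^esub> B \<in> carrier Loc" using * by (simp add: simps frac_in)
      show "A \<oplus>\<^bsub>Loc\<^esub> B = B \<oplus>\<^bsub>Loc\<^esub> A" using * by (simp add: simps m_comm a_comm)
      show "\<zero>\<^bsub>Loc\<^esub> \<oplus>\<^bsub>Loc\<^esub> A = A" using * by (simp add: simps)
      have "frac (\<ominus> a) f \<oplus>\<^bsub>Loc\<^esub> A = \<zero>\<^bsub>Loc\<^esub>"
        using * by (simp add: simps frac_eq_iff) (simp add: l_minus l_neg T_in)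
      then show "\<exists>B\<in>carrier Loc. B \<oplus>\<^bsub>Loc\<^esub> A = \<zero>\<^bsub>Loc\<^esub>" using * frac_in[of "\<ominus> a" f] by auto
    qed (simp add: simps frac_in)
    show "comm_monoid Loc"
    proof (rule comm_monoidI)
      fix A B C assume "A \<in> carrier Loc" "B \<in> carrier Loc" "C \<in> carrier Loc"
      then obtain a f b g c h where *: "a \<in> carrier R" "f \<in> T" "b \<in> carrier R" "g \<in> T" "c \<in> carrier R" "h \<in> T"
        "A = frac a f" "B = frac b g" "C = frac c h" using locE by metis
      then show "(A \<otimes>\<^bsub>Loc\<^esub> B) \<otimes>\<^bsub>Loc\<^esub> C = A \<otimes>\<^bsub>Loc\<^esub> (B \<otimes>\<^bsub>Loc\<^esub> C)" by (simp add: simps m_assoc)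
    next
      fix A B assume "A \<in> carrier Loc" "B \<in> carrier Loc"
      then obtain a f b g where *: "a \<in> carrier R" "f \<in> T" "b \<in> carrier R" "g \<in> T" "A = frac a f" "B = frac b g"
        using locE by metis
      show "A \<otimes>\<^bsub>Loc\<^esub> B \<in> carrier Loc" using * by (simp add: simps frac_in)
      show "A \<otimes>\<^bsub>Loc\<^esub> B = B \<otimes>\<^bsub>Loc\<^esub> A" using * by (simp add: simps m_comm)
      show "\<one>\<^bsub>Loc\<^esub> \<otimes>\<^bsub>Loc\<^esub> A = A" using * by (simp add: simps)
    qed (simp add: simps frac_in)
    fix A B C assume "A \<in> carrier Loc" "B \<in> carrier Loc" "C \<in> carrier Loc"
    then obtain a f b g c h where *: "a \<in> carrier R" "f \<in> T" "b \<in> carrier R" "g \<in> T" "c \<in> carrier R" "h \<in> T"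
      "A = frac a f" "B = frac b g" "C = frac c h" using locE by metis
    then have c: "f \<in> carrier R" "g \<in> carrier R" "h \<in> carrier R" using T_in by auto
    have "((a \<otimes> g \<oplus> b \<otimes> f) \<otimes> c) \<otimes> ((f \<otimes> h) \<otimes> (g \<otimes> h)) = ((a \<otimes> c) \<otimes> (g \<otimes> h) \<oplus> (b \<otimes> c) \<otimes> (f \<otimes> h)) \<otimes> ((f \<otimes> g) \<otimes> h)"
      using * c by algebra
    then show "(A \<oplus>\<^bsub>Loc\<^esub> B) \<otimes>\<^bsub>Loc\<^esub> C = A \<otimes>\<^bsub>Loc\<^esub> C \<oplus>\<^bsub>Loc\<^esub> B \<otimes>\<^bsub>Loc\<^esub> C"
      using * by (simp add: simps frac_eq_iff)
  qed
qed

lemma frac_minus: "r \<in> carrier R \<Longrightarrow> f \<in> T \<Longrightarrow> \<ominus>\<^bsub>Loc\<^esub> frac r f = frac (\<ominus> r) f"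
proof -
  assume rf: "r \<in> carrier R" "f \<in> T"
  interpret L: cring Loc by (rule cring_loc)
  have "frac (\<ominus> r) f \<oplus>\<^bsub>Loc\<^esub> frac r f = \<zero>\<^bsub>Loc\<^esub>"
    using rf by (simp add: frac_add loc_zero frac_eq_iff T_mult T_one T_in) (simp add: l_minus l_neg T_in)
  then show ?thesis using L.minus_equality frac_in rf by simp
qed

end

text \<open>Common ground for \<open>Proj\<close> and for \<open>Spec\<close> of a field: the space,
  the denominators at a point and the admissible fractions are parameters.\<close>

locale fraction_sheaf = domain R for R :: "('r, 'm) ring_scheme" (structure) +
  fixes X :: "'p topology" and T :: "'p \<Rightarrow> 'r set"
  assumes denoms: "p \<in> topspace X \<Longrightarrow> denominators R (T p)"
begin

abbreviation A where "A p \<equiv> localization R (T p)"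
abbreviation fr where "fr p \<equiv> loc_frac R (T p)"
abbreviation fsec where "fsec N U \<equiv> fraction_sections R X T N U"

definition shape :: "('r \<times> 'r) set \<Rightarrow> 'p set \<Rightarrow> ('p \<Rightarrow> ('r \<times> 'r) set) \<Rightarrow> bool" where
  "shape N V s \<longleftrightarrow> (\<exists>r f. (r, f) \<in> N \<and> (\<forall>q\<in>V. f \<in> T q \<and> s q = fr q r f))"

lemma fsec_eq: "fsec N U = {s \<in> extensional U. \<forall>p\<in>U. \<exists>V. openin X V \<and> p \<in> V \<and> V \<subseteq> U \<and> shape N V s}"
  unfolding fraction_sections_def shape_def by blast

lemma fsec_sheaf: "sheaf X (\<lambda>U. fsec N U) (\<lambda>U V s. restrict s V)"
proof -
  have eq: "(\<lambda>U. fsec N U) =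
     (\<lambda>U. {s \<in> extensional U. \<forall>p\<in>U. \<exists>V. openin X V \<and> p \<in> V \<and> V \<subseteq> U \<and> shape N V s})"
    by (rule ext) (rule fsec_eq)
  show ?thesis
    unfolding eq
  proof (rule local_functions_sheaf[of X "shape N"])
    show "shape N V' s" if V: "V' \<subseteq> V" and s: "shape N V s" for V V' s
    proof -
      obtain r f where "(r, f) \<in> N" "\<forall>q\<in>V. f \<in> T q \<and> s q = fr q r f" using s unfolding shape_def by blast
      moreover from this V have "\<forall>q\<in>V'. f \<in> T q \<and> s q = fr q r f" by blast
      ultimately show ?thesis unfolding shape_def by blast
    qed
    show "shape N V t" if s: "shape N V s" and st: "\<And>x. x \<in> V \<Longrightarrow> s x = t x" for V s t
    proof -
      obtain r f where rf: "(r, f) \<in> N" "\<forall>q\<in>V. f \<in> T q \<and> s q = fr q r f" using s unfolding shape_def by blast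
      have "f \<in> T q \<and> t q = fr q r f" if "q \<in> V" for q
        using bspec[OF rf(2) that] unfolding st[OF that] .
      with rf(1) show ?thesis unfolding shape_def by blast
    qed
  qed
qed

lemma fsecE:
  assumes "s \<in> fsec N U" "p \<in> U"
  obtains V r f where "openin X V" "p \<in> V" "V \<subseteq> U" "(r, f) \<in> N" "\<forall>q\<in>V. f \<in> T q" "\<forall>q\<in>V. s q = fr q r f"
proof -
  have "\<forall>p\<in>U. \<exists>V r f. openin X V \<and> p \<in> V \<and> V \<subseteq> U \<and> (r, f) \<in> N \<and> (\<forall>q\<in>V. f \<in> T q \<and> s q = fr q r f)"
    using assms(1) unfolding fraction_sections_def mem_Collect_eq by (rule conjunct2)
  from bspec[OF this assms(2)] obtain V r f where V: "openin X V" "p \<in> V" "V \<subseteq> U" "(r, f) \<in> N"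
    "\<forall>q\<in>V. f \<in> T q \<and> s q = fr q r f" by (elim exE conjE)
  show thesis by (rule that[OF V(1-4)]) (use V(5) in simp_all)
qed

lemma fsec_outside: "s \<in> fsec N U \<Longrightarrow> x \<notin> U \<Longrightarrow> s x = undefined"
  unfolding fraction_sections_def extensional_def by blast

lemma fsec_restrict_eqI: "s \<in> fsec N U \<Longrightarrow> (\<And>p. p \<in> U \<Longrightarrow> t p = s p) \<Longrightarrow> restrict t U = s"
  by (rule ext) (auto simp: restrict_def fsec_outside)

lemma fsecI:
  assumes "\<And>p. p \<in> U \<Longrightarrow> \<exists>V r f. openin X V \<and> p \<in> V \<and> V \<subseteq> U \<and> (r, f) \<in> N \<and> (\<forall>q\<in>V. f \<in> T q \<and> s q = fr q r f)"
  shows "restrict s U \<in> fsec N U"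
  unfolding fraction_sections_def
proof (intro CollectI conjI ballI)
  fix p assume "p \<in> U"
  from assms[OF this] obtain V r f where V: "openin X V" "p \<in> V" "V \<subseteq> U" "(r, f) \<in> N"
    "\<forall>q\<in>V. f \<in> T q \<and> s q = fr q r f" by blast
  have "\<forall>q\<in>V. f \<in> T q \<and> restrict s U q = fr q r f" using V by auto
  then show "\<exists>V r f. openin X V \<and> p \<in> V \<and> V \<subseteq> U \<and> (r, f) \<in> N \<and> (\<forall>q\<in>V. f \<in> T q \<and> restrict s U q = fr q r f)"
    using V by blast
qed simp

lemma fsec_const:
  assumes U: "openin X U" and "(r, f) \<in> N" "\<And>q. q \<in> U \<Longrightarrow> f \<in> T q"
  shows "(\<lambda>p\<in>U. fr p r f) \<in> fsec N U"
  by (rule fsecI) (use assms in blast)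

lemma pt_in: "openin X U \<Longrightarrow> p \<in> U \<Longrightarrow> p \<in> topspace X"
  using openin_subset by blast

lemma fsec_in:
  assumes N: "N \<subseteq> carrier R \<times> carrier R" and U: "openin X U" and s: "s \<in> fsec N U" "p \<in> U"
  shows "s p \<in> carrier (A p)"
proof -
  interpret denominators R "T p" using denoms[OF pt_in[OF U s(2)]] .
  obtain V r f where "openin X V" "p \<in> V" "V \<subseteq> U" "(r, f) \<in> N" "\<forall>q\<in>V. f \<in> T q" "\<forall>q\<in>V. s q = fr q r f"
    using fsecE[OF s] .
  then show ?thesis using N frac_in[of r f] by auto
qed

lemma fsec_map:
  assumes s: "s \<in> fsec N U" and U: "openin X U"
    and op: "\<And>r f. (r, f) \<in> N \<Longrightarrow> h r f \<in> N'"
    and opv: "\<And>r f p. (r, f) \<in> N \<Longrightarrow> p \<in> U \<Longrightarrow> f \<in> T p \<Longrightarrow> snd (h r f) \<in> T p \<and> k p (fr p r f) = fr p (fst (h r f)) (snd (h r f))"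
  shows "(\<lambda>p\<in>U. k p (s p)) \<in> fsec N' U"
proof (rule fsecI)
  fix p assume p: "p \<in> U"
  obtain V r f where V: "openin X V" "p \<in> V" "V \<subseteq> U" "(r, f) \<in> N" "\<forall>q\<in>V. f \<in> T q"
    "\<forall>q\<in>V. s q = fr q r f" using fsecE[OF s p] .
  have "\<forall>q\<in>V. snd (h r f) \<in> T q \<and> k q (s q) = fr q (fst (h r f)) (snd (h r f))"
    using opv[OF V(4)] V(3,5,6) by auto
  moreover have "(fst (h r f), snd (h r f)) \<in> N'" using op[OF V(4)] by simp
  ultimately show "\<exists>V r f. openin X V \<and> p \<in> V \<and> V \<subseteq> U \<and> (r, f) \<in> N' \<and> (\<forall>q\<in>V. f \<in> T q \<and> k q (s q) = fr q r f)"
    using V(1-3) by blast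
qed

lemma fsec_map2:
  assumes s: "s \<in> fsec N U" and t: "t \<in> fsec N' U" and U: "openin X U"
    and op: "\<And>r f r' f'. (r, f) \<in> N \<Longrightarrow> (r', f') \<in> N' \<Longrightarrow> (h r f r' f', f \<otimes> f') \<in> N''"
    and opv: "\<And>r f r' f' p. (r, f) \<in> N \<Longrightarrow> (r', f') \<in> N' \<Longrightarrow> p \<in> U \<Longrightarrow> f \<in> T p \<Longrightarrow> f' \<in> T p \<Longrightarrow>
        k p (fr p r f) (fr p r' f') = fr p (h r f r' f') (f \<otimes> f')"
  shows "(\<lambda>p\<in>U. k p (s p) (t p)) \<in> fsec N'' U"
proof (rule fsecI)
  fix p assume p: "p \<in> U"
  obtain V r f where V: "openin X V" "p \<in> V" "V \<subseteq> U" "(r, f) \<in> N" "\<forall>q\<in>V. f \<in> T q"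
    "\<forall>q\<in>V. s q = fr q r f" using fsecE[OF s p] .
  obtain V' r' f' where V': "openin X V'" "p \<in> V'" "V' \<subseteq> U" "(r', f') \<in> N'" "\<forall>q\<in>V'. f' \<in> T q"
    "\<forall>q\<in>V'. t q = fr q r' f'" using fsecE[OF t p] .
  have "f \<otimes> f' \<in> T q" if "q \<in> V \<inter> V'" for q
  proof -
    have "q \<in> U" "f \<in> T q" "f' \<in> T q" using V(3,5) V'(5) that by auto
    then show ?thesis using denominators.T_mult[OF denoms[OF pt_in[OF U]]] by metis
  qed
  then have "\<forall>q\<in>V \<inter> V'. f \<otimes> f' \<in> T q \<and> k q (s q) (t q) = fr q (h r f r' f') (f \<otimes> f')"
    using opv[OF V(4) V'(4)] V(3,5,6) V'(5,6) by auto
  moreover have "openin X (V \<inter> V')" "p \<in> V \<inter> V'" "V \<inter> V' \<subseteq> U" using V V' by auto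
  ultimately show "\<exists>V r f. openin X V \<and> p \<in> V \<and> V \<subseteq> U \<and> (r, f) \<in> N'' \<and> (\<forall>q\<in>V. f \<in> T q \<and> k q (s q) (t q) = fr q r f)"
    using op[OF V(4) V'(4)] by blast
qed

end

lemma pointwise_ring_simps [simp]:
  "carrier (pointwise_ring A U C) = C"
  "monoid.mult (pointwise_ring A U C) = (\<lambda>s t. \<lambda>p\<in>U. s p \<otimes>\<^bsub>A p\<^esub> t p)"
  "one (pointwise_ring A U C) = (\<lambda>p\<in>U. \<one>\<^bsub>A p\<^esub>)"
  "zero (pointwise_ring A U C) = (\<lambda>p\<in>U. \<zero>\<^bsub>A p\<^esub>)"
  "add (pointwise_ring A U C) = (\<lambda>s t. \<lambda>p\<in>U. s p \<oplus>\<^bsub>A p\<^esub> t p)"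
  by (simp_all add: pointwise_ring_def)

text \<open>For the projective line \<open>N0\<close> consists of the fractions of degree 0 and
  \<open>N\<close> of those of degree 1, which gives the structure sheaf and \<O>(1). For
  \<open>Spec\<close> of a field both are the set of all fractions.\<close>

locale fraction_module = fraction_sheaf R X T for R :: "('r, 'm) ring_scheme" (structure) and X :: "'p topology" and T +
  fixes N0 N :: "('r \<times> 'r) set"
  assumes N_sub: "N0 \<subseteq> carrier R \<times> carrier R" "N \<subseteq> carrier R \<times> carrier R"
    and N0_one: "(\<one>, \<one>) \<in> N0" and N0_zero: "(\<zero>, \<one>) \<in> N0" and N_zero: "(\<zero>, \<one>) \<in> N"
    and N0_add: "(r, f) \<in> N0 \<Longrightarrow> (r', f') \<in> N0 \<Longrightarrow> (r \<otimes> f' \<oplus> r' \<otimes> f, f \<otimes> f') \<in> N0"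
    and N_add: "(r, f) \<in> N \<Longrightarrow> (r', f') \<in> N \<Longrightarrow> (r \<otimes> f' \<oplus> r' \<otimes> f, f \<otimes> f') \<in> N"
    and N0_mult: "(r, f) \<in> N0 \<Longrightarrow> (r', f') \<in> N0 \<Longrightarrow> (r \<otimes> r', f \<otimes> f') \<in> N0"
    and N_mult: "(r, f) \<in> N0 \<Longrightarrow> (r', f') \<in> N \<Longrightarrow> (r \<otimes> r', f \<otimes> f') \<in> N"
    and N0_minus: "(r, f) \<in> N0 \<Longrightarrow> (\<ominus> r, f) \<in> N0" and N_minus: "(r, f) \<in> N \<Longrightarrow> (\<ominus> r, f) \<in> N"
begin

definition frs :: "('p, 'p \<Rightarrow> ('r \<times> 'r) set) ringed_space" where
  "frs = \<lparr>rs_top = X, rs_ring = (\<lambda>U. pointwise_ring A U (fsec N0 U)), rs_res = (\<lambda>U V s. restrict s V)\<rparr>"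

definition fms :: "('p, 'p \<Rightarrow> ('r \<times> 'r) set, 'p \<Rightarrow> ('r \<times> 'r) set) mod_sheaf" where
  "fms = \<lparr>ms_mod = (\<lambda>U. with_smult (pointwise_ring A U (fsec N U)) (\<lambda>c s. \<lambda>p\<in>U. c p \<otimes>\<^bsub>A p\<^esub> s p)),
    ms_res = (\<lambda>U V s. restrict s V)\<rparr>"

lemma fsec_zero: "openin X U \<Longrightarrow> (\<zero>, \<one>) \<in> M \<Longrightarrow> (\<lambda>p\<in>U. \<zero>\<^bsub>A p\<^esub>) \<in> fsec M U"
  and fsec_one: "openin X U \<Longrightarrow> (\<one>, \<one>) \<in> M \<Longrightarrow> (\<lambda>p\<in>U. \<one>\<^bsub>A p\<^esub>) \<in> fsec M U"
  by (simp_all add: localization_def) (rule fsec_const; use denominators.T_one[OF denoms] pt_in in blast)+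

lemma fsec_add:
  assumes U: "openin X U" and M: "M \<subseteq> carrier R \<times> carrier R"
    and cl: "\<And>r f r' f'. (r, f) \<in> M \<Longrightarrow> (r', f') \<in> M \<Longrightarrow> (r \<otimes> f' \<oplus> r' \<otimes> f, f \<otimes> f') \<in> M"
    and st: "s \<in> fsec M U" "t \<in> fsec M U"
  shows "(\<lambda>p\<in>U. s p \<oplus>\<^bsub>A p\<^esub> t p) \<in> fsec M U"
proof (rule fsec_map2[OF st U, where k="\<lambda>p. (\<oplus>\<^bsub>A p\<^esub>)" and h="\<lambda>r f r' f'. r \<otimes> f' \<oplus> r' \<otimes> f"])
  fix r f r' f' p assume "(r, f) \<in> M" "(r', f') \<in> M" "p \<in> U" "f \<in> T p" "f' \<in> T p"
  then show "fr p r f \<oplus>\<^bsub>A p\<^esub> fr p r' f' = fr p (r \<otimes> f' \<oplus> r' \<otimes> f) (f \<otimes> f')"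
    using M by (intro denominators.frac_add denoms[OF pt_in[OF U]]) auto
qed (rule cl)

lemma fsec_mult:
  assumes U: "openin X U" and M: "M \<subseteq> carrier R \<times> carrier R" "M' \<subseteq> carrier R \<times> carrier R"
    and cl: "\<And>r f r' f'. (r, f) \<in> M \<Longrightarrow> (r', f') \<in> M' \<Longrightarrow> (r \<otimes> r', f \<otimes> f') \<in> M''"
    and st: "s \<in> fsec M U" "t \<in> fsec M' U"
  shows "(\<lambda>p\<in>U. s p \<otimes>\<^bsub>A p\<^esub> t p) \<in> fsec M'' U"
proof (rule fsec_map2[OF st U, where k="\<lambda>p. (\<otimes>\<^bsub>A p\<^esub>)" and h="\<lambda>r f r' f'. r \<otimes> r'"])
  fix r f r' f' p assume "(r, f) \<in> M" "(r', f') \<in> M'" "p \<in> U" "f \<in> T p" "f' \<in> T p"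
  then show "fr p r f \<otimes>\<^bsub>A p\<^esub> fr p r' f' = fr p (r \<otimes> r') (f \<otimes> f')"
    using M by (intro denominators.frac_mult denoms[OF pt_in[OF U]]) auto
qed (rule cl)

lemma fsec_minus:
  assumes U: "openin X U" and M: "M \<subseteq> carrier R \<times> carrier R"
    and cl: "\<And>r f. (r, f) \<in> M \<Longrightarrow> (\<ominus> r, f) \<in> M" and s: "s \<in> fsec M U"
  shows "(\<lambda>p\<in>U. \<ominus>\<^bsub>A p\<^esub> s p) \<in> fsec M U"
proof (rule fsec_map[OF s U, where k="\<lambda>p. a_inv (A p)" and h="\<lambda>r f. (\<ominus> r, f)"])
  fix r f p assume "(r, f) \<in> M" "p \<in> U" "f \<in> T p"
  moreover from this M have "\<ominus>\<^bsub>A p\<^esub> fr p r f = fr p (\<ominus> r) f"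
    by (intro denominators.frac_minus denoms[OF pt_in[OF U]]) auto
  ultimately show "snd (\<ominus> r, f) \<in> T p \<and> \<ominus>\<^bsub>A p\<^esub> fr p r f = fr p (fst (\<ominus> r, f)) (snd (\<ominus> r, f))" by simp
qed (rule cl)

lemma fsec_closed:
  assumes U: "openin X U"
  shows "s \<in> fsec N0 U \<Longrightarrow> t \<in> fsec N0 U \<Longrightarrow> (\<lambda>p\<in>U. s p \<oplus>\<^bsub>A p\<^esub> t p) \<in> fsec N0 U"
    "s \<in> fsec N U \<Longrightarrow> t \<in> fsec N U \<Longrightarrow> (\<lambda>p\<in>U. s p \<oplus>\<^bsub>A p\<^esub> t p) \<in> fsec N U"
    "s \<in> fsec N0 U \<Longrightarrow> t \<in> fsec N0 U \<Longrightarrow> (\<lambda>p\<in>U. s p \<otimes>\<^bsub>A p\<^esub> t p) \<in> fsec N0 U"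
    "s \<in> fsec N0 U \<Longrightarrow> t \<in> fsec N U \<Longrightarrow> (\<lambda>p\<in>U. s p \<otimes>\<^bsub>A p\<^esub> t p) \<in> fsec N U"
    "s \<in> fsec N0 U \<Longrightarrow> (\<lambda>p\<in>U. \<ominus>\<^bsub>A p\<^esub> s p) \<in> fsec N0 U"
    "s \<in> fsec N U \<Longrightarrow> (\<lambda>p\<in>U. \<ominus>\<^bsub>A p\<^esub> s p) \<in> fsec N U"
proof -
  show "s \<in> fsec N0 U \<Longrightarrow> t \<in> fsec N0 U \<Longrightarrow> (\<lambda>p\<in>U. s p \<oplus>\<^bsub>A p\<^esub> t p) \<in> fsec N0 U"
    by (rule fsec_add[OF U N_sub(1)]) (assumption | rule N0_add)+
  show "s \<in> fsec N U \<Longrightarrow> t \<in> fsec N U \<Longrightarrow> (\<lambda>p\<in>U. s p \<oplus>\<^bsub>A p\<^esub> t p) \<in> fsec N U"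
    by (rule fsec_add[OF U N_sub(2)]) (assumption | rule N_add)+
  show "s \<in> fsec N0 U \<Longrightarrow> t \<in> fsec N0 U \<Longrightarrow> (\<lambda>p\<in>U. s p \<otimes>\<^bsub>A p\<^esub> t p) \<in> fsec N0 U"
    by (rule fsec_mult[OF U N_sub(1,1)]) (assumption | rule N0_mult)+
  show "s \<in> fsec N0 U \<Longrightarrow> t \<in> fsec N U \<Longrightarrow> (\<lambda>p\<in>U. s p \<otimes>\<^bsub>A p\<^esub> t p) \<in> fsec N U"
    by (rule fsec_mult[OF U N_sub]) (assumption | rule N_mult)+
  show "s \<in> fsec N0 U \<Longrightarrow> (\<lambda>p\<in>U. \<ominus>\<^bsub>A p\<^esub> s p) \<in> fsec N0 U"
    by (rule fsec_minus[OF U N_sub(1)]) (assumption | rule N0_minus)+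
  show "s \<in> fsec N U \<Longrightarrow> (\<lambda>p\<in>U. \<ominus>\<^bsub>A p\<^esub> s p) \<in> fsec N U"
    by (rule fsec_minus[OF U N_sub(2)]) (assumption | rule N_minus)+
qed

lemma cring_A: "openin X U \<Longrightarrow> p \<in> U \<Longrightarrow> cring (A p)"
  using denominators.cring_loc[OF denoms[OF pt_in]] .

lemma cring_frs: "openin X U \<Longrightarrow> cring (pointwise_ring A U (fsec N0 U))"
proof -
  assume U: "openin X U"
  note i = fsec_in[OF N_sub(1) U]
  note r = cring.cring_simprules[OF cring_A[OF U]]
  show ?thesis
  proof (intro cringI abelian_groupI comm_monoidI; unfold pointwise_ring_simps)
    fix s t u assume s: "s \<in> fsec N0 U" "t \<in> fsec N0 U" "u \<in> fsec N0 U"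
    show "(\<lambda>p\<in>U. (\<lambda>p\<in>U. s p \<oplus>\<^bsub>A p\<^esub> t p) p \<oplus>\<^bsub>A p\<^esub> u p) = (\<lambda>p\<in>U. s p \<oplus>\<^bsub>A p\<^esub> (\<lambda>p\<in>U. t p \<oplus>\<^bsub>A p\<^esub> u p) p)"
      using s i r(7) by (intro restrict_ext) auto
    show "(\<lambda>p\<in>U. (\<lambda>p\<in>U. s p \<otimes>\<^bsub>A p\<^esub> t p) p \<otimes>\<^bsub>A p\<^esub> u p) = (\<lambda>p\<in>U. s p \<otimes>\<^bsub>A p\<^esub> (\<lambda>p\<in>U. t p \<otimes>\<^bsub>A p\<^esub> u p) p)"
      using s i r(11) by (intro restrict_ext) auto
    show "(\<lambda>p\<in>U. (\<lambda>p\<in>U. s p \<oplus>\<^bsub>A p\<^esub> t p) p \<otimes>\<^bsub>A p\<^esub> u p) =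
       (\<lambda>p\<in>U. (\<lambda>p\<in>U. s p \<otimes>\<^bsub>A p\<^esub> u p) p \<oplus>\<^bsub>A p\<^esub> (\<lambda>p\<in>U. t p \<otimes>\<^bsub>A p\<^esub> u p) p)"
      using s i r(13) by (intro restrict_ext) auto
  next
    fix s t assume s: "s \<in> fsec N0 U" "t \<in> fsec N0 U"
    show "(\<lambda>p\<in>U. s p \<oplus>\<^bsub>A p\<^esub> t p) \<in> fsec N0 U" by (rule fsec_closed(1)[OF U s])
    show "(\<lambda>p\<in>U. s p \<otimes>\<^bsub>A p\<^esub> t p) \<in> fsec N0 U" by (rule fsec_closed(3)[OF U s])
    show "(\<lambda>p\<in>U. s p \<oplus>\<^bsub>A p\<^esub> t p) = (\<lambda>p\<in>U. t p \<oplus>\<^bsub>A p\<^esub> s p)"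
      using s i r(10) by (intro restrict_ext) auto
    show "(\<lambda>p\<in>U. s p \<otimes>\<^bsub>A p\<^esub> t p) = (\<lambda>p\<in>U. t p \<otimes>\<^bsub>A p\<^esub> s p)"
      using s i r(14) by (intro restrict_ext) auto
  next
    fix s assume s: "s \<in> fsec N0 U"
    show "(\<lambda>p\<in>U. (\<lambda>p\<in>U. \<zero>\<^bsub>A p\<^esub>) p \<oplus>\<^bsub>A p\<^esub> s p) = s"
      using i[OF s] r(8) fsec_outside[OF s] by (auto simp: fun_eq_iff restrict_def)
    show "(\<lambda>p\<in>U. (\<lambda>p\<in>U. \<one>\<^bsub>A p\<^esub>) p \<otimes>\<^bsub>A p\<^esub> s p) = s"
      using i[OF s] r(12) fsec_outside[OF s] by (auto simp: fun_eq_iff restrict_def)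
    show "\<exists>t\<in>fsec N0 U. (\<lambda>p\<in>U. t p \<oplus>\<^bsub>A p\<^esub> s p) = (\<lambda>p\<in>U. \<zero>\<^bsub>A p\<^esub>)"
      using i[OF s] r(9) by (intro bexI[OF _ fsec_closed(5)[OF U s]] restrict_ext) auto
  qed (rule fsec_zero[OF U N0_zero] fsec_one[OF U N0_one])+
qed

lemma ringed_frs: "ringed frs"
proof unfold_locales
  show "ringed_space frs"
    unfolding ringed_space_def is_sheaf_iff
  proof (intro conjI allI impI; (elim conjE)?)
    show "sheaf (rs_top frs) (\<lambda>U. carrier (rs_ring frs U)) (rs_res frs)"
      using fsec_sheaf by (simp add: frs_def)
    show "cring (rs_ring frs U)" if "openin (rs_top frs) U" for U using cring_frs that by (simp add: frs_def)
    fix U V assume U: "openin (rs_top frs) U" "openin (rs_top frs) V" "V \<subseteq> U"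
    show "rs_res frs U V \<in> ring_hom (rs_ring frs U) (rs_ring frs V)"
      using U presheaf.res_in[OF sheaf.axioms(1)[OF fsec_sheaf], of U V]
      by (intro ring_hom_memI) (auto simp: frs_def restrict_def fun_eq_iff)
  qed
qed

lemma fms_simps:
  "carrier (ms_mod fms U) = fsec N U" "add (ms_mod fms U) = (\<lambda>s t. \<lambda>p\<in>U. s p \<oplus>\<^bsub>A p\<^esub> t p)"
  "zero (ms_mod fms U) = (\<lambda>p\<in>U. \<zero>\<^bsub>A p\<^esub>)" "module.smult (ms_mod fms U) = (\<lambda>c s. \<lambda>p\<in>U. c p \<otimes>\<^bsub>A p\<^esub> s p)"
  "ms_res fms = (\<lambda>U V s. restrict s V)"
  by (simp_all add: fms_def)

lemma frs_simps:
  "rs_top frs = X" "carrier (rs_ring frs U) = fsec N0 U" "add (rs_ring frs U) = (\<lambda>s t. \<lambda>p\<in>U. s p \<oplus>\<^bsub>A p\<^esub> t p)"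
  "zero (rs_ring frs U) = (\<lambda>p\<in>U. \<zero>\<^bsub>A p\<^esub>)" "monoid.mult (rs_ring frs U) = (\<lambda>s t. \<lambda>p\<in>U. s p \<otimes>\<^bsub>A p\<^esub> t p)"
  "one (rs_ring frs U) = (\<lambda>p\<in>U. \<one>\<^bsub>A p\<^esub>)" "rs_res frs = (\<lambda>U V s. restrict s V)"
  by (simp_all add: frs_def)

lemma module_fms: "openin X U \<Longrightarrow> Module.module (rs_ring frs U) (ms_mod fms U)"
proof -
  assume U: "openin X U"
  note i = fsec_in[OF N_sub(2) U] and i0 = fsec_in[OF N_sub(1) U]
  note r = cring.cring_simprules[OF cring_A[OF U]]
  have R: "cring (rs_ring frs U)" using cring_frs[OF U] by (simp add: frs_def)
  show ?thesis
  proof (intro moduleI abelian_groupI R; unfold fms_simps frs_simps)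
    fix s t u assume s: "s \<in> fsec N U" "t \<in> fsec N U" "u \<in> fsec N U"
    show "(\<lambda>p\<in>U. (\<lambda>p\<in>U. s p \<oplus>\<^bsub>A p\<^esub> t p) p \<oplus>\<^bsub>A p\<^esub> u p) = (\<lambda>p\<in>U. s p \<oplus>\<^bsub>A p\<^esub> (\<lambda>p\<in>U. t p \<oplus>\<^bsub>A p\<^esub> u p) p)"
      using s i r(7) by (intro restrict_ext) auto
  next
    fix s t assume s: "s \<in> fsec N U" "t \<in> fsec N U"
    show "(\<lambda>p\<in>U. s p \<oplus>\<^bsub>A p\<^esub> t p) \<in> fsec N U" by (rule fsec_closed(2)[OF U s])
    show "(\<lambda>p\<in>U. s p \<oplus>\<^bsub>A p\<^esub> t p) = (\<lambda>p\<in>U. t p \<oplus>\<^bsub>A p\<^esub> s p)"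
      using s i r(10) by (intro restrict_ext) auto
    fix c assume c: "c \<in> fsec N0 U"
    show "(\<lambda>p\<in>U. c p \<otimes>\<^bsub>A p\<^esub> (\<lambda>p\<in>U. s p \<oplus>\<^bsub>A p\<^esub> t p) p) =
       (\<lambda>p\<in>U. (\<lambda>p\<in>U. c p \<otimes>\<^bsub>A p\<^esub> s p) p \<oplus>\<^bsub>A p\<^esub> (\<lambda>p\<in>U. c p \<otimes>\<^bsub>A p\<^esub> t p) p)"
      using s c i i0 r(25) by (intro restrict_ext) auto
  next
    fix s assume s: "s \<in> fsec N U"
    show "(\<lambda>p\<in>U. (\<lambda>p\<in>U. \<zero>\<^bsub>A p\<^esub>) p \<oplus>\<^bsub>A p\<^esub> s p) = s"
      using i[OF s] r(8) fsec_outside[OF s] by (auto simp: fun_eq_iff restrict_def)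
    show "(\<lambda>p\<in>U. (\<lambda>p\<in>U. \<one>\<^bsub>A p\<^esub>) p \<otimes>\<^bsub>A p\<^esub> s p) = s"
      using i[OF s] r(12) fsec_outside[OF s] by (auto simp: fun_eq_iff restrict_def)
    show "\<exists>t\<in>fsec N U. (\<lambda>p\<in>U. t p \<oplus>\<^bsub>A p\<^esub> s p) = (\<lambda>p\<in>U. \<zero>\<^bsub>A p\<^esub>)"
      using i[OF s] r(9) by (intro bexI[OF _ fsec_closed(6)[OF U s]] restrict_ext) auto
    fix c d assume c: "c \<in> fsec N0 U" "d \<in> fsec N0 U"
    show "(\<lambda>p\<in>U. c p \<otimes>\<^bsub>A p\<^esub> s p) \<in> fsec N U" using fsec_closed(4)[OF U c(1) s] .
    show "(\<lambda>p\<in>U. (\<lambda>p\<in>U. c p \<oplus>\<^bsub>A p\<^esub> d p) p \<otimes>\<^bsub>A p\<^esub> s p) =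
       (\<lambda>p\<in>U. (\<lambda>p\<in>U. c p \<otimes>\<^bsub>A p\<^esub> s p) p \<oplus>\<^bsub>A p\<^esub> (\<lambda>p\<in>U. d p \<otimes>\<^bsub>A p\<^esub> s p) p)"
      using s c i i0 r(13) by (intro restrict_ext) auto
    show "(\<lambda>p\<in>U. (\<lambda>p\<in>U. c p \<otimes>\<^bsub>A p\<^esub> d p) p \<otimes>\<^bsub>A p\<^esub> s p) =
       (\<lambda>p\<in>U. c p \<otimes>\<^bsub>A p\<^esub> (\<lambda>p\<in>U. d p \<otimes>\<^bsub>A p\<^esub> s p) p)"
      using s c i i0 r(11) by (intro restrict_ext) auto
  qed (rule fsec_zero[OF U N_zero])+
qed

lemma mod_sheaf_fms: "mod_sheaf frs fms"
proof (intro mod_sheaf.intro mod_sheaf_axioms.intro ringed_frs)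
  show "is_mod_sheaf frs fms"
    unfolding is_mod_sheaf_def is_sheaf_iff
  proof (intro conjI allI impI ballI; (elim conjE)?)
    show "sheaf (rs_top frs) (\<lambda>U. carrier (ms_mod fms U)) (ms_res fms)"
      using fsec_sheaf by (simp add: frs_simps fms_simps)
    show "Module.module (rs_ring frs U) (ms_mod fms U)" if "openin (rs_top frs) U" for U
      using module_fms that by (simp add: frs_simps)
  qed (auto simp: frs_simps fms_simps restrict_def fun_eq_iff)
qed

end


section \<open>The projective line\<close>

lemma Z_simps [simp]:
  "carrier Z_x0_x1 = UNIV" "monoid.mult Z_x0_x1 = (*)" "one Z_x0_x1 = 1" "zero Z_x0_x1 = 0" "add Z_x0_x1 = (+)"
  by (simp_all add: Z_x0_x1_def)

lemma domain_Z: "domain Z_x0_x1"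
proof -
  have "cring Z_x0_x1"
    by (intro cringI abelian_groupI comm_monoidI) (auto simp: algebra_simps intro: exI[of _ "- _"])
  then show ?thesis by (simp add: domain_def domain_axioms_def)
qed

lemma Z_minus [simp]: "\<ominus>\<^bsub>Z_x0_x1\<^esub> x = - x"
proof -
  interpret domain Z_x0_x1 by (rule domain_Z)
  show ?thesis using minus_equality[of "- x" x] by simp
qed

section \<open>Homogeneous polynomials in two variables\<close>

lemma bihom_zero: "0 \<in> bihom d" and bihom_one: "1 \<in> bihom 0"
  by (auto simp: bihom_def one_pCons coeff_pCons split: nat.splits)

lemma bihom_add: "p \<in> bihom d \<Longrightarrow> q \<in> bihom d \<Longrightarrow> p + q \<in> bihom d"
  unfolding bihom_def by (auto, metis add_0)

lemma bihom_minus: "p \<in> bihom d \<Longrightarrow> - p \<in> bihom d"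
  unfolding bihom_def by auto

lemma bihom_mult:
  assumes "p \<in> bihom d" "q \<in> bihom e"
  shows "p * q \<in> bihom (d + e)"
  unfolding bihom_def
proof (intro CollectI allI impI)
  fix i j assume "coeff (coeff (p * q) i) j \<noteq> 0"
  then have "(\<Sum>k\<le>i. \<Sum>l\<le>j. coeff (coeff p k) l * coeff (coeff q (i - k)) (j - l)) \<noteq> 0"
    by (simp add: coeff_mult coeff_sum)
  then obtain k l where "k \<le> i" "l \<le> j" "coeff (coeff p k) l * coeff (coeff q (i - k)) (j - l) \<noteq> 0"
    by (meson atMost_iff sum.not_neutral_contains_not_neutral)
  then have "k + l = d" "i - k + (j - l) = e" using assms unfolding bihom_def by auto
  then show "i + j = d + e" using \<open>k \<le> i\<close> \<open>l \<le> j\<close> by linarith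
qed

text \<open>Indexing the two variables by truth values makes \<open>\<not> k\<close> the other
  index; \<open>False\<close> stands for \<open>x0\<close>.\<close>

definition xvar :: "bool \<Rightarrow> int poly poly" where "xvar k = (if k then [:0, 1:] else [:[:0, 1:]:])"

lemma xvar_bihom: "xvar k \<in> bihom 1"
  by (auto simp: xvar_def bihom_def coeff_pCons split: nat.splits)

lemma bihom_power: "p \<in> bihom d \<Longrightarrow> p ^ n \<in> bihom (n * d)"
  by (induction n) (auto simp: bihom_one bihom_mult)

lemma xvar_power: "xvar k ^ n \<in> bihom n"
  using bihom_power[OF xvar_bihom, of k n] by simp

text \<open>Forms with integer coefficients arise from 1 by negation, addition within a degree and
  multiplication by a variable. The rule extends facts about the two variables to forms of all
  degrees, as in \<open>P1_chart_cover\<close> and \<open>agree_dehom\<close>.\<close>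

lemma bihom_induct:
  assumes h: "h \<in> bihom d"
    and zero: "\<And>d. P d 0" and one: "P 0 1"
    and minus: "\<And>d h. h \<in> bihom d \<Longrightarrow> P d h \<Longrightarrow> P d (- h)"
    and add: "\<And>d h h'. h \<in> bihom d \<Longrightarrow> h' \<in> bihom d \<Longrightarrow> P d h \<Longrightarrow> P d h' \<Longrightarrow> P d (h + h')"
    and mult: "\<And>d h k. h \<in> bihom d \<Longrightarrow> P d h \<Longrightarrow> P (Suc d) (xvar k * h)"
  shows "P d h"
proof -
  \<comment> \<open>Membership in \<open>bihom d\<close> is carried along, because the closure
    assumptions on \<open>P\<close> ask for it.\<close>
  define Q where "Q d h \<longleftrightarrow> h \<in> bihom d \<and> P d h" for d h
  have Q0: "Q d 0" and Q1: "Q 0 1" for d using zero one bihom_zero bihom_one by (auto simp: Q_def)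
  have Qm: "Q d h \<Longrightarrow> Q d (- h)" for d h using minus bihom_minus by (auto simp: Q_def)
  have Qa: "Q d h \<Longrightarrow> Q d h' \<Longrightarrow> Q d (h + h')" for d h h' using add bihom_add by (auto simp: Q_def)
  have Qx: "Q d h \<Longrightarrow> Q (Suc d) (xvar k * h)" for d h k
    using mult bihom_mult[OF xvar_bihom] by (auto simp: Q_def)
  \<comment> \<open>Integer constants are sums of ones and their negatives; powers of the inner and
    then of the outer variable turn them into monomials.\<close>
  have "Q 0 (of_nat n)" for n by (induction n) (auto simp: Q0 Q1 Qa)
  then have "Q 0 (of_int c)" for c
    by (cases c rule: int_cases2) (auto simp: Qm)
  then have "Q j [:monom c j:]" for c j
  proof (induction j)
    case 0
    have "(of_int c :: int poly poly) = [:[:c:]:]"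
      by (simp add: of_int_poly)
    then show ?case using 0[of c] by (simp add: monom_0)
  next
    case (Suc j)
    have "[:monom c (Suc j):] = xvar False * [:monom c j:]" by (simp add: xvar_def monom_Suc)
    then show ?case using Qx[OF Suc.IH[OF Suc.prems]] by simp
  qed
  then have mon: "Q (i + j) (monom (monom c j) i)" for c i j
  proof (induction i)
    case 0
    then show ?case by (simp add: monom_0)
  next
    case (Suc i)
    have "monom (monom c j) (Suc i) = xvar True * monom (monom c j) i" by (simp add: xvar_def monom_Suc)
    then show ?case using Qx[OF Suc.IH[OF Suc.prems]] by simp
  qed
  have Qsum: "Q d (\<Sum>i\<in>I. f i)" if "finite I" "\<And>i. i \<in> I \<Longrightarrow> Q d (f i)" for I :: "nat set" and f
    using that by (induction I) (auto simp: Q0 Qa)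
  have monsum: "monom (\<Sum>j\<in>J. f j) i = (\<Sum>j\<in>J. monom (f j) i)" for J :: "nat set" and f :: "nat \<Rightarrow> int poly" and i
    by (induction J rule: infinite_finite_induct) (auto simp: add_monom[symmetric])
  have "Q d (monom (monom (coeff (coeff h i) j) j) i)" for i j
  proof (cases "coeff (coeff h i) j = 0")
    case True then show ?thesis using Q0 by simp
  next
    case False
    then have "i + j = d" using h unfolding bihom_def by blast
    then show ?thesis using mon by blast
  qed
  then have "Q d (\<Sum>i\<le>degree h. \<Sum>j\<le>degree (coeff h i). monom (monom (coeff (coeff h i) j) j) i)"
    by (intro Qsum) auto
  also have "(\<Sum>i\<le>degree h. \<Sum>j\<le>degree (coeff h i). monom (monom (coeff (coeff h i) j) j) i) = h"
    by (simp flip: monsum add: poly_as_sum_of_monoms)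
  finally show ?thesis by (simp add: Q_def)
qed

section \<open>Points, charts and sections of the projective line\<close>

abbreviation P1T where "P1T \<equiv> Proj_denoms bihom"
abbreviation P1_pts where "P1_pts \<equiv> Proj_pts Z_x0_x1 bihom"

lemma P1_pt_primeideal: "p \<in> P1_pts \<Longrightarrow> primeideal p Z_x0_x1"
  by (simp add: Proj_pts_def)

lemma P1_pt_mult: "p \<in> P1_pts \<Longrightarrow> f * g \<in> p \<longleftrightarrow> f \<in> p \<or> g \<in> p"
proof -
  assume p: "p \<in> P1_pts"
  interpret primeideal p Z_x0_x1 by (rule P1_pt_primeideal[OF p])
  show ?thesis using I_prime[of f g] I_l_closed[of g f] I_r_closed[of f g] by auto
qed

lemma P1_pt_power: "p \<in> P1_pts \<Longrightarrow> f ^ n \<in> p \<Longrightarrow> f \<in> p"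
proof (induction n)
  case 0
  interpret primeideal p Z_x0_x1 using P1_pt_primeideal 0 by blast
  show ?case using 0 one_imp_carrier I_notcarr by simp
qed (auto simp: P1_pt_mult)

lemma P1_denominators: "p \<in> P1_pts \<Longrightarrow> denominators Z_x0_x1 (P1T p)"
proof -
  assume p: "p \<in> P1_pts"
  interpret primeideal p Z_x0_x1 by (rule P1_pt_primeideal[OF p])
  interpret Z: domain Z_x0_x1 by (rule domain_Z)
  show ?thesis
  proof unfold_locales
    show "P1T p \<subseteq> carrier Z_x0_x1 - {\<zero>\<^bsub>Z_x0_x1\<^esub>}" using additive_subgroup.zero_closed[OF is_additive_subgroup]
      by (auto simp: Proj_denoms_def)
    show "\<one>\<^bsub>Z_x0_x1\<^esub> \<in> P1T p" using P1_pt_power[OF p, of 0 0] bihom_one one_imp_carrier I_notcarr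
      by (auto simp: Proj_denoms_def)
    show "f \<otimes>\<^bsub>Z_x0_x1\<^esub> g \<in> P1T p" if "f \<in> P1T p" "g \<in> P1T p" for f g
      using that by (simp add: Proj_denoms_def P1_pt_mult[OF p]) (blast intro: bihom_mult)
  qed
qed

lemma P1_open_basic: "f \<in> bihom d \<Longrightarrow> 1 \<le> d \<Longrightarrow> openin (Proj_top Z_x0_x1 bihom) {p \<in> P1_pts. f \<notin> p}"
  unfolding Proj_top_def by (rule topology_generated_by_Basis) auto

lemma P1_topspace: "topspace (Proj_top Z_x0_x1 bihom) = P1_pts"
proof -
  have "topspace (Proj_top Z_x0_x1 bihom) = \<Union>{{p \<in> P1_pts. f \<notin> p} |f. f \<in> (\<Union>d\<in>{1..}. bihom d)}"
    unfolding Proj_top_def by (rule topology_generated_by_topspace)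
  also have "\<dots> = P1_pts"
  proof
    show "P1_pts \<subseteq> \<Union>{{p \<in> P1_pts. f \<notin> p} |f. f \<in> (\<Union>d\<in>{1..}. bihom d)}"
    proof
      fix p assume p: "p \<in> P1_pts"
      then obtain f where "f \<in> (\<Union>d\<in>{1..}. bihom d)" "f \<notin> p" by (auto simp: Proj_pts_def)
      with p show "p \<in> \<Union>{{p \<in> P1_pts. f \<notin> p} |f. f \<in> (\<Union>d\<in>{1..}. bihom d)}" by blast
    qed
  qed auto
  finally show ?thesis .
qed

interpretation P: fraction_module Z_x0_x1 "Proj_top Z_x0_x1 bihom" P1T
    "\<Union>d. bihom (d + 0) \<times> bihom d" "\<Union>d. bihom (d + 1) \<times> bihom d"
proof (intro fraction_module.intro fraction_sheaf.intro fraction_sheaf_axioms.intro fraction_module_axioms.intro domain_Z)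
  show "denominators Z_x0_x1 (P1T p)" if "p \<in> topspace (Proj_top Z_x0_x1 bihom)" for p
    using that P1_denominators P1_topspace by simp
  have sum: "r * f' + r' * f \<in> bihom (d + d' + n) \<and> f * f' \<in> bihom (d + d')"
    if "r \<in> bihom (d + n)" "f \<in> bihom d" "r' \<in> bihom (d' + n)" "f' \<in> bihom d'" for r f r' f' d d' n
    using bihom_add bihom_mult[OF that(1,4)] bihom_mult[OF that(3,2)] bihom_mult[OF that(2,4)]
    by (simp add: ac_simps)
  have prod: "r * r' \<in> bihom (d + d' + n) \<and> f * f' \<in> bihom (d + d')"
    if "r \<in> bihom (d + 0)" "f \<in> bihom d" "r' \<in> bihom (d' + n)" "f' \<in> bihom d'" for r f r' f' d d' n
    using bihom_mult[OF that(1,3)] bihom_mult[OF that(2,4)] by (simp add: ac_simps)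
  fix r f r' f'
  show "(r, f) \<in> (\<Union>d. bihom (d + 0) \<times> bihom d) \<Longrightarrow> (r', f') \<in> (\<Union>d. bihom (d + 0) \<times> bihom d) \<Longrightarrow>
    (r \<otimes>\<^bsub>Z_x0_x1\<^esub> f' \<oplus>\<^bsub>Z_x0_x1\<^esub> r' \<otimes>\<^bsub>Z_x0_x1\<^esub> f, f \<otimes>\<^bsub>Z_x0_x1\<^esub> f') \<in> (\<Union>d. bihom (d + 0) \<times> bihom d)"
    using sum[where n=0] by fastforce
  show "(r, f) \<in> (\<Union>d. bihom (d + 1) \<times> bihom d) \<Longrightarrow> (r', f') \<in> (\<Union>d. bihom (d + 1) \<times> bihom d) \<Longrightarrow>
    (r \<otimes>\<^bsub>Z_x0_x1\<^esub> f' \<oplus>\<^bsub>Z_x0_x1\<^esub> r' \<otimes>\<^bsub>Z_x0_x1\<^esub> f, f \<otimes>\<^bsub>Z_x0_x1\<^esub> f') \<in> (\<Union>d. bihom (d + 1) \<times> bihom d)"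
    using sum[where n=1] by fastforce
  show "(r, f) \<in> (\<Union>d. bihom (d + 0) \<times> bihom d) \<Longrightarrow> (r', f') \<in> (\<Union>d. bihom (d + 0) \<times> bihom d) \<Longrightarrow>
    (r \<otimes>\<^bsub>Z_x0_x1\<^esub> r', f \<otimes>\<^bsub>Z_x0_x1\<^esub> f') \<in> (\<Union>d. bihom (d + 0) \<times> bihom d)"
    using prod[where n=0] by fastforce
  show "(r, f) \<in> (\<Union>d. bihom (d + 0) \<times> bihom d) \<Longrightarrow> (r', f') \<in> (\<Union>d. bihom (d + 1) \<times> bihom d) \<Longrightarrow>
    (r \<otimes>\<^bsub>Z_x0_x1\<^esub> r', f \<otimes>\<^bsub>Z_x0_x1\<^esub> f') \<in> (\<Union>d. bihom (d + 1) \<times> bihom d)"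
    using prod[where n=1] by fastforce
qed (use bihom_zero bihom_one bihom_minus in auto)

lemma P1_eq: "P1 = P.frs" and P1_O1_eq: "P1_O1 = P.fms"
  unfolding P1_def Proj_def P.frs_def Proj_twist_def[abs_def] P1_O1_def Proj_sheaf_def P.fms_def
  by (rule HOL.refl)+

lemma ringed_P1: "ringed P1" and mod_sheaf_O1: "mod_sheaf P1 P1_O1"
  using P.ringed_frs P.mod_sheaf_fms by (simp_all only: P1_eq P1_O1_eq)

interpretation P1: mod_sheaf P1 P1_O1 by (rule mod_sheaf_O1)

lemmas P1_simps = P.frs_simps[folded P1_eq] P.fms_simps[folded P1_O1_eq]

lemma P1_points: "rs_pts P1 = P1_pts"
  by (simp add: P1_simps P1_topspace)

definition P1_chart :: "bool \<Rightarrow> P1_pt set" where "P1_chart k = {p \<in> P1_pts. xvar k \<notin> p}"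

definition P1_var :: "bool \<Rightarrow> P1_sec" where "P1_var k = (if k then P1_x1 else P1_x0)"

text \<open>Dehomogenization: for \<open>h\<close> of degree \<open>d\<close> this is a regular
  function on the chart. With \<open>d = 1\<close> and \<open>h = xvar j\<close> it is the affine
  coordinate \<open>x_j / x_k\<close>.\<close>

definition dehom :: "bool \<Rightarrow> nat \<Rightarrow> int poly poly \<Rightarrow> P1_sec" where
  "dehom k d h = (\<lambda>p\<in>P1_chart k. loc_frac Z_x0_x1 (P1T p) h (xvar k ^ d))"

lemma P1_chart_open: "P1.opn (P1_chart k)"
  unfolding P1_chart_def P1_simps using P1_open_basic[OF xvar_bihom] by simp

lemma P1_chart_denom: "p \<in> P1_chart k \<Longrightarrow> xvar k ^ d \<in> P1T p"
  using xvar_power P1_pt_power by (auto simp: P1_chart_def Proj_denoms_def)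

lemma P1_chart_denominators: "p \<in> P1_chart k \<Longrightarrow> denominators Z_x0_x1 (P1T p)"
  by (rule P1_denominators) (simp add: P1_chart_def)

text \<open>A prime containing both variables would contain every form of positive degree, which the
  definition of \<open>Proj_pts\<close> excludes.\<close>

lemma P1_chart_cover: "p \<in> P1_pts \<Longrightarrow> \<exists>k. p \<in> P1_chart k"
proof (rule ccontr)
  assume p: "p \<in> P1_pts" and "\<nexists>k. p \<in> P1_chart k"
  then have x: "xvar k \<in> p" for k by (auto simp: P1_chart_def)
  interpret primeideal p Z_x0_x1 by (rule P1_pt_primeideal[OF p])
  have minus: "- h \<in> p" if "h \<in> p" for h using P1_pt_mult[OF p, of "-1" h] that by simp
  have add: "h + h' \<in> p" if "h \<in> p" "h' \<in> p" for h h'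
    using additive_subgroup.a_closed[OF is_additive_subgroup that] by simp
  \<comment> \<open>The premise \<open>1 \<le> d\<close> makes the case of the constant 1 vacuous; a
    product with a variable lies in \<open>p\<close> because the variable does.\<close>
  have "1 \<le> d \<longrightarrow> h \<in> p" if "h \<in> bihom d" for d h
    by (rule bihom_induct[where P="\<lambda>d h. 1 \<le> d \<longrightarrow> h \<in> p", OF that])
      (use minus add x P1_pt_mult[OF p] additive_subgroup.zero_closed[OF is_additive_subgroup] in auto)
  then have "(\<Union>d\<in>{1..}. bihom d) \<subseteq> p" by auto
  moreover have "\<not> (\<Union>d\<in>{1..}. bihom d) \<subseteq> p" using p by (simp add: Proj_pts_def)
  ultimately show False by blast
qed

lemma P1_pt_eqI:
  assumes "p \<in> P1_pts" "q \<in> P1_pts" "\<And>d h. h \<in> bihom d \<Longrightarrow> h \<in> p \<longleftrightarrow> h \<in> q"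
  shows "p = q"
proof -
  have "p \<inter> (\<Union>d. bihom d) = q \<inter> (\<Union>d. bihom d)" using assms(3) by blast
  moreover have "p = genideal Z_x0_x1 (p \<inter> (\<Union>d. bihom d))" "q = genideal Z_x0_x1 (q \<inter> (\<Union>d. bihom d))"
    using assms(1,2) by (simp_all add: Proj_pts_def)
  ultimately show ?thesis by simp
qed

lemma dehom_in: "h \<in> bihom d \<Longrightarrow> dehom k d h \<in> carrier (P1.\<O> (P1_chart k))"
  unfolding dehom_def P1_simps
  by (rule P.fsec_const) (use P1_chart_open P1_chart_denom xvar_power in \<open>auto simp: P1_simps\<close>)

lemma dehom_zero: "dehom k d 0 = \<zero>\<^bsub>P1.\<O> (P1_chart k)\<^esub>"
  unfolding dehom_def P1_simps
proof (rule restrict_ext)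
  fix p assume p: "p \<in> P1_chart k"
  interpret denominators Z_x0_x1 "P1T p" by (rule P1_chart_denominators[OF p])
  show "frac 0 (xvar k ^ d) = \<zero>\<^bsub>Loc\<^esub>"
    using frac_eq_iff[OF _ P1_chart_denom[OF p], of 0 0 1] T_one by (simp add: loc_zero)
qed

lemma dehom_one: "dehom k 0 1 = \<one>\<^bsub>P1.\<O> (P1_chart k)\<^esub>"
  unfolding dehom_def P1_simps by (simp add: localization_def)

lemma dehom_add: "dehom k d (g + h) = dehom k d g \<oplus>\<^bsub>P1.\<O> (P1_chart k)\<^esub> dehom k d h"
  unfolding dehom_def P1_simps
proof (rule restrict_ext)
  fix p assume p: "p \<in> P1_chart k"
  interpret denominators Z_x0_x1 "P1T p" by (rule P1_chart_denominators[OF p])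
  note t = P1_chart_denom[OF p, of d]
  have "frac (g + h) (xvar k ^ d) = frac g (xvar k ^ d) \<oplus>\<^bsub>Loc\<^esub> frac h (xvar k ^ d)"
    using frac_add[OF _ t _ t, of g h] frac_eq_iff[OF _ t _ T_mult[OF t t]] by (simp add: algebra_simps)
  then show "frac (g + h) (xvar k ^ d) = restrict (\<lambda>p. loc_frac Z_x0_x1 (P1T p) g (xvar k ^ d)) (P1_chart k) p
     \<oplus>\<^bsub>Loc\<^esub> restrict (\<lambda>p. loc_frac Z_x0_x1 (P1T p) h (xvar k ^ d)) (P1_chart k) p"
    using p by simp
qed

lemma dehom_mult: "dehom k (d + e) (g * h) = dehom k d g \<otimes>\<^bsub>P1.\<O> (P1_chart k)\<^esub> dehom k e h"
  unfolding dehom_def P1_simps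
proof (rule restrict_ext)
  fix p assume p: "p \<in> P1_chart k"
  interpret denominators Z_x0_x1 "P1T p" by (rule P1_chart_denominators[OF p])
  show "frac (g * h) (xvar k ^ (d + e)) = restrict (\<lambda>p. loc_frac Z_x0_x1 (P1T p) g (xvar k ^ d)) (P1_chart k) p
     \<otimes>\<^bsub>Loc\<^esub> restrict (\<lambda>p. loc_frac Z_x0_x1 (P1T p) h (xvar k ^ e)) (P1_chart k) p"
    using p frac_mult[OF _ P1_chart_denom[OF p] _ P1_chart_denom[OF p], of g h d e] by (simp add: power_add)
qed

lemma dehom_minus:
  assumes "h \<in> bihom d" shows "dehom k d (- h) = \<ominus>\<^bsub>P1.\<O> (P1_chart k)\<^esub> dehom k d h"
proof -
  interpret U: cring "P1.\<O> (P1_chart k)" by (rule P1.cring_\<O>[OF P1_chart_open])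
  have "dehom k d (- h) \<oplus>\<^bsub>P1.\<O> (P1_chart k)\<^esub> dehom k d h = \<zero>\<^bsub>P1.\<O> (P1_chart k)\<^esub>"
    using dehom_add[of k d "- h" h] by (simp add: dehom_zero)
  then show ?thesis using U.minus_equality dehom_in assms bihom_minus by metis
qed

lemma P1_var_global: "P1_var k \<in> carrier (ms_global P1 P1_O1)"
proof -
  have "P1_var k = (\<lambda>p\<in>P1_pts. loc_frac Z_x0_x1 (P1T p) (xvar k) 1)"
    by (simp add: P1_var_def P1_x0_def P1_x1_def Proj_section_def xvar_def)
  moreover have "(\<lambda>p\<in>P1_pts. loc_frac Z_x0_x1 (P1T p) (xvar k) 1) \<in> P.fsec (\<Union>d. bihom (d + 1) \<times> bihom d) P1_pts"
    by (rule P.fsec_const)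
      (use openin_topspace[of "Proj_top Z_x0_x1 bihom"] xvar_bihom bihom_one denominators.T_one[OF P1_denominators]
        in \<open>auto simp: P1_topspace\<close>)
  ultimately show ?thesis by (simp only: P1_points) (simp only: P1_simps)
qed

lemma P1_var_at: "p \<in> P1_pts \<Longrightarrow> P1_var k p = loc_frac Z_x0_x1 (P1T p) (xvar k) 1"
  by (simp add: P1_var_def P1_x0_def P1_x1_def Proj_section_def xvar_def)

lemma P1_chart_sub: "P1_chart k \<subseteq> P1_pts" by (auto simp: P1_chart_def)

text \<open>Multiplication by \<open>x_k\<close> raises the degree of a fraction from 0 to 1. Over
  the chart of \<open>x_k\<close> it is undone by multiplication with \<open>1 / x_k\<close>, whose
  denominator is admissible there.\<close>

lemma P1_var_basis: "basis P1 P1_O1 (P1_chart k) (restrict (P1_var k) (P1_chart k))"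
  unfolding basis_def
proof (intro conjI allI impI; (elim conjE)?)
  show "P1.opn (P1_chart k)" by (rule P1_chart_open)
  have eq: "restrict (P1_var k) V = ms_res P1_O1 (rs_pts P1) V (P1_var k)" for V
    by (simp add: P1_simps)
  have inn: "restrict (P1_var k) V \<in> carrier (ms_mod P1_O1 V)" if "P1.opn V" for V
    unfolding eq using P1.\<M>.res_in[OF openin_topspace that openin_subset[OF that] P1_var_global] .
  then show "restrict (P1_var k) (P1_chart k) \<in> carrier (ms_mod P1_O1 (P1_chart k))" using P1_chart_open by blast
  fix V assume V: "P1.opn V" "V \<subseteq> P1_chart k"
  have U: "openin (Proj_top Z_x0_x1 bihom) V" using V(1) by (simp add: P1_simps)
  have rV: "ms_res P1_O1 (P1_chart k) V (restrict (P1_var k) (P1_chart k)) = restrict (P1_var k) V"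
    using V(2) by (auto simp: P1_simps restrict_def fun_eq_iff)
  let ?f = "\<lambda>c. c \<odot>\<^bsub>ms_mod P1_O1 V\<^esub> restrict (P1_var k) V"
  let ?g = "\<lambda>s. \<lambda>p\<in>V. s p \<otimes>\<^bsub>P.A p\<^esub> P.fr p 1 (xvar k)"
  have fac: "(a \<otimes>\<^bsub>P.A p\<^esub> P1_var k p) \<otimes>\<^bsub>P.A p\<^esub> P.fr p 1 (xvar k) = a"
    "(a \<otimes>\<^bsub>P.A p\<^esub> P.fr p 1 (xvar k)) \<otimes>\<^bsub>P.A p\<^esub> P1_var k p = a"
    if p: "p \<in> V" and a: "a \<in> carrier (P.A p)" for a p
  proof -
    have pk: "p \<in> P1_chart k" "p \<in> P1_pts" using p V(2) P1_chart_sub by auto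
    interpret denominators Z_x0_x1 "P1T p" by (rule P1_denominators[OF pk(2)])
    interpret L: cring Loc by (rule cring_loc)
    have t: "xvar k \<in> P1T p" using P1_chart_denom[OF pk(1), of 1] by simp
    note tt = T_one[simplified]
    have in0: "frac (xvar k) 1 \<in> carrier Loc" "frac 1 (xvar k) \<in> carrier Loc" using frac_in t tt by auto
    have "frac (xvar k) 1 \<otimes>\<^bsub>Loc\<^esub> frac 1 (xvar k) = \<one>\<^bsub>Loc\<^esub>"
      using frac_mult[OF _ tt _ t, of "xvar k" 1] frac_eq_iff[OF _ t _ tt, of "xvar k" 1] by (simp add: loc_one)
    then show "(a \<otimes>\<^bsub>P.A p\<^esub> P1_var k p) \<otimes>\<^bsub>P.A p\<^esub> P.fr p 1 (xvar k) = a"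
      "(a \<otimes>\<^bsub>P.A p\<^esub> P.fr p 1 (xvar k)) \<otimes>\<^bsub>P.A p\<^esub> P1_var k p = a"
      using a in0 pk by (simp_all add: P1_var_at L.m_assoc L.m_comm[OF in0(2,1)])
  qed
  have in0: "c p \<in> carrier (P.A p)" if "c \<in> P.fsec (\<Union>d. bihom (d + 0) \<times> bihom d) V" "p \<in> V" for c p
    using P.fsec_in[OF P.N_sub(1) U that] .
  have in1: "c p \<in> carrier (P.A p)" if "c \<in> P.fsec (\<Union>d. bihom (d + 1) \<times> bihom d) V" "p \<in> V" for c p
    using P.fsec_in[OF P.N_sub(2) U that] .
  have "bij_betw ?f (carrier (P1.\<O> V)) (carrier (ms_mod P1_O1 V))"
  proof (rule bij_betw_byWitness[where f'="?g"])
    show "\<forall>c\<in>carrier (P1.\<O> V). ?g (?f c) = c"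
    proof
      fix c assume "c \<in> carrier (P1.\<O> V)"
      then have c: "c \<in> P.fsec (\<Union>d. bihom (d + 0) \<times> bihom d) V" by (simp only: P1_simps)
      show "?g (?f c) = c" unfolding P1_simps by (rule P.fsec_restrict_eqI[OF c]) (use fac(1) in0[OF c] in simp)
    qed
    show "\<forall>s\<in>carrier (ms_mod P1_O1 V). ?f (?g s) = s"
    proof
      fix c assume "c \<in> carrier (ms_mod P1_O1 V)"
      then have c: "c \<in> P.fsec (\<Union>d. bihom (d + 1) \<times> bihom d) V" by (simp only: P1_simps)
      show "?f (?g c) = c" unfolding P1_simps by (rule P.fsec_restrict_eqI[OF c]) (use fac(2) in1[OF c] in simp)
    qed
    show "?f ` carrier (P1.\<O> V) \<subseteq> carrier (ms_mod P1_O1 V)"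
      by (rule image_subsetI) (rule P1.smult_closed[OF V(1) _ inn[OF V(1)]])
    show "?g ` carrier (ms_mod P1_O1 V) \<subseteq> carrier (P1.\<O> V)"
    proof (rule image_subsetI)
      fix s assume "s \<in> carrier (ms_mod P1_O1 V)"
      then have s: "s \<in> P.fsec (\<Union>d. bihom (d + 1) \<times> bihom d) V" by (simp only: P1_simps)
      have "?g s \<in> P.fsec (\<Union>d. bihom (d + 0) \<times> bihom d) V"
      proof (rule P.fsec_map[OF s U, where k="\<lambda>p a. a \<otimes>\<^bsub>P.A p\<^esub> P.fr p 1 (xvar k)" and h="\<lambda>r f. (r, f * xvar k)"])
        fix r f assume "(r, f) \<in> (\<Union>d. bihom (d + 1) \<times> bihom d)"
        then obtain d where d: "r \<in> bihom (d + 1)" "f \<in> bihom d" by blast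
        then have "(r, f * xvar k) \<in> bihom (d + 1 + 0) \<times> bihom (d + 1)" using bihom_mult[OF d(2) xvar_bihom[of k]] by simp
        then show "(r, f * xvar k) \<in> (\<Union>d. bihom (d + 0) \<times> bihom d)" by blast
      next
        fix r f p assume p: "p \<in> V" and f: "f \<in> P1T p"
        have pk: "p \<in> P1_chart k" using p V(2) by auto
        interpret denominators Z_x0_x1 "P1T p" by (rule P1_chart_denominators[OF pk])
        have t: "xvar k \<in> P1T p" using P1_chart_denom[OF pk, of 1] by simp
        show "snd (r, f * xvar k) \<in> P1T p \<and>
          P.fr p r f \<otimes>\<^bsub>P.A p\<^esub> P.fr p 1 (xvar k) = P.fr p (fst (r, f * xvar k)) (snd (r, f * xvar k))"
          using T_mult[OF f t] frac_mult[OF _ f _ t, of r 1] by simp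
      qed
      then show "?g s \<in> carrier (P1.\<O> V)" by (simp only: P1_simps)
    qed
  qed
  then show "bij_betw (\<lambda>c. c \<odot>\<^bsub>ms_mod P1_O1 V\<^esub> ms_res P1_O1 (P1_chart k) V (restrict (P1_var k) (P1_chart k)))
     (carrier (P1.\<O> V)) (carrier (ms_mod P1_O1 V))" unfolding rV .
qed

lemma P1_var_ratio:
  "restrict (P1_var j) (P1_chart k) = dehom k 1 (xvar j) \<odot>\<^bsub>ms_mod P1_O1 (P1_chart k)\<^esub> restrict (P1_var k) (P1_chart k)"
  unfolding P1_simps
proof (rule restrict_ext)
  fix p assume p: "p \<in> P1_chart k"
  interpret denominators Z_x0_x1 "P1T p" by (rule P1_chart_denominators[OF p])
  have t: "xvar k \<in> P1T p" using P1_chart_denom[OF p, of 1] by simp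
  note tt = T_one[simplified]
  have "frac (xvar j) 1 = frac (xvar j) (xvar k) \<otimes>\<^bsub>Loc\<^esub> frac (xvar k) 1"
    using frac_mult[OF _ t _ tt, of "xvar j" "xvar k"] frac_eq_iff[OF _ tt _ t, of "xvar j" "xvar j * xvar k"] by simp
  then show "P1_var j p = dehom k 1 (xvar j) p \<otimes>\<^bsub>Loc\<^esub> restrict (P1_var k) (P1_chart k) p"
    using p subsetD[OF P1_chart_sub p] by (simp add: P1_var_at dehom_def)
qed

text \<open>Near \<open>p\<close> the inverse is \<open>x_k^d / h\<close>, again a fraction of
  degree 0.\<close>

lemma dehom_unit:
  assumes p: "p \<in> P1_chart k" and h: "h \<in> bihom d" "h \<notin> p"
  shows "rs_germ P1 p (P1_chart k) (dehom k d h) \<in> Units (P1.\<O>\<^sub>x p)"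
proof -
  text \<open>The factor \<open>xvar k\<close> makes the degree positive.\<close>
  define V where "V = {q \<in> P1_pts. h * xvar k \<notin> q}"
  have hx: "h * xvar k \<in> bihom (d + 1)" by (rule bihom_mult[OF h(1) xvar_bihom])
  have V: "P1.opn V" unfolding V_def P1_simps by (rule P1_open_basic[OF hx]) simp
  have Vk: "V \<subseteq> P1_chart k" "\<And>q. q \<in> V \<Longrightarrow> h \<notin> q" using P1_pt_mult by (auto simp: V_def P1_chart_def)
  have pV: "p \<in> V" using p h P1_pt_mult by (auto simp: V_def P1_chart_def)
  define t where "t = (\<lambda>q\<in>V. P.fr q (xvar k ^ d) h)"
  have hT: "h \<in> P1T q" if "q \<in> V" for q using Vk(2)[OF that] h by (auto simp: Proj_denoms_def)
  have tV: "t \<in> carrier (P1.\<O> V)"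
    unfolding P1_simps t_def by (rule P.fsec_const) (use V xvar_power h hT in \<open>auto simp: P1_simps\<close>)
  interpret V: cring "P1.\<O> V" by (rule P1.cring_\<O>[OF V])
  let ?r = "P1.res (P1_chart k) V (dehom k d h)"
  have r: "?r \<in> carrier (P1.\<O> V)" using P1.\<O>.res_in[OF P1_chart_open V Vk(1) dehom_in[OF h(1)]] .
  have "t \<otimes>\<^bsub>P1.\<O> V\<^esub> ?r = \<one>\<^bsub>P1.\<O> V\<^esub>"
    unfolding P1_simps
  proof (rule restrict_ext)
    fix q assume q: "q \<in> V"
    have qk: "q \<in> P1_chart k" using q Vk by auto
    interpret denominators Z_x0_x1 "P1T q" by (rule P1_chart_denominators[OF qk])
    note x = P1_chart_denom[OF qk, of d]
    have "frac (xvar k ^ d) h \<otimes>\<^bsub>Loc\<^esub> frac h (xvar k ^ d) = \<one>\<^bsub>Loc\<^esub>"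
      using frac_mult[OF _ hT[OF q] _ x, of "xvar k ^ d" h]
        frac_eq_iff[OF _ T_mult[OF hT[OF q] x] _ T_one, of "xvar k ^ d * h" 1] by (simp add: loc_one ac_simps)
    then show "t q \<otimes>\<^bsub>Loc\<^esub> restrict (dehom k d h) V q = \<one>\<^bsub>Loc\<^esub>" using q qk by (simp add: t_def dehom_def)
  qed
  then have "?r \<in> Units (P1.\<O> V)" using tV r V.m_comm[OF tV r] unfolding Units_def by auto
  then show ?thesis
    unfolding P1.germ_Units_iff[OF P1_chart_open p dehom_in[OF h(1)]] using V pV Vk(1) by blast
qed

text \<open>An inverse near \<open>p\<close> would be a fraction \<open>r / f\<close> with
  \<open>r h = f x_k^d\<close>; the left side lies in the prime \<open>p\<close>, the right side
  does not. Together with \<open>dehom_unit\<close> this reads off from the stalk which forms belong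
  to \<open>p\<close>.\<close>

lemma dehom_nonunit:
  assumes p: "p \<in> P1_chart k" and h: "h \<in> bihom d" "h \<in> p"
  shows "rs_germ P1 p (P1_chart k) (dehom k d h) \<notin> Units (P1.\<O>\<^sub>x p)"
proof
  assume "rs_germ P1 p (P1_chart k) (dehom k d h) \<in> Units (P1.\<O>\<^sub>x p)"
  then obtain V where V: "P1.opn V" "p \<in> V" "V \<subseteq> P1_chart k" "P1.res (P1_chart k) V (dehom k d h) \<in> Units (P1.\<O> V)"
    unfolding P1.germ_Units_iff[OF P1_chart_open p dehom_in[OF h(1)]] by blast
  then obtain t where t: "t \<in> carrier (P1.\<O> V)" "t \<otimes>\<^bsub>P1.\<O> V\<^esub> P1.res (P1_chart k) V (dehom k d h) = \<one>\<^bsub>P1.\<O> V\<^esub>"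
    unfolding Units_def by blast
  interpret denominators Z_x0_x1 "P1T p" by (rule P1_chart_denominators[OF p])
  have pp: "p \<in> P1_pts" using p P1_chart_sub by auto
  note x = P1_chart_denom[OF p, of d]
  have "t \<in> P.fsec (\<Union>d. bihom (d + 0) \<times> bihom d) V" using t(1) by (simp only: P1_simps)
  from P.fsecE[OF this V(2)] obtain W r f where "openin (Proj_top Z_x0_x1 bihom) W" "p \<in> W" "W \<subseteq> V"
    "(r, f) \<in> (\<Union>d. bihom (d + 0) \<times> bihom d)" "\<forall>q\<in>W. f \<in> P1T q" "\<forall>q\<in>W. t q = P.fr q r f" .
  then have f: "f \<in> P1T p" "t p = frac r f" by auto
  have "t p \<otimes>\<^bsub>Loc\<^esub> frac h (xvar k ^ d) = \<one>\<^bsub>Loc\<^esub>"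
    using fun_cong[OF t(2), of p] V(2) p by (simp add: P1_simps dehom_def)
  then have "r * h = f * xvar k ^ d"
    using f frac_mult[OF _ f(1) _ x, of r h] frac_eq_iff[OF _ T_mult[OF f(1) x] _ T_one, of "r * h" 1]
    by (simp add: loc_one)
  moreover have "r * h \<in> p" using P1_pt_mult[OF pp] h by blast
  ultimately have "f \<in> p \<or> xvar k ^ d \<in> p" using P1_pt_mult[OF pp] by metis
  then show False using f(1) x by (auto simp: Proj_denoms_def)
qed

text \<open>Locally a section is \<open>r / g\<close> with forms of equal degree, hence the quotient
  of their dehomogenizations. The relation is stated without division, so that ring homomorphisms
  can be applied to it directly.\<close>

lemma P1_section_as_quotient:
  assumes V: "P1.opn V" "p \<in> V" and p: "p \<in> P1_chart k" and s: "s \<in> carrier (P1.\<O> V)"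
  obtains W d r g where "P1.opn W" "p \<in> W" "W \<subseteq> V" "W \<subseteq> P1_chart k" "r \<in> bihom d" "g \<in> bihom d" "g \<notin> p"
    "P1.res V W s \<otimes>\<^bsub>P1.\<O> W\<^esub> P1.res (P1_chart k) W (dehom k d g) = P1.res (P1_chart k) W (dehom k d r)"
proof -
  have "s \<in> P.fsec (\<Union>d. bihom (d + 0) \<times> bihom d) V" using s by (simp only: P1_simps)
  from P.fsecE[OF this V(2)] obtain W r g where W: "openin (Proj_top Z_x0_x1 bihom) W" "p \<in> W" "W \<subseteq> V"
    "(r, g) \<in> (\<Union>d. bihom (d + 0) \<times> bihom d)" "\<forall>q\<in>W. g \<in> P1T q" "\<forall>q\<in>W. s q = P.fr q r g" .
  obtain d where d: "r \<in> bihom d" "g \<in> bihom d" using W(4) by auto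
  let ?W = "W \<inter> P1_chart k"
  have o: "P1.opn ?W" using W(1) P1_chart_open by (auto simp: P1_simps)
  have gp: "g \<notin> p" using W(2,5) by (auto simp: Proj_denoms_def)
  have eq: "P1.res V ?W s \<otimes>\<^bsub>P1.\<O> ?W\<^esub> P1.res (P1_chart k) ?W (dehom k d g) = P1.res (P1_chart k) ?W (dehom k d r)"
    unfolding P1_simps
  proof (rule restrict_ext)
    fix q assume q: "q \<in> ?W"
    interpret denominators Z_x0_x1 "P1T q" using P1_chart_denominators q by blast
    have x: "xvar k ^ d \<in> P1T q" using P1_chart_denom q by blast
    have g: "g \<in> P1T q" using q W(5) by blast
    have "frac r g \<otimes>\<^bsub>Loc\<^esub> frac g (xvar k ^ d) = frac r (xvar k ^ d)"
      using frac_mult[OF _ g _ x, of r g] frac_eq_iff[OF _ T_mult[OF g x] _ x, of "r * g" r] by (simp add: ac_simps)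
    then show "restrict s ?W q \<otimes>\<^bsub>Loc\<^esub> restrict (dehom k d g) ?W q = dehom k d r q" using q W(6) by (simp add: dehom_def)
  qed
  show thesis by (rule that[OF o _ _ _ d gp eq]) (use W(2,3) p in auto)
qed


section \<open>Spectra of fields as one-point schemes\<close>

text \<open>Zorn's lemma for the ideals that contain \<open>a\<close> but not one; the union of a
  nonempty chain of them is again such an ideal.\<close>

lemma (in cring) nonunit_in_maximalideal:
  assumes a: "a \<in> carrier R" "a \<notin> Units R"
  obtains M where "maximalideal M R" "a \<in> M"
proof -
  define \<A> where "\<A> = {I. ideal I R \<and> a \<in> I \<and> \<one> \<notin> I}"
  have "\<one> \<notin> PIdl a"
  proof
    assume "\<one> \<in> PIdl a"
    then obtain r where "r \<in> carrier R" "\<one> = r \<otimes> a" unfolding cgenideal_def by blast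
    then show False using a m_comm[of r a] unfolding Units_def by auto
  qed
  then have P: "PIdl a \<in> \<A>" unfolding \<A>_def using cgenideal_ideal cgenideal_self a by blast
  have "\<exists>M\<in>\<A>. \<forall>X\<in>\<A>. M \<subseteq> X \<longrightarrow> X = M"
  proof (rule subset_Zorn_nonempty)
    show "\<A> \<noteq> {}" using P by blast
    fix \<C> assume ne: "\<C> \<noteq> {}" and ch: "subset.chain \<A> \<C>"
    have sub: "\<C> \<subseteq> \<A>" and tot: "\<And>I J. I \<in> \<C> \<Longrightarrow> J \<in> \<C> \<Longrightarrow> I \<subseteq> J \<or> J \<subseteq> I"
      using ch by (auto simp: subset_chain_def)
    have id: "ideal I R" if "I \<in> \<C>" for I using that sub by (auto simp: \<A>_def)
    have "ideal (\<Union>\<C>) R"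
    proof (rule idealI[OF ring_axioms])
      show "subgroup (\<Union>\<C>) (add_monoid R)"
      proof (rule add.subgroupI)
        show "\<Union>\<C> \<subseteq> carrier R" using id by (auto dest: ideal.Icarr)
        obtain I where "I \<in> \<C>" using ne by blast
        then show "\<Union>\<C> \<noteq> {}" using additive_subgroup.zero_closed[OF ideal.axioms(1)[OF id]] by fast
        show "\<ominus> x \<in> \<Union>\<C>" if x: "x \<in> \<Union>\<C>" for x
        proof -
          obtain I where "I \<in> \<C>" "x \<in> I" using x by blast
          then show ?thesis using additive_subgroup.a_inv_closed[OF ideal.axioms(1)[OF id]] by fast
        qed
        show "x \<oplus> y \<in> \<Union>\<C>" if xy: "x \<in> \<Union>\<C>" "y \<in> \<Union>\<C>" for x y
        proof -
          obtain I J where "I \<in> \<C>" "J \<in> \<C>" "x \<in> I" "y \<in> J" using xy by blast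
          then obtain K where "K \<in> \<C>" "x \<in> K" "y \<in> K" using tot[of I J] by blast
          then show ?thesis using additive_subgroup.a_closed[OF ideal.axioms(1)[OF id]] by fast
        qed
      qed
      show "x \<otimes> i \<in> \<Union>\<C>" "i \<otimes> x \<in> \<Union>\<C>" if "i \<in> \<Union>\<C>" "x \<in> carrier R" for i x
        using that id ideal.I_l_closed ideal.I_r_closed by (metis Union_iff)+
    qed
    moreover have "a \<in> \<Union>\<C>" "\<one> \<notin> \<Union>\<C>" using sub ne by (auto simp: \<A>_def)
    ultimately show "\<Union>\<C> \<in> \<A>" by (simp add: \<A>_def)
  qed
  then obtain M where M: "M \<in> \<A>" "\<And>X. X \<in> \<A> \<Longrightarrow> M \<subseteq> X \<Longrightarrow> X = M" by blast
  have "maximalideal M R"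
  proof (rule maximalidealI)
    show id: "ideal M R" using M by (simp add: \<A>_def)
    show "carrier R \<noteq> M" using M one_closed by (auto simp: \<A>_def)
    fix J assume J: "ideal J R" "M \<subseteq> J" "J \<subseteq> carrier R"
    show "J = M \<or> J = carrier R"
    proof (cases "\<one> \<in> J")
      case True
      then show ?thesis using ideal.one_imp_carrier[OF J(1)] by blast
    next
      case False
      then have "J \<in> \<A>" using J M by (auto simp: \<A>_def)
      then show ?thesis using M(2) J by blast
    qed
  qed
  moreover have "a \<in> M" using M by (simp add: \<A>_def)
  ultimately show thesis by (rule that)
qed

text \<open>Some maximal ideal contains the non-unit, and \<open>M\<close> is the only one.\<close>

lemma local_ring_nonunit:
  assumes "local_ring R" "maximalideal M R" "a \<in> carrier R" "a \<notin> Units R"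
  shows "a \<in> M"
proof -
  interpret cring R using assms by (simp add: local_ring_def)
  obtain M' where "maximalideal M' R" "a \<in> M'" using nonunit_in_maximalideal assms(3,4) by blast
  then show ?thesis using assms(1,2) unfolding local_ring_def by blast
qed

lemma field_local_ring:
  assumes "field R" shows "local_ring R"
proof -
  interpret field R by fact
  have "M = {\<zero>\<^bsub>R\<^esub>}" if "maximalideal M R" for M
    using all_ideals maximalideal.axioms(1)[OF that] maximalideal.I_notcarr[OF that] by blast
  then show ?thesis unfolding local_ring_def using zeromaximalideal is_cring by blast
qed

lemma (in ringed) carrier_empty: "s \<in> carrier (\<O> {}) \<Longrightarrow> s = \<zero>\<^bsub>\<O> {}\<^esub>"
  using \<O>.eqI[of "{}" s "\<zero>\<^bsub>\<O> {}\<^esub>"] cring.cring_simprules(2)[OF cring_\<O>] by simp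

locale one_point = ringed S for S :: "('a, 'b) ringed_space" +
  fixes x :: 'a
  assumes pts: "rs_pts S = {x}" and field_at: "field (\<O> {x})"
begin

lemma opn_pt: "opn {x}" using pts openin_topspace by metis

lemma opnD: "opn U \<Longrightarrow> U = {} \<or> U = {x}" using openin_subset pts by fastforce

lemma stalk_germ:
  assumes "A \<in> carrier (\<O>\<^sub>x x)" obtains s where "s \<in> carrier (\<O> {x})" "A = rs_germ S x {x} s"
proof -
  obtain U s where "opn U" "x \<in> U" "s \<in> carrier (\<O> U)" "A = rs_germ S x U s" using \<O>.stalk_repE[OF assms] .
  then show thesis using that opnD by blast
qed

lemma germ_eq: "s \<in> carrier (\<O> {x}) \<Longrightarrow> t \<in> carrier (\<O> {x}) \<Longrightarrow> rs_germ S x {x} s = rs_germ S x {x} t \<Longrightarrow> s = t"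
  by (rule germ_inj[OF opn_pt]) auto

lemma field_stalk: "field (\<O>\<^sub>x x)"
proof -
  have x: "x \<in> rs_pts S" using pts by simp
  interpret k: field "\<O> {x}" by (rule field_at)
  interpret R: cring "\<O>\<^sub>x x" by (rule cring_stalk[OF x])
  note g = stalk_mult[OF opn_pt] germ_one[OF opn_pt] germ_zero[OF opn_pt]
  show ?thesis
  proof (rule R.cring_fieldI2)
    show "\<zero>\<^bsub>\<O>\<^sub>x x\<^esub> \<noteq> \<one>\<^bsub>\<O>\<^sub>x x\<^esub>"
      using germ_eq[OF k.zero_closed k.one_closed] k.one_not_zero g(2,3)[of x] by auto
    fix A assume A: "A \<in> carrier (\<O>\<^sub>x x)" "A \<noteq> \<zero>\<^bsub>\<O>\<^sub>x x\<^esub>"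
    obtain s where s: "s \<in> carrier (\<O> {x})" "A = rs_germ S x {x} s" using stalk_germ[OF A(1)] .
    then have "s \<noteq> \<zero>\<^bsub>\<O> {x}\<^esub>" using A(2) g(3)[of x] by auto
    then obtain t where t: "t \<in> carrier (\<O> {x})" "s \<otimes>\<^bsub>\<O> {x}\<^esub> t = \<one>\<^bsub>\<O> {x}\<^esub>"
      using s(1) k.field_Units unfolding Units_def by blast
    show "\<exists>B\<in>carrier (\<O>\<^sub>x x). A \<otimes>\<^bsub>\<O>\<^sub>x x\<^esub> B = \<one>\<^bsub>\<O>\<^sub>x x\<^esub>"
      using s t g(1)[of x s t] g(2)[of x] by (intro bexI[of _ "rs_germ S x {x} t"]) (auto intro: \<O>.stalk_in[OF opn_pt])
  qed
qed

lemma locally_ringed: "locally_ringed_space S"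
  unfolding locally_ringed_space_def using ringed pts field_local_ring[OF field_stalk] by simp

end

lemma (in rs_morphism) lrs_homI:
  assumes "\<And>x A. x \<in> rs_pts X \<Longrightarrow> A \<in> carrier (Y.\<O>\<^sub>x (pt x)) \<Longrightarrow> A \<notin> Units (Y.\<O>\<^sub>x (pt x)) \<Longrightarrow>
    stalk_map X f x A \<notin> Units (X.\<O>\<^sub>x x)"
  shows "f \<in> lrs_hom X Y"
  unfolding lrs_hom_def using cont sec_hom sec_nat assms by blast

text \<open>Over an open set without \<open>y\<close> the preimage is empty, where zero is the only
  section.\<close>

definition one_point_mor :: "('a, 'b) ringed_space \<Rightarrow> 'c \<Rightarrow> ('d \<Rightarrow> 'b) \<Rightarrow> ('a, 'b, 'c, 'd) lrs_mor" where
  "one_point_mor X y k = \<lparr>mor_pt = (\<lambda>_. y), mor_sec = (\<lambda>V s. if y \<in> V then k s else \<zero>\<^bsub>rs_ring X {}\<^esub>)\<rparr>"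

text \<open>The condition on stalks is automatic: the stalks are fields, so a non-unit is zero and
  is mapped to zero.\<close>

lemma one_point_mor_hom:
  assumes X: "one_point X x" and Y: "one_point Y y" and k: "k \<in> ring_hom (rs_ring Y {y}) (rs_ring X {x})"
  shows "one_point_mor X y k \<in> lrs_hom X Y"
proof -
  interpret X: one_point X x by fact
  interpret Y: one_point Y y by fact
  let ?f = "one_point_mor X y k"
  have f: "mor_pt ?f = (\<lambda>_. y)" "\<And>V s. mor_sec ?f V s = (if y \<in> V then k s else \<zero>\<^bsub>rs_ring X {}\<^esub>)"
    by (simp_all add: one_point_mor_def)
  have pre: "mor_preim X ?f V = (if y \<in> V then {x} else {})" for V by (auto simp: mor_preim_def f X.pts)
  have emp: "X.opn {}" "cring (X.\<O> {})" using X.cring_\<O> by auto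
  interpret E: cring "X.\<O> {}" by (rule emp)
  have m: "rs_morphism X Y ?f"
  proof (intro rs_morphism.intro rs_morphism_axioms.intro X.ringed_axioms Y.ringed_axioms)
    show "continuous_map (rs_top X) (rs_top Y) (mor_pt ?f)" by (simp add: f Y.pts)
    show "mor_sec ?f V \<in> ring_hom (Y.\<O> V) (X.\<O> (mor_preim X ?f V))" if V: "Y.opn V" for V
    proof (cases "y \<in> V")
      case True
      then have "V = {y}" using Y.opnD V by blast
      moreover have "mor_sec ?f {y} = k" by (rule ext) (simp add: f)
      moreover have "mor_preim X ?f {y} = {x}" by (simp add: pre)
      ultimately show ?thesis using k by (simp only:)
    next
      case False
      have "\<one>\<^bsub>X.\<O> {}\<^esub> = \<zero>\<^bsub>X.\<O> {}\<^esub>" by (rule X.carrier_empty) simp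
      then show ?thesis using False by (intro ring_hom_memI) (auto simp: f pre)
    qed
    fix V W s assume V: "Y.opn V" "Y.opn W" "W \<subseteq> V" "s \<in> carrier (Y.\<O> V)"
    show "X.res (mor_preim X ?f V) (mor_preim X ?f W) (mor_sec ?f V s) = mor_sec ?f W (Y.res V W s)"
    proof (cases "y \<in> W")
      case True
      then have VW: "V = {y}" "W = {y}" using Y.opnD V by blast+
      then have "k s \<in> carrier (X.\<O> {x})" using k V ring_hom_closed by metis
      then show ?thesis using VW V X.\<O>.res_id[OF X.opn_pt] Y.\<O>.res_id by (simp add: f pre)
    next
      case False
      have 1: "mor_sec ?f V s \<in> carrier (X.\<O> (mor_preim X ?f V))"
        using k V Y.opnD[OF V(1)] ring_hom_closed[OF k] by (auto simp: f pre)
      have 2: "X.opn (mor_preim X ?f V)" using X.opn_pt by (simp add: pre)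
      have "X.res (mor_preim X ?f V) {} (mor_sec ?f V s) \<in> carrier (X.\<O> {})"
        by (rule X.\<O>.res_in[OF 2 _ _ 1]) simp_all
      then show ?thesis using False X.carrier_empty by (simp add: f pre)
    qed
  qed
  interpret m: rs_morphism X Y ?f by (rule m)
  interpret KX: field "X.\<O>\<^sub>x x" by (rule X.field_stalk)
  interpret KY: field "Y.\<O>\<^sub>x y" by (rule Y.field_stalk)
  have h: "stalk_map X ?f x \<in> ring_hom (Y.\<O>\<^sub>x y) (X.\<O>\<^sub>x x)" using m.stalk_map_hom[of x] X.pts by (simp add: f)
  interpret h: ring_hom_cring "Y.\<O>\<^sub>x y" "X.\<O>\<^sub>x x" "stalk_map X ?f x" by unfold_locales (rule h)
  show ?thesis
  proof (rule m.lrs_homI)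
    fix x' A assume "x' \<in> rs_pts X" "A \<in> carrier (Y.\<O>\<^sub>x (mor_pt ?f x'))" "A \<notin> Units (Y.\<O>\<^sub>x (mor_pt ?f x'))"
    then have "x' = x" "A = \<zero>\<^bsub>Y.\<O>\<^sub>x y\<^esub>" using KY.field_Units by (auto simp: X.pts f)
    then show "stalk_map X ?f x' A \<notin> Units (X.\<O>\<^sub>x x')" using KX.field_Units by simp
  qed
qed

lemma one_point_isomorphic:
  assumes X: "one_point X x" and Y: "one_point Y y"
    and h: "h \<in> ring_hom (rs_ring X {x}) (rs_ring Y {y})" and bij: "bij_betw h (carrier (rs_ring X {x})) (carrier (rs_ring Y {y}))"
  shows "lrs_isomorphic X Y"
proof -
  interpret X: one_point X x by fact
  interpret Y: one_point Y y by fact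
  interpret RX: field "X.\<O> {x}" by (rule X.field_at)
  define k where "k = inv_into (carrier (X.\<O> {x})) h"
  have kh: "k (h s) = s" if "s \<in> carrier (X.\<O> {x})" for s
    using that bij unfolding k_def by (simp add: bij_betw_def inv_into_f_f)
  have hk: "k s \<in> carrier (X.\<O> {x}) \<and> h (k s) = s" if "s \<in> carrier (Y.\<O> {y})" for s
    using that bij unfolding k_def by (metis bij_betw_def f_inv_into_f inv_into_into)
  have k: "k \<in> ring_hom (Y.\<O> {y}) (X.\<O> {x})"
  proof (rule ring_hom_memI)
    fix s t assume st: "s \<in> carrier (Y.\<O> {y})" "t \<in> carrier (Y.\<O> {y})"
    show "k s \<in> carrier (X.\<O> {x})" using hk st by blast
    show "k (s \<otimes>\<^bsub>Y.\<O> {y}\<^esub> t) = k s \<otimes>\<^bsub>X.\<O> {x}\<^esub> k t"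
      using hk[OF st(1)] hk[OF st(2)] ring_hom_mult[OF h, of "k s" "k t"] kh[of "k s \<otimes>\<^bsub>X.\<O> {x}\<^esub> k t"] by simp
    show "k (s \<oplus>\<^bsub>Y.\<O> {y}\<^esub> t) = k s \<oplus>\<^bsub>X.\<O> {x}\<^esub> k t"
      using hk[OF st(1)] hk[OF st(2)] ring_hom_add[OF h, of "k s" "k t"] kh[of "k s \<oplus>\<^bsub>X.\<O> {x}\<^esub> k t"] by simp
  next
    show "k \<one>\<^bsub>Y.\<O> {y}\<^esub> = \<one>\<^bsub>X.\<O> {x}\<^esub>" using ring_hom_one[OF h] kh[OF RX.one_closed] by simp
  qed
  let ?f = "one_point_mor X y k" and ?g = "one_point_mor Y x h"
  have sec: "mor_sec (mor_comp Y ?g ?f) V s = s" if V: "X.opn V" "s \<in> carrier (X.\<O> V)" for V s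
    using X.opnD[OF V(1)] V(2) kh X.carrier_empty
    by (auto simp: mor_comp_def one_point_mor_def mor_preim_def Y.pts)
  have sec': "mor_sec (mor_comp X ?f ?g) V s = s" if V: "Y.opn V" "s \<in> carrier (Y.\<O> V)" for V s
    using Y.opnD[OF V(1)] V(2) hk Y.carrier_empty
    by (auto simp: mor_comp_def one_point_mor_def mor_preim_def X.pts)
  have "mor_eq X X (mor_comp Y ?g ?f) mor_id" "mor_eq Y Y (mor_comp X ?f ?g) mor_id"
    unfolding mor_eq_def using sec sec' by (auto simp: X.pts Y.pts mor_id_def mor_comp_def one_point_mor_def)
  then show ?thesis
    unfolding lrs_isomorphic_def using one_point_mor_hom[OF X Y k] one_point_mor_hom[OF Y X h] by blast
qed

text \<open>\<open>affine_scheme\<close> refers to the construction \<open>Spec\<close>, which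
  therefore has to be computed for a field: its only point is the zero ideal, and the sections over
  it are the fractions \<open>r / 1\<close>.\<close>

lemma field_Spec:
  assumes K: "field K"
  shows "one_point (Spec K) {\<zero>\<^bsub>K\<^esub>}"
    and "\<exists>h. h \<in> ring_hom K (rs_ring (Spec K) {{\<zero>\<^bsub>K\<^esub>}}) \<and> bij_betw h (carrier K) (carrier (rs_ring (Spec K) {{\<zero>\<^bsub>K\<^esub>}}))"
proof -
  interpret K: field K by fact
  let ?o = "{\<zero>\<^bsub>K\<^esub>}" and ?N = "carrier K \<times> carrier K" and ?T = "\<lambda>\<pp>. carrier K - \<pp>"
  have primes: "primeideal \<pp> K \<longleftrightarrow> \<pp> = ?o" for \<pp>
    using K.all_ideals K.zeroprimeideal primeideal.axioms(1)[of \<pp> K] primeideal.I_notcarr[of \<pp> K] by blast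
  have "topspace (Spec_top K) = \<Union>{{\<pp>. primeideal \<pp> K \<and> f \<notin> \<pp>} | f. f \<in> carrier K}"
    unfolding Spec_top_def by (rule topology_generated_by_topspace)
  also have "\<dots> = {?o}" using K.one_not_zero K.one_closed unfolding primes by blast
  finally have top: "topspace (Spec_top K) = {?o}" .
  have den: "denominators K (carrier K - ?o)"
    by unfold_locales (use K.integral K.one_not_zero in auto)
  interpret S: fraction_module K "Spec_top K" ?T ?N ?N
    by (intro fraction_module.intro fraction_sheaf.intro fraction_sheaf_axioms.intro fraction_module_axioms.intro K.domain_axioms)
      (use den in \<open>auto simp: top\<close>)
  interpret D: denominators K "carrier K - ?o" by (rule den)
  interpret L: cring D.Loc by (rule D.cring_loc)
  have eq: "Spec K = S.frs" unfolding Spec_def S.frs_def ..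
  interpret R: ringed "Spec K" unfolding eq by (rule S.ringed_frs)
  note simps = S.frs_simps[folded eq]
  have pts: "rs_pts (Spec K) = {?o}" by (simp add: simps top)
  have o: "R.opn {?o}" using pts openin_topspace by metis
  interpret A: cring "R.\<O> {?o}" by (rule R.cring_\<O>[OF o])
  define h where "h r = (\<lambda>\<pp>\<in>{?o}. D.frac r \<one>\<^bsub>K\<^esub>)" for r
  have one: "\<one>\<^bsub>K\<^esub> \<in> carrier K - ?o" using K.one_not_zero by simp
  have hom: "h \<in> ring_hom K (R.\<O> {?o})"
  proof (rule ring_hom_memI)
    fix r s assume r: "r \<in> carrier K" "s \<in> carrier K"
    have "(\<lambda>\<pp>\<in>{?o}. S.fr \<pp> r \<one>\<^bsub>K\<^esub>) \<in> S.fsec ?N {?o}"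
      by (rule S.fsec_const) (use o r one in \<open>auto simp: simps\<close>)
    moreover have "(\<lambda>\<pp>\<in>{?o}. S.fr \<pp> r \<one>\<^bsub>K\<^esub>) = h r" unfolding h_def by (rule restrict_ext) simp
    ultimately show "h r \<in> carrier (R.\<O> {?o})" by (simp add: simps)
    show "h (r \<otimes>\<^bsub>K\<^esub> s) = h r \<otimes>\<^bsub>R.\<O> {?o}\<^esub> h s"
      unfolding h_def simps by (rule restrict_ext) (use D.frac_mult[OF r(1) one r(2) one] in simp)
    show "h (r \<oplus>\<^bsub>K\<^esub> s) = h r \<oplus>\<^bsub>R.\<O> {?o}\<^esub> h s"
      unfolding h_def simps by (rule restrict_ext) (use D.frac_add[OF r(1) one r(2) one] r in simp)
  next
    show "h \<one>\<^bsub>K\<^esub> = \<one>\<^bsub>R.\<O> {?o}\<^esub>" unfolding h_def simps by (rule restrict_ext) (simp add: D.loc_one)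
  qed
  have bij: "bij_betw h (carrier K) (carrier (R.\<O> {?o}))"
    unfolding bij_betw_def
  proof
    show "inj_on h (carrier K)"
    proof (rule inj_onI)
      fix r s assume r: "r \<in> carrier K" "s \<in> carrier K" "h r = h s"
      from fun_cong[OF r(3), of ?o] have "D.frac r \<one>\<^bsub>K\<^esub> = D.frac s \<one>\<^bsub>K\<^esub>" by (simp add: h_def)
      then show "r = s" using D.frac_eq_iff[OF r(1) one r(2) one] r by simp
    qed
    have "s \<in> h ` carrier K" if "s \<in> carrier (R.\<O> {?o})" for s
    proof -
      have s: "s \<in> S.fsec ?N {?o}" using that by (simp only: simps)
      from S.fsecE[OF s singletonI] obtain V r f where V: "openin (Spec_top K) V" "?o \<in> V" "V \<subseteq> {?o}"
        "(r, f) \<in> ?N" "\<forall>q\<in>V. f \<in> carrier K - q" "\<forall>q\<in>V. s q = S.fr q r f" .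
      then have rf: "r \<in> carrier K" "f \<in> carrier K - ?o" "s ?o = D.frac r f" by auto
      then obtain g where g: "g \<in> carrier K" "g \<otimes>\<^bsub>K\<^esub> f = \<one>\<^bsub>K\<^esub>" using K.field_Units unfolding Units_def by blast
      have f: "f \<in> carrier K" using rf by simp
      have "(r \<otimes>\<^bsub>K\<^esub> g) \<otimes>\<^bsub>K\<^esub> f = r" using g rf(1) f by (simp add: K.m_assoc)
      then have "D.frac (r \<otimes>\<^bsub>K\<^esub> g) \<one>\<^bsub>K\<^esub> = D.frac r f"
        using D.frac_eq_iff[OF _ one rf(1,2), of "r \<otimes>\<^bsub>K\<^esub> g"] g rf by simp
      then have "h (r \<otimes>\<^bsub>K\<^esub> g) = s"
        unfolding h_def by (intro S.fsec_restrict_eqI[OF s]) (use rf in simp)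
      then show ?thesis using g rf by blast
    qed
    then show "h ` carrier K = carrier (R.\<O> {?o})" using ring_hom_closed[OF hom] by blast
  qed
  interpret h: ring_hom_cring K "R.\<O> {?o}" h by unfold_locales (rule hom)
  have "field (R.\<O> {?o})"
  proof (rule A.cring_fieldI2)
    show "\<zero>\<^bsub>R.\<O> {?o}\<^esub> \<noteq> \<one>\<^bsub>R.\<O> {?o}\<^esub>"
      using bij K.one_not_zero h.hom_zero h.hom_one K.zero_closed K.one_closed unfolding bij_betw_def inj_on_def by metis
    fix a assume a: "a \<in> carrier (R.\<O> {?o})" "a \<noteq> \<zero>\<^bsub>R.\<O> {?o}\<^esub>"
    then obtain r where r: "r \<in> carrier K" "a = h r" using bij unfolding bij_betw_def by blast
    then have "r \<noteq> \<zero>\<^bsub>K\<^esub>" using a by auto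
    then obtain s where s: "s \<in> carrier K" "r \<otimes>\<^bsub>K\<^esub> s = \<one>\<^bsub>K\<^esub>" using r(1) K.field_Units unfolding Units_def by blast
    then have "a \<otimes>\<^bsub>R.\<O> {?o}\<^esub> h s = \<one>\<^bsub>R.\<O> {?o}\<^esub>" using r h.hom_mult[OF r(1) s(1)] by simp
    then show "\<exists>b\<in>carrier (R.\<O> {?o}). a \<otimes>\<^bsub>R.\<O> {?o}\<^esub> b = \<one>\<^bsub>R.\<O> {?o}\<^esub>" using s by blast
  qed
  then show "one_point (Spec K) ?o"
    using pts by (intro one_point.intro one_point_axioms.intro R.ringed_axioms)
  show "\<exists>h. h \<in> ring_hom K (R.\<O> {?o}) \<and> bij_betw h (carrier K) (carrier (R.\<O> {?o}))" using hom bij by blast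
qed

text \<open>The sections over the empty set form the zero ring; in the type \<open>'s\<close> its only element
  has to be supplied as \<open>z\<close>.\<close>

definition point_spec :: "'a \<Rightarrow> 's ring \<Rightarrow> 's \<Rightarrow> ('a, 's) ringed_space" where
  "point_spec x K z =
     \<lparr>rs_top = discrete_topology {x},
      rs_ring = (\<lambda>U. if x \<in> U then K else \<lparr>carrier = {z}, monoid.mult = (\<lambda>_ _. z), one = z, zero = z, add = (\<lambda>_ _. z)\<rparr>),
      rs_res = (\<lambda>U V s. if x \<in> V then s else z)\<rparr>"

lemma point_spec_one_point:
  fixes x :: 'a and K :: "'s ring"
  assumes K: "field K"
  shows "one_point (point_spec x K z) x"
proof -
  let ?T = "point_spec x K z"
  interpret K: field K by fact
  have top: "openin (rs_top ?T) U \<longleftrightarrow> U \<subseteq> {x}" for U by (simp add: point_spec_def)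
  have car: "carrier (rs_ring ?T U) = (if x \<in> U then carrier K else {z})" for U by (simp add: point_spec_def)
  have res: "rs_res ?T U V s = (if x \<in> V then s else z)" for U V s by (simp add: point_spec_def)
  have "sheaf (rs_top ?T) (\<lambda>U. carrier (rs_ring ?T U)) (rs_res ?T)"
  proof (unfold_locales, unfold top car res)
    fix \<U> and s :: "'a set \<Rightarrow> 's"
    assume s: "\<forall>V\<in>\<U>. V \<subseteq> {x} \<and> s V \<in> (if x \<in> V then carrier K else {z})"
    show "\<exists>!t. t \<in> (if x \<in> \<Union>\<U> then carrier K else {z}) \<and> (\<forall>V\<in>\<U>. (if x \<in> V then t else z) = s V)"
    proof (cases "x \<in> \<Union>\<U>")
      case True
      \<comment> \<open>A member of the cover that contains \<open>x\<close> is \<open>{x}\<close>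
        itself, so the glued section is the one given there.\<close>
      have only: "V = {x}" if "V \<in> \<U>" "x \<in> V" for V using that s by blast
      obtain V where "V \<in> \<U>" "x \<in> V" using True by blast
      then have V: "{x} \<in> \<U>" using only by blast
      have "\<exists>!t. t \<in> carrier K \<and> (\<forall>V\<in>\<U>. (if x \<in> V then t else z) = s V)"
      proof (rule ex1I[of _ "s {x}"])
        show "s {x} \<in> carrier K \<and> (\<forall>V\<in>\<U>. (if x \<in> V then s {x} else z) = s V)"
          using V s only by (metis singletonI singletonD)
        fix t assume "t \<in> carrier K \<and> (\<forall>V\<in>\<U>. (if x \<in> V then t else z) = s V)"
        then show "t = s {x}" using V by (metis singletonI)
      qed
      then show ?thesis using True by simp
    next
      case False
      then show ?thesis using s by auto
    qed
  qed (auto split: if_splits)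
  moreover have "cring (rs_ring ?T U)" for U
  proof (cases "x \<in> U")
    case False
    have "cring \<lparr>carrier = {z}, monoid.mult = (\<lambda>_ _. z), one = z, zero = z, add = (\<lambda>_ _. z)\<rparr>"
      by (intro cringI abelian_groupI comm_monoidI) auto
    then show ?thesis using False by (simp add: point_spec_def)
  qed (simp add: point_spec_def K.is_cring)
  moreover have "rs_res ?T U V \<in> ring_hom (rs_ring ?T U) (rs_ring ?T V)" if "V \<subseteq> U" for U V
    using that by (intro ring_hom_memI) (auto simp: point_spec_def)
  ultimately have "ringed_space ?T" unfolding ringed_space_def is_sheaf_iff by blast
  moreover have "rs_pts ?T = {x}" "field (rs_ring ?T {x})" using K by (simp_all add: point_spec_def)
  ultimately show ?thesis
    by (simp add: one_point_def one_point_axioms_def ringed_def)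
qed

lemma point_spec_scheme:
  assumes K: "field K"
  shows "is_scheme (point_spec x K z)"
proof -
  let ?T = "point_spec x K z"
  interpret K: field K by fact
  interpret T: one_point ?T x by (rule point_spec_one_point[OF K])
  obtain h where "h \<in> ring_hom K (rs_ring (Spec K) {{\<zero>\<^bsub>K\<^esub>}})"
    "bij_betw h (carrier K) (carrier (rs_ring (Spec K) {{\<zero>\<^bsub>K\<^esub>}}))" using field_Spec(2)[OF K] by blast
  then have "lrs_isomorphic ?T (Spec K)"
    by (intro one_point_isomorphic[OF T.one_point_axioms field_Spec(1)[OF K]]) (simp_all add: point_spec_def)
  then have aff: "affine_scheme ?T"
    unfolding affine_scheme_def using T.locally_ringed K.is_cring by blast
  have "open_sub ?T {x} = ?T"
    by (simp add: open_sub_def point_spec_def subtopology_discrete_topology)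
  then show ?thesis
    unfolding is_scheme_def using aff T.locally_ringed T.pts T.opn_pt by auto
qed


section \<open>Points of the projective line\<close>

locale P1_point =
  fixes S :: "('a, 'b) ringed_space" and a :: "('a, 'b) P1_point"
  assumes lrs: "locally_ringed_space S" and hom: "a \<in> lrs_hom S P1"

sublocale P1_point \<subseteq> pullback_bundle S P1 a P1_O1
proof (intro pullback_bundle.intro pullback_bundle_axioms.intro mod_sheaf_O1)
  show "rs_morphism S P1 a"
    using lrs_hom_morphism[OF _ _ hom] lrs ringed_P1 by (simp add: locally_ringed_space_def ringed_def)
  show "\<exists>W e. y \<in> W \<and> basis P1 P1_O1 W e" if "y \<in> rs_pts P1" for y
    using that P1_chart_cover P1_var_basis unfolding P1_points by blast
qed

context P1_point
begin

abbreviation chart where "chart k \<equiv> pre (P1_chart k)"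

lemma chart_open: "X.opn (chart k)" by (rule pre_open[OF P1_chart_open])

lemma chart_cover: "x \<in> rs_pts S \<Longrightarrow> \<exists>k. x \<in> chart k"
  using P1_chart_cover pt_in unfolding P1_points mem_pre by blast

lemma chart_other: "x \<in> rs_pts S \<Longrightarrow> x \<notin> chart k \<Longrightarrow> x \<in> chart (\<not> k)"
proof -
  assume x: "x \<in> rs_pts S" "x \<notin> chart k"
  obtain j where j: "x \<in> chart j" using chart_cover[OF x(1)] by blast
  then have "j \<noteq> k" using x(2) by blast
  then have "j = (\<not> k)" by blast
  then show ?thesis using j by simp
qed

abbreviation coord_section where "coord_section k \<equiv> pullback_section S P1 a P1_O1 (P1_var k)"

text \<open>The basis is hidden, because the invertibility of brackets and the local relation for
  the cross-ratio refer to coordinates only; \<open>frame\<close> exposes it.\<close>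

definition coords :: "'a set \<Rightarrow> (bool \<Rightarrow> 'b) \<Rightarrow> bool" where
  "coords U p \<longleftrightarrow> (\<exists>e. basis S \<P> U e \<and> (\<forall>k. p k \<in> carrier (X.\<O> U) \<and>
     ms_res \<P> (rs_pts S) U (coord_section k) = p k \<odot>\<^bsub>ms_mod \<P> U\<^esub> e))"

lemma coords_open: "coords U p \<Longrightarrow> X.opn U" and coords_in: "coords U p \<Longrightarrow> p k \<in> carrier (X.\<O> U)"
  unfolding coords_def by (metis basisD(1), metis)

sublocale \<P>: mod_sheaf S \<P> by (rule pullback_mod_sheaf)

lemma pre_pts: "pre (rs_pts P1) = rs_pts S"
  using pt_in by (auto simp: mem_pre)

lemma coord_section_in: "coord_section k \<in> carrier (ms_mod \<P> (rs_pts S))"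
  using local_pullback_in[OF _ P1_var_global] unfolding pullback_section_eq pre_pts by simp

abbreviation ratio where "ratio k j \<equiv> mor_sec a (P1_chart k) (dehom k 1 (xvar j))"

lemma ratio_in: "ratio k j \<in> carrier (X.\<O> (chart k))"
  by (rule sec_in[OF P1_chart_open dehom_in[OF xvar_bihom]])

lemma chart_basis: "basis S \<P> (chart k) (ms_res \<P> (rs_pts S) (chart k) (coord_section k))"
  and coord_ratio: "ms_res \<P> (rs_pts S) (chart k) (coord_section j) =
     ratio k j \<odot>\<^bsub>ms_mod \<P> (chart k)\<^esub> ms_res \<P> (rs_pts S) (chart k) (coord_section k)"
proof -
  have r: "ms_res P1_O1 (rs_pts P1) (P1_chart k) (P1_var j) = restrict (P1_var j) (P1_chart k)" for j
    by (simp add: P1_simps)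
  have eq: "ms_res \<P> (rs_pts S) (chart k) (coord_section j) =
      local_pullback S P1 a P1_O1 (P1_chart k) (restrict (P1_var j) (P1_chart k))" for j
    using local_pullback_res[OF openin_topspace P1_chart_open openin_subset[OF P1_chart_open] P1_var_global, of k j]
    by (simp only: pullback_section_eq pre_pts r)
  show "basis S \<P> (chart k) (ms_res \<P> (rs_pts S) (chart k) (coord_section k))"
    unfolding eq by (rule local_pullback_basis[OF P1_var_basis])
  show "ms_res \<P> (rs_pts S) (chart k) (coord_section j) =
     ratio k j \<odot>\<^bsub>ms_mod \<P> (chart k)\<^esub> ms_res \<P> (rs_pts S) (chart k) (coord_section k)"
    unfolding eq P1_var_ratio[of j k] by (rule local_pullback_scale[OF P1_var_basis dehom_in[OF xvar_bihom]])
qed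

text \<open>Over chart \<open>k\<close> the pullback of \<open>x_k\<close> is itself a basis, so
  \<open>p k\<close> is the coefficient between two bases. The second claim identifies the ratio of
  the coordinates with the pullback of \<open>x_j / x_k\<close>.\<close>

lemma coords_chart:
  assumes c: "coords U p"
  shows "X.res U (U \<inter> chart k) (p k) \<in> Units (X.\<O> (U \<inter> chart k))"
    and "X.res U (U \<inter> chart k) (p j) =
      X.res (chart k) (U \<inter> chart k) (ratio k j) \<otimes>\<^bsub>X.\<O> (U \<inter> chart k)\<^esub> X.res U (U \<inter> chart k) (p k)"
proof -
  obtain e where e: "basis S \<P> U e" and p: "\<And>k. p k \<in> carrier (X.\<O> U)"
    "\<And>k. ms_res \<P> (rs_pts S) U (coord_section k) = p k \<odot>\<^bsub>ms_mod \<P> U\<^esub> e"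
    using c unfolding coords_def by metis
  note U = basisD(1,2)[OF e]
  let ?V = "U \<inter> chart k"
  have V: "X.opn ?V" "?V \<subseteq> U" "?V \<subseteq> chart k" using U chart_open by auto
  have sub: "U \<subseteq> rs_pts S" "chart k \<subseteq> rs_pts S" using openin_subset U chart_open by auto
  interpret V: module "X.\<O> ?V" "ms_mod \<P> ?V" by (rule \<P>.module[OF V(1)])
  let ?e = "ms_res \<P> U ?V e" and ?p = "\<lambda>k. X.res U ?V (p k)" and ?s = "\<lambda>k. ms_res \<P> (rs_pts S) ?V (coord_section k)"
  let ?f = "\<lambda>j. X.res (chart k) ?V (ratio k j)"
  have eV: "basis S \<P> ?V ?e" by (rule \<P>.basis_res[OF e V(1,2)])
  note eVc = basisD(2)[OF eV]
  have pV: "?p j \<in> carrier (X.\<O> ?V)" and fV: "?f j \<in> carrier (X.\<O> ?V)" for j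
    using X.\<O>.res_in[OF U(1) V(1,2) p(1)] X.\<O>.res_in[OF chart_open V(1,3) ratio_in] by auto
  have s: "?s j = ?p j \<odot>\<^bsub>ms_mod \<P> ?V\<^esub> ?e" for j
    using \<P>.\<M>.res_res[OF openin_topspace U(1) V(1,2) sub(1) coord_section_in, of j]
      \<P>.mres_smult[OF U(1) V(1,2) p(1) U(2)] unfolding p(2) by simp
  have rr: "ms_res \<P> (chart k) ?V (ms_res \<P> (rs_pts S) (chart k) (coord_section j)) = ?s j" for j
    by (rule \<P>.\<M>.res_res[OF openin_topspace chart_open V(1,3) sub(2) coord_section_in])
  have s': "basis S \<P> ?V (?s k)" "?s j = ?f j \<odot>\<^bsub>ms_mod \<P> ?V\<^esub> ?s k" for j
    using \<P>.basis_res[OF chart_basis V(1,3)]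
      \<P>.mres_smult[OF chart_open V(1,3) ratio_in basisD(2)[OF chart_basis], of j]
    unfolding coord_ratio[of k j, symmetric] rr .
  show "?p k \<in> Units (X.\<O> ?V)" by (rule \<P>.basis_coef_Units[OF eV s'(1) pV s])
  have "?p j \<odot>\<^bsub>ms_mod \<P> ?V\<^esub> ms_res \<P> U ?V e = (?f j \<otimes>\<^bsub>X.\<O> ?V\<^esub> ?p k) \<odot>\<^bsub>ms_mod \<P> ?V\<^esub> ms_res \<P> U ?V e"
    using s'(2)[of j] fV pV eVc unfolding s by (simp add: V.smult_assoc1)
  then show "?p j = ?f j \<otimes>\<^bsub>X.\<O> ?V\<^esub> ?p k"
    by (rule \<P>.basis_cancel[OF e V(1,2), rotated -1]) (use pV fV in auto)
qed

end

section \<open>Values in the residue field of a point\<close>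

locale P1_residue = P1_point S a for S :: "('a, 'b) ringed_space" and a +
  fixes x and M
  assumes x: "x \<in> rs_pts S" and M: "maximalideal M (rs_stalk S x)"
begin

abbreviation \<kappa> where "\<kappa> \<equiv> rs_stalk S x Quot M"
abbreviation cl where "cl U s \<equiv> M +>\<^bsub>rs_stalk S x\<^esub> rs_germ S x U s"

lemma field_\<kappa>: "field \<kappa>"
  by (rule maximalideal.quotient_is_field[OF M X.cring_stalk[OF x]])

lemma zero_\<kappa>: "\<zero>\<^bsub>\<kappa>\<^esub> = M" by (simp add: FactRing_def)

text \<open>The coset vanishes exactly for elements of \<open>M\<close>, and in a local ring these
  are exactly the non-units.\<close>

lemma coset_zero_iff:
  assumes "A \<in> carrier (rs_stalk S x)"
  shows "M +>\<^bsub>rs_stalk S x\<^esub> A = \<zero>\<^bsub>\<kappa>\<^esub> \<longleftrightarrow> A \<notin> Units (rs_stalk S x)"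
proof -
  interpret R: cring "rs_stalk S x" by (rule X.cring_stalk[OF x])
  interpret M: maximalideal M "rs_stalk S x" by (rule M)
  have loc: "local_ring (rs_stalk S x)" using lrs x by (simp add: locally_ringed_space_def)
  have "M +>\<^bsub>rs_stalk S x\<^esub> A = M \<longleftrightarrow> A \<in> M"
    using M.a_rcos_self[OF assms] R.a_rcos_zero[OF M.ideal_axioms] by metis
  also have "\<dots> \<longleftrightarrow> A \<notin> Units (rs_stalk S x)"
  proof
    assume A: "A \<in> M"
    show "A \<notin> Units (rs_stalk S x)"
    proof
      assume "A \<in> Units (rs_stalk S x)"
      then obtain B where "B \<in> carrier (rs_stalk S x)" "B \<otimes>\<^bsub>rs_stalk S x\<^esub> A = \<one>\<^bsub>rs_stalk S x\<^esub>" unfolding Units_def by blast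
      then have "\<one>\<^bsub>rs_stalk S x\<^esub> \<in> M" using M.I_l_closed[OF A] by metis
      then show False using M.one_imp_carrier M.I_notcarr by simp
    qed
  qed (use local_ring_nonunit[OF loc M assms] in blast)
  finally show ?thesis unfolding zero_\<kappa> .
qed

lemma cl_hom:
  assumes "X.opn U" "x \<in> U"
  shows "cl U \<in> ring_hom (X.\<O> U) \<kappa>"
proof -
  interpret M: maximalideal M "rs_stalk S x" by (rule M)
  have "(+>\<^bsub>rs_stalk S x\<^esub>) M \<circ> rs_germ S x U \<in> ring_hom (X.\<O> U) \<kappa>"
    by (rule ring_hom_trans[OF X.germ_hom[OF assms] M.rcos_ring_hom])
  then show ?thesis by (simp add: comp_def)
qed

lemma cl_res: "X.opn U \<Longrightarrow> X.opn V \<Longrightarrow> x \<in> V \<Longrightarrow> V \<subseteq> U \<Longrightarrow> s \<in> carrier (X.\<O> U) \<Longrightarrow> cl V (X.res U V s) = cl U s"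
  by (simp add: X.\<O>.germ_res)

lemma cl_zero_iff:
  "X.opn U \<Longrightarrow> x \<in> U \<Longrightarrow> s \<in> carrier (X.\<O> U) \<Longrightarrow> cl U s = \<zero>\<^bsub>\<kappa>\<^esub> \<longleftrightarrow> rs_germ S x U s \<notin> Units (rs_stalk S x)"
  by (rule coset_zero_iff) (rule X.\<O>.stalk_in)

text \<open>What the composite of \<open>a\<close> with the residue field point at \<open>x\<close>
  does to sections of the projective line; compare \<open>test_point\<close>.\<close>

definition ev :: "P1_pt set \<Rightarrow> P1_sec \<Rightarrow> ('a set \<times> 'b) set set" where "ev V s = cl (pre V) (mor_sec a V s)"

lemma ev_hom:
  assumes "openin (rs_top P1) V" "x \<in> pre V"
  shows "ring_hom_cring (rs_ring P1 V) \<kappa> (ev V)"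
proof -
  have "cl (pre V) \<circ> mor_sec a V \<in> ring_hom (rs_ring P1 V) \<kappa>"
    by (rule ring_hom_trans[OF sec_hom[OF assms(1)] cl_hom[OF pre_open[OF assms(1)] assms(2)]])
  moreover have "cl (pre V) \<circ> mor_sec a V = ev V" by (simp add: comp_def ev_def fun_eq_iff)
  ultimately show ?thesis
    using Y.cring_\<O>[OF assms(1)] field.axioms(1)[OF field_\<kappa>]
    by (simp add: ring_hom_cring_def ring_hom_cring_axioms_def domain_def)
qed

lemma ev_res:
  assumes "openin (rs_top P1) V" "openin (rs_top P1) W" "W \<subseteq> V" "x \<in> pre W" "s \<in> carrier (rs_ring P1 V)"
  shows "ev W (rs_res P1 V W s) = ev V s"
  unfolding ev_def sec_nat[OF assms(1-3,5), symmetric]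
  by (rule cl_res[OF pre_open[OF assms(1)] pre_open[OF assms(2)] assms(4) pre_mono[OF assms(3)] sec_in[OF assms(1,5)]])

text \<open>So \<open>ev\<close> recovers the homogeneous prime \<open>pt x\<close> through the
  forms that vanish at \<open>x\<close>. Units go to units under any ring homomorphism; that
  non-units go to non-units is the locality of the morphism \<open>a\<close>.\<close>

lemma ev_dehom_zero_iff:
  assumes k: "x \<in> chart k" and h: "h \<in> bihom d"
  shows "ev (P1_chart k) (dehom k d h) = \<zero>\<^bsub>\<kappa>\<^esub> \<longleftrightarrow> h \<in> pt x"
proof -
  let ?g = "rs_germ P1 (pt x) (P1_chart k) (dehom k d h)"
  have pk: "pt x \<in> P1_chart k" using k mem_pre by blast
  note dh = dehom_in[OF h]
  have gin: "?g \<in> carrier (rs_stalk P1 (pt x))" by (rule Y.\<O>.stalk_in[OF P1_chart_open pk dh])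
  have "rs_germ S x (chart k) (mor_sec a (P1_chart k) (dehom k d h)) = stalk_map S a x ?g"
    by (rule stalk_map_germ[OF P1_chart_open k dh, symmetric])
  then have "ev (P1_chart k) (dehom k d h) = \<zero>\<^bsub>\<kappa>\<^esub> \<longleftrightarrow> stalk_map S a x ?g \<notin> Units (rs_stalk S x)"
    unfolding ev_def using cl_zero_iff[OF chart_open k sec_in[OF P1_chart_open dh]] by simp
  also have "\<dots> \<longleftrightarrow> ?g \<notin> Units (rs_stalk P1 (pt x))"
  proof
    assume n: "stalk_map S a x ?g \<notin> Units (rs_stalk S x)"
    show "?g \<notin> Units (rs_stalk P1 (pt x))"
    proof
      assume u: "?g \<in> Units (rs_stalk P1 (pt x))"
      then obtain B where B: "B \<in> carrier (rs_stalk P1 (pt x))" "B \<otimes>\<^bsub>rs_stalk P1 (pt x)\<^esub> ?g = \<one>\<^bsub>rs_stalk P1 (pt x)\<^esub>"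
        "?g \<otimes>\<^bsub>rs_stalk P1 (pt x)\<^esub> B = \<one>\<^bsub>rs_stalk P1 (pt x)\<^esub>" unfolding Units_def by blast
      note h = stalk_map_hom[OF x]
      have "stalk_map S a x B \<in> carrier (rs_stalk S x)" "stalk_map S a x ?g \<in> carrier (rs_stalk S x)"
        using ring_hom_closed[OF h] B(1) gin by auto
      moreover have "stalk_map S a x B \<otimes>\<^bsub>rs_stalk S x\<^esub> stalk_map S a x ?g = \<one>\<^bsub>rs_stalk S x\<^esub>"
        "stalk_map S a x ?g \<otimes>\<^bsub>rs_stalk S x\<^esub> stalk_map S a x B = \<one>\<^bsub>rs_stalk S x\<^esub>"
        using ring_hom_mult[OF h B(1) gin] ring_hom_mult[OF h gin B(1)] B ring_hom_one[OF h] by auto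
      ultimately show False using n unfolding Units_def by blast
    qed
  next
    assume "?g \<notin> Units (rs_stalk P1 (pt x))"
    then show "stalk_map S a x ?g \<notin> Units (rs_stalk S x)"
      using hom x gin unfolding lrs_hom_def by blast
  qed
  also have "\<dots> \<longleftrightarrow> h \<in> pt x" using dehom_unit[OF pk h] dehom_nonunit[OF pk h] by blast
  finally show ?thesis .
qed

text \<open>The values at \<open>x\<close> are homogeneous coordinates over the residue field, not
  all zero and with ratios given by \<open>ev\<close>. If \<open>x\<close> lies outside chart
  \<open>k\<close>, it lies in the other chart and \<open>x_k\<close> belongs to the prime
  \<open>pt x\<close>, so the ratio of \<open>x_k\<close> to the other variable vanishes at
  \<open>x\<close>.\<close>

lemma coords_residue:
  assumes c: "coords U p" and xU: "x \<in> U"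
  shows "x \<in> chart k \<Longrightarrow> cl U (p k) \<noteq> \<zero>\<^bsub>\<kappa>\<^esub>"
    and "x \<in> chart k \<Longrightarrow> cl U (p j) = ev (P1_chart k) (dehom k 1 (xvar j)) \<otimes>\<^bsub>\<kappa>\<^esub> cl U (p k)"
    and "x \<notin> chart k \<Longrightarrow> cl U (p k) = \<zero>\<^bsub>\<kappa>\<^esub>"
proof -
  interpret K: field \<kappa> by (rule field_\<kappa>)
  obtain e where e: "basis S \<P> U e" and p: "\<And>k. p k \<in> carrier (X.\<O> U)" using c unfolding coords_def by metis
  note U = basisD(1)[OF e]
  have clin: "cl U (p j) \<in> carrier \<kappa>" for j using ring_hom_closed[OF cl_hom[OF U xU] p] .
  have 1: "cl U (p k) \<noteq> \<zero>\<^bsub>\<kappa>\<^esub> \<and> cl U (p j) = ev (P1_chart k) (dehom k 1 (xvar j)) \<otimes>\<^bsub>\<kappa>\<^esub> cl U (p k)"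
    if k: "x \<in> chart k" for j k
  proof -
    let ?V = "U \<inter> chart k"
    have V: "X.opn ?V" "x \<in> ?V" "?V \<subseteq> U" "?V \<subseteq> chart k" using U chart_open k xU by auto
    note r = cl_res[OF U V(1-3) p] cl_res[OF chart_open V(1,2,4) ratio_in]
    have "rs_germ S x U (p k) \<in> Units (rs_stalk S x)"
      unfolding X.germ_Units_iff[OF U xU p] using coords_chart(1)[OF c] V by blast
    then have "cl U (p k) \<noteq> \<zero>\<^bsub>\<kappa>\<^esub>" using cl_zero_iff[OF U xU p] by simp
    moreover have "cl U (p j) = cl (chart k) (ratio k j) \<otimes>\<^bsub>\<kappa>\<^esub> cl U (p k)"
      using coords_chart(2)[OF c, of k j] ring_hom_mult[OF cl_hom[OF V(1,2)] X.\<O>.res_in[OF chart_open V(1,4) ratio_in]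
          X.\<O>.res_in[OF U V(1,3) p], of j k] r by metis
    ultimately show ?thesis by (simp add: ev_def)
  qed
  show "x \<in> chart k \<Longrightarrow> cl U (p k) \<noteq> \<zero>\<^bsub>\<kappa>\<^esub>" using 1 by blast
  show "x \<in> chart k \<Longrightarrow> cl U (p j) = ev (P1_chart k) (dehom k 1 (xvar j)) \<otimes>\<^bsub>\<kappa>\<^esub> cl U (p k)" using 1 by blast
  show "cl U (p k) = \<zero>\<^bsub>\<kappa>\<^esub>" if k: "x \<notin> chart k"
  proof -
    have k': "x \<in> chart (\<not> k)" by (rule chart_other[OF x k])
    have "pt x \<in> P1_pts" using pt_in[OF x] by (simp add: P1_points)
    then have "xvar k \<in> pt x" using k x by (auto simp: mem_pre P1_chart_def)
    then have "ev (P1_chart (\<not> k)) (dehom (\<not> k) 1 (xvar k)) = \<zero>\<^bsub>\<kappa>\<^esub>"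
      using ev_dehom_zero_iff[OF k' xvar_bihom] by blast
    then show ?thesis using 1[OF k', of k] clin by simp
  qed
qed

text \<open>Sections over open sets without \<open>x\<close> go to \<open>{}\<close>, the element
  supplied for the zero ring of \<open>test_scheme\<close>. Sections of the source are cosets of
  germs, which is the type fixed for test schemes in \<open>strongly_distinct\<close>.\<close>

definition test_point :: "('a, ('a set \<times> 'b) set set, 'a, 'b) lrs_mor" where
  "test_point = \<lparr>mor_pt = (\<lambda>_. x), mor_sec = (\<lambda>U s. if x \<in> U then cl U s else {})\<rparr>"

abbreviation test_scheme where "test_scheme \<equiv> point_spec x \<kappa> {}"

text \<open>The condition on stalks holds because a non-unit germ at \<open>x\<close> has value zero
  in the residue field.\<close>

lemma test_point_hom: "test_point \<in> lrs_hom test_scheme S"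
proof -
  interpret K: field \<kappa> by (rule field_\<kappa>)
  interpret T: one_point test_scheme x by (rule point_spec_one_point[OF field_\<kappa>])
  have t: "mor_pt test_point = (\<lambda>_. x)" "\<And>U s. mor_sec test_point U s = (if x \<in> U then cl U s else {})"
    by (simp_all add: test_point_def)
  have pre: "mor_preim test_scheme test_point V = (if x \<in> V then {x} else {})" for V by (auto simp: mor_preim_def t T.pts)
  have ring: "rs_ring test_scheme U = (if x \<in> U then \<kappa> else
     \<lparr>carrier = {{}}, monoid.mult = (\<lambda>_ _. {}), one = {}, zero = {}, add = (\<lambda>_ _. {})\<rparr>)"
    "rs_res test_scheme U V s = (if x \<in> V then s else {})" for U V s by (simp_all add: point_spec_def)
  have m: "rs_morphism test_scheme S test_point"
  proof (intro rs_morphism.intro rs_morphism_axioms.intro X.ringed_axioms T.ringed_axioms)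
    show "continuous_map (rs_top test_scheme) (rs_top S) (mor_pt test_point)" by (simp add: t x)
    show "mor_sec test_point V \<in> ring_hom (X.\<O> V) (rs_ring test_scheme (mor_preim test_scheme test_point V))"
      if V: "X.opn V" for V
    proof (cases "x \<in> V")
      case True
      have "mor_sec test_point V = cl V" by (rule ext) (simp add: t True)
      moreover have "rs_ring test_scheme (mor_preim test_scheme test_point V) = \<kappa>" using True by (simp add: pre ring)
      ultimately show ?thesis using cl_hom[OF V True] by (simp only:)
    next
      case False
      then show ?thesis by (intro ring_hom_memI) (auto simp: pre ring t)
    qed
    fix V W s assume V: "X.opn V" "X.opn W" "W \<subseteq> V" "s \<in> carrier (X.\<O> V)"
    show "rs_res test_scheme (mor_preim test_scheme test_point V) (mor_preim test_scheme test_point W) (mor_sec test_point V s)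
      = mor_sec test_point W (X.res V W s)"
      using V cl_res[OF V(1,2) _ V(3,4)] by (auto simp: ring pre t)
  qed
  interpret m: rs_morphism test_scheme S test_point by (rule m)
  interpret KT: field "rs_stalk test_scheme x" by (rule T.field_stalk)
  show ?thesis
  proof (rule m.lrs_homI)
    fix x' A assume A: "x' \<in> rs_pts test_scheme" "A \<in> carrier (X.\<O>\<^sub>x (mor_pt test_point x'))"
      "A \<notin> Units (X.\<O>\<^sub>x (mor_pt test_point x'))"
    have x': "x' = x" "A \<in> carrier (X.\<O>\<^sub>x x)" "A \<notin> Units (X.\<O>\<^sub>x x)" using A by (auto simp: T.pts t)
    obtain V s where V: "X.opn V" "x \<in> V" "s \<in> carrier (X.\<O> V)" "A = rs_germ S x V s"
      using X.\<O>.stalk_repE[OF x'(2)] .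
    have xp: "x \<in> mor_preim test_scheme test_point V" using V by (simp add: pre)
    have "stalk_map test_scheme test_point x A = rs_germ test_scheme x {x} (cl V s)"
      using m.stalk_map_germ[OF V(1) xp V(3)] V by (simp add: t pre)
    also have "cl V s = \<zero>\<^bsub>rs_ring test_scheme {x}\<^esub>" using cl_zero_iff[OF V(1-3)] x'(3) V(4) by (simp add: ring)
    also have "rs_germ test_scheme x {x} \<dots> = \<zero>\<^bsub>rs_stalk test_scheme x\<^esub>" by (rule T.germ_zero[OF T.opn_pt]) simp
    finally show "stalk_map test_scheme test_point x' A \<notin> Units (rs_stalk test_scheme x')"
      using KT.field_Units x'(1) by simp
  qed
qed

end

section \<open>Two points that agree over a residue field\<close>

locale P1_residue_pair = A: P1_residue S a x M + B: P1_residue S b x M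
  for S :: "('a, 'b) ringed_space" and a b x M +
  fixes k :: bool
  assumes charts: "x \<in> A.chart k" "x \<in> B.chart k"
    and agree: "A.ev (P1_chart k) (dehom k 1 (xvar j)) = B.ev (P1_chart k) (dehom k 1 (xvar j))"
begin

text \<open>Both evaluations are ring homomorphisms on the functions over the chart and agree on the
  ratios \<open>x_j / x_k\<close>; since \<open>dehom\<close> is additive and multiplicative,
  \<open>bihom_induct\<close> extends this to all forms.\<close>

lemma agree_dehom:
  assumes "h \<in> bihom d"
  shows "A.ev (P1_chart k) (dehom k d h) = B.ev (P1_chart k) (dehom k d h)"
  using assms
proof (rule bihom_induct)
  interpret a: ring_hom_cring "rs_ring P1 (P1_chart k)" A.\<kappa> "A.ev (P1_chart k)" by (rule A.ev_hom[OF P1_chart_open charts(1)])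
  interpret b: ring_hom_cring "rs_ring P1 (P1_chart k)" A.\<kappa> "B.ev (P1_chart k)" by (rule B.ev_hom[OF P1_chart_open charts(2)])
  show "A.ev (P1_chart k) (dehom k d 0) = B.ev (P1_chart k) (dehom k d 0)" for d by (simp add: dehom_zero)
  show "A.ev (P1_chart k) (dehom k 0 1) = B.ev (P1_chart k) (dehom k 0 1)" by (simp add: dehom_one)
  show "A.ev (P1_chart k) (dehom k d (- h)) = B.ev (P1_chart k) (dehom k d (- h))"
    if "h \<in> bihom d" "A.ev (P1_chart k) (dehom k d h) = B.ev (P1_chart k) (dehom k d h)" for d h
    using that dehom_in[OF that(1)] by (simp add: dehom_minus)
  show "A.ev (P1_chart k) (dehom k d (h + h')) = B.ev (P1_chart k) (dehom k d (h + h'))"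
    if "h \<in> bihom d" "h' \<in> bihom d" "A.ev (P1_chart k) (dehom k d h) = B.ev (P1_chart k) (dehom k d h)"
      "A.ev (P1_chart k) (dehom k d h') = B.ev (P1_chart k) (dehom k d h')" for d h h'
    using that dehom_in[OF that(1)] dehom_in[OF that(2)] by (simp add: dehom_add)
  show "A.ev (P1_chart k) (dehom k (Suc d) (xvar j * h)) = B.ev (P1_chart k) (dehom k (Suc d) (xvar j * h))"
    if "h \<in> bihom d" "A.ev (P1_chart k) (dehom k d h) = B.ev (P1_chart k) (dehom k d h)" for d h j
    using that dehom_in[OF that(1)] dehom_in[OF xvar_bihom] agree[of j] dehom_mult[of k 1 d "xvar j" h] by simp
qed

text \<open>A homogeneous prime is determined by its forms, and by \<open>ev_dehom_zero_iff\<close>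
  these are the forms with value zero at \<open>x\<close>.\<close>

lemma same_point: "mor_pt a x = mor_pt b x"
proof (rule P1_pt_eqI)
  show "mor_pt a x \<in> P1_pts" "mor_pt b x \<in> P1_pts"
    using A.pt_in[OF A.x] B.pt_in[OF A.x] by (simp_all add: P1_points)
  show "h \<in> mor_pt a x \<longleftrightarrow> h \<in> mor_pt b x" if "h \<in> bihom d" for d h
    using A.ev_dehom_zero_iff[OF charts(1) that] B.ev_dehom_zero_iff[OF charts(2) that] agree_dehom[OF that] by simp
qed

text \<open>Near the image point \<open>s g = r\<close> for dehomogenized forms \<open>r\<close> and
  \<open>g\<close>, on which both evaluations agree, and the value of \<open>g\<close> is nonzero.
  So both values of \<open>s\<close> are the same quotient in the residue field.\<close>

lemma agree_ev:
  assumes V: "openin (rs_top P1) V" "x \<in> A.pre V" and s: "s \<in> carrier (rs_ring P1 V)"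
  shows "A.ev V s = B.ev V s"
proof -
  interpret K: field A.\<kappa> by (rule A.field_\<kappa>)
  have xp: "x \<in> A.pre W \<longleftrightarrow> x \<in> B.pre W" for W by (simp add: A.mem_pre B.mem_pre same_point)
  have pV: "mor_pt a x \<in> V" "mor_pt a x \<in> P1_chart k" using V charts A.mem_pre by auto
  obtain W d r g where W: "openin (rs_top P1) W" "mor_pt a x \<in> W" "W \<subseteq> V" "W \<subseteq> P1_chart k" "r \<in> bihom d" "g \<in> bihom d"
    "g \<notin> mor_pt a x"
    "rs_res P1 V W s \<otimes>\<^bsub>rs_ring P1 W\<^esub> rs_res P1 (P1_chart k) W (dehom k d g) = rs_res P1 (P1_chart k) W (dehom k d r)"
    using P1_section_as_quotient[OF V(1) pV s] .
  have xW: "x \<in> A.pre W" "x \<in> B.pre W" "x \<in> B.pre V" using W(2) A.x V xp by (auto simp: A.mem_pre)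
  have wi: "rs_res P1 V W s \<in> carrier (rs_ring P1 W)" "rs_res P1 (P1_chart k) W (dehom k d g) \<in> carrier (rs_ring P1 W)"
    using A.Y.\<O>.res_in[OF V(1) W(1,3) s] A.Y.\<O>.res_in[OF P1_chart_open W(1,4) dehom_in[OF W(6)]] by auto
  interpret a: ring_hom_cring "rs_ring P1 W" A.\<kappa> "A.ev W" by (rule A.ev_hom[OF W(1) xW(1)])
  interpret b: ring_hom_cring "rs_ring P1 W" A.\<kappa> "B.ev W" by (rule B.ev_hom[OF W(1) xW(2)])
  note ra = A.ev_res[OF V(1) W(1,3) xW(1) s] A.ev_res[OF P1_chart_open W(1,4) xW(1) dehom_in]
  note rb = B.ev_res[OF V(1) W(1,3) xW(2) s] B.ev_res[OF P1_chart_open W(1,4) xW(2) dehom_in]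
  let ?g = "A.ev (P1_chart k) (dehom k d g)"
  have "A.ev V s \<otimes>\<^bsub>A.\<kappa>\<^esub> ?g = A.ev (P1_chart k) (dehom k d r)"
    using a.hom_mult[OF wi] unfolding W(8) ra(1) ra(2)[OF W(5)] ra(2)[OF W(6)] by simp
  moreover have "B.ev V s \<otimes>\<^bsub>A.\<kappa>\<^esub> ?g = A.ev (P1_chart k) (dehom k d r)"
    using b.hom_mult[OF wi] unfolding W(8) rb(1) rb(2)[OF W(5)] rb(2)[OF W(6)] agree_dehom[OF W(5)] agree_dehom[OF W(6)]
    by simp
  moreover have "?g \<noteq> \<zero>\<^bsub>A.\<kappa>\<^esub>" using A.ev_dehom_zero_iff[OF charts(1) W(6)] W(7) by simp
  moreover have "A.ev V s \<in> carrier A.\<kappa>" "B.ev V s \<in> carrier A.\<kappa>" "?g \<in> carrier A.\<kappa>"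
    using a.hom_closed[OF wi(1)] b.hom_closed[OF wi(1)] a.hom_closed[OF wi(2)] unfolding ra(1) rb(1) ra(2)[OF W(6)] by auto
  ultimately show ?thesis using K.m_rcancel by metis
qed

text \<open>By \<open>same_point\<close> and \<open>agree_ev\<close> the two composites with
  \<open>test_point\<close> coincide. The universal property would then map the one-point test
  scheme to an equalizer without points.\<close>

lemma not_strongly_distinct: "\<not> strongly_distinct S P1 a b"
proof
  assume "strongly_distinct S P1 a b"
  then obtain E :: "('a, ('a set \<times> 'b) set set) ringed_space" and e where
    E: "is_equalizer S P1 a b E e" "rs_pts E = {}" unfolding strongly_distinct_def by blast
  interpret T: one_point A.test_scheme x by (rule point_spec_one_point[OF A.field_\<kappa>])
  have eq: "mor_eq A.test_scheme P1 (mor_comp S a A.test_point) (mor_comp S b A.test_point)"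
    unfolding mor_eq_def
  proof (intro conjI ballI allI impI)
    show "mor_pt (mor_comp S a A.test_point) y = mor_pt (mor_comp S b A.test_point) y" for y
      by (simp add: mor_comp_def A.test_point_def same_point)
    fix V s assume V: "openin (rs_top P1) V" and s: "s \<in> carrier (rs_ring P1 V)"
    have xp: "x \<in> A.pre V \<longleftrightarrow> x \<in> B.pre V" by (simp add: A.mem_pre B.mem_pre same_point)
    then show "mor_sec (mor_comp S a A.test_point) V s = mor_sec (mor_comp S b A.test_point) V s"
      using agree_ev[OF V _ s] by (simp add: mor_comp_def A.test_point_def A.ev_def B.ev_def)
  qed
  note univ = E(1)[unfolded is_equalizer_def, THEN conjunct2, THEN conjunct2, THEN conjunct2, rule_format,
      of A.test_scheme A.test_point]
  obtain u where "u \<in> lrs_hom A.test_scheme E"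
    using univ[OF conjI[OF point_spec_scheme[OF A.field_\<kappa>] conjI[OF A.test_point_hom eq]]] by (elim bexE)
  then have "mor_pt u x \<in> rs_pts E" unfolding lrs_hom_def continuous_map_def using T.pts by auto
  then show False using E(2) by simp
qed

end

lemma (in ring) minus_eq_zero_iff: "a \<in> carrier R \<Longrightarrow> b \<in> carrier R \<Longrightarrow> a \<ominus> b = \<zero> \<longleftrightarrow> a = b"
  by (metis a_minus_def add.inv_closed minus_equality r_neg)

definition bracket :: "('b, 'm) ring_scheme \<Rightarrow> (bool \<Rightarrow> 'b) \<Rightarrow> (bool \<Rightarrow> 'b) \<Rightarrow> 'b" where
  "bracket R p q = p False \<otimes>\<^bsub>R\<^esub> q True \<ominus>\<^bsub>R\<^esub> p True \<otimes>\<^bsub>R\<^esub> q False"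

lemma bracket_unit:
  assumes a: "P1_point S a" and b: "P1_point S b" and sd: "strongly_distinct S P1 a b"
    and p: "P1_point.coords S a U p" and q: "P1_point.coords S b U q"
  shows "bracket (rs_ring S U) p q \<in> Units (rs_ring S U)"
proof -
  interpret A: P1_point S a by fact
  interpret B: P1_point S b by fact
  have U: "A.X.opn U" and pin: "p j \<in> carrier (A.X.\<O> U)" and qin: "q j \<in> carrier (A.X.\<O> U)" for j
    using A.coords_open[OF p] A.coords_in[OF p] B.coords_in[OF q] by auto
  interpret U: cring "A.X.\<O> U" by (rule A.X.cring_\<O>[OF U])
  let ?b = "bracket (A.X.\<O> U) p q"
  have bin: "?b \<in> carrier (A.X.\<O> U)" using pin qin by (simp add: bracket_def)
  show ?thesis
  proof (rule A.X.Units_local[OF U bin])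
    fix x assume xU: "x \<in> U"
    have "rs_germ S x U ?b \<in> Units (A.X.\<O>\<^sub>x x)"
    proof (rule ccontr)
      assume nu: "rs_germ S x U ?b \<notin> Units (A.X.\<O>\<^sub>x x)"
      have x: "x \<in> rs_pts S" by (rule A.X.opn_pts[OF U xU])
      interpret R: cring "A.X.\<O>\<^sub>x x" by (rule A.X.cring_stalk[OF x])
      obtain M where M: "maximalideal M (A.X.\<O>\<^sub>x x)"
        using R.nonunit_in_maximalideal[OF A.X.\<O>.stalk_in[OF U xU bin] nu] .
      interpret A: P1_residue S a x M by (rule P1_residue.intro[OF A.P1_point_axioms P1_residue_axioms.intro[OF x M]])
      interpret B: P1_residue S b x M by (rule P1_residue.intro[OF B.P1_point_axioms P1_residue_axioms.intro[OF x M]])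
      interpret K: field A.\<kappa> by (rule A.field_\<kappa>)
      interpret c: ring_hom_cring "A.X.\<O> U" A.\<kappa> "A.cl U" by unfold_locales (rule A.cl_hom[OF U xU])
      let ?p = "\<lambda>j. A.cl U (p j)" and ?q = "\<lambda>j. A.cl U (q j)"
      have in\<kappa>: "?p j \<in> carrier A.\<kappa>" "?q j \<in> carrier A.\<kappa>" for j using pin qin by auto
      have "A.cl U ?b = \<zero>\<^bsub>A.\<kappa>\<^esub>" using A.cl_zero_iff[OF U xU bin] nu by simp
      then have "?p False \<otimes>\<^bsub>A.\<kappa>\<^esub> ?q True \<ominus>\<^bsub>A.\<kappa>\<^esub> ?p True \<otimes>\<^bsub>A.\<kappa>\<^esub> ?q False = \<zero>\<^bsub>A.\<kappa>\<^esub>"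
        using pin qin by (simp add: bracket_def U.minus_eq K.minus_eq)
      then have "?p False \<otimes>\<^bsub>A.\<kappa>\<^esub> ?q True = ?p True \<otimes>\<^bsub>A.\<kappa>\<^esub> ?q False"
        using in\<kappa> by (simp add: K.minus_eq_zero_iff)
      \<comment> \<open>All index pairs at once: equal indices are trivial, and unequal ones are the
        vanishing bracket or its mirror image.\<close>
      then have rel: "?p i \<otimes>\<^bsub>A.\<kappa>\<^esub> ?q j = ?p j \<otimes>\<^bsub>A.\<kappa>\<^esub> ?q i" for i j
        by (cases i; cases j) simp_all
      obtain k where k: "x \<in> A.chart k" using A.chart_cover[OF x] by blast
      note pk = A.coords_residue(1)[OF p xU k]
      \<comment> \<open>If \<open>q k\<close> vanished at \<open>x\<close>, then so would
        \<open>p k\<close> times the other coordinate of \<open>q\<close>; as \<open>p k\<close>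
        does not vanish, neither coordinate of \<open>q\<close> would survive.\<close>
      have k': "x \<in> B.chart k"
      proof (rule ccontr)
        assume n: "x \<notin> B.chart k"
        have "?q k = \<zero>\<^bsub>A.\<kappa>\<^esub>" by (rule B.coords_residue(3)[OF q xU n])
        then have "?p k \<otimes>\<^bsub>A.\<kappa>\<^esub> ?q (\<not> k) = \<zero>\<^bsub>A.\<kappa>\<^esub>" using rel[of k "\<not> k"] in\<kappa> by simp
        then have "?q (\<not> k) = \<zero>\<^bsub>A.\<kappa>\<^esub>" using K.integral in\<kappa> pk by blast
        then show False using B.coords_residue(1)[OF q xU B.chart_other[OF x n]] by simp
      qed
      note qk = B.coords_residue(1)[OF q xU k']
      have agree: "A.ev (P1_chart k) (dehom k 1 (xvar j)) = B.ev (P1_chart k) (dehom k 1 (xvar j))" (is "?a = ?b") for j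
      proof -
        have ab: "?a \<in> carrier A.\<kappa>" "?b \<in> carrier A.\<kappa>"
          by (rule ring_hom_closed[OF ring_hom_cring.homh[OF A.ev_hom[OF P1_chart_open k]] dehom_in[OF xvar_bihom]],
            rule ring_hom_closed[OF ring_hom_cring.homh[OF B.ev_hom[OF P1_chart_open k']] dehom_in[OF xvar_bihom]])
        \<comment> \<open>The ratios are compared after multiplication by the value of
          \<open>p k\<close> times \<open>q k\<close>, which is nonzero and can be
          cancelled.\<close>
        have "?a \<otimes>\<^bsub>A.\<kappa>\<^esub> (?p k \<otimes>\<^bsub>A.\<kappa>\<^esub> ?q k) = ?p j \<otimes>\<^bsub>A.\<kappa>\<^esub> ?q k"
          using A.coords_residue(2)[OF p xU k, of j] ab in\<kappa> by (simp add: K.m_assoc)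
        also have "\<dots> = ?p k \<otimes>\<^bsub>A.\<kappa>\<^esub> ?q j" by (rule rel)
        also have "\<dots> = ?b \<otimes>\<^bsub>A.\<kappa>\<^esub> (?p k \<otimes>\<^bsub>A.\<kappa>\<^esub> ?q k)"
          using B.coords_residue(2)[OF q xU k', of j] ab in\<kappa> by (simp add: K.m_lcomm)
        finally show ?thesis
          using K.m_rcancel[of "?p k \<otimes>\<^bsub>A.\<kappa>\<^esub> ?q k" ?a ?b] ab in\<kappa> pk qk K.integral_iff by simp
      qed
      interpret P1_residue_pair S a b x M k
        by (rule P1_residue_pair.intro[OF A.P1_residue_axioms B.P1_residue_axioms P1_residue_pair_axioms.intro[OF k k' agree]])
      show False using not_strongly_distinct sd by blast
    qed
    then show "\<exists>V. A.X.opn V \<and> x \<in> V \<and> V \<subseteq> U \<and> A.X.res U V ?b \<in> Units (A.X.\<O> V)"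
      by (rule iffD1[OF A.X.germ_Units_iff[OF U xU bin]])
  qed
qed


section \<open>The cross-ratio\<close>

context cring
begin

lemma bracket_in: "(\<And>k. p k \<in> carrier R) \<Longrightarrow> (\<And>k. q k \<in> carrier R) \<Longrightarrow> bracket R p q \<in> carrier R"
  by (simp add: bracket_def)

lemma bracket_swap:
  assumes "\<And>k. p k \<in> carrier R" "\<And>k. q k \<in> carrier R"
  shows "bracket R q p = \<ominus> bracket R p q"
  using assms unfolding bracket_def by (simp add: minus_eq minus_add m_comm a_comm)

lemma bracket_scale:
  assumes "\<And>k. p k \<in> carrier R" "\<And>k. q k \<in> carrier R" "u \<in> carrier R" "v \<in> carrier R"
  shows "bracket R (\<lambda>k. u \<otimes> p k) (\<lambda>k. v \<otimes> q k) = u \<otimes> (v \<otimes> bracket R p q)"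
proof -
  have "(u \<otimes> x) \<otimes> (v \<otimes> y') \<ominus> (u \<otimes> x') \<otimes> (v \<otimes> y) = u \<otimes> (v \<otimes> (x \<otimes> y' \<ominus> x' \<otimes> y))"
    if "x \<in> carrier R" "x' \<in> carrier R" "y \<in> carrier R" "y' \<in> carrier R" for x x' y y'
    using that assms(3,4) by algebra
  from this[OF assms(1,1,2,2)] show ?thesis unfolding bracket_def .
qed

lemma bracket_pluecker:
  assumes "\<And>k. p k \<in> carrier R" "\<And>k. q k \<in> carrier R" "\<And>k. r k \<in> carrier R" "\<And>k. s k \<in> carrier R"
  shows "bracket R p r \<otimes> bracket R q s \<ominus> bracket R p s \<otimes> bracket R q r = bracket R p q \<otimes> bracket R r s"
proof -
  have "(a \<otimes> c' \<ominus> a' \<otimes> c) \<otimes> (b \<otimes> d' \<ominus> b' \<otimes> d) \<ominus> (a \<otimes> d' \<ominus> a' \<otimes> d) \<otimes> (b \<otimes> c' \<ominus> b' \<otimes> c)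
      = (a \<otimes> b' \<ominus> a' \<otimes> b) \<otimes> (c \<otimes> d' \<ominus> c' \<otimes> d)"
    if "a \<in> carrier R" "a' \<in> carrier R" "b \<in> carrier R" "b' \<in> carrier R"
      "c \<in> carrier R" "c' \<in> carrier R" "d \<in> carrier R" "d' \<in> carrier R" for a a' b b' c c' d d'
    using that by algebra
  from this[OF assms(1,1,2,2,3,3,4,4)] show ?thesis unfolding bracket_def .
qed

lemma Units_uminus: "u \<in> Units R \<Longrightarrow> \<ominus> u \<in> Units R"
proof -
  assume u: "u \<in> Units R"
  then have c: "u \<in> carrier R" "inv u \<in> carrier R" "inv u \<otimes> u = \<one>" "u \<otimes> inv u = \<one>" by auto
  then show ?thesis unfolding Units_def by (auto simp: l_minus r_minus intro!: bexI[of _ "\<ominus> (inv u)"])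
qed

lemma unit_eqI: "u \<in> Units R \<Longrightarrow> x \<in> carrier R \<Longrightarrow> y \<in> carrier R \<Longrightarrow> u \<otimes> x = u \<otimes> y \<Longrightarrow> x = y"
  by simp

text \<open>The coordinates of three points are multiplied by \<open>a\<close>, \<open>c\<close> and
  the unit \<open>w\<close>; \<open>l\<close> and \<open>l'\<close> stand for
  \<open>[p r]/[q r]\<close> before and after. The factor \<open>w\<close> cancels, so
  \<open>l'\<close> compares to \<open>l\<close> like \<open>a\<close> to \<open>c\<close>. Only
  \<open>w\<close> and the denominator are units, hence the form without division.\<close>

lemma scaled_quotient:
  assumes "c \<in> carrier R" "a \<in> carrier R" "w \<in> Units R" "B \<in> Units R" "C \<in> carrier R" "l \<in> carrier R" "l' \<in> carrier R"
    and "l \<otimes> B = C" "l' \<otimes> (c \<otimes> (w \<otimes> B)) = a \<otimes> (w \<otimes> C)"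
  shows "c \<otimes> l' = a \<otimes> l"
proof (rule unit_eqI[of "w \<otimes> B"])
  have k: "w \<in> carrier R" "B \<in> carrier R" using assms by auto
  have "(w \<otimes> B) \<otimes> (c \<otimes> l') = l' \<otimes> (c \<otimes> (w \<otimes> B))" using assms(1,7) k by algebra
  also have "\<dots> = a \<otimes> (w \<otimes> (l \<otimes> B))" using assms(8,9) by simp
  also have "\<dots> = (w \<otimes> B) \<otimes> (a \<otimes> l)" using assms(2,6) k by algebra
  finally show "(w \<otimes> B) \<otimes> (c \<otimes> l') = (w \<otimes> B) \<otimes> (a \<otimes> l)" .
qed (use assms in auto)

text \<open>The coordinates are multiplied by \<open>a\<close>, \<open>v\<close> and
  \<open>w\<close>, and \<open>m\<close> stands for \<open>[q r]/([p q][p r])\<close>, with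
  \<open>P\<close>, \<open>Q\<close>, \<open>C\<close> for \<open>[p q]\<close>,
  \<open>[p r]\<close>, \<open>[q r]\<close>. The factors \<open>v\<close> and \<open>w\<close>
  cancel and the square of \<open>a\<close> remains.\<close>

lemma scaled_square_quotient:
  assumes "a \<in> carrier R" "v \<in> Units R" "w \<in> Units R" "P \<in> Units R" "Q \<in> Units R" "C \<in> carrier R" "m \<in> carrier R" "m' \<in> carrier R"
    and "m \<otimes> (P \<otimes> Q) = C" "m' \<otimes> ((a \<otimes> (v \<otimes> P)) \<otimes> (a \<otimes> (w \<otimes> Q))) = v \<otimes> (w \<otimes> C)"
  shows "m = (a \<otimes> a) \<otimes> m'"
proof (rule unit_eqI[of "(v \<otimes> w) \<otimes> (P \<otimes> Q)"])
  have k: "v \<in> carrier R" "w \<in> carrier R" "P \<in> carrier R" "Q \<in> carrier R" using assms by auto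
  have "((v \<otimes> w) \<otimes> (P \<otimes> Q)) \<otimes> m = v \<otimes> (w \<otimes> (m \<otimes> (P \<otimes> Q)))" using assms(7) k by algebra
  also have "\<dots> = m' \<otimes> ((a \<otimes> (v \<otimes> P)) \<otimes> (a \<otimes> (w \<otimes> Q)))" using assms(9,10) by simp
  also have "\<dots> = ((v \<otimes> w) \<otimes> (P \<otimes> Q)) \<otimes> ((a \<otimes> a) \<otimes> m')" using assms(1,8) k by algebra
  finally show "((v \<otimes> w) \<otimes> (P \<otimes> Q)) \<otimes> m = ((v \<otimes> w) \<otimes> (P \<otimes> Q)) \<otimes> ((a \<otimes> a) \<otimes> m')" .
qed (use assms in auto)

text \<open>Each point occurs once in the numerator and once in the denominator, so the factors
  \<open>u\<close>, \<open>v\<close>, \<open>w\<close>, \<open>t\<close> of the four points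
  cancel.\<close>

lemma scaled_cross_ratio:
  assumes "u \<in> Units R" "v \<in> Units R" "w \<in> Units R" "t \<in> Units R" "P \<in> Units R" "Q \<in> Units R"
    and "C \<in> carrier R" "D \<in> carrier R" "m \<in> carrier R" "m' \<in> carrier R"
    and "m \<otimes> (P \<otimes> Q) = C \<otimes> D"
    and "m' \<otimes> ((u \<otimes> (t \<otimes> P)) \<otimes> (v \<otimes> (w \<otimes> Q))) = (u \<otimes> (w \<otimes> C)) \<otimes> (v \<otimes> (t \<otimes> D))"
  shows "m = m'"
proof (rule unit_eqI[of "((u \<otimes> v) \<otimes> (w \<otimes> t)) \<otimes> (P \<otimes> Q)"])
  have k: "u \<in> carrier R" "v \<in> carrier R" "w \<in> carrier R" "t \<in> carrier R" "P \<in> carrier R" "Q \<in> carrier R"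
    using assms by auto
  have "(((u \<otimes> v) \<otimes> (w \<otimes> t)) \<otimes> (P \<otimes> Q)) \<otimes> m = ((u \<otimes> v) \<otimes> (w \<otimes> t)) \<otimes> (m \<otimes> (P \<otimes> Q))" using assms(9) k by algebra
  also have "\<dots> = (u \<otimes> (w \<otimes> C)) \<otimes> (v \<otimes> (t \<otimes> D))" unfolding assms(11) using assms(7,8) k by algebra
  also have "\<dots> = m' \<otimes> ((u \<otimes> (t \<otimes> P)) \<otimes> (v \<otimes> (w \<otimes> Q)))" using assms(12) by simp
  also have "\<dots> = (((u \<otimes> v) \<otimes> (w \<otimes> t)) \<otimes> (P \<otimes> Q)) \<otimes> m'" using assms(10) k by algebra
  finally show "(((u \<otimes> v) \<otimes> (w \<otimes> t)) \<otimes> (P \<otimes> Q)) \<otimes> m = (((u \<otimes> v) \<otimes> (w \<otimes> t)) \<otimes> (P \<otimes> Q)) \<otimes> m'" .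
qed (use assms in auto)

text \<open>Exchanging the two pairs reverses all four brackets, and the signs cancel on each
  side.\<close>

lemma cross_ratio_exchange:
  assumes "\<And>k. p k \<in> carrier R" "\<And>k. q k \<in> carrier R" "\<And>k. r k \<in> carrier R" "\<And>k. s k \<in> carrier R" "m \<in> carrier R"
    and "m \<otimes> (bracket R p s \<otimes> bracket R q r) = bracket R p r \<otimes> bracket R q s"
  shows "m \<otimes> (bracket R r q \<otimes> bracket R s p) = bracket R r p \<otimes> bracket R s q"
proof -
  note b = bracket_in[OF assms(1,4)] bracket_in[OF assms(2,3)] bracket_in[OF assms(1,3)] bracket_in[OF assms(2,4)]
  have "m \<otimes> (bracket R r q \<otimes> bracket R s p) = m \<otimes> (bracket R p s \<otimes> bracket R q r)"
    unfolding bracket_swap[OF assms(2,3)] bracket_swap[OF assms(1,4)] using b by (simp add: l_minus r_minus m_comm)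
  also have "\<dots> = bracket R p r \<otimes> bracket R q s" by (rule assms(6))
  also have "\<dots> = bracket R r p \<otimes> bracket R s q"
    unfolding bracket_swap[OF assms(1,3)] bracket_swap[OF assms(2,4)] using b by (simp add: l_minus r_minus)
  finally show ?thesis .
qed

text \<open>Reversing \<open>[q r]\<close> and inserting the relation for \<open>m\<close> turns the
  left side into \<open>[p r][q s] - [p s][q r]\<close>, the left side of
  \<open>bracket_pluecker\<close>.\<close>

lemma cross_ratio_complement:
  assumes "\<And>k. p k \<in> carrier R" "\<And>k. q k \<in> carrier R" "\<And>k. r k \<in> carrier R" "\<And>k. s k \<in> carrier R" "m \<in> carrier R"
    and "m \<otimes> (bracket R p s \<otimes> bracket R q r) = bracket R p r \<otimes> bracket R q s"
  shows "(\<one> \<ominus> m) \<otimes> (bracket R p s \<otimes> bracket R r q) = bracket R p q \<otimes> bracket R r s"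
proof -
  have b: "bracket R p s \<in> carrier R" "bracket R q r \<in> carrier R" using assms(1-4) by (simp_all add: bracket_in)
  have "(\<one> \<ominus> m) \<otimes> (x \<otimes> (\<ominus> y)) = m \<otimes> (x \<otimes> y) \<ominus> x \<otimes> y" if "x \<in> carrier R" "y \<in> carrier R" for x y
    using that assms(5) by algebra
  from this[OF b] show ?thesis
    unfolding bracket_swap[OF assms(2,3)] assms(6) bracket_pluecker[OF assms(1-4)] .
qed

text \<open>Exchanging the first two points exchanges numerator and denominator; no bracket is
  reversed, so no sign occurs.\<close>

lemma cross_ratio_inverse:
  assumes "m \<in> carrier R" "m' \<in> carrier R" "P \<in> carrier R" "Q \<in> carrier R" "C \<in> carrier R" "D \<in> carrier R"
    and "m' \<otimes> m = \<one>" "m \<otimes> (P \<otimes> Q) = C \<otimes> D"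
  shows "m' \<otimes> (D \<otimes> C) = Q \<otimes> P"
proof -
  have "m' \<otimes> (D \<otimes> C) = m' \<otimes> (m \<otimes> (P \<otimes> Q))" unfolding assms(8) using assms(5,6) by (simp add: m_comm)
  also have "\<dots> = (m' \<otimes> m) \<otimes> (P \<otimes> Q)" using assms(1-4) by algebra
  also have "\<dots> = Q \<otimes> P" unfolding assms(7) using assms(3,4) by (simp add: m_comm)
  finally show ?thesis .
qed

lemma Units_of_quotient:
  assumes "m \<in> carrier R" "u \<in> Units R" "v \<in> Units R" "m \<otimes> u = v"
  shows "m \<in> Units R"
proof -
  have "m = v \<otimes> inv u" unfolding assms(4)[symmetric] using assms(1,2) Units_closed[OF assms(2)] by (simp add: m_assoc)
  then show ?thesis using assms(2,3) by simp
qed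

text \<open>\<open>mod_sheaf_iso\<close> speaks of sums only, so the value of an isomorphism on a
  difference is found by solving an equation between sums.\<close>

lemma difference_coef:
  assumes "x \<in> carrier R" "a \<in> carrier R" "b \<in> carrier R" "t \<in> carrier R" "x \<oplus> a \<otimes> t = b \<otimes> t"
  shows "x = t \<otimes> (b \<ominus> a)"
proof -
  have "x = (x \<oplus> a \<otimes> t) \<ominus> a \<otimes> t" using assms(1,2,4) by algebra
  also have "\<dots> = t \<otimes> (b \<ominus> a)" unfolding assms(5) using assms(2-4) by algebra
  finally show ?thesis .
qed

text \<open>The factor \<open>t\<close> will be the value of the trivialization on
  \<open>n \<otimes> n\<close> for a local basis \<open>n\<close>; it is common to all four
  brackets.\<close>

lemma cancel_common_factor:
  assumes "t \<in> Units R" "m \<in> carrier R" "P \<in> carrier R" "Q \<in> carrier R" "C \<in> carrier R" "D \<in> carrier R"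
    and "m \<otimes> ((t \<otimes> P) \<otimes> (t \<otimes> Q)) = (t \<otimes> C) \<otimes> (t \<otimes> D)"
  shows "m \<otimes> (P \<otimes> Q) = C \<otimes> D"
proof (rule unit_eqI[of "t \<otimes> t"])
  have t: "t \<in> carrier R" using assms(1) by auto
  have "(t \<otimes> t) \<otimes> (m \<otimes> (P \<otimes> Q)) = m \<otimes> ((t \<otimes> P) \<otimes> (t \<otimes> Q))" using t assms(2-4) by algebra
  also have "\<dots> = (t \<otimes> t) \<otimes> (C \<otimes> D)" unfolding assms(7) using t assms(5,6) by algebra
  finally show "(t \<otimes> t) \<otimes> (m \<otimes> (P \<otimes> Q)) = (t \<otimes> t) \<otimes> (C \<otimes> D)" .
qed (use assms in auto)

end

lemma (in ringed) res_bracket: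
  assumes "opn U" "opn V" "V \<subseteq> U" "\<And>k. p k \<in> carrier (\<O> U)" "\<And>k. q k \<in> carrier (\<O> U)"
  shows "res U V (bracket (\<O> U) p q) = bracket (\<O> V) (\<lambda>k. res U V (p k)) (\<lambda>k. res U V (q k))"
proof -
  interpret U: cring "\<O> U" by (rule cring_\<O>[OF assms(1)])
  show ?thesis using assms by (simp add: bracket_def res_simps)
qed

context mod_sheaf
begin

lemma iso_basis_reflect:
  assumes iso: "mod_sheaf_iso S M N \<phi>" and e: "e \<in> carrier (\<M> U)" and b: "basis S N U (\<phi> U e)"
  shows "basis S M U e"
  unfolding basis_def
proof (intro conjI allI impI e; (elim conjE)?)
  show U: "opn U" by (rule basisD(1)[OF b])
  fix V assume V: "opn V" "V \<subseteq> U"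
  have eV: "mres U V e \<in> carrier (\<M> V)" by (rule \<M>.res_in[OF U V e])
  have eq: "(\<phi> V \<circ> (\<lambda>c. c \<odot>\<^bsub>\<M> V\<^esub> mres U V e)) c = c \<odot>\<^bsub>ms_mod N V\<^esub> ms_res N U V (\<phi> U e)" if "c \<in> carrier (\<O> V)" for c
    using mod_sheaf_isoD(4)[OF iso V(1) that eV] mod_sheaf_isoD(5)[OF iso U V e] by simp
  have "bij_betw (\<phi> V \<circ> (\<lambda>c. c \<odot>\<^bsub>\<M> V\<^esub> mres U V e)) (carrier (\<O> V)) (carrier (ms_mod N V))"
    by (rule iffD2[OF bij_betw_cong[OF eq] basisD(3)[OF b V]])
  then show "bij_betw (\<lambda>c. c \<odot>\<^bsub>\<M> V\<^esub> mres U V e) (carrier (\<O> V)) (carrier (\<M> V))"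
    by (rule iffD2[OF bij_betw_comp_iff2[OF mod_sheaf_isoD(1)[OF iso V(1)]], rotated])
      (use smult_closed[OF V(1) _ eV] in blast)
qed

text \<open>Near each point one of the two sections is a basis and generates the stalk by itself;
  the other one gets the coefficient zero.\<close>

lemma generate_local:
  assumes l: "\<And>k. l k \<in> carrier (ms_global S M)"
    and loc: "\<And>x. x \<in> rs_pts S \<Longrightarrow> \<exists>U k. x \<in> U \<and> basis S M U (mres (rs_pts S) U (l k))"
  shows "generate_sheaf S M (l False) (l True)"
  unfolding generate_sheaf_def
proof (intro ballI)
  fix x A assume x: "x \<in> rs_pts S" and A: "A \<in> carrier (\<M>\<^sub>x x)"
  interpret Mx: module "\<O>\<^sub>x x" "\<M>\<^sub>x x" by (rule mstalk_module[OF x])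
  obtain U k where U: "x \<in> U" "basis S M U (mres (rs_pts S) U (l k))" using loc[OF x] by blast
  have top: "opn (rs_pts S)" by simp
  have g: "mgerm x (rs_pts S) (l j) \<in> carrier (\<M>\<^sub>x x)" for j by (rule mgerm_in[OF top x l])
  have "mgerm x U (mres (rs_pts S) U (l k)) = mgerm x (rs_pts S) (l k)"
    by (rule \<M>.germ_res[OF top basisD(1)[OF U(2)] U(1) openin_subset[OF basisD(1)[OF U(2)]] l])
  with basis_stalk[OF U(2,1)] have "carrier (\<M>\<^sub>x x) = (\<lambda>c. c \<odot>\<^bsub>\<M>\<^sub>x x\<^esub> mgerm x (rs_pts S) (l k)) ` carrier (\<O>\<^sub>x x)"
    by (simp add: bij_betw_def)
  with A obtain c where c: "c \<in> carrier (\<O>\<^sub>x x)" "A = c \<odot>\<^bsub>\<M>\<^sub>x x\<^esub> mgerm x (rs_pts S) (l k)"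
    by (simp only: image_iff bex_simps) (elim bexE)
  show "\<exists>c0\<in>carrier (\<O>\<^sub>x x). \<exists>c1\<in>carrier (\<O>\<^sub>x x).
      A = c0 \<odot>\<^bsub>\<M>\<^sub>x x\<^esub> mgerm x (rs_pts S) (l False) \<oplus>\<^bsub>\<M>\<^sub>x x\<^esub> c1 \<odot>\<^bsub>\<M>\<^sub>x x\<^esub> mgerm x (rs_pts S) (l True)"
    by (rule bexI[of _ "if k then \<zero>\<^bsub>\<O>\<^sub>x x\<^esub> else c"], rule bexI[of _ "if k then c else \<zero>\<^bsub>\<O>\<^sub>x x\<^esub>"])
      (use c g in auto)
qed

end

section \<open>Frames and the data that represent a point\<close>

context P1_point
begin

text \<open>The basis has to be visible here, because isomorphisms of line bundles are defined by
  prescribing the images of bases.\<close>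

definition frame :: "'a set \<Rightarrow> ('a \<Rightarrow> ((P1_pt set \<times> P1_sec) set \<times> ('a set \<times> 'b) set) list set) \<Rightarrow> (bool \<Rightarrow> 'b) \<Rightarrow> bool" where
  "frame U e p \<longleftrightarrow> basis S \<P> U e \<and> (\<forall>k. p k \<in> carrier (X.\<O> U) \<and>
     ms_res \<P> (rs_pts S) U (coord_section k) = p k \<odot>\<^bsub>ms_mod \<P> U\<^esub> e)"

lemma coords_frame: "coords U p \<longleftrightarrow> (\<exists>e. frame U e p)"
  by (simp add: coords_def frame_def)

lemma frame_coords: "frame U e p \<Longrightarrow> coords U p"
  unfolding coords_frame by (rule exI)

lemma frameD:
  assumes "frame U e p"
  shows "basis S \<P> U e" "p k \<in> carrier (X.\<O> U)" "ms_res \<P> (rs_pts S) U (coord_section k) = p k \<odot>\<^bsub>ms_mod \<P> U\<^esub> e"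
    "X.opn U" "U \<subseteq> rs_pts S" "e \<in> carrier (ms_mod \<P> U)"
proof -
  show b: "basis S \<P> U e" using assms by (simp add: frame_def)
  show "X.opn U" "e \<in> carrier (ms_mod \<P> U)" by (rule basisD(1)[OF b], rule basisD(2)[OF b])
  show "U \<subseteq> rs_pts S" by (rule openin_subset[OF basisD(1)[OF b]])
qed (use assms in \<open>simp_all add: frame_def\<close>)

lemma basis_frame:
  assumes e: "basis S \<P> U e" obtains p where "frame U e p"
proof -
  note U = basisD(1,2)[OF e]
  have "\<exists>c. c \<in> carrier (X.\<O> U) \<and> ms_res \<P> (rs_pts S) U (coord_section k) = c \<odot>\<^bsub>ms_mod \<P> U\<^esub> e" for k
    using \<P>.basis_coefE[OF e U(1) subset_refl \<P>.\<M>.res_in[OF openin_topspace U(1) openin_subset[OF U(1)] coord_section_in]]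
      \<P>.\<M>.res_id[OF U] by metis
  then obtain p where "\<And>k. p k \<in> carrier (X.\<O> U) \<and> ms_res \<P> (rs_pts S) U (coord_section k) = p k \<odot>\<^bsub>ms_mod \<P> U\<^esub> e"
    by metis
  then show thesis using that e unfolding frame_def by blast
qed

lemma frame_res:
  assumes f: "frame U e p" and V: "X.opn V" "V \<subseteq> U"
  shows "frame V (ms_res \<P> U V e) (\<lambda>k. X.res U V (p k))"
  unfolding frame_def
proof (intro conjI allI)
  note f = frameD[OF f]
  show "basis S \<P> V (ms_res \<P> U V e)" by (rule \<P>.basis_res[OF f(1) V])
  show "X.res U V (p k) \<in> carrier (X.\<O> V)" for k by (rule X.\<O>.res_in[OF f(4) V f(2)])
  show "ms_res \<P> (rs_pts S) V (coord_section k) = X.res U V (p k) \<odot>\<^bsub>ms_mod \<P> V\<^esub> ms_res \<P> U V e" for k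
    using \<P>.mres_smult[OF f(4) V f(2,6), of k]
      \<P>.\<M>.res_res[OF openin_topspace f(4) V(1) V(2) f(5) coord_section_in, of k] unfolding f(3) by simp
qed

text \<open>Both frames express the same sections, so the coordinates change by the factor that
  undoes the change of basis.\<close>

lemma frame_change:
  assumes f: "frame U e p" "frame U e' p'" and c: "c \<in> carrier (X.\<O> U)" "e = c \<odot>\<^bsub>ms_mod \<P> U\<^esub> e'"
  shows "p' k = c \<otimes>\<^bsub>X.\<O> U\<^esub> p k"
proof -
  note f1 = frameD[OF f(1)] and f2 = frameD[OF f(2)]
  interpret U: module "X.\<O> U" "ms_mod \<P> U" by (rule \<P>.module[OF f1(4)])
  have id: "ms_res \<P> U U e' = e'" by (rule \<P>.\<M>.res_id[OF f2(4,6)])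
  have "p' k \<odot>\<^bsub>ms_mod \<P> U\<^esub> e' = (c \<otimes>\<^bsub>X.\<O> U\<^esub> p k) \<odot>\<^bsub>ms_mod \<P> U\<^esub> e'"
    using f1(3)[of k] f2(3)[of k] c f1(2)[of k] f2(6) U.smult_assoc1[of "p k" c e'] U.m_comm[of c "p k"] by metis
  then show ?thesis
    using \<P>.basis_cancel[OF f2(1,4) subset_refl f2(2), of "c \<otimes>\<^bsub>X.\<O> U\<^esub> p k" k] c(1) f1(2) id by simp
qed

lemma coords_res: "coords U p \<Longrightarrow> X.opn V \<Longrightarrow> V \<subseteq> U \<Longrightarrow> coords V (\<lambda>k. X.res U V (p k))"
  unfolding coords_frame using frame_res by blast

lemma coords_change:
  assumes "coords U p" "coords U p'"
  shows "\<exists>u\<in>Units (X.\<O> U). \<forall>k. p' k = u \<otimes>\<^bsub>X.\<O> U\<^esub> p k"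
proof -
  obtain e e' where f: "frame U e p" "frame U e' p'" using assms unfolding coords_frame by blast
  note f1 = frameD[OF f(1)] and f2 = frameD[OF f(2)]
  obtain c where c: "c \<in> carrier (X.\<O> U)" "e = c \<odot>\<^bsub>ms_mod \<P> U\<^esub> e'"
    using \<P>.basis_coefE[OF f2(1,4) subset_refl f1(6)] \<P>.\<M>.res_id[OF f2(4,6)] by metis
  show ?thesis
    using \<P>.basis_coef_Units[OF f2(1) f1(1) c] frame_change[OF f c] by blast
qed

lemma frame_at:
  assumes "x \<in> rs_pts S" obtains U e p where "x \<in> U" "frame U e p"
proof -
  obtain k where "x \<in> chart k" using chart_cover[OF assms] by blast
  then show thesis using basis_frame[OF chart_basis] that by metis
qed

text \<open>The basis \<open>n\<close> of \<open>L\<close> is carried back along the isomorphism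
  from the pullback of \<O>(1); the coordinates in the resulting frame are the coefficients of the
  given sections. Thus a single basis of \<open>L\<close> yields coordinates for every point
  represented on \<open>L\<close>.\<close>

lemma representsD:
  assumes "represents S a L (l False, l True)"
  shows "line_bundle S L" "l k \<in> carrier (ms_global S L)"
    "basis S L U n \<Longrightarrow> \<exists>p. coords U p \<and> (\<forall>k. ms_res L (rs_pts S) U (l k) = p k \<odot>\<^bsub>ms_mod L U\<^esub> n)"
proof -
  obtain \<theta> where L: "line_bundle S L" "l False \<in> carrier (ms_global S L)" "l True \<in> carrier (ms_global S L)"
    and iso: "mod_sheaf_iso S \<P> L \<theta>" and l: "\<theta> (rs_pts S) (coord_section False) = l False" "\<theta> (rs_pts S) (coord_section True) = l True"
    using assms by (auto simp: represents_def P1_var_def)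
  have lk: "\<theta> (rs_pts S) (coord_section k) = l k" for k using l by (cases k) auto
  show "line_bundle S L" by (rule L(1))
  show "l k \<in> carrier (ms_global S L)" using L by (cases k) auto
  assume n: "basis S L U n"
  note U = basisD(1,2)[OF n]
  have "bij_betw (\<theta> U) (carrier (ms_mod \<P> U)) (carrier (ms_mod L U))" by (rule mod_sheaf_isoD(1)[OF iso U(1)])
  then obtain e where e: "e \<in> carrier (ms_mod \<P> U)" "n = \<theta> U e" using U(2) unfolding bij_betw_def by blast
  have "basis S \<P> U e" by (rule \<P>.iso_basis_reflect[OF iso e(1) n[unfolded e(2)]])
  then obtain p where p: "frame U e p" by (rule basis_frame)
  have "ms_res L (rs_pts S) U (l k) = p k \<odot>\<^bsub>ms_mod L U\<^esub> n" for k
    using mod_sheaf_isoD(5)[OF iso openin_topspace U(1) openin_subset[OF U(1)] coord_section_in, of k]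
      mod_sheaf_isoD(4)[OF iso U(1) frameD(2)[OF p] e(1), of k] frameD(3)[OF p, of k] lk[of k] e(2) by simp
  then show "\<exists>p. coords U p \<and> (\<forall>k. ms_res L (rs_pts S) U (l k) = p k \<odot>\<^bsub>ms_mod L U\<^esub> n)"
    using p unfolding coords_frame by blast
qed

text \<open>Generation is checked on the charts: over chart \<open>k\<close> the isomorphism sends
  the basis given by \<open>x_k\<close> to a basis of \<open>L\<close>.\<close>

lemma represents_iso:
  assumes L: "line_bundle S L" and iso: "mod_sheaf_iso S \<P> L \<theta>"
  shows "represents S a L (\<theta> (rs_pts S) (coord_section False), \<theta> (rs_pts S) (coord_section True))"
proof -
  interpret L: mod_sheaf S L using L X.line_bundle_iff by unfold_locales blast
  let ?l = "\<lambda>k. \<theta> (rs_pts S) (coord_section k)"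
  have l: "?l k \<in> carrier (ms_global S L)" for k by (rule mod_sheaf_isoD(2)[OF iso openin_topspace coord_section_in])
  have "generate_sheaf S L (?l False) (?l True)"
  proof (rule L.generate_local[OF l])
    fix x assume "x \<in> rs_pts S"
    then obtain k where k: "x \<in> chart k" using chart_cover by blast
    have "ms_res L (rs_pts S) (chart k) (?l k) = \<theta> (chart k) (ms_res \<P> (rs_pts S) (chart k) (coord_section k))"
      by (rule mod_sheaf_isoD(5)[OF iso openin_topspace chart_open openin_subset[OF chart_open] coord_section_in])
    then have "basis S L (chart k) (ms_res L (rs_pts S) (chart k) (?l k))"
      using \<P>.iso_basis[OF iso chart_basis] by simp
    then show "\<exists>U k. x \<in> U \<and> basis S L U (ms_res L (rs_pts S) U (?l k))" using k by blast
  qed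
  then show ?thesis unfolding represents_def prod.case
    using L l[of False] l[of True] iso by (auto simp: P1_var_def)
qed

lemma represents_self: "represents S a \<P> (coord_section False, coord_section True)"
proof -
  have "mod_sheaf_iso S \<P> \<P> (\<lambda>_ m. m)" unfolding mod_sheaf_iso_def by (simp add: bij_betw_def)
  from represents_iso[OF pullback_line_bundle this] show ?thesis .
qed

end


text \<open>The consequence of strong distinctness, established in \<open>bracket_unit\<close>, on
  which the remaining constructions rest.\<close>

definition apart :: "('a, 'b) ringed_space \<Rightarrow> ('a, 'b) P1_point \<Rightarrow> ('a, 'b) P1_point \<Rightarrow> bool" where
  "apart S a b \<longleftrightarrow> (\<forall>U p q. P1_point.coords S a U p \<longrightarrow> P1_point.coords S b U q \<longrightarrow>
     bracket (rs_ring S U) p q \<in> Units (rs_ring S U))"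

lemma apartD:
  "apart S a b \<Longrightarrow> P1_point.coords S a U p \<Longrightarrow> P1_point.coords S b U q \<Longrightarrow>
    bracket (rs_ring S U) p q \<in> Units (rs_ring S U)"
  by (simp add: apart_def)

lemma apart_sym:
  assumes a: "P1_point S a" and b: "P1_point S b" and ab: "apart S a b"
  shows "apart S b a"
  unfolding apart_def
proof (intro allI impI)
  interpret A: P1_point S a by fact
  interpret B: P1_point S b by fact
  fix U p q assume p: "B.coords U p" and q: "A.coords U q"
  interpret U: cring "A.X.\<O> U" by (rule A.X.cring_\<O>[OF A.coords_open[OF q]])
  have "bracket (A.X.\<O> U) q p \<in> Units (A.X.\<O> U)" using ab p q unfolding apart_def by blast
  then show "bracket (A.X.\<O> U) p q \<in> Units (A.X.\<O> U)"
    using U.Units_uminus U.bracket_swap[OF A.coords_in[OF q] B.coords_in[OF p]] by simp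
qed

section \<open>A common line bundle and the trivialization of its square\<close>

locale P1_triple = A: P1_point S a + B: P1_point S b + C: P1_point S c
  for S :: "('a, 'b) ringed_space" and a b c +
  assumes ap: "apart S a b" "apart S a c" "apart S b c"
begin

text \<open>Under \<open>e \<mapsto> u e\<close> the coordinates scale by the inverse of \<open>u\<close>, so the coefficient
  \<open>[p r]/[q r]\<close> turns a basis for \<open>b\<close> into one for \<open>a\<close> independently of all choices.\<close>

definition transfer_bases where
  "transfer_bases = {(U, e, l \<odot>\<^bsub>ms_mod A.\<P> U\<^esub> e') |U e e' l p q r. A.frame U e' p \<and> B.frame U e q \<and> C.coords U r \<and>
     l = bracket (A.X.\<O> U) p r \<otimes>\<^bsub>A.X.\<O> U\<^esub> inv\<^bsub>A.X.\<O> U\<^esub> bracket (A.X.\<O> U) q r}"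

lemma transfer_basesI:
  "A.frame U e' p \<Longrightarrow> B.frame U e q \<Longrightarrow> C.coords U r \<Longrightarrow>
    (U, e, (bracket (A.X.\<O> U) p r \<otimes>\<^bsub>A.X.\<O> U\<^esub> inv\<^bsub>A.X.\<O> U\<^esub> bracket (A.X.\<O> U) q r) \<odot>\<^bsub>ms_mod A.\<P> U\<^esub> e') \<in> transfer_bases"
  unfolding transfer_bases_def mem_Collect_eq by (intro exI conjI) (rule HOL.refl | assumption)+

lemma common_frames:
  assumes x: "x \<in> rs_pts S"
  obtains U e p e' q r where "x \<in> U" "A.frame U e p" "B.frame U e' q" "C.coords U r"
proof -
  obtain U1 e1 p1 where 1: "x \<in> U1" "A.frame U1 e1 p1" using A.frame_at[OF x] .
  obtain U2 e2 p2 where 2: "x \<in> U2" "B.frame U2 e2 p2" using B.frame_at[OF x] .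
  obtain U3 e3 p3 where 3: "x \<in> U3" "C.frame U3 e3 p3" using C.frame_at[OF x] .
  let ?U = "U1 \<inter> U2 \<inter> U3"
  have U: "A.X.opn ?U" using A.frameD(4)[OF 1(2)] B.frameD(4)[OF 2(2)] C.frameD(4)[OF 3(2)] by auto
  have 4: "A.frame ?U (ms_res A.\<P> U1 ?U e1) (\<lambda>k. A.X.res U1 ?U (p1 k))" by (rule A.frame_res[OF 1(2) U]) auto
  have 5: "B.frame ?U (ms_res B.\<P> U2 ?U e2) (\<lambda>k. A.X.res U2 ?U (p2 k))" by (rule B.frame_res[OF 2(2) U]) auto
  have "C.frame ?U (ms_res C.\<P> U3 ?U e3) (\<lambda>k. A.X.res U3 ?U (p3 k))" by (rule C.frame_res[OF 3(2) U]) auto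
  note 6 = C.frame_coords[OF this]
  have "x \<in> ?U" using 1(1) 2(1) 3(1) by simp
  from that[OF this 4 5 6] show thesis .
qed

lemma brackets:
  assumes "A.coords U p" "B.coords U q" "C.coords U r"
  shows "bracket (A.X.\<O> U) p q \<in> Units (A.X.\<O> U)" "bracket (A.X.\<O> U) p r \<in> Units (A.X.\<O> U)"
    "bracket (A.X.\<O> U) q r \<in> Units (A.X.\<O> U)"
  using apartD[OF ap(1) assms(1,2)] apartD[OF ap(2) assms(1,3)] apartD[OF ap(3) assms(2,3)] .

lemma matching: "matching_bases S B.\<P> A.\<P> transfer_bases"
proof (intro matching_bases.intro matching_bases_axioms.intro B.pullback_mod_sheaf A.pullback_mod_sheaf)
  fix U m n assume "(U, m, n) \<in> transfer_bases"
  then obtain e' l p q r where f: "A.frame U e' p" "B.frame U m q" "C.coords U r"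
    "l = bracket (A.X.\<O> U) p r \<otimes>\<^bsub>A.X.\<O> U\<^esub> inv\<^bsub>A.X.\<O> U\<^esub> bracket (A.X.\<O> U) q r"
    "n = l \<odot>\<^bsub>ms_mod A.\<P> U\<^esub> e'"
    unfolding transfer_bases_def by blast
  interpret U: cring "A.X.\<O> U" by (rule A.X.cring_\<O>[OF A.frameD(4)[OF f(1)]])
  have cc: "A.coords U p" "B.coords U q" by (rule A.frame_coords[OF f(1)], rule B.frame_coords[OF f(2)])
  have "l \<in> Units (A.X.\<O> U)" unfolding f(4) using brackets[OF cc f(3)] by simp
  then show "basis S B.\<P> U m \<and> basis S A.\<P> U n"
    unfolding f(5) using A.\<P>.basis_smult[OF A.frameD(1)[OF f(1)]] B.frameD(1)[OF f(2)] by blast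
next
  fix x assume "x \<in> rs_pts S"
  then obtain U e p e' q r where c: "x \<in> U" "A.frame U e p" "B.frame U e' q" "C.coords U r" by (rule common_frames)
  show "\<exists>U m n. (U, m, n) \<in> transfer_bases \<and> x \<in> U"
    using transfer_basesI[OF c(2-4)] c(1) by (intro exI conjI)
next
  fix U m n U' m' n' V g
  assume b: "(U, m, n) \<in> transfer_bases" "(U', m', n') \<in> transfer_bases" and V: "A.X.opn V" "V \<subseteq> U" "V \<subseteq> U'"
    and g: "g \<in> carrier (A.X.\<O> V)" "ms_res B.\<P> U V m = g \<odot>\<^bsub>ms_mod B.\<P> V\<^esub> ms_res B.\<P> U' V m'"
  obtain e l p q r where f: "A.frame U e p" "B.frame U m q" "C.coords U r"
    "l = bracket (A.X.\<O> U) p r \<otimes>\<^bsub>A.X.\<O> U\<^esub> inv\<^bsub>A.X.\<O> U\<^esub> bracket (A.X.\<O> U) q r" "n = l \<odot>\<^bsub>ms_mod A.\<P> U\<^esub> e"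
    using b(1) unfolding transfer_bases_def by blast
  obtain e' l' p' q' r' where f': "A.frame U' e' p'" "B.frame U' m' q'" "C.coords U' r'"
    "l' = bracket (A.X.\<O> U') p' r' \<otimes>\<^bsub>A.X.\<O> U'\<^esub> inv\<^bsub>A.X.\<O> U'\<^esub> bracket (A.X.\<O> U') q' r'" "n' = l' \<odot>\<^bsub>ms_mod A.\<P> U'\<^esub> e'"
    using b(2) unfolding transfer_bases_def by blast
  interpret V: module "A.X.\<O> V" "ms_mod A.\<P> V" by (rule A.\<P>.module[OF V(1)])
  note F = A.frame_res[OF f(1) V(1,2)] B.frame_res[OF f(2) V(1,2)] C.coords_res[OF f(3) V(1,2)]
  note F' = A.frame_res[OF f'(1) V(1,3)] B.frame_res[OF f'(2) V(1,3)] C.coords_res[OF f'(3) V(1,3)]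
  let ?r = "A.X.res U V" and ?r' = "A.X.res U' V"
  let ?P = "\<lambda>k. ?r (p k)" and ?Q = "\<lambda>k. ?r (q k)" and ?R = "\<lambda>k. ?r (r k)"
  let ?P' = "\<lambda>k. ?r' (p' k)" and ?Q' = "\<lambda>k. ?r' (q' k)" and ?R' = "\<lambda>k. ?r' (r' k)"
  let ?e = "ms_res A.\<P> U V e" and ?e' = "ms_res A.\<P> U' V e'"
  \<comment> \<open>Restriction is applied to the equation that characterizes the quotient, so that
    no inverse has to be restricted.\<close>
  have quot: "A.X.res W V (bracket (A.X.\<O> W) p1 r1 \<otimes>\<^bsub>A.X.\<O> W\<^esub> inv\<^bsub>A.X.\<O> W\<^esub> bracket (A.X.\<O> W) q1 r1) \<otimes>\<^bsub>A.X.\<O> V\<^esub>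
       bracket (A.X.\<O> V) (\<lambda>k. A.X.res W V (q1 k)) (\<lambda>k. A.X.res W V (r1 k))
      = bracket (A.X.\<O> V) (\<lambda>k. A.X.res W V (p1 k)) (\<lambda>k. A.X.res W V (r1 k)) \<and>
      bracket (A.X.\<O> W) p1 r1 \<otimes>\<^bsub>A.X.\<O> W\<^esub> inv\<^bsub>A.X.\<O> W\<^esub> bracket (A.X.\<O> W) q1 r1 \<in> carrier (A.X.\<O> W)"
    if W: "A.X.opn W" "V \<subseteq> W" and c: "A.coords W p1" "B.coords W q1" "C.coords W r1" for W p1 q1 r1
  proof -
    interpret W: cring "A.X.\<O> W" by (rule A.X.cring_\<O>[OF W(1)])
    note bu = brackets[OF c]
    have "(bracket (A.X.\<O> W) p1 r1 \<otimes>\<^bsub>A.X.\<O> W\<^esub> inv\<^bsub>A.X.\<O> W\<^esub> bracket (A.X.\<O> W) q1 r1) \<otimes>\<^bsub>A.X.\<O> W\<^esub> bracket (A.X.\<O> W) q1 r1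
      = bracket (A.X.\<O> W) p1 r1"
      using bu(2,3) W.Units_closed by (simp add: W.m_assoc)
    from arg_cong[OF this, of "A.X.res W V"] show ?thesis
      using bu(2,3) W.Units_closed A.X.res_bracket[OF W(1) V(1) W(2) A.coords_in[OF c(1)] C.coords_in[OF c(3)]]
        A.X.res_bracket[OF W(1) V(1) W(2) B.coords_in[OF c(2)] C.coords_in[OF c(3)]]
      by (simp add: A.X.res_simps(3)[OF W(1) V(1) W(2)])
  qed
  have cc: "A.coords U p" "B.coords U q" "A.coords U' p'" "B.coords U' q'"
    by (rule A.frame_coords[OF f(1)], rule B.frame_coords[OF f(2)], rule A.frame_coords[OF f'(1)], rule B.frame_coords[OF f'(2)])
  note Q1 = quot[OF A.frameD(4)[OF f(1)] V(2) cc(1,2) f(3), folded f(4)]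
  note Q2 = quot[OF A.frameD(4)[OF f'(1)] V(3) cc(3,4) f'(3), folded f'(4)]
  have lV: "?r l \<in> carrier (A.X.\<O> V)" "?r' l' \<in> carrier (A.X.\<O> V)"
    using A.X.\<O>.res_in[OF A.frameD(4)[OF f(1)] V(1,2)] A.X.\<O>.res_in[OF A.frameD(4)[OF f'(1)] V(1,3)] Q1 Q2 by auto
  obtain al where al: "al \<in> carrier (A.X.\<O> V)" "?e = al \<odot>\<^bsub>ms_mod A.\<P> V\<^esub> ?e'"
    using A.\<P>.basis_coefE[OF A.frameD(1)[OF F'(1)] V(1) subset_refl A.frameD(6)[OF F(1)]]
      A.\<P>.\<M>.res_id[OF V(1) A.frameD(6)[OF F'(1)]] by metis
  obtain w where w: "w \<in> Units (A.X.\<O> V)" "\<And>k. ?R' k = w \<otimes>\<^bsub>A.X.\<O> V\<^esub> ?R k" using C.coords_change[OF F(3) F'(3)] by blast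
  have sc: "?P' = (\<lambda>k. al \<otimes>\<^bsub>A.X.\<O> V\<^esub> ?P k)" "?Q' = (\<lambda>k. g \<otimes>\<^bsub>A.X.\<O> V\<^esub> ?Q k)" "?R' = (\<lambda>k. w \<otimes>\<^bsub>A.X.\<O> V\<^esub> ?R k)"
    using A.frame_change[OF F(1) F'(1) al] B.frame_change[OF F(2) F'(2) g] w(2) by auto
  have cV: "A.coords V ?P" "B.coords V ?Q" by (rule A.frame_coords[OF F(1)], rule B.frame_coords[OF F(2)])
  note bu = brackets[OF cV F(3)]
  have wc: "w \<in> carrier (A.X.\<O> V)" using w by auto
  \<comment> \<open>Over \<open>V\<close> the claim compares \<open>l e\<close> with
    \<open>g l' e'\<close>, where \<open>e = al e'\<close>; so it amounts to this identity of
    coefficients.\<close>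
  have "g \<otimes>\<^bsub>A.X.\<O> V\<^esub> ?r' l' = al \<otimes>\<^bsub>A.X.\<O> V\<^esub> ?r l"
  proof (rule V.R.scaled_quotient[OF g(1) al(1) w(1) bu(3) V.R.Units_closed[OF bu(2)] lV])
    show "?r l \<otimes>\<^bsub>A.X.\<O> V\<^esub> bracket (A.X.\<O> V) ?Q ?R = bracket (A.X.\<O> V) ?P ?R" using Q1 by blast
    show "?r' l' \<otimes>\<^bsub>A.X.\<O> V\<^esub> (g \<otimes>\<^bsub>A.X.\<O> V\<^esub> (w \<otimes>\<^bsub>A.X.\<O> V\<^esub> bracket (A.X.\<O> V) ?Q ?R))
      = al \<otimes>\<^bsub>A.X.\<O> V\<^esub> (w \<otimes>\<^bsub>A.X.\<O> V\<^esub> bracket (A.X.\<O> V) ?P ?R)"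
      using conjunct1[OF Q2] unfolding sc
        V.R.bracket_scale[OF A.coords_in[OF cV(1)] C.coords_in[OF F(3)] al(1) wc]
        V.R.bracket_scale[OF B.coords_in[OF cV(2)] C.coords_in[OF F(3)] g(1) wc] .
  qed
  then have "?r l \<odot>\<^bsub>ms_mod A.\<P> V\<^esub> ?e = g \<odot>\<^bsub>ms_mod A.\<P> V\<^esub> (?r' l' \<odot>\<^bsub>ms_mod A.\<P> V\<^esub> ?e')"
    unfolding al(2) using al(1) g(1) lV A.frameD(6)[OF F'(1)]
    by (simp add: V.R.m_comm flip: V.smult_assoc1)
  then show "ms_res A.\<P> U V n = g \<odot>\<^bsub>ms_mod A.\<P> V\<^esub> ms_res A.\<P> U' V n'"
    unfolding f(5) f'(5)
    using A.\<P>.mres_smult[OF A.frameD(4)[OF f(1)] V(1,2) conjunct2[OF Q1] A.frameD(6)[OF f(1)]]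
      A.\<P>.mres_smult[OF A.frameD(4)[OF f'(1)] V(1,3) conjunct2[OF Q2] A.frameD(6)[OF f'(1)]] by simp
qed

lemma represents_transfer: "\<exists>\<beta>. represents S b A.\<P> \<beta>"
  using B.represents_iso[OF A.pullback_line_bundle matching_bases.glued_iso[OF matching]] by blast

end


lemma (in ringed) tensor_bundle_self:
  assumes "line_bundle S L" shows "tensor_bundle S L L"
proof -
  interpret L: mod_sheaf S L using assms line_bundle_iff by unfold_locales blast
  show ?thesis
    using assms line_bundle_iff
    by (intro tensor_bundle.intro tensor_bundle_axioms.intro L.mod_sheaf_axioms) blast
qed

context P1_triple
begin

text \<open>Here the coefficient is \<open>[q r]/([p q][p r])\<close>: of degree \<open>-2\<close> in the coordinates of \<open>a\<close> and
  of degree \<open>0\<close> in those of \<open>b\<close> and \<open>c\<close>, so it transforms like \<open>e \<otimes> e\<close>.\<close>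

definition tensor_bases where
  "tensor_bases = {(U, local_tensor S A.\<P> A.\<P> U e e, \<mu>) |U e \<mu> p q r. A.frame U e p \<and> B.coords U q \<and> C.coords U r \<and>
     \<mu> \<in> carrier (A.X.\<O> U) \<and>
     \<mu> \<otimes>\<^bsub>A.X.\<O> U\<^esub> (bracket (A.X.\<O> U) p q \<otimes>\<^bsub>A.X.\<O> U\<^esub> bracket (A.X.\<O> U) p r) = bracket (A.X.\<O> U) q r}"

lemma tensor_basesI:
  "A.frame U e p \<Longrightarrow> B.coords U q \<Longrightarrow> C.coords U r \<Longrightarrow> \<mu> \<in> carrier (A.X.\<O> U) \<Longrightarrow>
   \<mu> \<otimes>\<^bsub>A.X.\<O> U\<^esub> (bracket (A.X.\<O> U) p q \<otimes>\<^bsub>A.X.\<O> U\<^esub> bracket (A.X.\<O> U) p r) = bracket (A.X.\<O> U) q r \<Longrightarrow>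
   (U, local_tensor S A.\<P> A.\<P> U e e, \<mu>) \<in> tensor_bases"
  unfolding tensor_bases_def mem_Collect_eq by (intro exI conjI) (rule HOL.refl | assumption)+

lemma tensor_matching: "matching_bases S (tensor_sheaf S A.\<P> A.\<P>) (struct_sheaf S) tensor_bases"
proof -
  interpret T: tensor_bundle S A.\<P> A.\<P> by (rule A.X.tensor_bundle_self[OF A.pullback_line_bundle])
  interpret T2: mod_sheaf S "tensor_sheaf S A.\<P> A.\<P>" by (rule T.tensor_mod_sheaf)
  interpret O: mod_sheaf S "struct_sheaf S" by (rule A.X.struct_mod_sheaf)
  show ?thesis
  proof (intro matching_bases.intro matching_bases_axioms.intro T.tensor_mod_sheaf A.X.struct_mod_sheaf)
    fix U m n assume "(U, m, n) \<in> tensor_bases"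
    then obtain e p q r where f: "m = local_tensor S A.\<P> A.\<P> U e e" "A.frame U e p" "B.coords U q" "C.coords U r" "n \<in> carrier (A.X.\<O> U)"
      "n \<otimes>\<^bsub>A.X.\<O> U\<^esub> (bracket (A.X.\<O> U) p q \<otimes>\<^bsub>A.X.\<O> U\<^esub> bracket (A.X.\<O> U) p r) = bracket (A.X.\<O> U) q r"
      unfolding tensor_bases_def by blast
    note U = A.frameD(4)[OF f(2)]
    interpret U: cring "A.X.\<O> U" by (rule A.X.cring_\<O>[OF U])
    note bu = brackets[OF A.frame_coords[OF f(2)] f(3,4)]
    have "n \<in> Units (A.X.\<O> U)" by (rule U.Units_of_quotient[OF f(5) U.Units_m_closed[OF bu(1,2)] bu(3) f(6)])
    then have "basis S (struct_sheaf S) U (n \<odot>\<^bsub>ms_mod (struct_sheaf S) U\<^esub> \<one>\<^bsub>A.X.\<O> U\<^esub>)"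
      by (rule O.basis_smult[OF A.X.struct_basis_one[OF U]])
    then have n: "basis S (struct_sheaf S) U n" using f(5) by (simp add: A.X.struct_sheaf_simps)
    show "basis S (tensor_sheaf S A.\<P> A.\<P>) U m \<and> basis S (struct_sheaf S) U n"
      using T.local_tensor_basis[OF A.frameD(1)[OF f(2)] A.frameD(1)[OF f(2)]] n unfolding f(1) by (rule conjI)
  next
    fix x assume "x \<in> rs_pts S"
    then obtain U e p e' q r where c: "x \<in> U" "A.frame U e p" "B.frame U e' q" "C.coords U r" by (rule common_frames)
    note q = B.frame_coords[OF c(3)]
    note bu = brackets[OF A.frame_coords[OF c(2)] q c(4)]
    interpret U: cring "A.X.\<O> U" by (rule A.X.cring_\<O>[OF A.frameD(4)[OF c(2)]])
    let ?d = "bracket (A.X.\<O> U) p q \<otimes>\<^bsub>A.X.\<O> U\<^esub> bracket (A.X.\<O> U) p r"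
    let ?m = "bracket (A.X.\<O> U) q r \<otimes>\<^bsub>A.X.\<O> U\<^esub> inv\<^bsub>A.X.\<O> U\<^esub> ?d"
    have d: "?d \<in> Units (A.X.\<O> U)" by (rule U.Units_m_closed[OF bu(1,2)])
    have m: "?m \<in> carrier (A.X.\<O> U)" "?m \<otimes>\<^bsub>A.X.\<O> U\<^esub> ?d = bracket (A.X.\<O> U) q r"
      using d U.Units_closed[OF bu(3)] U.Units_closed[OF d] U.Units_inv_closed[OF d] by (simp_all only: U.m_assoc U.Units_l_inv U.r_one U.m_closed)
    show "\<exists>U m n. (U, m, n) \<in> tensor_bases \<and> x \<in> U"
      using tensor_basesI[OF c(2) q c(4) m] c(1) by (intro exI conjI)
  next
    fix U m n U' m' n' V g
    assume b: "(U, m, n) \<in> tensor_bases" "(U', m', n') \<in> tensor_bases" and V: "A.X.opn V" "V \<subseteq> U" "V \<subseteq> U'"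
      and g: "g \<in> carrier (A.X.\<O> V)" "ms_res (tensor_sheaf S A.\<P> A.\<P>) U V m
        = g \<odot>\<^bsub>ms_mod (tensor_sheaf S A.\<P> A.\<P>) V\<^esub> ms_res (tensor_sheaf S A.\<P> A.\<P>) U' V m'"
    obtain e p q r where f: "m = local_tensor S A.\<P> A.\<P> U e e" "A.frame U e p" "B.coords U q" "C.coords U r" "n \<in> carrier (A.X.\<O> U)"
      "n \<otimes>\<^bsub>A.X.\<O> U\<^esub> (bracket (A.X.\<O> U) p q \<otimes>\<^bsub>A.X.\<O> U\<^esub> bracket (A.X.\<O> U) p r) = bracket (A.X.\<O> U) q r"
      using b(1) unfolding tensor_bases_def by blast
    obtain e' p' q' r' where f': "m' = local_tensor S A.\<P> A.\<P> U' e' e'" "A.frame U' e' p'" "B.coords U' q'" "C.coords U' r'" "n' \<in> carrier (A.X.\<O> U')"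
      "n' \<otimes>\<^bsub>A.X.\<O> U'\<^esub> (bracket (A.X.\<O> U') p' q' \<otimes>\<^bsub>A.X.\<O> U'\<^esub> bracket (A.X.\<O> U') p' r') = bracket (A.X.\<O> U') q' r'"
      using b(2) unfolding tensor_bases_def by blast
    interpret V: cring "A.X.\<O> V" by (rule A.X.cring_\<O>[OF V(1)])
    note F = A.frame_res[OF f(2) V(1,2)] B.coords_res[OF f(3) V(1,2)] C.coords_res[OF f(4) V(1,2)]
    note F' = A.frame_res[OF f'(2) V(1,3)] B.coords_res[OF f'(3) V(1,3)] C.coords_res[OF f'(4) V(1,3)]
    let ?r = "A.X.res U V" and ?r' = "A.X.res U' V"
    let ?P = "\<lambda>k. ?r (p k)" and ?Q = "\<lambda>k. ?r (q k)" and ?R = "\<lambda>k. ?r (r k)"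
    let ?P' = "\<lambda>k. ?r' (p' k)" and ?Q' = "\<lambda>k. ?r' (q' k)" and ?R' = "\<lambda>k. ?r' (r' k)"
    let ?e = "ms_res A.\<P> U V e" and ?e' = "ms_res A.\<P> U' V e'"
    have quot: "A.X.res W V l \<otimes>\<^bsub>A.X.\<O> V\<^esub>
         (bracket (A.X.\<O> V) (\<lambda>k. A.X.res W V (p1 k)) (\<lambda>k. A.X.res W V (q1 k)) \<otimes>\<^bsub>A.X.\<O> V\<^esub>
          bracket (A.X.\<O> V) (\<lambda>k. A.X.res W V (p1 k)) (\<lambda>k. A.X.res W V (r1 k)))
        = bracket (A.X.\<O> V) (\<lambda>k. A.X.res W V (q1 k)) (\<lambda>k. A.X.res W V (r1 k))"
      if W: "A.X.opn W" "V \<subseteq> W" and c: "A.coords W p1" "B.coords W q1" "C.coords W r1" and l: "l \<in> carrier (A.X.\<O> W)"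
        and eq: "l \<otimes>\<^bsub>A.X.\<O> W\<^esub> (bracket (A.X.\<O> W) p1 q1 \<otimes>\<^bsub>A.X.\<O> W\<^esub> bracket (A.X.\<O> W) p1 r1) = bracket (A.X.\<O> W) q1 r1"
      for W p1 q1 r1 l
    proof -
      interpret W: cring "A.X.\<O> W" by (rule A.X.cring_\<O>[OF W(1)])
      note bc = W.bracket_in[OF A.coords_in[OF c(1)] B.coords_in[OF c(2)]] W.bracket_in[OF A.coords_in[OF c(1)] C.coords_in[OF c(3)]]
      note res = A.X.res_bracket[OF W(1) V(1) W(2)]
      show ?thesis
        using arg_cong[OF eq, of "A.X.res W V"]
        unfolding A.X.res_simps(3)[OF W(1) V(1) W(2) l W.m_closed[OF bc]] A.X.res_simps(3)[OF W(1) V(1) W(2) bc]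
          res[OF A.coords_in[OF c(1)] B.coords_in[OF c(2)]] res[OF A.coords_in[OF c(1)] C.coords_in[OF c(3)]]
          res[OF B.coords_in[OF c(2)] C.coords_in[OF c(3)]] .
    qed
    note Q1 = quot[OF A.frameD(4)[OF f(2)] V(2) A.frame_coords[OF f(2)] f(3-6)]
    note Q2 = quot[OF A.frameD(4)[OF f'(2)] V(3) A.frame_coords[OF f'(2)] f'(3-6)]
    have nV: "?r n \<in> carrier (A.X.\<O> V)" "?r' n' \<in> carrier (A.X.\<O> V)"
      by (rule A.X.\<O>.res_in[OF A.frameD(4)[OF f(2)] V(1,2) f(5)], rule A.X.\<O>.res_in[OF A.frameD(4)[OF f'(2)] V(1,3) f'(5)])
    obtain al where al: "al \<in> carrier (A.X.\<O> V)" "?e = al \<odot>\<^bsub>ms_mod A.\<P> V\<^esub> ?e'"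
      using A.\<P>.basis_coefE[OF A.frameD(1)[OF F'(1)] V(1) subset_refl A.frameD(6)[OF F(1)]]
        A.\<P>.\<M>.res_id[OF V(1) A.frameD(6)[OF F'(1)]] by metis
    obtain v where v: "v \<in> Units (A.X.\<O> V)" "\<And>k. ?Q' k = v \<otimes>\<^bsub>A.X.\<O> V\<^esub> ?Q k" using B.coords_change[OF F(2) F'(2)] by blast
    obtain w where w: "w \<in> Units (A.X.\<O> V)" "\<And>k. ?R' k = w \<otimes>\<^bsub>A.X.\<O> V\<^esub> ?R k" using C.coords_change[OF F(3) F'(3)] by blast
    have sc: "?P' = (\<lambda>k. al \<otimes>\<^bsub>A.X.\<O> V\<^esub> ?P k)" "?Q' = (\<lambda>k. v \<otimes>\<^bsub>A.X.\<O> V\<^esub> ?Q k)" "?R' = (\<lambda>k. w \<otimes>\<^bsub>A.X.\<O> V\<^esub> ?R k)"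
      using A.frame_change[OF F(1) F'(1) al] v(2) w(2) by auto
    note cV = A.frame_coords[OF F(1)]
    note bu = brackets[OF cV F(2,3)]
    note vc = V.Units_closed[OF v(1)] and wc = V.Units_closed[OF w(1)]
    have n: "?r n = (al \<otimes>\<^bsub>A.X.\<O> V\<^esub> al) \<otimes>\<^bsub>A.X.\<O> V\<^esub> ?r' n'"
    proof (rule V.scaled_square_quotient[OF al(1) v(1) w(1) bu(1,2) V.Units_closed[OF bu(3)] nV Q1])
      show "?r' n' \<otimes>\<^bsub>A.X.\<O> V\<^esub> ((al \<otimes>\<^bsub>A.X.\<O> V\<^esub> (v \<otimes>\<^bsub>A.X.\<O> V\<^esub> bracket (A.X.\<O> V) ?P ?Q)) \<otimes>\<^bsub>A.X.\<O> V\<^esub>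
          (al \<otimes>\<^bsub>A.X.\<O> V\<^esub> (w \<otimes>\<^bsub>A.X.\<O> V\<^esub> bracket (A.X.\<O> V) ?P ?R)))
        = v \<otimes>\<^bsub>A.X.\<O> V\<^esub> (w \<otimes>\<^bsub>A.X.\<O> V\<^esub> bracket (A.X.\<O> V) ?Q ?R)"
        using Q2 unfolding sc
          V.bracket_scale[OF A.coords_in[OF cV] B.coords_in[OF F(2)] al(1) vc]
          V.bracket_scale[OF A.coords_in[OF cV] C.coords_in[OF F(3)] al(1) wc]
          V.bracket_scale[OF B.coords_in[OF F(2)] C.coords_in[OF F(3)] vc wc] .
    qed
    have e'V: "basis S A.\<P> V ?e'" by (rule A.frameD(1)[OF F'(1)])
    note tb = T.local_tensor_basis[OF e'V e'V]
    \<comment> \<open>The assumed relation between \<open>m\<close> and \<open>m'\<close> is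
      compared with the scaling of \<open>e' \<otimes> e'\<close> under \<open>e = al e'\<close>.
      Coefficients in this basis are unique, so \<open>g\<close> is the square of
      \<open>al\<close>.\<close>
    have "(al \<otimes>\<^bsub>A.X.\<O> V\<^esub> al) \<odot>\<^bsub>ms_mod (tensor_sheaf S A.\<P> A.\<P>) V\<^esub> local_tensor S A.\<P> A.\<P> V ?e' ?e' = local_tensor S A.\<P> A.\<P> V ?e ?e"
      unfolding al(2) by (rule T.local_tensor_scale[OF e'V basisD(2)[OF e'V] al(1) al(1), symmetric])
    also have "\<dots> = g \<odot>\<^bsub>ms_mod (tensor_sheaf S A.\<P> A.\<P>) V\<^esub> local_tensor S A.\<P> A.\<P> V ?e' ?e'"
      using g(2) unfolding f(1) f'(1)
        T.local_tensor_res[OF A.frameD(4)[OF f(2)] V(1,2) A.frameD(6)[OF f(2)] A.frameD(6)[OF f(2)]]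
        T.local_tensor_res[OF A.frameD(4)[OF f'(2)] V(1,3) A.frameD(6)[OF f'(2)] A.frameD(6)[OF f'(2)]] .
    finally have "al \<otimes>\<^bsub>A.X.\<O> V\<^esub> al = g"
      using T2.basis_cancel[OF tb V(1) subset_refl V.m_closed[OF al(1) al(1)] g(1)] T2.\<M>.res_id[OF V(1) basisD(2)[OF tb]] by simp
    then show "ms_res (struct_sheaf S) U V n = g \<odot>\<^bsub>ms_mod (struct_sheaf S) V\<^esub> ms_res (struct_sheaf S) U' V n'"
      using n by (simp add: A.X.struct_sheaf_simps)
  qed
qed

lemma tensor_square_iso: "\<exists>\<phi>. mod_sheaf_iso S (tensor_sheaf S A.\<P> A.\<P>) (struct_sheaf S) \<phi>"
  using matching_bases.glued_iso[OF tensor_matching] by blast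

end

section \<open>The formula in local coordinates\<close>

context ringed
begin

text \<open>A basis of the square goes to a basis of the structure sheaf, which is a unit multiple
  of the basis one.\<close>

lemma tensor_iso_Units:
  assumes L: "line_bundle S L" and \<phi>: "mod_sheaf_iso S (tensor_sheaf S L L) (struct_sheaf S) \<phi>" and n: "basis S L U n"
  shows "\<phi> U (local_tensor S L L U n n) \<in> Units (\<O> U)"
proof -
  interpret T: tensor_bundle S L L by (rule tensor_bundle_self[OF L])
  interpret T2: mod_sheaf S "tensor_sheaf S L L" by (rule T.tensor_mod_sheaf)
  interpret O: mod_sheaf S "struct_sheaf S" by (rule struct_mod_sheaf)
  note U = basisD(1)[OF n]
  interpret U: cring "\<O> U" by (rule cring_\<O>[OF U])
  have b: "basis S (struct_sheaf S) U (\<phi> U (local_tensor S L L U n n))"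
    by (rule T2.iso_basis[OF \<phi> T.local_tensor_basis[OF n n]])
  have c: "\<phi> U (local_tensor S L L U n n) \<in> carrier (\<O> U)" using basisD(2)[OF b] by (simp add: struct_sheaf_simps)
  show ?thesis
    by (rule O.basis_coef_Units[OF struct_basis_one[OF U] b c]) (use c in \<open>simp add: struct_sheaf_simps\<close>)
qed

text \<open>The factor in front of the bracket depends on \<open>n\<close> and the trivialization
  but not on the pair of points, which is why it drops out of the cross-ratio.\<close>

lemma Delta_local:
  assumes L: "line_bundle S L" and \<phi>: "mod_sheaf_iso S (tensor_sheaf S L L) (struct_sheaf S) \<phi>"
    and l: "\<And>k. l k \<in> carrier (ms_global S L)" and l': "\<And>k. l' k \<in> carrier (ms_global S L)"
  shows "\<phi> (rs_pts S) (cr_Delta S L (l False, l True) (l' False, l' True)) \<in> carrier (rs_global S)"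
    and "\<lbrakk>basis S L U n; \<And>k. p k \<in> carrier (\<O> U); \<And>k. ms_res L (rs_pts S) U (l k) = p k \<odot>\<^bsub>ms_mod L U\<^esub> n;
      \<And>k. q k \<in> carrier (\<O> U); \<And>k. ms_res L (rs_pts S) U (l' k) = q k \<odot>\<^bsub>ms_mod L U\<^esub> n\<rbrakk> \<Longrightarrow>
      res (rs_pts S) U (\<phi> (rs_pts S) (cr_Delta S L (l False, l True) (l' False, l' True)))
        = \<phi> U (local_tensor S L L U n n) \<otimes>\<^bsub>\<O> U\<^esub> bracket (\<O> U) p q"
proof -
  interpret T: tensor_bundle S L L by (rule tensor_bundle_self[OF L])
  interpret T2: mod_sheaf S "tensor_sheaf S L L" by (rule T.tensor_mod_sheaf)
  let ?X = "rs_pts S" and ?T = "tensor_sheaf S L L"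
  have X: "opn ?X" by (rule openin_topspace)
  interpret G: abelian_group "ms_mod ?T ?X" by (rule T2.abelian_group_\<M>[OF X])
  let ?t = "\<lambda>i j. local_tensor S L L ?X (l i) (l' j)"
  have t: "?t i j \<in> carrier (ms_mod ?T ?X)" for i j by (rule T.local_tensor_in[OF X l l'])
  let ?D = "cr_Delta S L (l False, l True) (l' False, l' True)"
  have D: "?D = ?t False True \<ominus>\<^bsub>ms_mod ?T ?X\<^esub> ?t True False"
    by (simp add: cr_Delta_def global_tensor_def local_tensor_def)
  have Din: "?D \<in> carrier (ms_mod ?T ?X)" unfolding D by (rule G.minus_closed[OF t t])
  \<comment> \<open>The difference is rewritten as a sum, which the trivialization preserves, and
    recovered at the end by \<open>difference_coef\<close>.\<close>
  have Dt: "?D \<oplus>\<^bsub>ms_mod ?T ?X\<^esub> ?t True False = ?t False True"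
    unfolding D G.minus_eq using t by (simp add: G.a_assoc G.l_neg)
  note \<phi>D = mod_sheaf_isoD[OF \<phi>, unfolded struct_sheaf_simps]
  show Dc: "\<phi> ?X ?D \<in> carrier (rs_global S)" by (rule \<phi>D(2)[OF X Din])
  assume n: "basis S L U n" and p: "\<And>k. p k \<in> carrier (\<O> U)" "\<And>k. ms_res L ?X U (l k) = p k \<odot>\<^bsub>ms_mod L U\<^esub> n"
    and q: "\<And>k. q k \<in> carrier (\<O> U)" "\<And>k. ms_res L ?X U (l' k) = q k \<odot>\<^bsub>ms_mod L U\<^esub> n"
  have U: "opn U" "U \<subseteq> ?X" by (rule basisD(1)[OF n], rule openin_subset[OF basisD(1)[OF n]])
  interpret U: cring "\<O> U" by (rule cring_\<O>[OF U(1)])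
  let ?\<tau> = "\<phi> U (local_tensor S L L U n n)"
  have nn: "local_tensor S L L U n n \<in> carrier (ms_mod ?T U)" by (rule T.local_tensor_in[OF U(1) basisD(2)[OF n] basisD(2)[OF n]])
  have \<tau>: "?\<tau> \<in> carrier (\<O> U)" by (rule \<phi>D(2)[OF U(1) nn])
  have loc: "res ?X U (\<phi> ?X (?t i j)) = (p i \<otimes>\<^bsub>\<O> U\<^esub> q j) \<otimes>\<^bsub>\<O> U\<^esub> ?\<tau>" for i j
    unfolding \<phi>D(5)[OF X U t] T.local_tensor_res[OF X U l l'] p(2) q(2)
      T.local_tensor_scale[OF n basisD(2)[OF n] p(1) q(1)]
    by (rule \<phi>D(4)[OF U(1) U.m_closed[OF p(1) q(1)] nn])
  have "\<phi> ?X ?D \<oplus>\<^bsub>rs_global S\<^esub> \<phi> ?X (?t True False) = \<phi> ?X (?t False True)"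
    using \<phi>D(3)[OF X Din t, of True False] unfolding Dt by simp
  from arg_cong[OF this, of "res ?X U"]
  have "res ?X U (\<phi> ?X ?D) \<oplus>\<^bsub>\<O> U\<^esub> (p True \<otimes>\<^bsub>\<O> U\<^esub> q False) \<otimes>\<^bsub>\<O> U\<^esub> ?\<tau> = (p False \<otimes>\<^bsub>\<O> U\<^esub> q True) \<otimes>\<^bsub>\<O> U\<^esub> ?\<tau>"
    unfolding res_simps(2)[OF X U Dc \<phi>D(2)[OF X t]] loc .
  from U.difference_coef[OF res_simps(1)[OF X U Dc] U.m_closed[OF p(1) q(1)] U.m_closed[OF p(1) q(1)] \<tau> this]
  show "res ?X U (\<phi> ?X ?D) = ?\<tau> \<otimes>\<^bsub>\<O> U\<^esub> bracket (\<O> U) p q" unfolding bracket_def .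
qed

end


text \<open>The cross-ratio is pinned down by its values in local homogeneous coordinates; the
  denominator is multiplied out so that no inverses occur.\<close>

definition local_cross_ratio where
  "local_cross_ratio S a b c d \<rho> \<longleftrightarrow> \<rho> \<in> carrier (rs_global S) \<and>
     (\<forall>x\<in>rs_pts S. \<exists>U p q r s. x \<in> U \<and> P1_point.coords S a U p \<and> P1_point.coords S b U q \<and>
        P1_point.coords S c U r \<and> P1_point.coords S d U s \<and>
        rs_res S (rs_pts S) U \<rho> \<otimes>\<^bsub>rs_ring S U\<^esub> (bracket (rs_ring S U) p s \<otimes>\<^bsub>rs_ring S U\<^esub> bracket (rs_ring S U) q r)
          = bracket (rs_ring S U) p r \<otimes>\<^bsub>rs_ring S U\<^esub> bracket (rs_ring S U) q s)"

locale P1_quadruple = A: P1_point S a + B: P1_point S b + C: P1_point S c + D: P1_point S d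
  for S :: "('a, 'b) ringed_space" and a b c d +
  assumes ap: "apart S a b" "apart S a c" "apart S a d" "apart S b c" "apart S b d" "apart S c d"
begin

lemma local_cross_ratioE:
  assumes "local_cross_ratio S a b c d \<rho>" "x \<in> rs_pts S"
  obtains U p q r s where "x \<in> U" "A.coords U p" "B.coords U q" "C.coords U r" "D.coords U s"
    "A.X.res (rs_pts S) U \<rho> \<otimes>\<^bsub>A.X.\<O> U\<^esub> (bracket (A.X.\<O> U) p s \<otimes>\<^bsub>A.X.\<O> U\<^esub> bracket (A.X.\<O> U) q r)
      = bracket (A.X.\<O> U) p r \<otimes>\<^bsub>A.X.\<O> U\<^esub> bracket (A.X.\<O> U) q s"
  using assms unfolding local_cross_ratio_def by metis

lemma relation_res:
  assumes U: "A.X.opn U" "A.X.opn V" "V \<subseteq> U" and \<rho>: "\<rho> \<in> carrier (rs_global S)"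
    and co: "A.coords U p" "B.coords U q" "C.coords U r" "D.coords U s"
    and eq: "A.X.res (rs_pts S) U \<rho> \<otimes>\<^bsub>A.X.\<O> U\<^esub> (bracket (A.X.\<O> U) p s \<otimes>\<^bsub>A.X.\<O> U\<^esub> bracket (A.X.\<O> U) q r)
      = bracket (A.X.\<O> U) p r \<otimes>\<^bsub>A.X.\<O> U\<^esub> bracket (A.X.\<O> U) q s"
  shows "A.X.res (rs_pts S) V \<rho> \<otimes>\<^bsub>A.X.\<O> V\<^esub>
      (bracket (A.X.\<O> V) (\<lambda>k. A.X.res U V (p k)) (\<lambda>k. A.X.res U V (s k)) \<otimes>\<^bsub>A.X.\<O> V\<^esub>
       bracket (A.X.\<O> V) (\<lambda>k. A.X.res U V (q k)) (\<lambda>k. A.X.res U V (r k)))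
      = bracket (A.X.\<O> V) (\<lambda>k. A.X.res U V (p k)) (\<lambda>k. A.X.res U V (r k)) \<otimes>\<^bsub>A.X.\<O> V\<^esub>
        bracket (A.X.\<O> V) (\<lambda>k. A.X.res U V (q k)) (\<lambda>k. A.X.res U V (s k))"
proof -
  interpret U: cring "A.X.\<O> U" by (rule A.X.cring_\<O>[OF U(1)])
  note X = openin_topspace openin_subset[OF U(1)]
  have c: "p k \<in> carrier (A.X.\<O> U)" "q k \<in> carrier (A.X.\<O> U)" "r k \<in> carrier (A.X.\<O> U)" "s k \<in> carrier (A.X.\<O> U)" for k
    by (rule A.coords_in[OF co(1)], rule B.coords_in[OF co(2)], rule C.coords_in[OF co(3)], rule D.coords_in[OF co(4)])
  have m: "A.X.res (rs_pts S) U \<rho> \<in> carrier (A.X.\<O> U)" by (rule A.X.res_simps(1)[OF X(1) U(1) X(2) \<rho>])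
  have b: "bracket (A.X.\<O> U) p s \<in> carrier (A.X.\<O> U)" "bracket (A.X.\<O> U) q r \<in> carrier (A.X.\<O> U)"
    "bracket (A.X.\<O> U) p r \<in> carrier (A.X.\<O> U)" "bracket (A.X.\<O> U) q s \<in> carrier (A.X.\<O> U)"
    using c by (simp_all add: U.bracket_in)
  note mult = A.X.res_simps(3)[OF U] and br = A.X.res_bracket[OF U]
  show ?thesis
    using arg_cong[OF eq, of "A.X.res U V"]
    unfolding mult[OF m U.m_closed[OF b(1,2)]] mult[OF b(1,2)] mult[OF b(3,4)]
      br[OF c(1,4)] br[OF c(2,3)] br[OF c(1,3)] br[OF c(2,4)]
      A.X.\<O>.res_res[OF X(1) U(1) U(2) U(3) X(2) \<rho>] .
qed

text \<open>The two relations may come with different open sets and coordinates. Over the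
  intersection the coordinates differ by units, which cancel by \<open>scaled_cross_ratio\<close>,
  and the brackets of the denominator are units, so the restrictions agree there.\<close>

lemma local_cross_ratio_unique:
  assumes \<rho>: "local_cross_ratio S a b c d \<rho>" and \<sigma>: "local_cross_ratio S a b c d \<sigma>"
  shows "\<rho> = \<sigma>"
proof (rule A.X.\<O>.eqI[OF openin_topspace])
  show \<rho>c: "\<rho> \<in> carrier (rs_global S)" and \<sigma>c: "\<sigma> \<in> carrier (rs_global S)"
    using \<rho> \<sigma> by (simp_all add: local_cross_ratio_def)
  fix x assume x: "x \<in> rs_pts S"
  obtain U p q r s where u: "x \<in> U" "A.coords U p" "B.coords U q" "C.coords U r" "D.coords U s"
    "A.X.res (rs_pts S) U \<rho> \<otimes>\<^bsub>A.X.\<O> U\<^esub> (bracket (A.X.\<O> U) p s \<otimes>\<^bsub>A.X.\<O> U\<^esub> bracket (A.X.\<O> U) q r)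
      = bracket (A.X.\<O> U) p r \<otimes>\<^bsub>A.X.\<O> U\<^esub> bracket (A.X.\<O> U) q s"
    using \<rho> x by (rule local_cross_ratioE)
  obtain U' p' q' r' s' where u': "x \<in> U'" "A.coords U' p'" "B.coords U' q'" "C.coords U' r'" "D.coords U' s'"
    "A.X.res (rs_pts S) U' \<sigma> \<otimes>\<^bsub>A.X.\<O> U'\<^esub> (bracket (A.X.\<O> U') p' s' \<otimes>\<^bsub>A.X.\<O> U'\<^esub> bracket (A.X.\<O> U') q' r')
      = bracket (A.X.\<O> U') p' r' \<otimes>\<^bsub>A.X.\<O> U'\<^esub> bracket (A.X.\<O> U') q' s'"
    using \<sigma> x by (rule local_cross_ratioE)
  let ?V = "U \<inter> U'"
  note U = A.coords_open[OF u(2)] and U' = A.coords_open[OF u'(2)]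
  have V: "A.X.opn ?V" "?V \<subseteq> U" "?V \<subseteq> U'" by (rule openin_Int[OF U U'], simp_all)
  interpret V: cring "A.X.\<O> ?V" by (rule A.X.cring_\<O>[OF V(1)])
  let ?r = "A.X.res U ?V" and ?r' = "A.X.res U' ?V"
  note R = A.coords_res[OF u(2) V(1,2)] B.coords_res[OF u(3) V(1,2)] C.coords_res[OF u(4) V(1,2)] D.coords_res[OF u(5) V(1,2)]
  note R' = A.coords_res[OF u'(2) V(1,3)] B.coords_res[OF u'(3) V(1,3)] C.coords_res[OF u'(4) V(1,3)] D.coords_res[OF u'(5) V(1,3)]
  note E = relation_res[OF U V(1,2) \<rho>c u(2-6)] and E' = relation_res[OF U' V(1,3) \<sigma>c u'(2-6)]
  let ?p = "\<lambda>k. ?r (p k)" and ?q = "\<lambda>k. ?r (q k)" and ?c = "\<lambda>k. ?r (r k)" and ?d = "\<lambda>k. ?r (s k)"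
  obtain e where e: "e \<in> Units (A.X.\<O> ?V)" "\<And>k. ?r' (p' k) = e \<otimes>\<^bsub>A.X.\<O> ?V\<^esub> ?p k" using A.coords_change[OF R(1) R'(1)] by blast
  obtain f where f: "f \<in> Units (A.X.\<O> ?V)" "\<And>k. ?r' (q' k) = f \<otimes>\<^bsub>A.X.\<O> ?V\<^esub> ?q k" using B.coords_change[OF R(2) R'(2)] by blast
  obtain g where g: "g \<in> Units (A.X.\<O> ?V)" "\<And>k. ?r' (r' k) = g \<otimes>\<^bsub>A.X.\<O> ?V\<^esub> ?c k" using C.coords_change[OF R(3) R'(3)] by blast
  obtain h where h: "h \<in> Units (A.X.\<O> ?V)" "\<And>k. ?r' (s' k) = h \<otimes>\<^bsub>A.X.\<O> ?V\<^esub> ?d k" using D.coords_change[OF R(4) R'(4)] by blast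
  have sc: "(\<lambda>k. ?r' (p' k)) = (\<lambda>k. e \<otimes>\<^bsub>A.X.\<O> ?V\<^esub> ?p k)" "(\<lambda>k. ?r' (q' k)) = (\<lambda>k. f \<otimes>\<^bsub>A.X.\<O> ?V\<^esub> ?q k)"
    "(\<lambda>k. ?r' (r' k)) = (\<lambda>k. g \<otimes>\<^bsub>A.X.\<O> ?V\<^esub> ?c k)" "(\<lambda>k. ?r' (s' k)) = (\<lambda>k. h \<otimes>\<^bsub>A.X.\<O> ?V\<^esub> ?d k)"
    using e(2) f(2) g(2) h(2) by (auto simp only:)
  note uc = V.Units_closed[OF e(1)] V.Units_closed[OF f(1)] V.Units_closed[OF g(1)] V.Units_closed[OF h(1)]
  have c: "?p k \<in> carrier (A.X.\<O> ?V)" "?q k \<in> carrier (A.X.\<O> ?V)" "?c k \<in> carrier (A.X.\<O> ?V)" "?d k \<in> carrier (A.X.\<O> ?V)" for k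
    by (rule A.coords_in[OF R(1)], rule B.coords_in[OF R(2)], rule C.coords_in[OF R(3)], rule D.coords_in[OF R(4)])
  note X = openin_topspace V(1) openin_subset[OF V(1)]
  note E' = E'[unfolded sc V.bracket_scale[OF c(1,4) uc(1,4)] V.bracket_scale[OF c(2,3) uc(2,3)]
    V.bracket_scale[OF c(1,3) uc(1,3)] V.bracket_scale[OF c(2,4) uc(2,4)]]
  have "A.X.res (rs_pts S) ?V \<rho> = A.X.res (rs_pts S) ?V \<sigma>"
    by (rule V.scaled_cross_ratio[OF e(1) f(1) g(1) h(1) apartD[OF ap(3) R(1,4)] apartD[OF ap(4) R(2,3)]
      V.bracket_in[OF c(1,3)] V.bracket_in[OF c(2,4)] A.X.res_simps(1)[OF X \<rho>c] A.X.res_simps(1)[OF X \<sigma>c] E E'])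
  then show "\<exists>V. A.X.opn V \<and> x \<in> V \<and> V \<subseteq> rs_pts S \<and> A.X.res (rs_pts S) V \<rho> = A.X.res (rs_pts S) V \<sigma>"
    using X(2,3) u(1) u'(1) by blast
qed

text \<open>The bundle, its sections and the trivialization are arbitrary here; combined with
  \<open>local_cross_ratio_unique\<close> this gives the independence of all choices.\<close>

lemma formula_local:
  assumes rep: "represents S a L \<alpha>" "represents S b L \<beta>" "represents S c L \<gamma>" "represents S d L \<delta>"
    and \<phi>: "mod_sheaf_iso S (tensor_sheaf S L L) (struct_sheaf S) \<phi>"
  shows "local_cross_ratio S a b c d (cr_formula S L \<phi> \<alpha> \<beta> \<gamma> \<delta>)"
proof -
  \<comment> \<open>Pairs are rewritten as families indexed by truth values, the form in which
    coordinates are treated.\<close>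
  have pair: "\<exists>l. z = (l False, l True)" for z :: "'c \<times> 'c"
    by (rule exI[of _ "\<lambda>k. if k then snd z else fst z"]) simp
  obtain la where la: "\<alpha> = (la False, la True)" using pair by blast
  obtain lb where lb: "\<beta> = (lb False, lb True)" using pair by blast
  obtain lc where lc: "\<gamma> = (lc False, lc True)" using pair by blast
  obtain ld where ld: "\<delta> = (ld False, ld True)" using pair by blast
  note L = A.representsD(1)[OF rep(1)[unfolded la]]
  note ga = A.representsD(2)[OF rep(1)[unfolded la]] and A = A.representsD(3)[OF rep(1)[unfolded la]]
  note gb = B.representsD(2)[OF rep(2)[unfolded lb]] and B = B.representsD(3)[OF rep(2)[unfolded lb]]
  note gc = C.representsD(2)[OF rep(3)[unfolded lc]] and C = C.representsD(3)[OF rep(3)[unfolded lc]]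
  note gd = D.representsD(2)[OF rep(4)[unfolded ld]] and D = D.representsD(3)[OF rep(4)[unfolded ld]]
  note \<Delta> = A.X.Delta_local[OF L \<phi>]
  let ?X = "rs_pts S" and ?O = "rs_global S"
  let ?D = "\<lambda>l l'. \<phi> ?X (cr_Delta S L (l False, l True) (l' False, l' True))"
  interpret G: cring ?O by (rule A.X.cring_\<O>[OF openin_topspace])
  have Dc: "?D la lc \<in> carrier ?O" "?D lb ld \<in> carrier ?O" "?D la ld \<in> carrier ?O" "?D lb lc \<in> carrier ?O"
    by (rule \<Delta>(1)[OF ga gc], rule \<Delta>(1)[OF gb gd], rule \<Delta>(1)[OF ga gd], rule \<Delta>(1)[OF gb gc])
  \<comment> \<open>One basis \<open>n\<close> of \<open>L\<close> provides coordinates for all four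
    points, with the same factor \<open>\<tau>\<close> in front of every bracket.\<close>
  have loc: "\<exists>U \<tau> p q r s. x \<in> U \<and> A.X.opn U \<and> \<tau> \<in> Units (A.X.\<O> U) \<and> A.coords U p \<and> B.coords U q \<and> C.coords U r \<and> D.coords U s \<and>
      A.X.res ?X U (?D la lc) = \<tau> \<otimes>\<^bsub>A.X.\<O> U\<^esub> bracket (A.X.\<O> U) p r \<and> A.X.res ?X U (?D lb ld) = \<tau> \<otimes>\<^bsub>A.X.\<O> U\<^esub> bracket (A.X.\<O> U) q s \<and>
      A.X.res ?X U (?D la ld) = \<tau> \<otimes>\<^bsub>A.X.\<O> U\<^esub> bracket (A.X.\<O> U) p s \<and> A.X.res ?X U (?D lb lc) = \<tau> \<otimes>\<^bsub>A.X.\<O> U\<^esub> bracket (A.X.\<O> U) q r"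
    if x: "x \<in> ?X" for x
  proof -
    obtain U n where n: "x \<in> U" "basis S L U n" using L A.X.line_bundle_iff x by metis
    obtain p where p: "A.coords U p" "\<And>k. ms_res L ?X U (la k) = p k \<odot>\<^bsub>ms_mod L U\<^esub> n" using A[OF n(2)] by metis
    obtain q where q: "B.coords U q" "\<And>k. ms_res L ?X U (lb k) = q k \<odot>\<^bsub>ms_mod L U\<^esub> n" using B[OF n(2)] by metis
    obtain r where r: "C.coords U r" "\<And>k. ms_res L ?X U (lc k) = r k \<odot>\<^bsub>ms_mod L U\<^esub> n" using C[OF n(2)] by metis
    obtain s where s: "D.coords U s" "\<And>k. ms_res L ?X U (ld k) = s k \<odot>\<^bsub>ms_mod L U\<^esub> n" using D[OF n(2)] by metis
    note c = A.coords_in[OF p(1)] B.coords_in[OF q(1)] C.coords_in[OF r(1)] D.coords_in[OF s(1)]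
    show ?thesis
      by (intro exI conjI, rule n(1), rule basisD(1)[OF n(2)], rule A.X.tensor_iso_Units[OF L \<phi> n(2)],
        rule p(1), rule q(1), rule r(1), rule s(1),
        rule \<Delta>(2)[OF ga gc n(2) c(1) p(2) c(3) r(2)], rule \<Delta>(2)[OF gb gd n(2) c(2) q(2) c(4) s(2)],
        rule \<Delta>(2)[OF ga gd n(2) c(1) p(2) c(4) s(2)], rule \<Delta>(2)[OF gb gc n(2) c(2) q(2) c(3) r(2)])
  qed
  \<comment> \<open>The inverse in \<open>cr_formula\<close> is meaningful only for units, so the
    denominator has to be globally invertible; this is checked locally, where its factors are
    \<open>\<tau>\<close> times invertible brackets.\<close>
  have un: "?D la ld \<in> Units ?O" "?D lb lc \<in> Units ?O"
  proof -
    have "\<exists>U. A.X.opn U \<and> x \<in> U \<and> U \<subseteq> ?X \<and> A.X.res ?X U (?D la ld) \<in> Units (A.X.\<O> U) \<and>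
        A.X.res ?X U (?D lb lc) \<in> Units (A.X.\<O> U)" if x: "x \<in> ?X" for x
    proof -
      obtain U \<tau> p q r s where u: "x \<in> U" "A.X.opn U" "\<tau> \<in> Units (A.X.\<O> U)" "A.coords U p" "B.coords U q" "C.coords U r" "D.coords U s"
        "A.X.res ?X U (?D la ld) = \<tau> \<otimes>\<^bsub>A.X.\<O> U\<^esub> bracket (A.X.\<O> U) p s" "A.X.res ?X U (?D lb lc) = \<tau> \<otimes>\<^bsub>A.X.\<O> U\<^esub> bracket (A.X.\<O> U) q r"
        using loc[OF x] by (elim exE conjE)
      interpret U: cring "A.X.\<O> U" by (rule A.X.cring_\<O>[OF u(2)])
      have "A.X.res ?X U (?D la ld) \<in> Units (A.X.\<O> U)" "A.X.res ?X U (?D lb lc) \<in> Units (A.X.\<O> U)"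
        unfolding u(8,9) by (rule U.Units_m_closed[OF u(3) apartD[OF ap(3) u(4,7)]], rule U.Units_m_closed[OF u(3) apartD[OF ap(4) u(5,6)]])
      then show ?thesis using u(1,2) openin_subset[OF u(2)] by (intro exI conjI)
    qed
    note un = this
    show "?D la ld \<in> Units ?O" by (rule A.X.Units_local[OF openin_topspace Dc(3)]) (drule un, elim exE conjE, intro exI conjI)
    show "?D lb lc \<in> Units ?O" by (rule A.X.Units_local[OF openin_topspace Dc(4)]) (drule un, elim exE conjE, intro exI conjI)
  qed
  let ?den = "?D la ld \<otimes>\<^bsub>?O\<^esub> ?D lb lc"
  have den: "?den \<in> Units ?O" by (rule G.Units_m_closed[OF un])
  let ?\<rho> = "cr_formula S L \<phi> \<alpha> \<beta> \<gamma> \<delta>"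
  have \<rho>: "?\<rho> = (?D la lc \<otimes>\<^bsub>?O\<^esub> ?D lb ld) \<otimes>\<^bsub>?O\<^esub> inv\<^bsub>?O\<^esub> ?den"
    unfolding cr_formula_def la lb lc ld Let_def ..
  have \<rho>c: "?\<rho> \<in> carrier ?O" and eq: "?\<rho> \<otimes>\<^bsub>?O\<^esub> ?den = ?D la lc \<otimes>\<^bsub>?O\<^esub> ?D lb ld"
    unfolding \<rho> using G.m_closed[OF Dc(1,2)] G.Units_closed[OF den] G.Units_inv_closed[OF den]
    by (simp_all only: G.m_closed G.m_assoc G.Units_l_inv[OF den] G.r_one)
  show ?thesis
    unfolding local_cross_ratio_def
  proof (intro conjI ballI \<rho>c)
    fix x assume x: "x \<in> ?X"
    obtain U \<tau> p q r s where u: "x \<in> U" "A.X.opn U" "\<tau> \<in> Units (A.X.\<O> U)" "A.coords U p" "B.coords U q" "C.coords U r" "D.coords U s"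
      "A.X.res ?X U (?D la lc) = \<tau> \<otimes>\<^bsub>A.X.\<O> U\<^esub> bracket (A.X.\<O> U) p r" "A.X.res ?X U (?D lb ld) = \<tau> \<otimes>\<^bsub>A.X.\<O> U\<^esub> bracket (A.X.\<O> U) q s"
      "A.X.res ?X U (?D la ld) = \<tau> \<otimes>\<^bsub>A.X.\<O> U\<^esub> bracket (A.X.\<O> U) p s" "A.X.res ?X U (?D lb lc) = \<tau> \<otimes>\<^bsub>A.X.\<O> U\<^esub> bracket (A.X.\<O> U) q r"
      using loc[OF x] by (elim exE conjE)
    interpret U: cring "A.X.\<O> U" by (rule A.X.cring_\<O>[OF u(2)])
    note X = openin_topspace u(2) openin_subset[OF u(2)]
    note mult = A.X.res_simps(3)[OF X]
    note c = A.coords_in[OF u(4)] B.coords_in[OF u(5)] C.coords_in[OF u(6)] D.coords_in[OF u(7)]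
    from arg_cong[OF eq, of "A.X.res ?X U"]
    have "A.X.res ?X U ?\<rho> \<otimes>\<^bsub>A.X.\<O> U\<^esub> ((\<tau> \<otimes>\<^bsub>A.X.\<O> U\<^esub> bracket (A.X.\<O> U) p s) \<otimes>\<^bsub>A.X.\<O> U\<^esub> (\<tau> \<otimes>\<^bsub>A.X.\<O> U\<^esub> bracket (A.X.\<O> U) q r))
      = (\<tau> \<otimes>\<^bsub>A.X.\<O> U\<^esub> bracket (A.X.\<O> U) p r) \<otimes>\<^bsub>A.X.\<O> U\<^esub> (\<tau> \<otimes>\<^bsub>A.X.\<O> U\<^esub> bracket (A.X.\<O> U) q s)"
      unfolding mult[OF \<rho>c G.m_closed[OF Dc(3,4)]] mult[OF Dc(3,4)] mult[OF Dc(1,2)] u(8-11) .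
    from U.cancel_common_factor[OF u(3) A.X.res_simps(1)[OF X \<rho>c] U.bracket_in[OF c(1,4)] U.bracket_in[OF c(2,3)]
        U.bracket_in[OF c(1,3)] U.bracket_in[OF c(2,4)] this]
    show "\<exists>U p q r s. x \<in> U \<and> A.coords U p \<and> B.coords U q \<and> C.coords U r \<and> D.coords U s \<and>
        A.X.res ?X U ?\<rho> \<otimes>\<^bsub>A.X.\<O> U\<^esub> (bracket (A.X.\<O> U) p s \<otimes>\<^bsub>A.X.\<O> U\<^esub> bracket (A.X.\<O> U) q r)
          = bracket (A.X.\<O> U) p r \<otimes>\<^bsub>A.X.\<O> U\<^esub> bracket (A.X.\<O> U) q s"
      by (intro exI conjI) (rule u | assumption)+
  qed
qed

text \<open>The common bundle is the pullback of \<O>(1) along \<open>a\<close>. Transferring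
  another point to it takes a third point as an auxiliary: \<open>c\<close> for \<open>b\<close> and
  for \<open>d\<close>, and \<open>b\<close> for \<open>c\<close>. The square is trivialized by
  means of \<open>a\<close>, \<open>b\<close>, \<open>c\<close>.\<close>

lemma representation_exists:
  "\<exists>(L :: ('a, 'b, ('a, 'b) P1_pullback_sec) mod_sheaf) \<alpha> \<beta> \<gamma> \<delta> \<phi>. represents S a L \<alpha> \<and> represents S b L \<beta> \<and>
     represents S c L \<gamma> \<and> represents S d L \<delta> \<and> mod_sheaf_iso S (tensor_sheaf S L L) (struct_sheaf S) \<phi>"
proof -
  note pts = A.P1_point_axioms B.P1_point_axioms C.P1_point_axioms D.P1_point_axioms
  have cb: "apart S c b" and dc: "apart S d c" by (rule apart_sym[OF pts(2,3) ap(4)], rule apart_sym[OF pts(3,4) ap(6)])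
  interpret b: P1_triple S a b c by (rule P1_triple.intro[OF pts(1,2,3) P1_triple_axioms.intro[OF ap(1,2,4)]])
  interpret c: P1_triple S a c b by (rule P1_triple.intro[OF pts(1,3,2) P1_triple_axioms.intro[OF ap(2,1) cb]])
  interpret d: P1_triple S a d c by (rule P1_triple.intro[OF pts(1,4,3) P1_triple_axioms.intro[OF ap(3,2) dc]])
  obtain \<beta> where \<beta>: "represents S b A.\<P> \<beta>" using b.represents_transfer ..
  obtain \<gamma> where \<gamma>: "represents S c A.\<P> \<gamma>" using c.represents_transfer ..
  obtain \<delta> where \<delta>: "represents S d A.\<P> \<delta>" using d.represents_transfer ..
  obtain \<phi> where \<phi>: "mod_sheaf_iso S (tensor_sheaf S A.\<P> A.\<P>) (struct_sheaf S) \<phi>" using b.tensor_square_iso ..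
  from A.represents_self \<beta> \<gamma> \<delta> \<phi> show ?thesis by (intro exI conjI)
qed

text \<open>The description by \<open>THE\<close> is legitimate: a representation exists, and the
  values from any two of them satisfy the same local relation, hence coincide.\<close>

lemma local_cross_ratio: "local_cross_ratio S a b c d (cross_ratio S a b c d)"
proof -
  obtain L :: "('a, 'b, ('a, 'b) P1_pullback_sec) mod_sheaf" and \<alpha> \<beta> \<gamma> \<delta> \<phi> where
    r: "represents S a L \<alpha>" "represents S b L \<beta>" "represents S c L \<gamma>" "represents S d L \<delta>"
      "mod_sheaf_iso S (tensor_sheaf S L L) (struct_sheaf S) \<phi>"
    using representation_exists by (elim exE conjE)
  have "cross_ratio S a b c d = cr_formula S L \<phi> \<alpha> \<beta> \<gamma> \<delta>"
    unfolding cross_ratio_def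
  proof (rule the_equality)
    show "\<exists>(L' :: ('a, 'b, ('a, 'b) P1_pullback_sec) mod_sheaf) \<alpha>' \<beta>' \<gamma>' \<delta>' \<phi>'.
        represents S a L' \<alpha>' \<and> represents S b L' \<beta>' \<and> represents S c L' \<gamma>' \<and> represents S d L' \<delta>' \<and>
        mod_sheaf_iso S (tensor_sheaf S L' L') (struct_sheaf S) \<phi>' \<and>
        cr_formula S L \<phi> \<alpha> \<beta> \<gamma> \<delta> = cr_formula S L' \<phi>' \<alpha>' \<beta>' \<gamma>' \<delta>'"
      by (intro exI conjI, rule r(1), rule r(2), rule r(3), rule r(4), rule r(5), rule HOL.refl)
    fix t assume "\<exists>(L' :: ('a, 'b, ('a, 'b) P1_pullback_sec) mod_sheaf) \<alpha>' \<beta>' \<gamma>' \<delta>' \<phi>'.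
        represents S a L' \<alpha>' \<and> represents S b L' \<beta>' \<and> represents S c L' \<gamma>' \<and> represents S d L' \<delta>' \<and>
        mod_sheaf_iso S (tensor_sheaf S L' L') (struct_sheaf S) \<phi>' \<and> t = cr_formula S L' \<phi>' \<alpha>' \<beta>' \<gamma>' \<delta>'"
    then obtain L' :: "('a, 'b, ('a, 'b) P1_pullback_sec) mod_sheaf" and \<alpha>' \<beta>' \<gamma>' \<delta>' \<phi>' where
      r': "represents S a L' \<alpha>'" "represents S b L' \<beta>'" "represents S c L' \<gamma>'" "represents S d L' \<delta>'"
        "mod_sheaf_iso S (tensor_sheaf S L' L') (struct_sheaf S) \<phi>'" and t: "t = cr_formula S L' \<phi>' \<alpha>' \<beta>' \<gamma>' \<delta>'"
      by (elim exE conjE)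
    show "t = cr_formula S L \<phi> \<alpha> \<beta> \<gamma> \<delta>" unfolding t by (rule local_cross_ratio_unique[OF formula_local[OF r'] formula_local[OF r]])
  qed
  then show ?thesis using formula_local[OF r] by simp
qed

section \<open>The symmetries\<close>

lemma cross_ratio_eqI: "local_cross_ratio S a b c d \<rho> \<Longrightarrow> cross_ratio S a b c d = \<rho>"
  by (rule local_cross_ratio_unique[OF local_cross_ratio])

lemma exchange_quadruple: "P1_quadruple S c d a b"
  and swap_quadruple: "P1_quadruple S b a c d" and transpose_quadruple: "P1_quadruple S a c b d"
proof -
  note pts = A.P1_point_axioms B.P1_point_axioms C.P1_point_axioms D.P1_point_axioms
  note sym = apart_sym[OF pts(1,2) ap(1)] apart_sym[OF pts(1,3) ap(2)] apart_sym[OF pts(1,4) ap(3)]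
    apart_sym[OF pts(2,3) ap(4)] apart_sym[OF pts(2,4) ap(5)]
  show "P1_quadruple S c d a b"
    by (rule P1_quadruple.intro[OF pts(3,4,1,2) P1_quadruple_axioms.intro[OF ap(6) sym(2) sym(4) sym(3) sym(5) ap(1)]])
  show "P1_quadruple S b a c d"
    by (rule P1_quadruple.intro[OF pts(2,1,3,4) P1_quadruple_axioms.intro[OF sym(1) ap(4,5,2,3,6)]])
  show "P1_quadruple S a c b d"
    by (rule P1_quadruple.intro[OF pts(1,3,2,4) P1_quadruple_axioms.intro[OF ap(2,1,3) sym(4) ap(6,5)]])
qed

text \<open>For each symmetry the claimed value is shown to satisfy the local relation of the
  permuted points; the coordinates that serve for \<open>a\<close>, \<open>b\<close>,
  \<open>c\<close>, \<open>d\<close> serve again in the new order. Invertibility is a local matter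
  and comes from that of the brackets on both sides of the relation.\<close>

lemma cross_ratio_symmetries:
  shows "cross_ratio S c d a b = cross_ratio S a b c d"
    and "cross_ratio S a b c d \<in> Units (rs_global S)"
    and "cross_ratio S b a c d = inv\<^bsub>rs_global S\<^esub> cross_ratio S a b c d"
    and "cross_ratio S a c b d = \<one>\<^bsub>rs_global S\<^esub> \<ominus>\<^bsub>rs_global S\<^esub> cross_ratio S a b c d"
proof -
  let ?X = "rs_pts S" and ?O = "rs_global S" and ?\<rho> = "cross_ratio S a b c d"
  interpret G: cring ?O by (rule A.X.cring_\<O>[OF openin_topspace])
  have \<rho>: "?\<rho> \<in> carrier ?O" using local_cross_ratio by (simp add: local_cross_ratio_def)
  note E = local_cross_ratioE[OF local_cross_ratio]
  show "cross_ratio S c d a b = ?\<rho>"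
  proof (rule P1_quadruple.cross_ratio_eqI[OF exchange_quadruple], unfold local_cross_ratio_def, intro conjI ballI \<rho>)
    fix x assume "x \<in> ?X"
    then obtain U p q r s where u: "x \<in> U" "A.coords U p" "B.coords U q" "C.coords U r" "D.coords U s"
      "A.X.res ?X U ?\<rho> \<otimes>\<^bsub>A.X.\<O> U\<^esub> (bracket (A.X.\<O> U) p s \<otimes>\<^bsub>A.X.\<O> U\<^esub> bracket (A.X.\<O> U) q r)
        = bracket (A.X.\<O> U) p r \<otimes>\<^bsub>A.X.\<O> U\<^esub> bracket (A.X.\<O> U) q s"
      by (rule E)
    interpret U: cring "A.X.\<O> U" by (rule A.X.cring_\<O>[OF A.coords_open[OF u(2)]])
    note X = openin_topspace A.coords_open[OF u(2)] openin_subset[OF A.coords_open[OF u(2)]]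
    have "A.X.res ?X U ?\<rho> \<otimes>\<^bsub>A.X.\<O> U\<^esub> (bracket (A.X.\<O> U) r q \<otimes>\<^bsub>A.X.\<O> U\<^esub> bracket (A.X.\<O> U) s p)
        = bracket (A.X.\<O> U) r p \<otimes>\<^bsub>A.X.\<O> U\<^esub> bracket (A.X.\<O> U) s q"
      by (rule U.cross_ratio_exchange[OF A.coords_in[OF u(2)] B.coords_in[OF u(3)] C.coords_in[OF u(4)] D.coords_in[OF u(5)]
        A.X.res_simps(1)[OF X \<rho>] u(6)])
    then show "\<exists>U p q r s. x \<in> U \<and> C.coords U p \<and> D.coords U q \<and> A.coords U r \<and> B.coords U s \<and>
        A.X.res ?X U ?\<rho> \<otimes>\<^bsub>A.X.\<O> U\<^esub> (bracket (A.X.\<O> U) p s \<otimes>\<^bsub>A.X.\<O> U\<^esub> bracket (A.X.\<O> U) q r)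
          = bracket (A.X.\<O> U) p r \<otimes>\<^bsub>A.X.\<O> U\<^esub> bracket (A.X.\<O> U) q s"
      by (intro exI conjI) (rule u | assumption)+
  qed
  show un: "?\<rho> \<in> Units ?O"
  proof (rule A.X.Units_local[OF openin_topspace \<rho>])
    fix x assume "x \<in> ?X"
    then obtain U p q r s where u: "x \<in> U" "A.coords U p" "B.coords U q" "C.coords U r" "D.coords U s"
      "A.X.res ?X U ?\<rho> \<otimes>\<^bsub>A.X.\<O> U\<^esub> (bracket (A.X.\<O> U) p s \<otimes>\<^bsub>A.X.\<O> U\<^esub> bracket (A.X.\<O> U) q r)
        = bracket (A.X.\<O> U) p r \<otimes>\<^bsub>A.X.\<O> U\<^esub> bracket (A.X.\<O> U) q s"
      by (rule E)
    note X = openin_topspace A.coords_open[OF u(2)] openin_subset[OF A.coords_open[OF u(2)]]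
    interpret U: cring "A.X.\<O> U" by (rule A.X.cring_\<O>[OF X(2)])
    have "A.X.res ?X U ?\<rho> \<in> Units (A.X.\<O> U)"
      by (rule U.Units_of_quotient[OF A.X.res_simps(1)[OF X \<rho>]
        U.Units_m_closed[OF apartD[OF ap(3) u(2,5)] apartD[OF ap(4) u(3,4)]]
        U.Units_m_closed[OF apartD[OF ap(2) u(2,4)] apartD[OF ap(5) u(3,5)]] u(6)])
    then show "\<exists>V. A.X.opn V \<and> x \<in> V \<and> V \<subseteq> ?X \<and> A.X.res ?X V ?\<rho> \<in> Units (A.X.\<O> V)"
      using X(2,3) u(1) by blast
  qed
  have inv: "inv\<^bsub>?O\<^esub> ?\<rho> \<in> carrier ?O" "inv\<^bsub>?O\<^esub> ?\<rho> \<otimes>\<^bsub>?O\<^esub> ?\<rho> = \<one>\<^bsub>?O\<^esub>" by (rule G.Units_inv_closed[OF un], rule G.Units_l_inv[OF un])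
  show "cross_ratio S b a c d = inv\<^bsub>?O\<^esub> ?\<rho>"
  proof (rule P1_quadruple.cross_ratio_eqI[OF swap_quadruple], unfold local_cross_ratio_def, intro conjI ballI inv(1))
    fix x assume "x \<in> ?X"
    then obtain U p q r s where u: "x \<in> U" "A.coords U p" "B.coords U q" "C.coords U r" "D.coords U s"
      "A.X.res ?X U ?\<rho> \<otimes>\<^bsub>A.X.\<O> U\<^esub> (bracket (A.X.\<O> U) p s \<otimes>\<^bsub>A.X.\<O> U\<^esub> bracket (A.X.\<O> U) q r)
        = bracket (A.X.\<O> U) p r \<otimes>\<^bsub>A.X.\<O> U\<^esub> bracket (A.X.\<O> U) q s"
      by (rule E)
    note X = openin_topspace A.coords_open[OF u(2)] openin_subset[OF A.coords_open[OF u(2)]]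
    interpret U: cring "A.X.\<O> U" by (rule A.X.cring_\<O>[OF X(2)])
    note c = A.coords_in[OF u(2)] B.coords_in[OF u(3)] C.coords_in[OF u(4)] D.coords_in[OF u(5)]
    have "A.X.res ?X U (inv\<^bsub>?O\<^esub> ?\<rho>) \<otimes>\<^bsub>A.X.\<O> U\<^esub> A.X.res ?X U ?\<rho> = \<one>\<^bsub>A.X.\<O> U\<^esub>"
      using arg_cong[OF inv(2), of "A.X.res ?X U"] unfolding A.X.res_simps(3)[OF X inv(1) \<rho>] A.X.res_simps(4)[OF X] .
    from U.cross_ratio_inverse[OF A.X.res_simps(1)[OF X \<rho>] A.X.res_simps(1)[OF X inv(1)] U.bracket_in[OF c(1,4)] U.bracket_in[OF c(2,3)]
        U.bracket_in[OF c(1,3)] U.bracket_in[OF c(2,4)] this u(6)]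
    show "\<exists>U p q r s. x \<in> U \<and> B.coords U p \<and> A.coords U q \<and> C.coords U r \<and> D.coords U s \<and>
        A.X.res ?X U (inv\<^bsub>?O\<^esub> ?\<rho>) \<otimes>\<^bsub>A.X.\<O> U\<^esub> (bracket (A.X.\<O> U) p s \<otimes>\<^bsub>A.X.\<O> U\<^esub> bracket (A.X.\<O> U) q r)
          = bracket (A.X.\<O> U) p r \<otimes>\<^bsub>A.X.\<O> U\<^esub> bracket (A.X.\<O> U) q s"
      by (intro exI conjI) (rule u | assumption)+
  qed
  have com: "\<one>\<^bsub>?O\<^esub> \<ominus>\<^bsub>?O\<^esub> ?\<rho> \<in> carrier ?O" by (rule G.minus_closed[OF G.one_closed \<rho>])
  show "cross_ratio S a c b d = \<one>\<^bsub>?O\<^esub> \<ominus>\<^bsub>?O\<^esub> ?\<rho>"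
  proof (rule P1_quadruple.cross_ratio_eqI[OF transpose_quadruple], unfold local_cross_ratio_def, intro conjI ballI com)
    fix x assume "x \<in> ?X"
    then obtain U p q r s where u: "x \<in> U" "A.coords U p" "B.coords U q" "C.coords U r" "D.coords U s"
      "A.X.res ?X U ?\<rho> \<otimes>\<^bsub>A.X.\<O> U\<^esub> (bracket (A.X.\<O> U) p s \<otimes>\<^bsub>A.X.\<O> U\<^esub> bracket (A.X.\<O> U) q r)
        = bracket (A.X.\<O> U) p r \<otimes>\<^bsub>A.X.\<O> U\<^esub> bracket (A.X.\<O> U) q s"
      by (rule E)
    note X = openin_topspace A.coords_open[OF u(2)] openin_subset[OF A.coords_open[OF u(2)]]
    interpret U: cring "A.X.\<O> U" by (rule A.X.cring_\<O>[OF X(2)])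
    have "A.X.res ?X U (\<one>\<^bsub>?O\<^esub> \<ominus>\<^bsub>?O\<^esub> ?\<rho>) \<otimes>\<^bsub>A.X.\<O> U\<^esub> (bracket (A.X.\<O> U) p s \<otimes>\<^bsub>A.X.\<O> U\<^esub> bracket (A.X.\<O> U) r q)
        = bracket (A.X.\<O> U) p q \<otimes>\<^bsub>A.X.\<O> U\<^esub> bracket (A.X.\<O> U) r s"
      unfolding A.X.res_simps(7)[OF X G.one_closed \<rho>] A.X.res_simps(4)[OF X]
      by (rule U.cross_ratio_complement[OF A.coords_in[OF u(2)] B.coords_in[OF u(3)] C.coords_in[OF u(4)] D.coords_in[OF u(5)]
        A.X.res_simps(1)[OF X \<rho>] u(6)])
    then show "\<exists>U p q r s. x \<in> U \<and> A.coords U p \<and> C.coords U q \<and> B.coords U r \<and> D.coords U s \<and>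
        A.X.res ?X U (\<one>\<^bsub>?O\<^esub> \<ominus>\<^bsub>?O\<^esub> ?\<rho>) \<otimes>\<^bsub>A.X.\<O> U\<^esub> (bracket (A.X.\<O> U) p s \<otimes>\<^bsub>A.X.\<O> U\<^esub> bracket (A.X.\<O> U) q r)
          = bracket (A.X.\<O> U) p r \<otimes>\<^bsub>A.X.\<O> U\<^esub> bracket (A.X.\<O> U) q s"
      by (intro exI conjI) (rule u | assumption)+
  qed
qed

end

theorem proposition6p7:
  fixes S :: "('a, 'b) ringed_space"
    and a b c d :: "('a, 'b) P1_point"
  assumes "is_scheme S"
    and "a \<in> lrs_hom S P1" and "b \<in> lrs_hom S P1" and "c \<in> lrs_hom S P1" and "d \<in> lrs_hom S P1"
    and "strongly_distinct S P1 a b" and "strongly_distinct S P1 a c"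
    and "strongly_distinct S P1 a d" and "strongly_distinct S P1 b c"
    and "strongly_distinct S P1 b d" and "strongly_distinct S P1 c d"
  shows "cross_ratio S c d a b = cross_ratio S a b c d \<and>
    (cross_ratio S a b c d \<in> Units (rs_global S) \<and>
     cross_ratio S b a c d = inv\<^bsub>rs_global S\<^esub> cross_ratio S a b c d) \<and>
    cross_ratio S a c b d = \<one>\<^bsub>rs_global S\<^esub> \<ominus>\<^bsub>rs_global S\<^esub> cross_ratio S a b c d"
proof -
  have lrs: "locally_ringed_space S" using assms(1) by (simp add: is_scheme_def)
  note pts = P1_point.intro[OF lrs assms(2)] P1_point.intro[OF lrs assms(3)]
    P1_point.intro[OF lrs assms(4)] P1_point.intro[OF lrs assms(5)]
  have ap: "apart S e f" if "P1_point S e" "P1_point S f" "strongly_distinct S P1 e f" for e f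
    unfolding apart_def using bracket_unit[OF that] by blast
  interpret P1_quadruple S a b c d
    by (rule P1_quadruple.intro[OF pts P1_quadruple_axioms.intro[OF ap[OF pts(1,2) assms(6)] ap[OF pts(1,3) assms(7)]
      ap[OF pts(1,4) assms(8)] ap[OF pts(2,3) assms(9)] ap[OF pts(2,4) assms(10)] ap[OF pts(3,4) assms(11)]]])
  show ?thesis using cross_ratio_symmetries by (intro conjI)
qed


end
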